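(* Let $\mathbb{K}\in\{\mathbb{R},\mathbb{C}\}$, $d=\dim_{\mathbb{R}}\mathbb{K}$, and let $K$, $L$, $\chi$, $\rho=d(n+1)/2$ and the intertwining operator $J(\lambda)$ be as in the context. Put $k=1$ if $\mathbb{K}=\mathbb{R}$, and $k=|l|$ if $\mathbb{K}=\mathbb{C}$ and $\chi=\chi_l$, $l\in\mathbb{Z}$. Let $\mu^0=k(\varepsilon_1+\cdots+\varepsilon_p)$, the element of smallest norm in $\Lambda_\chi^+$. Then the scalar $\eta_{\mu^0}(\lambda)$ by which $J(\lambda)$ acts on $L^2_{\mu^0}(\mathcal{B};\mathcal{L}_\chi)$ is (as a meromorphic function of $\lambda\in\mathbb{C}$) $$\eta_{\mu^0}(\lambda)=\frac{\Gamma_{p,d}(d(n+1)/2)}{\Gamma_{p,d}(dp/2)}\;\frac{\Gamma_{p,d}\left(\frac12(\lambda-\rho+k+dp)\right)}{\Gamma_{p,d}\left(\frac12(\lambda+\rho+k)\right)}.$$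
   Context: Cases. $G=\mathrm{SL}(n+1,\mathbb{K})$, $n+1=p+q$. If $\mathbb{K}=\mathbb{R}$: $K=\mathrm{SO}(n+1)$, $L=\mathrm{S}(\mathrm{O}(p)\times\mathrm{O}(q))$ with $p=2$, $q\ge 3$. If $\mathbb{K}=\mathbb{C}$: $K=\mathrm{SU}(n+1)$, $L=\mathrm{S}(\mathrm{U}(p)\times\mathrm{U}(q))$ with $q\ge p\ge1$. $L$ consists of block diagonal matrices $\mathrm{diag}(A,B)$, $\mathcal{B}=K/L$. Compact groups carry normalized Haar measure. Parabolic. In $(p,q)$-block form: $N$ block upper unitriangular, $\overline N$ block lower unitriangular, $A=\exp(\mathbb{R}H_0)$ with $H_0=\mathrm{diag}(\frac{q}{n+1}I_p,-\frac{p}{n+1}I_q)$, $M=\{\mathrm{diag}(a,b):|\det a|=|\det b|=1,\ \det a\det b=1\}$. Every $g$ in the open dense set $\overline NMAN$ is uniquely $g=\overline n(g)m(g)\alpha(g)n(g)$ with $\overline n(g)\in\overline N$, $m(g)\in M$, $\alpha(g)\in A$, $n(g)\in N$. $\mathfrak{a}_{\mathbb{C}}^*$ ($\mathfrak{a}=\mathbb{R}H_0$) is identified with $\mathbb{C}$ by $\lambda\mapsto\frac{n+1}{pq}\lambda(H_0)$; under this identification $\rho=\frac12\sum(\text{roots of }\mathfrak{a}\text{ in }\mathrm{Lie}(N)\text{ with multiplicity})$ corresponds to $d(n+1)/2$. Characters. If $\mathbb{K}=\mathbb{R}$, $\chi(\mathrm{diag}(A,B))=\det A$. If $\mathbb{K}=\mathbb{C}$,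 $\chi=\chi_l$, $l\in\mathbb{Z}$, $\chi_l(\exp(tZ)h)=e^{ilt}$ for $t\in\mathbb{R}$, $h\in[L,L]$, where $Z=\mathrm{diag}(\frac ipI_p,-\frac iqI_q)$. $\chi$ is extended to $M$ by $\chi(a\exp X)=\chi(a)$ for $a\in L$ and $X\in\mathrm{Lie}(M)$ Hermitian (symmetric). $C^\infty(\mathcal{B};\mathcal{L}_\chi)=\{f\in C^\infty(K):f(km)=\chi(m)^{-1}f(k)\ \forall m\in L\}$. Operator. For $f\in C^\infty(\mathcal{B};\mathcal{L}_\chi)$ and $\mathrm{Re}\,\lambda$ large, $$J(\lambda)f(x)=\int_K\alpha(x^{-1}h)^{\lambda-\rho}\chi(m(x^{-1}h))f(h)\,dh,\qquad x\in K,$$ extended meromorphically to $\lambda\in\mathbb{C}$. $K$-types. $\mathfrak{b}=\{Y(\mathbf{t}):\mathbf{t}\in\mathbb{R}^p\}\subset\mathrm{Lie}(K)$ with $$\exp Y(\mathbf t)=\begin{pmatrix}\mathrm{diag}(\cos t_j)&0&-\mathrm{diag}(\sin t_j)\\0&I_{q-p}&0\\ \mathrm{diag}(\sin t_j)&0&\mathrm{diag}(\cos t_j)\end{pmatrix},\qquad \varepsilon_j(Y(\mathbf t))=it_j.$$ An irreducible unitary representation $(\pi,V)$ of $K$ is $\chi$-spherical if $V^\chi=\{v:\pi(m)v=\chi(m)v\ \forall m\in L\}\ne0$ (then $\dim V^\chi=1$). $\Lambda_\chi^+$ is the set of restrictions to $\mathfrak{b}$ of highest weights of irreducible $\chi$-spherical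 representations (positive restricted roots: $\varepsilon_i,\ \varepsilon_i\pm\varepsilon_j\ (i<j),\ 2\varepsilon_i$, as far as they occur); $\mu\in\Lambda_\chi^+$ determines the representation $(\pi_\mu,V_\mu)$. Explicitly ($\mathbb{Z}^+=\{0,1,2,\dots\}$, $\mu=\sum\mu_j\varepsilon_j$): for $\mathbb{K}=\mathbb{R}$, $\mu_1\ge\dots\ge\mu_p\ge0$ with all $\mu_j$ odd; for $\mathbb{K}=\mathbb{C}$, $\mu_i-\mu_j\in2\mathbb{Z}^+$ for $i<j$ and $\mu_p\in|l|+2\mathbb{Z}^+$. $L^2_\mu(\mathcal{B};\mathcal{L}_\chi)$ is the space of functions $x\mapsto(v,\pi_\mu(x)e_\mu)$, $v\in V_\mu$, with $e_\mu\in V_\mu^\chi$ a unit vector (inner product linear in the first slot). Gamma function. $\Gamma_{p,d}(\lambda)=\prod_{j=1}^p\Gamma(\lambda_j-\frac d2(j-1))$ for $\lambda\in\mathbb{C}^p$; a scalar $z$ is identified with $(z,\dots,z)$. *)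

theory Defs
  imports "HOL-Complex_Analysis.Complex_Analysis" "HOL-Probability.Probability"
    "HOL-Algebra.Generated_Groups"
begin

text \<open>
  Both base fields are treated inside complex matrices; the real case restricts all entries to
  the real numbers.  The integer of the complex case is the parameter \<open>l\<close> of the character.
  Matrices are indexed by the sum type \<open>'p + 'q\<close>, so that \<open>p = CARD('p)\<close>, \<open>q = CARD('q)\<close>,
  \<open>n + 1 = CARD('p + 'q)\<close>; the linear orders on \<open>'p\<close> and \<open>'q\<close> number the rows of each block.
\<close>

datatype base_case = Real_Case | Complex_Case int

fun scalars :: "base_case \<Rightarrow> complex set" where
  "scalars Real_Case = \<real>"
| "scalars (Complex_Case l) = UNIV"

fun dim_base :: "base_case \<Rightarrow> nat" where
  "dim_base Real_Case = 1"
| "dim_base (Complex_Case l) = 2"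

fun min_type :: "base_case \<Rightarrow> nat" where
  "min_type Real_Case = 1"
| "min_type (Complex_Case l) = nat \<bar>l\<bar>"

type_synonym ('p, 'q) bmat = "complex^('p + 'q)^('p + 'q)"

definition blocks ::
  "complex^'p^'p \<Rightarrow> complex^'q^'p \<Rightarrow> complex^'p^'q \<Rightarrow> complex^'q^'q \<Rightarrow> ('p::finite, 'q::finite) bmat"
  where "blocks A B C D = (\<chi> i j. case i of
      Inl a \<Rightarrow> (case j of Inl b \<Rightarrow> A $ a $ b | Inr b \<Rightarrow> B $ a $ b)
    | Inr a \<Rightarrow> (case j of Inl b \<Rightarrow> C $ a $ b | Inr b \<Rightarrow> D $ a $ b))"

definition diag_blocks :: "complex^'p^'p \<Rightarrow> complex^'q^'q \<Rightarrow> ('p::finite, 'q::finite) bmat" where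
  "diag_blocks A B = blocks A 0 0 B"

definition block11 :: "('p::finite, 'q::finite) bmat \<Rightarrow> complex^'p^'p" where
  "block11 g = (\<chi> a b. g $ Inl a $ Inl b)"

definition herm :: "complex^'n^'m \<Rightarrow> complex^'m^'n" where
  "herm A = (\<chi> i j. cnj (A $ j $ i))"

definition cscale :: "complex \<Rightarrow> complex^'n^'m \<Rightarrow> complex^'n^'m" where
  "cscale c A = (\<chi> i j. c * A $ i $ j)"

primrec mat_power :: "complex^'n^'n \<Rightarrow> nat \<Rightarrow> complex^'n^'n" where
  "mat_power A 0 = mat 1"
| "mat_power A (Suc k) = A ** mat_power A k"

definition mexp :: "complex^'n^'n \<Rightarrow> complex^'n^'n" where
  "mexp A = (\<Sum>k. mat_power A k /\<^sub>R fact k)"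

text \<open>The Lie algebra of a closed subgroup of the general linear group.\<close>

definition lie_algebra :: "(complex^'n^'n) set \<Rightarrow> (complex^'n^'n) set" where
  "lie_algebra G = {X. \<forall>t::real. mexp (t *\<^sub>R X) \<in> G}"

definition matrices_over :: "base_case \<Rightarrow> (complex^'n^'m) set" where
  "matrices_over \<kappa> = {A. \<forall>i j. A $ i $ j \<in> scalars \<kappa>}"


subsection \<open>The groups\<close>

definition SL_group :: "base_case \<Rightarrow> (complex^'n^'n) set" where
  "SL_group \<kappa> = {g \<in> matrices_over \<kappa>. det g = 1}"

definition K_group :: "base_case \<Rightarrow> (complex^'n^'n) set" where
  "K_group \<kappa> = {g \<in> SL_group \<kappa>. herm g ** g = mat 1}"

definition L_group :: "base_case \<Rightarrow> ('p::finite, 'q::finite) bmat set" where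
  "L_group \<kappa> = {g \<in> K_group \<kappa>. \<exists>A B. g = diag_blocks A B}"

definition M_group :: "base_case \<Rightarrow> ('p::finite, 'q::finite) bmat set" where
  "M_group \<kappa> = {g \<in> matrices_over \<kappa>. \<exists>a b. g = diag_blocks a b \<and>
      cmod (det a) = 1 \<and> cmod (det b) = 1 \<and> det a * det b = 1}"

definition N_group :: "base_case \<Rightarrow> ('p::finite, 'q::finite) bmat set" where
  "N_group \<kappa> = {blocks (mat 1) X 0 (mat 1) |X. X \<in> matrices_over \<kappa>}"

definition Nbar_group :: "base_case \<Rightarrow> ('p::finite, 'q::finite) bmat set" where
  "Nbar_group \<kappa> = {blocks (mat 1) 0 X (mat 1) |X. X \<in> matrices_over \<kappa>}"

definition H0 :: "('p::finite, 'q::finite) bmat" where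
  "H0 = diag_blocks (mat (of_nat CARD('q) / of_nat CARD('p + 'q)))
                    (mat (- of_nat CARD('p) / of_nat CARD('p + 'q)))"

definition A_group :: "('p::finite, 'q::finite) bmat set" where
  "A_group = {mexp (t *\<^sub>R H0) |t::real. True}"

text \<open>The factorisation \<open>g = nbar m \<alpha> n\<close> on the open dense set; each factor is unique there.\<close>

definition big_cell :: "base_case \<Rightarrow> ('p::finite, 'q::finite) bmat set" where
  "big_cell \<kappa> = {nb ** m ** a ** n |nb m a n.
     nb \<in> Nbar_group \<kappa> \<and> m \<in> M_group \<kappa> \<and> a \<in> A_group \<and> n \<in> N_group \<kappa>}"

definition m_part :: "base_case \<Rightarrow> ('p::finite, 'q::finite) bmat \<Rightarrow> ('p, 'q) bmat" where
  "m_part \<kappa> g = (THE m. m \<in> M_group \<kappa> \<and> (\<exists>nb\<in>Nbar_group \<kappa>. \<exists>a\<in>A_group. \<exists>n\<in>N_group \<kappa>.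
      g = nb ** m ** a ** n))"

definition a_part :: "base_case \<Rightarrow> ('p::finite, 'q::finite) bmat \<Rightarrow> ('p, 'q) bmat" where
  "a_part \<kappa> g = (THE a. a \<in> A_group \<and> (\<exists>nb\<in>Nbar_group \<kappa>. \<exists>m\<in>M_group \<kappa>. \<exists>n\<in>N_group \<kappa>.
      g = nb ** m ** a ** n))"

text \<open>
  For \<open>a = exp (t H0)\<close>, the power \<open>a\<^sup>\<lambda>\<close> is \<open>exp (t \<lambda>(H0))\<close>, and the linear form corresponding to the
  complex number \<open>z\<close> takes the value \<open>z p q / (n + 1)\<close> at \<open>H0\<close>.
\<close>

definition A_log :: "('p::finite, 'q::finite) bmat \<Rightarrow> real" where
  "A_log a = (THE t. a = mexp (t *\<^sub>R H0))"

definition A_power :: "('p::finite, 'q::finite) bmat \<Rightarrow> complex \<Rightarrow> complex" where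
  "A_power a z = exp (of_real (A_log a) *
      (z * of_nat (CARD('p) * CARD('q)) / of_nat CARD('p + 'q)))"

definition rho :: "base_case \<Rightarrow> ('p::finite \<times> 'q::finite) itself \<Rightarrow> complex" where
  "rho \<kappa> _ = of_nat (dim_base \<kappa>) * of_nat CARD('p + 'q) / 2"


subsection \<open>The characters\<close>

definition L_monoid :: "base_case \<Rightarrow> ('p::finite, 'q::finite) bmat monoid" where
  "L_monoid \<kappa> = \<lparr>carrier = L_group \<kappa>, mult = (**), one = mat 1\<rparr>"

definition Z_elt :: "('p::finite, 'q::finite) bmat" where
  "Z_elt = diag_blocks (mat (\<i> / of_nat CARD('p))) (mat (- \<i> / of_nat CARD('q)))"

fun chi_L :: "base_case \<Rightarrow> ('p::finite, 'q::finite) bmat \<Rightarrow> complex" where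
  "chi_L Real_Case m = det (block11 m)"
| "chi_L (Complex_Case l) m = (THE c. \<exists>t::real.
     \<exists>h \<in> derived (L_monoid (Complex_Case l)) (carrier (L_monoid (Complex_Case l))).
       m = mexp (t *\<^sub>R Z_elt) ** h \<and> c = exp (\<i> * of_int l * of_real t))"

definition chi_M :: "base_case \<Rightarrow> ('p::finite, 'q::finite) bmat \<Rightarrow> complex" where
  "chi_M \<kappa> m = (THE c. \<exists>a\<in>L_group \<kappa>. \<exists>X\<in>lie_algebra (M_group \<kappa>).
      herm X = X \<and> m = a ** mexp X \<and> c = chi_L \<kappa> a)"


subsection \<open>The intertwining operator\<close>

text \<open>Left invariance determines a Borel probability measure on a compact group.\<close>

definition normalized_Haar :: "(complex^'n^'n) set \<Rightarrow> (complex^'n^'n) measure \<Rightarrow> bool" where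
  "normalized_Haar G \<nu> \<longleftrightarrow> prob_space \<nu> \<and> sets \<nu> = sets (restrict_space borel G) \<and>
     (\<forall>g\<in>G. distr \<nu> \<nu> (\<lambda>h. g ** h) = \<nu>)"

text \<open>The integrand of \<open>J(\<lambda>) f (x)\<close>, set to \<open>0\<close> on the null set where \<open>\<alpha>\<close> and \<open>m\<close> are undefined.\<close>

definition J_integrand ::
  "base_case \<Rightarrow> (('p::finite, 'q::finite) bmat \<Rightarrow> complex) \<Rightarrow> ('p, 'q) bmat \<Rightarrow> complex
    \<Rightarrow> ('p, 'q) bmat \<Rightarrow> complex"
  where "J_integrand \<kappa> f x z h = (let g = matrix_inv x ** h in
      if g \<in> big_cell \<kappa>
      then A_power (a_part \<kappa> g) (z - rho \<kappa> TYPE('p \<times> 'q)) * chi_M \<kappa> (m_part \<kappa> g) * f h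
      else 0)"

text \<open>
  \<open>F\<close> is the meromorphic continuation of \<open>\<lambda> \<mapsto> J(\<lambda>) f (x)\<close> from a right half plane.  As
  \<^const>\<open>nicely_meromorphic_on\<close> fixes the values at singularities, there is at most one such \<open>F\<close>.
\<close>

definition J_continuation ::
  "base_case \<Rightarrow> ('p::finite, 'q::finite) bmat measure \<Rightarrow> (('p, 'q) bmat \<Rightarrow> complex)
    \<Rightarrow> ('p, 'q) bmat \<Rightarrow> (complex \<Rightarrow> complex) \<Rightarrow> bool"
  where "J_continuation \<kappa> \<nu> f x F \<longleftrightarrow> F nicely_meromorphic_on UNIV \<and>
     (\<exists>c::real. \<forall>z. Re z > c \<longrightarrow> integrable \<nu> (J_integrand \<kappa> f x z) \<and>
        F z = integral\<^sup>L \<nu> (J_integrand \<kappa> f x z))"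

definition J_op ::
  "base_case \<Rightarrow> ('p::finite, 'q::finite) bmat measure \<Rightarrow> complex
    \<Rightarrow> (('p, 'q) bmat \<Rightarrow> complex) \<Rightarrow> ('p, 'q) bmat \<Rightarrow> complex"
  where "J_op \<kappa> \<nu> z f x = (THE F. J_continuation \<kappa> \<nu> f x F) z"

definition acts_by_scalar ::
  "base_case \<Rightarrow> ((('p::finite, 'q::finite) bmat \<Rightarrow> complex) \<Rightarrow> ('p, 'q) bmat \<Rightarrow> complex)
    \<Rightarrow> (('p, 'q) bmat \<Rightarrow> complex) set \<Rightarrow> complex \<Rightarrow> bool"
  where "acts_by_scalar \<kappa> T S c \<longleftrightarrow> (\<forall>f\<in>S. \<forall>x\<in>K_group \<kappa>. T f x = c * f x)"

definition J_scalar ::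
  "base_case \<Rightarrow> ('p::finite, 'q::finite) bmat measure \<Rightarrow> (('p, 'q) bmat \<Rightarrow> complex) set
    \<Rightarrow> complex \<Rightarrow> complex"
  where "J_scalar \<kappa> \<nu> S z = (THE c. acts_by_scalar \<kappa> (J_op \<kappa> \<nu> z) S c)"


subsection \<open>Irreducible unitary representations of \<open>K\<close>\<close>

text \<open>
  They are finite dimensional, so after the choice of an orthonormal basis the representation
  space is \<open>complex^'v\<close> with its standard inner product, linear in the first slot.
\<close>

definition cip :: "complex^'v \<Rightarrow> complex^'v \<Rightarrow> complex" where
  "cip v w = (\<Sum>i\<in>UNIV. v $ i * cnj (w $ i))"

definition unitary_rep :: "(complex^'n^'n) set \<Rightarrow> (complex^'n^'n \<Rightarrow> complex^'v^'v) \<Rightarrow> bool" where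
  "unitary_rep G \<pi> \<longleftrightarrow> continuous_on G \<pi> \<and> \<pi> (mat 1) = mat 1 \<and>
     (\<forall>g\<in>G. \<forall>h\<in>G. \<pi> (g ** h) = \<pi> g ** \<pi> h) \<and>
     (\<forall>g\<in>G. \<forall>v w. cip (\<pi> g *v v) (\<pi> g *v w) = cip v w)"

definition irreducible_rep :: "(complex^'n^'n) set \<Rightarrow> (complex^'n^'n \<Rightarrow> complex^'v^'v) \<Rightarrow> bool"
  where "irreducible_rep G \<pi> \<longleftrightarrow>
     (\<forall>W. vec.subspace W \<and> (\<forall>g\<in>G. \<forall>w\<in>W. \<pi> g *v w \<in> W) \<longrightarrow> W = {0} \<or> W = UNIV)"

definition chi_vectors ::
  "base_case \<Rightarrow> (('p::finite, 'q::finite) bmat \<Rightarrow> complex^'v^'v) \<Rightarrow> (complex^'v) set"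
  where "chi_vectors \<kappa> \<pi> = {v. \<forall>m\<in>L_group \<kappa>. \<pi> m *v v = chi_L \<kappa> m *s v}"

definition chi_spherical ::
  "base_case \<Rightarrow> (('p::finite, 'q::finite) bmat \<Rightarrow> complex^'v^'v) \<Rightarrow> bool"
  where "chi_spherical \<kappa> \<pi> \<longleftrightarrow> chi_vectors \<kappa> \<pi> \<noteq> {0}"

definition matrix_coefficients ::
  "(('p::finite, 'q::finite) bmat \<Rightarrow> complex^'v^'v) \<Rightarrow> complex^'v
    \<Rightarrow> (('p, 'q) bmat \<Rightarrow> complex) set"
  where "matrix_coefficients \<pi> e = {(\<lambda>x. cip v (\<pi> x *v e)) |v. True}"


subsection \<open>Restricted highest weights\<close>

text \<open>
  \<open>last_rows\<close> maps the \<open>j\<close>-th of the \<open>p\<close> indices to the \<open>(q - p + j)\<close>-th of the \<open>q\<close> indices, and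
  \<open>mexp (Y_elt t)\<close> is the rotation matrix with blocks \<open>diag (cos t\<^sub>j)\<close>, \<open>- diag (sin t\<^sub>j)\<close>,
  \<open>diag (sin t\<^sub>j)\<close>, \<open>diag (cos t\<^sub>j)\<close>.
\<close>

definition last_rows :: "'p::{finite, linorder} \<Rightarrow> 'q::{finite, linorder}" where
  "last_rows i = (THE j. card {k. j < k} = card {k. i < k})"

definition Y_elt :: "real^'p::{finite, linorder} \<Rightarrow> ('p::{finite, linorder}, 'q::{finite, linorder}) bmat" where
  "Y_elt t = blocks 0 (\<chi> i j. if j = last_rows i then - of_real (t $ i) else 0)
                      (\<chi> j i. if j = last_rows i then of_real (t $ i) else 0) 0"

text \<open>
  A vector \<open>b\<close> of \<open>real^'p\<close> stands for the linear form \<open>\<Sum>j. b\<^sub>j \<epsilon>\<^sub>j\<close>, i.e. \<open>Y_elt t \<mapsto> \<i> (b \<bullet> t)\<close>.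
\<close>

definition restricts_to ::
  "(('p::{finite, linorder}, 'q::{finite, linorder}) bmat \<Rightarrow> complex) \<Rightarrow> real^'p::{finite, linorder} \<Rightarrow> bool"
  where "restricts_to \<Lambda> b \<longleftrightarrow> (\<forall>t. \<Lambda> (Y_elt t) = \<i> * of_real (b \<bullet> t))"

definition positive_restricted :: "(real^'p::{finite, linorder}) set" where
  "positive_restricted =
     {axis i 1 |i. True} \<union> {2 *\<^sub>R axis i 1 |i. True} \<union>
     {axis i 1 + axis j 1 |i j. i < j} \<union> {axis i 1 - axis j 1 |i j. i < j}"

definition abelian_subspace :: "(complex^'n^'n) set \<Rightarrow> bool" where
  "abelian_subspace T \<longleftrightarrow> subspace T \<and> (\<forall>X\<in>T. \<forall>Y\<in>T. X ** Y = Y ** X)"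

definition cartan_subalgebra :: "(complex^'n^'n) set \<Rightarrow> (complex^'n^'n) set \<Rightarrow> bool" where
  "cartan_subalgebra \<kk> T \<longleftrightarrow> T \<subseteq> \<kk> \<and> abelian_subspace T \<and>
     (\<forall>S. T \<subseteq> S \<and> S \<subseteq> \<kk> \<and> abelian_subspace S \<longrightarrow> S = T)"

text \<open>
  \<open>X + \<i> Y\<close> with \<open>X, Y \<in> \<kk>\<close> is a root vector of the complexified Lie algebra for the root \<open>\<alpha>\<close>.
  Here \<open>\<kk>\<close> consists of skew-Hermitian matrices, so its complexification is \<open>\<kk> + \<i> \<kk>\<close>.
  Only the values of \<open>\<alpha>\<close> on \<open>T\<close> matter.
\<close>

definition root_vector ::
  "(complex^'n^'n) set \<Rightarrow> (complex^'n^'n) set \<Rightarrow> (complex^'n^'n \<Rightarrow> complex)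
    \<Rightarrow> complex^'n^'n \<Rightarrow> complex^'n^'n \<Rightarrow> bool"
  where "root_vector \<kk> T \<alpha> X Y \<longleftrightarrow> X \<in> \<kk> \<and> Y \<in> \<kk> \<and>
     X + cscale \<i> Y \<noteq> 0 \<and> (\<exists>H\<in>T. \<alpha> H \<noteq> 0) \<and>
     (\<forall>H\<in>T. H ** (X + cscale \<i> Y) - (X + cscale \<i> Y) ** H = cscale (\<alpha> H) (X + cscale \<i> Y))"

definition is_root ::
  "(complex^'n^'n) set \<Rightarrow> (complex^'n^'n) set \<Rightarrow> (complex^'n^'n \<Rightarrow> complex) \<Rightarrow> bool"
  where "is_root \<kk> T \<alpha> \<longleftrightarrow> (\<exists>X Y. root_vector \<kk> T \<alpha> X Y)"

text \<open>
  Roots take imaginary values on \<open>T\<close>.  A positive system of roots is given by a regular element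
  \<open>H\<close> of \<open>T\<close>: \<open>\<alpha>\<close> is positive iff \<open>Im (\<alpha> H) > 0\<close>.
\<close>

definition regular_element ::
  "(complex^'n^'n) set \<Rightarrow> (complex^'n^'n) set \<Rightarrow> complex^'n^'n \<Rightarrow> bool"
  where "regular_element \<kk> T H \<longleftrightarrow> H \<in> T \<and> (\<forall>\<alpha>. is_root \<kk> T \<alpha> \<longrightarrow> Im (\<alpha> H) \<noteq> 0)"

definition compatible_element ::
  "(('p::{finite, linorder}, 'q::{finite, linorder}) bmat) set \<Rightarrow> ('p, 'q) bmat set
    \<Rightarrow> ('p, 'q) bmat \<Rightarrow> bool"
  where "compatible_element \<kk> T H \<longleftrightarrow>
     (\<forall>\<alpha>. \<forall>b\<in>positive_restricted. is_root \<kk> T \<alpha> \<and> restricts_to \<alpha> b \<longrightarrow> Im (\<alpha> H) > 0)"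

definition drep :: "(complex^'n^'n \<Rightarrow> complex^'v^'v) \<Rightarrow> complex^'n^'n \<Rightarrow> complex^'v^'v" where
  "drep \<pi> X = vector_derivative (\<lambda>s. \<pi> (mexp (s *\<^sub>R X))) (at (0::real))"

definition highest_weight ::
  "(complex^'n^'n) set \<Rightarrow> (complex^'n^'n) set \<Rightarrow> complex^'n^'n
    \<Rightarrow> (complex^'n^'n \<Rightarrow> complex^'v^'v) \<Rightarrow> (complex^'n^'n \<Rightarrow> complex) \<Rightarrow> bool"
  where "highest_weight \<kk> T H \<pi> \<Lambda> \<longleftrightarrow> (\<exists>v. v \<noteq> 0 \<and>
     (\<forall>X\<in>T. drep \<pi> X *v v = \<Lambda> X *s v) \<and>
     (\<forall>\<alpha> X Y. root_vector \<kk> T \<alpha> X Y \<and> Im (\<alpha> H) > 0 \<longrightarrow>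
        drep \<pi> X *v v + \<i> *s (drep \<pi> Y *v v) = 0))"

text \<open>
  The restriction to \<open>\<bb>\<close> of the highest weight, for a Cartan subalgebra containing \<open>\<bb>\<close> and a
  positive system compatible with the positive restricted roots.
\<close>

definition restricted_highest_weight ::
  "base_case \<Rightarrow> (('p::{finite, linorder}, 'q::{finite, linorder}) bmat \<Rightarrow> complex^'v^'v)
    \<Rightarrow> real^'p::{finite, linorder} \<Rightarrow> bool"
  where "restricted_highest_weight \<kappa> \<pi> mu \<longleftrightarrow> (\<exists>T H \<Lambda>.
     cartan_subalgebra (lie_algebra (K_group \<kappa>)) T \<and> range Y_elt \<subseteq> T \<and>
     regular_element (lie_algebra (K_group \<kappa>)) T H \<and>
     compatible_element (lie_algebra (K_group \<kappa>)) T H \<and>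
     highest_weight (lie_algebra (K_group \<kappa>)) T H \<pi> \<Lambda> \<and> restricts_to \<Lambda> mu)"


subsection \<open>The Gamma function of several variables\<close>

text \<open>The \<open>j\<close>-th index in the order of \<open>'p\<close> has \<open>card {i. i < j}\<close> predecessors (\<open>j - 1\<close> in 1-based
  numbering); a scalar \<open>z\<close> is identified with \<open>vec z\<close>.\<close>

definition Gamma_pd :: "nat \<Rightarrow> complex^'p::{finite, linorder} \<Rightarrow> complex" where
  "Gamma_pd d z = (\<Prod>j\<in>UNIV. Gamma (z $ j - of_nat d / 2 * of_nat (card {i. i < j})))"

definition eta_formula ::
  "base_case \<Rightarrow> ('p::{finite, linorder} \<times> 'q::{finite, linorder}) itself \<Rightarrow> complex \<Rightarrow> complex"
  where "eta_formula \<kappa> T z = (let d = dim_base \<kappa>; k = of_nat (min_type \<kappa>) in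
     Gamma_pd d (vec (of_nat (d * CARD('p + 'q)) / 2) :: complex^'p::{finite, linorder})
       / Gamma_pd d (vec (of_nat (d * CARD('p)) / 2) :: complex^'p::{finite, linorder})
     * (Gamma_pd d (vec ((z - rho \<kappa> T + k + of_nat (d * CARD('p))) / 2) :: complex^'p::{finite, linorder})
       / Gamma_pd d (vec ((z + rho \<kappa> T + k) / 2) :: complex^'p::{finite, linorder})))"

end

theory Submission imports Defs begin

text \<open>The proof computes the action of \<open>J(\<lambda>)\<close> on one vector: if \<open>J(\<lambda>)\<close> acts by a scalar on the matrix
  coefficients \<open>x \<mapsto> (v, \<pi>(x) e)\<close>, then this scalar is the integral over \<open>K\<close> of the kernel
  \<open>\<alpha>(g)\<^bsup>\<lambda> - \<rho>\<^esup> \<chi>(m(g))\<close> against the conjugate of the spherical function \<open>\<phi>(g) = (\<pi>(g) e, e)\<close>.  Three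
  facts make the integral explicit.

  First, all data of the open cell are functions of the determinant \<open>D(g)\<close> of the upper left block
  (\<open>chi_L_eq\<close>, \<open>chi_M_eq\<close>, \<open>cell_kernel\<close>): the element \<open>g\<close> lies in the cell iff \<open>D(g) \<noteq> 0\<close>, and then
  \<open>\<alpha>(g)\<^bsup>z\<^esup> = \<bar>D(g)\<bar>\<^bsup>z\<^esup>\<close>, while \<open>\<chi>(m(g))\<close> is the \<open>k\<close>-th power of the phase of \<open>D(g)\<close>, conjugated for negative
  \<open>l\<close>.

  Second, for the smallest \<open>K\<close>-type the spherical function is the same power of \<open>D(g)\<close> itself
  (\<open>spherical_function\<close>).  The coefficient \<open>(\<pi>(g) v, e)\<close> of a highest weight vector \<open>v\<close> is compared with
  an explicit polynomial, the \<open>k\<close>-th power of a \<open>p \<times> p\<close> minor in a frame of weight vectors.  On both the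
  Lie algebra of \<open>L\<close> acts on the left by the same character, and on the right the Iwasawa decomposition
  reduces every element of the complexified Lie algebra to that of \<open>L\<close> in the same way
  (\<open>right_reduction\<close>); so all derivatives at the identity agree (\<open>words_agree\<close>), and analyticity along
  one-parameter groups gives equality on \<open>K\<close> (\<open>coefficient_eq_model\<close>).  An average over finitely many
  elements of \<open>L\<close> then turns the minor into \<open>D(g)\<close> and \<open>v\<close> into a multiple of \<open>e\<close>; this also shows that
  the \<open>\<chi>\<close>-spherical vectors form a line.

  The phases of kernel and spherical function cancel, and the scalar becomes the integral of
  \<open>\<bar>D(g)\<bar>\<^bsup>\<lambda> - \<rho> + k\<^esup>\<close>.  Third, this integral is a product of Gamma quotients (\<open>haar_integral_det_power\<close>).
  By Gram-Schmidt orthogonalisation \<open>\<bar>D(g)\<bar>\<^sup>2\<close> is the product of the squared distances of each row of the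
  block to the span of the previous ones.  Infinitesimal rotations of a row into the remaining ones
  preserve Haar measure; this yields a recursion for the moments of each squared distance
  (\<open>moment_recursion\<close>), which is that of a Beta distribution.

  For real part of \<open>\<lambda>\<close> greater than \<open>\<rho>\<close> the integral converges, and the meromorphic continuation is
  given by the same formula, by uniqueness of continuation.\<close>


(* The dollar sign is reserved for the entries of vectors. *)
no_notation fps_nth (infixl \<open>$\<close> 75)

section \<open>Complex matrices and the matrix exponential\<close>

lemma bounded_bilinear_matrix_mult:
  "bounded_bilinear ((**) :: complex^'n::finite^'m::finite \<Rightarrow> complex^'k::finite^'n \<Rightarrow> complex^'k^'m)"
  unfolding bilinear_conv_bounded_bilinear [symmetric] bilinear_def
  by (auto simp: linear_iff vec_eq_iff matrix_matrix_mult_def sum.distrib algebra_simps scaleR_sum_right)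

interpretation mm: bounded_bilinear
  "(**) :: complex^'n::finite^'m::finite \<Rightarrow> complex^'k::finite^'n \<Rightarrow> complex^'k^'m"
  by (rule bounded_bilinear_matrix_mult)

lemma bounded_bilinear_matrix_vector_mult:
  "bounded_bilinear ((*v) :: complex^'n::finite^'m::finite \<Rightarrow> complex^'n \<Rightarrow> complex^'m)"
  unfolding bilinear_conv_bounded_bilinear [symmetric] bilinear_def
  by (auto simp: linear_iff vec_eq_iff matrix_vector_mult_def sum.distrib algebra_simps scaleR_sum_right)

interpretation mv: bounded_bilinear
  "(*v) :: complex^'n::finite^'m::finite \<Rightarrow> complex^'n \<Rightarrow> complex^'m"
  by (rule bounded_bilinear_matrix_vector_mult)

definition mcnj :: "complex^'n^'m \<Rightarrow> complex^'n^'m" where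
  "mcnj A = (\<chi> i j. cnj (A $ i $ j))"

lemma cscale_nth [simp]: "cscale c A $ i $ j = c * A $ i $ j"
  by (simp add: cscale_def)

lemma herm_nth [simp]: "herm A $ i $ j = cnj (A $ j $ i)"
  by (simp add: herm_def)

lemma mcnj_nth [simp]: "mcnj A $ i $ j = cnj (A $ i $ j)"
  by (simp add: mcnj_def)

lemma mat_nth: "mat c $ i $ j = (if i = j then c else 0)"
  by (simp add: mat_def)

lemma matrix_mult_nth: "(A ** B) $ i $ j = (\<Sum>k\<in>UNIV. A $ i $ k * B $ k $ j)"
  by (simp add: matrix_matrix_mult_def)

lemma cscale_mult_left: "cscale c A ** B = cscale c (A ** B)"
  and cscale_mult_right: "A ** cscale c B = cscale c (A ** B)"
  for A :: "complex^'n::finite^'m::finite"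
  by (simp_all add: vec_eq_iff matrix_mult_nth sum_distrib_left algebra_simps)

lemma cscale_add_right: "cscale c (A + B) = cscale c A + cscale c B"
  and cscale_diff_right: "cscale c (A - B) = cscale c A - cscale c B"
  and cscale_minus_right: "cscale c (- A) = - cscale c A"
  and cscale_add_left: "cscale (c + d) A = cscale c A + cscale d A"
  and cscale_cscale [simp]: "cscale c (cscale d A) = cscale (c * d) A"
  and cscale_one [simp]: "cscale 1 A = A"
  and cscale_zero [simp]: "cscale 0 A = 0"
  and cscale_zero_right [simp]: "cscale c 0 = 0"
  and cscale_minus_one: "cscale (- 1) A = - A"
  by (simp_all add: vec_eq_iff algebra_simps)

lemma scaleR_cscale: "r *\<^sub>R A = cscale (of_real r) A"
  by (simp only: vec_eq_iff cscale_nth vector_scaleR_component) (simp add: scaleR_conv_of_real)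

lemma cscale_vector_mult: "cscale c A *v x = c *s (A *v x)"
  and cscale_vector_mult': "A *v (c *s x) = c *s (A *v x)"
  for A :: "complex^'n::finite^'m::finite"
  by (simp_all add: vec_eq_iff matrix_vector_mult_def sum_distrib_left algebra_simps)

lemma herm_mult: "herm (A ** B) = herm B ** herm A"
  for A :: "complex^'n::finite^'m::finite"
  by (simp add: vec_eq_iff matrix_mult_nth algebra_simps)

lemma herm_herm [simp]: "herm (herm A) = A"
  and herm_add: "herm (A + B) = herm A + herm B"
  and herm_diff: "herm (A - B) = herm A - herm B"
  and herm_minus: "herm (- A) = - herm A"
  and herm_zero [simp]: "herm 0 = 0"
  and herm_scaleR: "herm (r *\<^sub>R A) = r *\<^sub>R herm A"
  and herm_cscale: "herm (cscale c A) = cscale (cnj c) (herm A)"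
  by (simp_all add: vec_eq_iff)

lemma herm_mat [simp]: "herm (mat c) = mat (cnj c)"
  by (simp add: vec_eq_iff mat_nth)

lemma mcnj_mult: "mcnj (A ** B) = mcnj A ** mcnj B"
  for A :: "complex^'n::finite^'m::finite"
  by (simp add: vec_eq_iff matrix_mult_nth)

lemma mcnj_mcnj [simp]: "mcnj (mcnj A) = A"
  and mcnj_add: "mcnj (A + B) = mcnj A + mcnj B"
  and mcnj_scaleR: "mcnj (r *\<^sub>R A) = r *\<^sub>R mcnj A"
  and herm_mcnj: "herm (mcnj A) = mcnj (herm A)"
  by (simp_all add: vec_eq_iff)

lemma mcnj_mat [simp]: "mcnj (mat c) = mat (cnj c)"
  by (simp add: vec_eq_iff mat_nth)

lemma bounded_linear_herm: "bounded_linear (herm :: complex^'n::finite^'m::finite \<Rightarrow> _)"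
  by (intro linear_conv_bounded_linear [THEN iffD1]) (simp add: linear_iff herm_add herm_scaleR)

lemma bounded_linear_mcnj: "bounded_linear (mcnj :: complex^'n::finite^'m::finite \<Rightarrow> _)"
  by (intro linear_conv_bounded_linear [THEN iffD1]) (simp add: linear_iff mcnj_add mcnj_scaleR)

lemma det_mcnj: "det (mcnj A) = cnj (det A)"
  by (simp add: det_def)

lemma det_herm: "det (herm A) = cnj (det A)" for A :: "complex^'n::finite^'n"
proof -
  have "herm A = mcnj (transpose A)" by (simp add: vec_eq_iff transpose_def)
  then show ?thesis by (simp add: det_mcnj det_transpose)
qed

lemma matrices_over_Real: "A \<in> matrices_over Real_Case \<longleftrightarrow> mcnj A = A"
  by (simp add: matrices_over_def vec_eq_iff Reals_cnj_iff)

lemma matrices_over_Complex [simp]: "A \<in> matrices_over (Complex_Case l)"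
  by (simp add: matrices_over_def)

lemma scalars_closed:
  shows "a \<in> scalars \<kappa> \<Longrightarrow> b \<in> scalars \<kappa> \<Longrightarrow> a + b \<in> scalars \<kappa>"
    "a \<in> scalars \<kappa> \<Longrightarrow> b \<in> scalars \<kappa> \<Longrightarrow> a - b \<in> scalars \<kappa>"
    "a \<in> scalars \<kappa> \<Longrightarrow> b \<in> scalars \<kappa> \<Longrightarrow> a * b \<in> scalars \<kappa>"
    "a \<in> scalars \<kappa> \<Longrightarrow> - a \<in> scalars \<kappa>"
    "a \<in> scalars \<kappa> \<Longrightarrow> cnj a \<in> scalars \<kappa>"
    "a \<in> scalars \<kappa> \<Longrightarrow> b \<in> scalars \<kappa> \<Longrightarrow> a / b \<in> scalars \<kappa>"
    "a \<in> scalars \<kappa> \<Longrightarrow> a ^ n \<in> scalars \<kappa>"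
  by (cases \<kappa>; simp add: Reals_cnj_iff)+

lemma scalars_of_real [simp]: "of_real r \<in> scalars \<kappa>" "0 \<in> scalars \<kappa>" "1 \<in> scalars \<kappa>"
  by (cases \<kappa>; simp)+

lemma scalars_sum: "(\<And>i. i \<in> I \<Longrightarrow> f i \<in> scalars \<kappa>) \<Longrightarrow> sum f I \<in> scalars \<kappa>"
  by (cases \<kappa>) (auto intro: sum_in_Reals)

lemma matrices_over_mult:
  "A \<in> matrices_over \<kappa> \<Longrightarrow> B \<in> matrices_over \<kappa> \<Longrightarrow> A ** B \<in> matrices_over \<kappa>"
  for A :: "complex^'n::finite^'m::finite"
  unfolding matrices_over_def by (auto simp: matrix_mult_nth intro!: scalars_sum scalars_closed)

lemma matrices_over_herm: "A \<in> matrices_over \<kappa> \<Longrightarrow> herm A \<in> matrices_over \<kappa>"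
  unfolding matrices_over_def by (auto intro: scalars_closed)

lemma matrices_over_mat: "c \<in> scalars \<kappa> \<Longrightarrow> mat c \<in> matrices_over \<kappa>"
  unfolding matrices_over_def by (auto simp: mat_nth)

lemma mat_power_norm_bound:
  fixes A :: "complex^'n::finite^'n"
  shows "\<exists>C c. 0 \<le> c \<and> (\<forall>k. norm (mat_power A k) \<le> C * c ^ k)"
proof -
  obtain K where K: "K > 0" "\<And>(X :: complex^'n^'n) (Y :: complex^'n^'n). norm (X ** Y) \<le> norm X * norm Y * K"
    using mm.pos_bounded by blast
  let ?C = "norm (mat 1 :: complex^'n^'n)" and ?c = "norm A * K"
  have "norm (mat_power A k) \<le> ?C * ?c ^ k" for k
  proof (induction k)
    case (Suc k)
    have "norm (A ** mat_power A k) \<le> norm A * norm (mat_power A k) * K" by (rule K(2))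
    also have "\<dots> \<le> norm A * (?C * ?c ^ k) * K"
      using Suc K(1) by (intro mult_right_mono mult_left_mono) auto
    finally show ?case by (simp add: algebra_simps)
  qed simp
  then show ?thesis using K(1) by (intro exI[of _ ?C] exI[of _ ?c]) auto
qed

lemma summable_mexp: "summable (\<lambda>k. mat_power A k /\<^sub>R fact k)"
proof -
  obtain C c where c: "0 \<le> c" "\<And>k. norm (mat_power A k) \<le> C * c ^ k"
    using mat_power_norm_bound by blast
  have "summable (\<lambda>k. C * (c ^ k /\<^sub>R fact k))"
    by (intro summable_mult summable_exp_generic)
  moreover have "norm (mat_power A k /\<^sub>R fact k) \<le> C * (c ^ k /\<^sub>R fact k)" for k
    using c(2)[of k] by (simp add: divide_simps)
  ultimately show ?thesis by (rule summable_comparison_test'[of _ 0])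
qed

lemma mexp_transfer:
  assumes "bounded_linear T" "\<And>k. T (mat_power A k) = mat_power B k"
  shows "T (mexp A) = mexp B"
proof -
  interpret bounded_linear T by fact
  show ?thesis
    unfolding mexp_def suminf[OF summable_mexp]
    by (simp add: scaleR assms(2))
qed

lemma mat_power_commute:
  assumes "A ** B = B ** A" shows "A ** mat_power B k = mat_power B k ** A"
proof (induction k)
  case (Suc k)
  have "A ** (B ** mat_power B k) = B ** (A ** mat_power B k)"
    by (simp add: assms matrix_mul_assoc)
  then show ?case by (simp add: Suc matrix_mul_assoc)
qed simp

lemma mat_power_cscale: "mat_power (cscale s A) k = cscale (s ^ k) (mat_power A k)"
  by (induction k) (simp_all add: cscale_mult_left cscale_mult_right mult.commute)

lemma mexp_commute:
  assumes "A ** B = B ** A" shows "A ** mexp B = mexp B ** A"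
proof -
  have "A ** mexp B - mexp B ** A = (\<Sum>k. (A ** mat_power B k - mat_power B k ** A) /\<^sub>R fact k)"
    unfolding mexp_def mm.bounded_linear_right[THEN bounded_linear.suminf, OF summable_mexp]
      mm.bounded_linear_left[THEN bounded_linear.suminf, OF summable_mexp]
    by (subst suminf_diff)
       (rule bounded_linear.summable[OF mm.bounded_linear_right summable_mexp]
          bounded_linear.summable[OF mm.bounded_linear_left summable_mexp]
        | simp add: mm.scaleR_left mm.scaleR_right scaleR_diff_right)+
  then show ?thesis by (simp add: mat_power_commute[OF assms])
qed

lemma herm_mexp: "herm (mexp A) = mexp (herm A)"
proof (rule mexp_transfer[OF bounded_linear_herm])
  show "herm (mat_power A k) = mat_power (herm A) k" for k
    by (induction k) (simp_all add: herm_mult mat_power_commute)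
qed

lemma mcnj_mexp: "mcnj (mexp A) = mexp (mcnj A)"
proof (rule mexp_transfer[OF bounded_linear_mcnj])
  show "mcnj (mat_power A k) = mat_power (mcnj A) k" for k
    by (induction k) (simp_all add: mcnj_mult)
qed

lemma mexp_similar:
  fixes S :: "complex^'n::finite^'n"
  assumes "S' ** S = mat 1"
  shows "S ** mexp A ** S' = mexp (S ** A ** S')"
proof (rule mexp_transfer[where T = "\<lambda>B. S ** B ** S'"])
  show "bounded_linear (\<lambda>B. S ** B ** S')"
    by (rule bounded_linear_compose[OF mm.bounded_linear_left mm.bounded_linear_right])
  have SS: "S ** S' = mat 1" using assms by (simp add: matrix_left_right_inverse)
  show "S ** mat_power A k ** S' = mat_power (S ** A ** S') k" for k
  proof (induction k)
    case (Suc k)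
    have "S ** mat_power A (Suc k) ** S' = S ** A ** (S' ** S) ** mat_power A k ** S'"
      by (simp add: assms matrix_mul_assoc)
    also have "\<dots> = (S ** A ** S') ** (S ** mat_power A k ** S')" by (simp add: matrix_mul_assoc)
    finally show ?case using Suc by simp
  qed (simp add: SS)
qed

lemma mexp_eigen:
  fixes A :: "complex^'n::finite^'n"
  assumes "A *v x = c *s x" shows "mexp A *v x = exp c *s x"
proof -
  have p: "mat_power A k *v x = c ^ k *s x" for k
  proof (induction k)
    case (Suc k)
    have "mat_power A (Suc k) *v x = A *v (mat_power A k *v x)" by (simp add: matrix_vector_mul_assoc)
    also have "\<dots> = c ^ k *s (A *v x)"
      unfolding Suc by (simp add: vec_eq_iff matrix_vector_mult_def sum_distrib_left algebra_simps)
    finally show ?case by (simp add: assms vector_smult_assoc mult.commute)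
  qed simp
  have "mexp A *v x = (\<Sum>k. (mat_power A k /\<^sub>R fact k) *v x)"
    unfolding mexp_def mv.bounded_linear_left[THEN bounded_linear.suminf, OF summable_mexp] ..
  also have "\<dots> = (\<Sum>k. (c ^ k /\<^sub>R fact k) *s x)"
    by (rule suminf_cong) (simp add: mv.scaleR_left p vec_eq_iff)
  also have "\<dots> = (\<Sum>k. c ^ k /\<^sub>R fact k) *s x"
  proof -
    have "bounded_linear (\<lambda>c::complex. c *s x)"
      by (intro linear_conv_bounded_linear[THEN iffD1])
         (simp add: linear_iff vec_eq_iff algebra_simps)
    from bounded_linear.suminf[OF this summable_exp_generic] show ?thesis by simp
  qed
  finally show ?thesis by (simp add: exp_def)
qed

lemma mexp_matrices_over: "A \<in> matrices_over \<kappa> \<Longrightarrow> mexp A \<in> matrices_over \<kappa>"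
  by (cases \<kappa>) (auto simp: matrices_over_Real mcnj_mexp)

definition mderiv :: "(complex \<Rightarrow> complex^'n^'m) \<Rightarrow> complex^'n^'m \<Rightarrow> complex \<Rightarrow> bool" where
  "mderiv M M' s \<longleftrightarrow> (\<forall>i j. ((\<lambda>s. M s $ i $ j) has_field_derivative M' $ i $ j) (at s))"

lemma mderiv_const: "mderiv (\<lambda>_. A) 0 s"
  by (simp add: mderiv_def)

lemma mderiv_cscale: "mderiv (\<lambda>s. cscale s A) A s"
  unfolding mderiv_def cscale_nth by (auto intro!: derivative_eq_intros)

lemma mderiv_add: "mderiv M M' s \<Longrightarrow> mderiv N N' s \<Longrightarrow> mderiv (\<lambda>s. M s + N s) (M' + N') s"
  by (auto simp: mderiv_def intro!: derivative_intros)

lemma mderiv_mult: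
  fixes M :: "complex \<Rightarrow> complex^'n::finite^'m::finite"
  shows "mderiv M M' s \<Longrightarrow> mderiv N N' s \<Longrightarrow> mderiv (\<lambda>s. M s ** N s) (M' ** N s + M s ** N') s"
  unfolding mderiv_def matrix_mult_nth vector_add_component sum.distrib[symmetric]
  by (intro allI DERIV_sum) (auto intro!: derivative_eq_intros)

lemma mderiv_zero_constant:
  assumes "\<And>s. mderiv M 0 s" shows "M s = M t"
proof -
  have "M s $ i $ j = M t $ i $ j" for i j
  proof -
    have "\<exists>c. \<forall>s\<in>UNIV. M s $ i $ j = c"
      using assms unfolding mderiv_def by (intro has_field_derivative_zero_constant) auto
    then show ?thesis by auto
  qed
  then show ?thesis by (simp add: vec_eq_iff)
qed

lemma mderiv_mexp: "mderiv (\<lambda>s. mexp (cscale s A)) (A ** mexp (cscale s A)) s"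
  unfolding mderiv_def
proof (intro allI)
  fix i j
  have entry: "(\<lambda>k. (mat_power B k /\<^sub>R fact k) $ i $ j) sums (mexp B $ i $ j)" for B :: "complex^'n^'n" and i j
  proof -
    have "bounded_linear (\<lambda>B::complex^'n^'n. B $ i $ j)"
      by (intro bounded_linear_compose[OF bounded_linear_vec_nth] bounded_linear_vec_nth)
    from bounded_linear.sums[OF this summable_sums[OF summable_mexp[of B]]] show ?thesis
      by (simp add: mexp_def)
  qed
  define c where "c k = mat_power A k $ i $ j / fact k" for k
  have c: "(mat_power (cscale y A) k /\<^sub>R fact k) $ i $ j = c k * y ^ k" for y k
    unfolding vector_scaleR_component c_def mat_power_cscale cscale_nth
    by (simp add: scaleR_conv_of_real field_simps)
  have sc: "(\<lambda>k. c k * y ^ k) sums (mexp (cscale y A) $ i $ j)" for y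
    using entry[of "cscale y A" i j] unfolding c .
  have "diffs c k * s ^ k = (\<Sum>l\<in>UNIV. A $ i $ l * (mat_power (cscale s A) k /\<^sub>R fact k) $ l $ j)" for k
  proof -
    have "diffs c k = mat_power A (Suc k) $ i $ j / fact k"
      by (simp add: diffs_def c_def del: mat_power.simps of_nat_Suc)
    then show ?thesis
      unfolding vector_scaleR_component mat_power_cscale cscale_nth
      by (simp add: matrix_mult_nth sum_distrib_left sum_divide_distrib
          scaleR_conv_of_real field_simps)
  qed
  moreover have "(\<lambda>k. \<Sum>l\<in>UNIV. A $ i $ l * (mat_power (cscale s A) k /\<^sub>R fact k) $ l $ j)
      sums (A ** mexp (cscale s A)) $ i $ j"
    unfolding matrix_mult_nth[of A] by (rule sums_sum, rule sums_mult, rule entry)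
  ultimately have d: "(\<lambda>k. diffs c k * s ^ k) sums (A ** mexp (cscale s A)) $ i $ j" by simp
  have "((\<lambda>x. \<Sum>k. c k * x ^ k) has_field_derivative (\<Sum>k. diffs c k * s ^ k)) (at s)"
    using sc by (intro termdiffs_strong_converges_everywhere) (auto dest: sums_summable)
  then show "((\<lambda>s. mexp (cscale s A) $ i $ j) has_field_derivative (A ** mexp (cscale s A)) $ i $ j) (at s)"
    using sc d by (simp add: sums_iff)
qed

lemma mexp_zero [simp]: "mexp (0 :: complex^'n::finite^'n) = mat 1"
proof -
  have "mat_power (0::complex^'n^'n) k /\<^sub>R fact k = (if k = 0 then mat 1 else 0)" for k
    by (cases k) (auto simp: mm.zero_left)
  then show ?thesis unfolding mexp_def by (subst suminf_finite[of "{0}"]) (simp_all del: scaleR_eq_0_iff)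
qed

text \<open>The product \<open>exp (s(A + B)) exp (-sA) exp (-sB)\<close> has derivative zero in \<open>s\<close> because all factors
  commute with \<open>A\<close> and \<open>B\<close>.\<close>

lemma mexp_add_aux:
  assumes AB: "A ** B = B ** A"
  shows "mexp (A + B) ** mexp (- A) ** mexp (- B) = mat 1"
proof -
  define E F G where "E s = mexp (cscale s (A + B))" and "F s = mexp (cscale s (- A))"
    and "G s = mexp (cscale s (- B))" for s
  have E: "mderiv E ((A + B) ** E s) s" and F: "mderiv F (- A ** F s) s" and G: "mderiv G (- B ** G s) s" for s
    unfolding E_def F_def G_def by (rule mderiv_mexp)+
  have AE: "A ** E s = E s ** A" and BE: "B ** E s = E s ** B" and BF: "B ** F s = F s ** B" for s
    unfolding E_def F_def by (intro mexp_commute,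
        simp add: AB mm.add_left mm.add_right mm.minus_left mm.minus_right cscale_mult_left cscale_mult_right
          cscale_minus_right cscale_add_right)+
  have "mderiv (\<lambda>s. E s ** F s ** G s) 0 s" for s
  proof -
    have "((A + B) ** E s ** F s + E s ** (- A ** F s)) ** G s + E s ** F s ** (- B ** G s) = 0"
      using AE[of s] BE[of s] BF[of s]
      by (simp add: mm.add_left mm.minus_left mm.minus_right matrix_mul_assoc)
         (metis matrix_mul_assoc)
    then show ?thesis using mderiv_mult[OF mderiv_mult[OF E F] G, of s] by simp
  qed
  from mderiv_zero_constant[OF this, of 1 0] show ?thesis by (simp add: E_def F_def G_def)
qed

lemma mexp_minus: "mexp A ** mexp (- A) = mat 1" "mexp (- A) ** mexp A = mat 1"
  using mexp_add_aux[of "- A" A] mexp_add_aux[of "A" "- A"] by (simp_all add: mm.minus_left mm.minus_right)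

lemma mexp_add: "mexp (A + B) = mexp A ** mexp B" if "A ** B = B ** A"
proof -
  have "mexp (A + B) ** mexp (- A) ** mexp (- B) ** mexp B ** mexp A = mexp B ** mexp A"
    by (simp add: mexp_add_aux[OF that])
  then have "mexp (A + B) = mexp B ** mexp A"
    by (simp add: mexp_minus flip: matrix_mul_assoc)
  also have "\<dots> = mexp A ** mexp B"
    by (metis mexp_commute that)
  finally show ?thesis .
qed

lemma mexp_cscale_add: "mexp (cscale (s + t) A) = mexp (cscale s A) ** mexp (cscale t A)"
  by (simp add: cscale_add_left mexp_add cscale_mult_left cscale_mult_right mult.commute)

lemma mexp_scaleR_add: "mexp ((s + t) *\<^sub>R A) = mexp (s *\<^sub>R A) ** mexp (t *\<^sub>R A)"
  by (simp add: scaleR_cscale mexp_cscale_add)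

lemma mexp_mat: "mexp (mat c :: complex^'n::finite^'n) = mat (exp c)"
proof -
  have "mat c *v x = c *s x" for x :: "complex^'n" and c
    by (simp add: vec_eq_iff matrix_vector_mult_def mat_nth if_distrib if_distribR cong: if_cong)
  then show ?thesis by (metis matrix_eq mexp_eigen)
qed

text \<open>Every permutation other than the identity moves at least two indices, so its term in the Leibniz
  formula vanishes to second order at the identity matrix.\<close>

lemma det_deriv_at_identity:
  fixes M :: "complex \<Rightarrow> complex^'n::finite^'n"
  assumes "mderiv M M' s" "M s = mat 1"
  shows "((\<lambda>s. det (M s)) has_field_derivative trace M') (at s)"
proof -
  have d: "((\<lambda>s. M s $ i $ j) has_field_derivative M' $ i $ j) (at s)" for i j
    using assms(1) by (simp add: mderiv_def)
  have "((\<lambda>s. det (M s)) has_field_derivative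
      (\<Sum>p | p permutes UNIV. of_int (sign p) *
         (\<Sum>i\<in>UNIV. M' $ i $ p i * (\<Prod>j\<in>UNIV - {i}. M s $ j $ p j)))) (at s)"
    unfolding det_def
    by (intro DERIV_sum DERIV_cmult has_field_derivative_prod d)
  also have "(\<Sum>p | p permutes UNIV. of_int (sign p) *
         (\<Sum>i\<in>UNIV. M' $ i $ p i * (\<Prod>j\<in>UNIV - {i}. M s $ j $ p j))) =
      (\<Sum>p\<in>{id}. of_int (sign p) *
         (\<Sum>i\<in>UNIV. M' $ i $ p i * (\<Prod>j\<in>UNIV - {i}. M s $ j $ p j)))"
  proof (rule sum.mono_neutral_right)
    show "\<forall>p\<in>{p. p permutes UNIV} - {id}. of_int (sign p) *
         (\<Sum>i\<in>UNIV. M' $ i $ p i * (\<Prod>j\<in>UNIV - {i}. M s $ j $ p j)) = 0"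
    proof
      fix p :: "'n \<Rightarrow> 'n" assume p: "p \<in> {p. p permutes UNIV} - {id}"
      have "(\<Prod>j\<in>UNIV - {i}. M s $ j $ p j) = 0" for i
      proof -
        have "\<exists>j. j \<noteq> i \<and> p j \<noteq> j"
        proof (rule ccontr)
          assume "\<not> ?thesis"
          then have fixp: "p j = j" if "j \<noteq> i" for j using that by blast
          have "p i = i"
            using p fixp permutes_inj[of p UNIV] by (metis DiffD1 injD mem_Collect_eq)
          then have "p x = x" for x using fixp by (cases "x = i") auto
          then show False using p by (auto simp: fun_eq_iff)
        qed
        then obtain j where j: "j \<noteq> i" "p j \<noteq> j" by blast
        then have "M s $ j $ p j = 0" by (simp add: assms(2) mat_nth)
        then show ?thesis using j(1) by (intro prod_zero) auto
      qed
      then show "of_int (sign p) *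
         (\<Sum>i\<in>UNIV. M' $ i $ p i * (\<Prod>j\<in>UNIV - {i}. M s $ j $ p j)) = 0"
        by (simp only: mult_zero_right sum.neutral_const)
    qed
  qed (auto simp: permutes_id)
  also have "\<dots> = trace M'" by (simp add: trace_def assms(2) mat_nth)
  finally show ?thesis .
qed

lemma trace_cscale: "trace (cscale c A) = c * trace A"
  by (simp add: trace_def sum_distrib_left)

text \<open>Both sides solve \<open>d' = (trace A) d\<close> along \<open>s \<mapsto> exp (sA)\<close>, by multiplicativity of the determinant.\<close>

lemma det_mexp: "det (mexp A) = exp (trace A)" for A :: "complex^'n::finite^'n"
proof -
  define d where "d s = det (mexp (cscale s A))" for s
  have d: "(d has_field_derivative d s * trace A) (at s)" for s
  proof -
    have "mderiv (\<lambda>h. mexp (cscale h A)) A 0" using mderiv_mexp[of A 0] by simp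
    from det_deriv_at_identity[OF this] have "(d has_field_derivative trace A) (at 0)"
      by (simp add: d_def[abs_def])
    then have "((\<lambda>h. d s * d h) has_field_derivative d s * trace A) (at 0)" by (rule DERIV_cmult)
    moreover have "d s * d h = d (h + s)" for h
      by (simp add: d_def mexp_cscale_add det_mul)
    ultimately show ?thesis using DERIV_shift[of d "d s * trace A" 0 s] by simp
  qed
  have "((\<lambda>s. d s * exp (- s * trace A)) has_field_derivative 0) (at s)" for s
    by (auto intro!: derivative_eq_intros d simp: algebra_simps)
  then have "d 1 * exp (- 1 * trace A) = d 0 * exp (- 0 * trace A)"
    using has_field_derivative_zero_constant[of UNIV "\<lambda>s. d s * exp (- s * trace A)"]
    by (metis UNIV_I convex_UNIV)
  then show ?thesis by (simp add: d_def exp_minus field_simps)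
qed

lemma has_vector_derivative_matrix:
  fixes M :: "real \<Rightarrow> complex^'n::finite^'m::finite"
  assumes "\<And>i j. ((\<lambda>s. M s $ i $ j) has_vector_derivative M' $ i $ j) (at s)"
  shows "(M has_vector_derivative M') (at s)"
  using assms unfolding has_vector_derivative_def has_derivative_def
  by (auto intro!: vec_tendstoI bounded_linear_scaleR_left simp: bounded_linear_scaleR_left)

lemma has_vector_derivative_mexp:
  "((\<lambda>s. mexp (s *\<^sub>R A)) has_vector_derivative A ** mexp (s *\<^sub>R A)) (at s)"
proof (rule has_vector_derivative_matrix)
  fix i j
  have "((\<lambda>s. mexp (cscale s A) $ i $ j) has_field_derivative
      (A ** mexp (cscale (of_real s) A)) $ i $ j) (at (of_real s))"
    using mderiv_mexp[of A "of_real s"] by (simp add: mderiv_def)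
  from has_vector_derivative_real_field[OF this]
  show "((\<lambda>s. mexp (s *\<^sub>R A) $ i $ j) has_vector_derivative (A ** mexp (s *\<^sub>R A)) $ i $ j) (at s)"
    by (simp add: scaleR_cscale)
qed

section \<open>Commuting self-adjoint operators\<close>

text \<open>A maximum of the Rayleigh quotient \<open>A x \<bullet> x\<close> on the unit sphere of \<open>W\<close> is an eigenvector.\<close>

lemma selfadjoint_eigenvector:
  fixes A :: "'a::euclidean_space \<Rightarrow> 'a"
  assumes W: "subspace W" "x0 \<in> W" "x0 \<noteq> 0"
    and A: "linear A" "\<And>x. x \<in> W \<Longrightarrow> A x \<in> W"
    and sa: "\<And>x y. x \<in> W \<Longrightarrow> y \<in> W \<Longrightarrow> A x \<bullet> y = x \<bullet> A y"
  obtains x l where "x \<in> W" "x \<noteq> 0" "A x = l *\<^sub>R x"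
proof -
  interpret A: linear A by fact
  define S where "S = W \<inter> sphere 0 1"
  have "compact S" unfolding S_def using W(1) by (simp add: closed_Int_compact closed_subspace)
  moreover have "x0 /\<^sub>R norm x0 \<in> S" using W by (simp add: S_def subspace_scale)
  moreover have "continuous_on S (\<lambda>x. A x \<bullet> x)"
    by (intro continuous_on_inner continuous_on_id linear_continuous_on) (simp add: A(1) linear_linear)
  ultimately obtain x where x: "x \<in> S" "\<And>y. y \<in> S \<Longrightarrow> A y \<bullet> y \<le> A x \<bullet> x"
    using continuous_attains_sup[of S "\<lambda>x. A x \<bullet> x"] by blast
  define l where "l = A x \<bullet> x"
  have xW: "x \<in> W" and nx: "x \<bullet> x = 1" using x(1) by (auto simp: S_def dot_square_norm)
  have le: "A y \<bullet> y \<le> l * (y \<bullet> y)" if "y \<in> W" for y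
  proof (cases "y = 0")
    case False
    then have "y /\<^sub>R norm y \<in> S" using that W(1) by (simp add: S_def subspace_scale)
    from x(2)[OF this] have "(A y \<bullet> y) / (norm y)\<^sup>2 \<le> l"
      by (simp add: A.scaleR l_def power2_eq_square field_simps)
    then show ?thesis using False by (simp add: field_simps dot_square_norm)
  qed (simp add: A.zero)
  define z where "z = A x - l *\<^sub>R x"
  have zW: "z \<in> W" using xW A(2) W(1) by (simp add: z_def subspace_diff subspace_scale)
  define b where "b = A z \<bullet> z - l * (z \<bullet> z)"
  have q: "2 * t * (z \<bullet> z) + t\<^sup>2 * b \<le> 0" for t
  proof -
    have "x + t *\<^sub>R z \<in> W" using xW zW W(1) by (simp add: subspace_add subspace_scale)
    from le[OF this] have
      "A x \<bullet> x + t * (A x \<bullet> z) + t * (A z \<bullet> x) + t\<^sup>2 * (A z \<bullet> z) \<le> l * (x \<bullet> x + 2 * t * (x \<bullet> z) + t\<^sup>2 * (z \<bullet> z))"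
      by (simp add: A.add A.scaleR inner_add_left inner_add_right algebra_simps power2_eq_square inner_commute)
    moreover have "A z \<bullet> x = A x \<bullet> z" using sa[OF zW xW] by (simp add: inner_commute)
    moreover have "A x \<bullet> z = z \<bullet> z + l * (x \<bullet> z)"
    proof -
      have "z \<bullet> z = A x \<bullet> z - l * (x \<bullet> z)" by (subst (1) z_def) (simp add: inner_diff_left)
      then show ?thesis by simp
    qed
    ultimately show ?thesis using nx by (simp add: l_def[symmetric] b_def algebra_simps)
  qed
  have "z = 0"
  proof (rule ccontr)
    assume "z \<noteq> 0"
    then have a: "z \<bullet> z > 0" by simp
    define t where "t = (z \<bullet> z) / (\<bar>b\<bar> + 1)"
    have t: "t > 0" using a by (simp add: t_def add_nonneg_pos)
    have "t * \<bar>b\<bar> \<le> z \<bullet> z" using a by (simp add: t_def field_simps add_nonneg_pos)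
    then have "- (z \<bullet> z) \<le> t * b" using t abs_le_iff[of "t * b" "z \<bullet> z"] by (simp add: abs_mult)
    then have "0 < 2 * (z \<bullet> z) + t * b" using a by linarith
    then have "0 < t * (2 * (z \<bullet> z) + t * b)" using t by (intro mult_pos_pos)
    then show False using q[of t] by (simp add: algebra_simps power2_eq_square)
  qed
  then have "A x = l *\<^sub>R x" "x \<noteq> 0" using nx by (auto simp: z_def)
  then show ?thesis using that[of x l] xW by blast
qed

definition joint_eigenvector :: "('a::real_vector \<Rightarrow> 'a) set \<Rightarrow> 'a \<Rightarrow> bool" where
  "joint_eigenvector \<A> x \<longleftrightarrow> x \<noteq> 0 \<and> (\<forall>A\<in>\<A>. \<exists>l. A x = l *\<^sub>R x)"

text \<open>An invariant subspace of least positive dimension lies in a single eigenspace of every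
  operator of the family, because the eigenspaces are again invariant.\<close>

lemma joint_eigenvector_exists:
  fixes \<A> :: "('a::euclidean_space \<Rightarrow> 'a) set"
  assumes W: "subspace W" "x0 \<in> W" "x0 \<noteq> 0"
    and lin: "\<And>A. A \<in> \<A> \<Longrightarrow> linear A"
    and inv: "\<And>A x. A \<in> \<A> \<Longrightarrow> x \<in> W \<Longrightarrow> A x \<in> W"
    and comm: "\<And>A B x. A \<in> \<A> \<Longrightarrow> B \<in> \<A> \<Longrightarrow> x \<in> W \<Longrightarrow> A (B x) = B (A x)"
    and sa: "\<And>A x y. A \<in> \<A> \<Longrightarrow> x \<in> W \<Longrightarrow> y \<in> W \<Longrightarrow> A x \<bullet> y = x \<bullet> A y"
  obtains x where "x \<in> W" "joint_eigenvector \<A> x"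
proof -
  define P where "P V \<longleftrightarrow> subspace V \<and> V \<subseteq> W \<and> (\<exists>x\<in>V. x \<noteq> 0) \<and> (\<forall>A\<in>\<A>. \<forall>x\<in>V. A x \<in> V)" for V
  have "P W" using W inv by (auto simp: P_def)
  then obtain V where V: "P V" "\<And>U. P U \<Longrightarrow> dim V \<le> dim U"
    using ex_has_least_nat[of P W dim] by blast
  obtain x where x: "x \<in> V" "x \<noteq> 0" using V(1) by (auto simp: P_def)
  have "\<exists>l. A x = l *\<^sub>R x" if A: "A \<in> \<A>" for A
  proof -
    interpret A: linear A by (rule lin[OF A])
    have V': "subspace V" "V \<subseteq> W" "\<And>x. x \<in> V \<Longrightarrow> A x \<in> V" using V(1) A by (auto simp: P_def)
    obtain y l where y: "y \<in> V" "y \<noteq> 0" "A y = l *\<^sub>R y"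
      by (rule selfadjoint_eigenvector[OF V'(1) x lin[OF A] V'(3)]) (use sa[OF A] V'(2) in blast)+
    define E where "E = {v \<in> V. A v = l *\<^sub>R v}"
    have "subspace E" using V'(1)
      by (auto simp: E_def subspace_def A.add A.scaleR A.zero algebra_simps)
    moreover have "B v \<in> E" if "B \<in> \<A>" "v \<in> E" for B v
    proof -
      interpret B: linear B by (rule lin[OF that(1)])
      have "A (B v) = B (A v)" using comm[OF A that(1)] that(2) V'(2) by (auto simp: E_def)
      then show ?thesis using that V(1) by (auto simp: E_def B.scaleR P_def)
    qed
    ultimately have "P E" using V' y by (auto simp: P_def E_def)
    then have "E = V"
      using V(2) V'(1) by (intro subspace_dim_equal \<open>subspace E\<close>) (auto simp: E_def)
    then show ?thesis using x by (auto simp: E_def)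
  qed
  then show ?thesis using that[of x] x V(1) by (auto simp: P_def joint_eigenvector_def)
qed

text \<open>The orthogonal complement of all joint eigenvectors is again invariant, so if it were nonzero it
  would contain one.\<close>

lemma joint_eigenvectors_span:
  fixes \<A> :: "('a::euclidean_space \<Rightarrow> 'a) set"
  assumes W: "subspace W"
    and lin: "\<And>A. A \<in> \<A> \<Longrightarrow> linear A"
    and inv: "\<And>A x. A \<in> \<A> \<Longrightarrow> x \<in> W \<Longrightarrow> A x \<in> W"
    and comm: "\<And>A B x. A \<in> \<A> \<Longrightarrow> B \<in> \<A> \<Longrightarrow> x \<in> W \<Longrightarrow> A (B x) = B (A x)"
    and sa: "\<And>A x y. A \<in> \<A> \<Longrightarrow> x \<in> W \<Longrightarrow> y \<in> W \<Longrightarrow> A x \<bullet> y = x \<bullet> A y"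
  shows "W \<subseteq> span {x \<in> W. joint_eigenvector \<A> x}"
proof
  let ?E = "{x \<in> W. joint_eigenvector \<A> x}"
  fix x assume x: "x \<in> W"
  obtain y z where yz: "y \<in> span ?E" "\<And>w. w \<in> span ?E \<Longrightarrow> orthogonal z w" "x = y + z"
    using orthogonal_subspace_decomp_exists by blast
  have "span ?E \<subseteq> W" using W by (intro span_minimal) auto
  then have zW: "z \<in> W" using yz(1,3) x W subspace_diff[of W x y] by auto
  define V where "V = {v \<in> W. \<forall>e\<in>?E. v \<bullet> e = 0}"
  have V: "subspace V" using W by (auto simp: V_def subspace_def inner_add_left)
  have zV: "z \<in> V" using zW yz(2) by (auto simp: V_def orthogonal_def span_base)
  have "z = 0"
  proof (rule ccontr)
    assume z: "z \<noteq> 0"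
    have "A v \<in> V" if "A \<in> \<A>" "v \<in> V" for A v
    proof -
      have v: "v \<in> W" "\<And>e. e \<in> ?E \<Longrightarrow> v \<bullet> e = 0" using that(2) by (auto simp: V_def)
      have "A v \<bullet> e = 0" if e: "e \<in> ?E" for e
      proof -
        obtain l where "A e = l *\<^sub>R e" using e \<open>A \<in> \<A>\<close> by (auto simp: joint_eigenvector_def)
        then show ?thesis using sa[OF \<open>A \<in> \<A>\<close> v(1), of e] e v(2)[OF e] by simp
      qed
      then show ?thesis using inv[OF that(1) v(1)] by (simp add: V_def)
    qed
    note inv' = this
    obtain v where v: "v \<in> V" "joint_eigenvector \<A> v"
      by (rule joint_eigenvector_exists[of V z \<A>])
         (use V zV z lin inv' comm sa in \<open>auto simp: V_def\<close>)
    then have "v \<bullet> v = 0" by (auto simp: V_def)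
    then show False using v(2) by (simp add: joint_eigenvector_def)
  qed
  then show "x \<in> span ?E" using yz by simp
qed

section \<open>Hermitian logarithms\<close>

lemma scaleR_smult: "r *\<^sub>R x = of_real r *s x" for x :: "complex^'n"
  unfolding vec_eq_iff vector_scaleR_component vector_smult_component
  by (simp add: scaleR_conv_of_real)

lemma inner_cip: "v \<bullet> w = Re (cip v w)"
  by (simp add: inner_vec_def cip_def inner_complex_def)

lemma cip_adjoint: "cip (A *v x) y = cip x (herm A *v y)"
  for A :: "complex^'n::finite^'m::finite"
  unfolding cip_def matrix_vector_mult_def
  by (simp add: sum_distrib_left sum_distrib_right mult.assoc mult.left_commute)
     (rule sum.swap)

lemma inner_herm: "(A *v x) \<bullet> y = x \<bullet> (herm A *v y)"
  for A :: "complex^'n::finite^'m::finite"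
  by (simp add: inner_cip cip_adjoint)

lemma real_polynomial_interpolation:
  fixes f :: "real \<Rightarrow> real"
  assumes "finite S" shows "\<exists>p. \<forall>x\<in>S. poly p x = f x"
  using assms
proof (induction S)
  case (insert a S)
  then obtain p where p: "\<And>x. x \<in> S \<Longrightarrow> poly p x = f x" by blast
  define q where "q = (\<Prod>x\<in>S. [:-x, 1:])"
  have q: "poly q x = 0" if "x \<in> S" for x
    using that insert(1) by (auto simp: q_def poly_prod)
  have qa: "poly q a \<noteq> 0" using insert(1,2) by (auto simp: q_def poly_prod)
  show ?case
    by (rule exI[of _ "p + smult ((f a - poly p a) / poly q a) q"])
       (use p q qa insert(2) in auto)
qed simp

definition matrix_poly :: "real poly \<Rightarrow> complex^'n::finite^'n \<Rightarrow> complex^'n^'n" where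
  "matrix_poly q P = (\<Sum>i\<le>degree q. coeff q i *\<^sub>R mat_power P i)"

lemma mat_power_eigen:
  fixes P :: "complex^'n::finite^'n"
  shows "P *v x = l *\<^sub>R x \<Longrightarrow> mat_power P i *v x = l ^ i *\<^sub>R x"
  by (induction i) (simp_all add: mv.scaleR_right flip: matrix_vector_mul_assoc)

lemma matrix_poly_eigen:
  "P *v x = l *\<^sub>R x \<Longrightarrow> matrix_poly q P *v x = poly q l *\<^sub>R x"
  unfolding matrix_poly_def poly_altdef
  by (simp add: mv.sum_left mv.scaleR_left mat_power_eigen[of P x l] scaleR_sum_left)

text \<open>The logarithm of a positive definite matrix is taken as a real polynomial in it, so that
  reality and block structure are inherited.\<close>

lemma hermitian_log:
  fixes P :: "complex^'n::finite^'n"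
  assumes P: "herm P = P" and pos: "\<And>x. x \<noteq> 0 \<Longrightarrow> (P *v x) \<bullet> x > 0"
  obtains q where "mexp (2 *\<^sub>R matrix_poly q P) = P"
proof -
  define E where "E = {x \<in> UNIV. joint_eigenvector {(*v) P} x}"
  have "UNIV \<subseteq> span E" unfolding E_def
    by (rule joint_eigenvectors_span) (auto simp: inner_herm P intro!: bounded_linear.linear mv.bounded_linear_right)
  then obtain B where B: "B \<subseteq> E" "independent B" "span B = UNIV"
    using maximal_independent_subset[of E] by (metis span_mono span_span top.extremum_unique subset_antisym)
  have fB: "finite B" using B(2) by (rule independent_imp_finite)
  define ev where "ev x = (SOME l::real. P *v x = l *\<^sub>R x)" for x
  have ev: "P *v x = ev x *\<^sub>R x" "x \<noteq> 0" if "x \<in> B" for x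
    using that B(1) someI_ex[of "\<lambda>l. P *v x = l *\<^sub>R x"] unfolding ev_def E_def joint_eigenvector_def by auto
  have evpos: "ev x > 0" if "x \<in> B" for x
    using pos[of x] ev[OF that] inner_ge_zero[of x] by (auto simp: zero_less_mult_iff)
  obtain q where q: "\<And>l. l \<in> ev ` B \<Longrightarrow> poly q l = ln l / 2"
    using real_polynomial_interpolation[of "ev ` B" "\<lambda>l. ln l / 2"] fB by auto
  have "mexp (2 *\<^sub>R matrix_poly q P) *v x = P *v x" if "x \<in> B" for x
  proof -
    have "(2 *\<^sub>R matrix_poly q P) *v x = (2 * poly q (ev x)) *\<^sub>R x"
      by (simp add: mv.scaleR_left matrix_poly_eigen[OF ev(1)[OF that]])
    also have "\<dots> = of_real (ln (ev x)) *s x"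
    proof -
      have "2 * poly q (ev x) = ln (ev x)" using q[of "ev x"] that by simp
      then show ?thesis by (simp only: scaleR_smult)
    qed
    finally have "mexp (2 *\<^sub>R matrix_poly q P) *v x = exp (of_real (ln (ev x))) *s x"
      by (rule mexp_eigen)
    also have "\<dots> = ev x *\<^sub>R x"
      using evpos[OF that] by (simp add: exp_of_real scaleR_smult)
    finally show ?thesis using ev(1)[OF that] by simp
  qed
  then have "mexp (2 *\<^sub>R matrix_poly q P) *v x = P *v x" for x
    using linear_eq_on[of "(*v) (mexp (2 *\<^sub>R matrix_poly q P))" "(*v) P" x B] B(3)
    by (auto intro!: bounded_linear.linear mv.bounded_linear_right)
  then have "mexp (2 *\<^sub>R matrix_poly q P) = P" by (simp add: matrix_eq)
  then show ?thesis by (rule that)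
qed

lemma matrix_poly_induct:
  assumes "S (mat 1)" "\<And>A. S A \<Longrightarrow> S (P ** A)" "\<And>A B. S A \<Longrightarrow> S B \<Longrightarrow> S (A + B)"
    "\<And>r A. S A \<Longrightarrow> S (r *\<^sub>R A)"
  shows "S (matrix_poly q P)"
proof -
  have pw: "S (mat_power P i)" for i by (induction i) (auto intro: assms)
  have "S (\<Sum>i\<le>n. coeff q i *\<^sub>R mat_power P i)" for n
    by (induction n) (auto intro!: assms pw)
  then show ?thesis by (simp add: matrix_poly_def)
qed

section \<open>Block matrices\<close>

lemma blocks_nth [simp]:
  "blocks A B C D $ Inl a $ Inl b = A $ a $ b" "blocks A B C D $ Inl a $ Inr b' = B $ a $ b'"
  "blocks A B C D $ Inr a' $ Inl b = C $ a' $ b" "blocks A B C D $ Inr a' $ Inr b' = D $ a' $ b'"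
  by (simp_all add: blocks_def)

definition block12 :: "('p::finite, 'q::finite) bmat \<Rightarrow> complex^'q^'p" where
  "block12 g = (\<chi> a b. g $ Inl a $ Inr b)"

definition block21 :: "('p::finite, 'q::finite) bmat \<Rightarrow> complex^'p^'q" where
  "block21 g = (\<chi> a b. g $ Inr a $ Inl b)"

definition block22 :: "('p::finite, 'q::finite) bmat \<Rightarrow> complex^'q^'q" where
  "block22 g = (\<chi> a b. g $ Inr a $ Inr b)"

lemma block_nth [simp]:
  "block11 g $ a $ b = g $ Inl a $ Inl b" "block12 g $ a $ b' = g $ Inl a $ Inr b'"
  "block21 g $ a' $ b = g $ Inr a' $ Inl b" "block22 g $ a' $ b' = g $ Inr a' $ Inr b'"
  by (simp_all add: block11_def block12_def block21_def block22_def)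

lemma block_blocks [simp]: "block11 (blocks A B C D) = A" "block12 (blocks A B C D) = B"
  "block21 (blocks A B C D) = C" "block22 (blocks A B C D) = D"
  by (simp_all add: vec_eq_iff)

lemma all_sum_iff: "(\<forall>i. P i) \<longleftrightarrow> (\<forall>a. P (Inl a)) \<and> (\<forall>b. P (Inr b))"
  by (metis sum.exhaust)

lemma blocks_eta: "blocks (block11 g) (block12 g) (block21 g) (block22 g) = g"
  by (simp add: vec_eq_iff all_sum_iff)

lemma blocks_eq_iff: "blocks A B C D = blocks A' B' C' D' \<longleftrightarrow> A = A' \<and> B = B' \<and> C = C' \<and> D = D'"
  by (metis block_blocks)

lemma sum_UNIV_sum: "(\<Sum>k\<in>UNIV. f k) = (\<Sum>a\<in>UNIV. f (Inl a)) + (\<Sum>b\<in>UNIV. f (Inr b))"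
  for f :: "'p::finite + 'q::finite \<Rightarrow> 'c::comm_monoid_add"
  by (simp add: UNIV_Plus_UNIV [symmetric] sum.Plus del: UNIV_Plus_UNIV)

lemma blocks_mult:
  "blocks A B C D ** blocks A' B' C' D' =
    blocks (A ** A' + B ** C') (A ** B' + B ** D') (C ** A' + D ** C') (C ** B' + D ** D')"
  by (simp add: vec_eq_iff all_sum_iff matrix_mult_nth sum_UNIV_sum)

lemma blocks_mat: "mat c = blocks (mat c) 0 0 (mat c)"
  by (simp add: vec_eq_iff all_sum_iff mat_nth)

lemma herm_blocks: "herm (blocks A B C D) = blocks (herm A) (herm C) (herm B) (herm D)"
  and cscale_blocks: "cscale c (blocks A B C D) = blocks (cscale c A) (cscale c B) (cscale c C) (cscale c D)"
  by (simp_all add: vec_eq_iff all_sum_iff)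

lemma scaleR_blocks: "r *\<^sub>R blocks A B C D = blocks (r *\<^sub>R A) (r *\<^sub>R B) (r *\<^sub>R C) (r *\<^sub>R D)"
  by (simp add: scaleR_cscale cscale_blocks)

lemma diag_blocks_mult: "diag_blocks A B ** diag_blocks A' B' = diag_blocks (A ** A') (B ** B')"
  by (simp add: diag_blocks_def blocks_mult mm.zero_left mm.zero_right)

lemma diag_blocks_one: "diag_blocks (mat 1) (mat 1) = mat 1"
  by (simp add: diag_blocks_def blocks_mat)

lemma matrices_over_blocks: "blocks A B C D \<in> matrices_over \<kappa> \<longleftrightarrow>
    A \<in> matrices_over \<kappa> \<and> B \<in> matrices_over \<kappa> \<and> C \<in> matrices_over \<kappa> \<and> D \<in> matrices_over \<kappa>"
  by (auto simp: matrices_over_def all_sum_iff)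

lemma mexp_diag_blocks: "mexp (diag_blocks A B) = diag_blocks (mexp A) (mexp B)"
proof -
  have p: "mat_power (diag_blocks A B) k = diag_blocks (mat_power A k) (mat_power B k)" for k
    by (induction k) (simp_all add: diag_blocks_one diag_blocks_mult)
  have lin: "bounded_linear (\<lambda>X. block11 X)" "bounded_linear (\<lambda>X. block12 X)"
    "bounded_linear (\<lambda>X. block21 X)" "bounded_linear (\<lambda>X. block22 X)"
    by (intro linear_conv_bounded_linear[THEN iffD1], simp add: linear_iff vec_eq_iff)+
  have "block11 (mexp (diag_blocks A B)) = mexp A"
    by (rule mexp_transfer[OF lin(1)]) (simp add: p, simp add: diag_blocks_def)
  moreover have "block22 (mexp (diag_blocks A B)) = mexp B"
    by (rule mexp_transfer[OF lin(4)]) (simp add: p, simp add: diag_blocks_def)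
  moreover have "block12 (mexp (diag_blocks A B)) = 0" "block21 (mexp (diag_blocks A B)) = 0"
    unfolding mexp_def bounded_linear.suminf[OF lin(2) summable_mexp] bounded_linear.suminf[OF lin(3) summable_mexp]
    by (simp_all add: p, simp_all add: diag_blocks_def scaleR_blocks)
  ultimately show ?thesis by (metis blocks_eta diag_blocks_def)
qed

text \<open>Only permutations that fix every index outside the range of \<open>f\<close> contribute to the Leibniz
  formula, and these are the permutations transported along \<open>f\<close>.\<close>

lemma det_extend_by_identity:
  fixes f :: "'a::finite \<Rightarrow> 'n::finite" and M :: "complex^'n^'n"
  assumes f: "inj f" and id: "\<And>i j. i \<notin> range f \<Longrightarrow> M $ i $ j = (if i = j then 1 else 0)"
  shows "det M = det (\<chi> a b. M $ f a $ f b)"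
proof -
  let ?t = "\<lambda>p. of_int (sign p) * (\<Prod>i\<in>UNIV. M $ i $ p i)"
  let ?L = "range f" and ?m = "map_permutation UNIV f" and ?m' = "map_permutation (range f) (inv_into UNIV f)"
  have bij: "bij_betw f UNIV ?L" using f by (simp add: bij_betw_def)
  have bij': "bij_betw (inv_into UNIV f) ?L UNIV" using bij by (rule bij_betw_inv_into)
  have bm: "bij_betw ?m {p. p permutes UNIV} {p. p permutes ?L}"
  proof (rule bij_betw_byWitness[where f' = ?m'])
    show "\<forall>a\<in>{p. p permutes UNIV}. ?m' (?m a) = a"
      using map_permutation_compose_inv[OF bij, of _ "inv_into UNIV f"] f by (simp add: inv_f_f)
    show "\<forall>a'\<in>{p. p permutes ?L}. ?m (?m' a') = a'"
      using map_permutation_compose_inv[OF bij', of _ f] by (simp add: f_inv_into_f)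
    show "?m ` {p. p permutes UNIV} \<subseteq> {p. p permutes ?L}"
      using map_permutation_permutes[OF bij] by auto
    show "?m' ` {p. p permutes ?L} \<subseteq> {p. p permutes UNIV}"
      using map_permutation_permutes[OF bij'] by auto
  qed
  have "det M = (\<Sum>p | p permutes UNIV. ?t p)" by (simp add: det_def)
  also have "\<dots> = (\<Sum>p | p permutes ?L. ?t p)"
  proof (rule sum.mono_neutral_right)
    show "\<forall>p\<in>{p. p permutes UNIV} - {p. p permutes ?L}. ?t p = 0"
    proof
      fix p assume p: "p \<in> {p. p permutes UNIV} - {p. p permutes ?L}"
      then obtain x where x: "x \<notin> ?L" "p x \<noteq> x"
        by (auto simp: permutes_def)
      then have "M $ x $ p x = 0" by (simp add: id)
      then have "(\<Prod>i\<in>UNIV. M $ i $ p i) = 0" by (intro prod_zero) auto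
      then show "?t p = 0" by simp
    qed
  qed (auto intro: permutes_subset)
  also have "\<dots> = (\<Sum>p | p permutes UNIV. ?t (?m p))"
    using sum.reindex_bij_betw[OF bm, of ?t] by simp
  also have "\<dots> = det (\<chi> a b. M $ f a $ f b)"
    unfolding det_def
  proof (rule sum.cong[OF refl])
    fix p :: "'a \<Rightarrow> 'a" assume p: "p \<in> {p. p permutes UNIV}"
    have 1: "?m p (f a) = f (p a)" for a by (simp add: map_permutation_apply f)
    have 2: "?m p i = i" if "i \<notin> ?L" for i using that by (auto simp: map_permutation_def restrict_id_def)
    have "(\<Prod>i\<in>UNIV. M $ i $ ?m p i) = (\<Prod>i\<in>?L. M $ i $ ?m p i)"
      by (rule prod.mono_neutral_right) (auto simp: 2 id)
    also have "\<dots> = (\<Prod>a\<in>UNIV. M $ f a $ f (p a))"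
      using f by (simp add: prod.reindex 1)
    finally show "?t (?m p) = of_int (sign p) * (\<Prod>i\<in>UNIV. (\<chi> a b. M $ f a $ f b) $ i $ p i)"
      using p f by (simp add: sign_map_permutation)
  qed
  finally show ?thesis .
qed

lemma det_diag_blocks_left: "det (diag_blocks A (mat 1) :: ('p::finite, 'q::finite) bmat) = det A"
proof -
  have "diag_blocks A (mat 1) $ i $ j = (if i = j then 1 else 0)"
    if "i \<notin> range Inl" for i j :: "'p + 'q"
    using that by (cases i; cases j) (auto simp: diag_blocks_def mat_nth)
  then show ?thesis
    by (subst det_extend_by_identity[of Inl]) (simp_all add: diag_blocks_def vec_lambda_eta)
qed

lemma det_diag_blocks_right: "det (diag_blocks (mat 1) B :: ('p::finite, 'q::finite) bmat) = det B"
proof -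
  have "diag_blocks (mat 1) B $ i $ j = (if i = j then 1 else 0)"
    if "i \<notin> range Inr" for i j :: "'p + 'q"
    using that by (cases i; cases j) (auto simp: diag_blocks_def mat_nth)
  then show ?thesis
    by (subst det_extend_by_identity[of Inr]) (simp_all add: diag_blocks_def vec_lambda_eta)
qed

lemma det_diag_blocks: "det (diag_blocks A B) = det A * det B"
proof -
  have "diag_blocks A B = diag_blocks A (mat 1) ** diag_blocks (mat 1) B"
    by (simp add: diag_blocks_mult)
  then show ?thesis by (simp add: det_mul det_diag_blocks_left det_diag_blocks_right)
qed

text \<open>Conjugation by \<open>diag (2, 1)\<close> squares a block unipotent matrix, so its determinant is idempotent.\<close>

lemma det_block_unipotent:
  "det (blocks (mat 1) X 0 (mat 1) :: ('p::finite, 'q::finite) bmat) = 1"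
  "det (blocks (mat 1) 0 Y (mat 1) :: ('p::finite, 'q::finite) bmat) = 1"
proof -
  have mc: "mat c ** A = cscale c A" "A ** mat c = cscale c A" for c and A :: "complex^'n::finite^'m::finite"
    by (simp_all add: vec_eq_iff matrix_mult_nth mat_nth if_distrib if_distribR sum.delta cong: if_cong)
  have two: "cscale 2 A = A + A" for A :: "complex^'n::finite^'m::finite"
    by (simp add: vec_eq_iff)
  have sc: "cscale 2 (mat 1) ** cscale (1/2) (mat 1) = (mat 1 :: complex^'n::finite^'n)"
    by (simp add: cscale_mult_left cscale_mult_right)
  let ?d = "diag_blocks (mat 2) (mat 1) :: ('p, 'q) bmat" and ?d' = "diag_blocks (mat (1/2)) (mat 1) :: ('p, 'q) bmat"
  have dd: "?d ** ?d' = mat 1"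
    by (simp add: vec_eq_iff all_sum_iff matrix_mult_nth sum_UNIV_sum diag_blocks_def mat_nth
        if_distrib if_distribR cong: if_cong)
  have d: "det ?d * det ?d' = 1" using arg_cong[OF dd, of det] by (simp add: det_mul)
  let ?n = "blocks (mat 1) X 0 (mat 1) :: ('p, 'q) bmat" and ?n' = "blocks (mat 1) (- X) 0 (mat 1) :: ('p, 'q) bmat"
  have "?d ** ?n ** ?d' = ?n ** ?n"
    by (simp add: diag_blocks_def blocks_mult mm.zero_left mm.zero_right mc blocks_eq_iff two)
       (simp add: vec_eq_iff mat_nth)
  from arg_cong[OF this, of det] have "det ?n * (det ?d * det ?d') = det ?n * det ?n"
    by (simp add: det_mul mult_ac)
  moreover have "?n ** ?n' = mat 1" by (simp add: blocks_mult mm.zero_left mm.zero_right blocks_mat[symmetric])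
  from arg_cong[OF this, of det] have "det ?n * det ?n' = 1" by (simp add: det_mul)
  ultimately show "det ?n = 1" unfolding d by auto
  let ?m = "blocks (mat 1) 0 Y (mat 1) :: ('p, 'q) bmat" and ?m' = "blocks (mat 1) 0 (- Y) (mat 1) :: ('p, 'q) bmat"
  have "?d' ** ?m ** ?d = ?m ** ?m"
    by (simp add: diag_blocks_def blocks_mult mm.zero_left mm.zero_right mc blocks_eq_iff two)
       (simp add: vec_eq_iff mat_nth)
  from arg_cong[OF this, of det] have "det ?m * (det ?d * det ?d') = det ?m * det ?m"
    by (simp add: det_mul mult_ac)
  moreover have "?m ** ?m' = mat 1" by (simp add: blocks_mult mm.zero_left mm.zero_right blocks_mat[symmetric])
  from arg_cong[OF this, of det] have "det ?m * det ?m' = 1" by (simp add: det_mul)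
  ultimately show "det ?m = 1" unfolding d by auto
qed

section \<open>Generators of the special orthogonal and special unitary groups\<close>

definition plane4 :: "'n \<Rightarrow> 'n \<Rightarrow> complex \<Rightarrow> complex \<Rightarrow> complex \<Rightarrow> complex \<Rightarrow> complex^'n::finite^'n" where
  "plane4 i j a b c d = (\<chi> k l. if k = i then (if l = i then a else if l = j then b else 0)
     else if k = j then (if l = i then c else if l = j then d else 0) else if k = l then 1 else 0)"

definition plane_elt :: "'n \<Rightarrow> 'n \<Rightarrow> complex \<Rightarrow> complex \<Rightarrow> complex^'n::finite^'n" where
  "plane_elt i j a b = plane4 i j a (- cnj b) b (cnj a)"

lemma sum_two_deltas:
  "i \<noteq> j \<Longrightarrow> (\<Sum>m\<in>UNIV. (if m = i then a else if m = j then b else 0) * f m) = a * f i + b * (f j :: complex)"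
  for i j :: "'n::finite"
proof -
  assume "i \<noteq> j"
  then have "(if m = i then a else if m = j then b else 0) * f m =
      (if m = i then a * f i else 0) + (if m = j then b * f j else 0)" for m by auto
  then show ?thesis by (simp add: sum.distrib)
qed

lemma sum_delta_left: "(\<Sum>m\<in>UNIV. (if k = m then c else 0) * f m) = c * (f k :: complex)"
  for k :: "'n::finite"
proof -
  have "(if k = m then c else 0) * f m = (if k = m then c * f k else 0)" for m by auto
  then show ?thesis by simp
qed

lemma plane4_mult_nth:
  "i \<noteq> j \<Longrightarrow> (plane4 i j a b c d ** g) $ k $ l =
    (if k = i then a * g $ i $ l + b * g $ j $ l else if k = j then c * g $ i $ l + d * g $ j $ l else g $ k $ l)"
  by (simp add: matrix_mult_nth plane4_def sum_two_deltas sum_delta_left)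

lemma plane_elt_mult_nth:
  "i \<noteq> j \<Longrightarrow> (plane_elt i j a b ** g) $ k $ l =
    (if k = i then a * g $ i $ l - cnj b * g $ j $ l
     else if k = j then b * g $ i $ l + cnj a * g $ j $ l else g $ k $ l)"
  by (simp add: plane_elt_def plane4_mult_nth)

lemma plane_elt_mult:
  "i \<noteq> j \<Longrightarrow> plane_elt i j a b ** plane_elt i j a' b' =
    plane_elt i j (a * a' - cnj b * b') (b * a' + cnj a * b')"
  by (subst vec_eq_iff, intro allI, subst vec_eq_iff, intro allI)
     (simp add: plane_elt_mult_nth, auto simp: plane_elt_def plane4_def algebra_simps)

lemma plane_elt_one: "plane_elt i j 1 0 = mat 1"
  by (auto simp: plane_elt_def plane4_def vec_eq_iff mat_nth)

lemma herm_plane_elt: "i \<noteq> j \<Longrightarrow> herm (plane_elt i j a b) = plane_elt i j (cnj a) (- b)"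
  by (auto simp: plane_elt_def plane4_def vec_eq_iff)

lemma cmod_sq: "of_real ((cmod a)\<^sup>2) = cnj a * a"
  by (metis complex_norm_square mult.commute)

lemma plane_elt_inverse:
  assumes "i \<noteq> j" "(cmod a)\<^sup>2 + (cmod b)\<^sup>2 = 1"
  shows "plane_elt i j (cnj a) (- b) ** plane_elt i j a b = mat 1"
proof -
  have "cnj a * a - cnj (- b) * b = of_real ((cmod a)\<^sup>2 + (cmod b)\<^sup>2)"
    by (simp add: cmod_sq del: of_real_power)
  then have 1: "cnj a * a - cnj (- b) * b = 1" using assms(2) by simp
  show ?thesis
    unfolding plane_elt_mult[OF assms(1)] 1 by (simp add: plane_elt_one mult.commute)
qed

lemma mexp_unique:
  fixes M :: "complex \<Rightarrow> complex^'n::finite^'n"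
  assumes d: "\<And>s. mderiv M (A ** M s) s" and 0: "M 0 = mat 1"
  shows "M s = mexp (cscale s A)"
proof -
  define E where "E s = mexp (cscale s (- A))" for s
  have E: "mderiv E (- A ** E s) s" for s unfolding E_def by (rule mderiv_mexp)
  have AE: "A ** E s = E s ** A" for s unfolding E_def
    by (rule mexp_commute) (simp add: cscale_minus_right mm.minus_left mm.minus_right cscale_mult_left cscale_mult_right)
  have "mderiv (\<lambda>s. E s ** M s) 0 s" for s
    using mderiv_mult[OF E d, of s] AE[of s] by (simp add: mm.minus_left matrix_mul_assoc)
  from mderiv_zero_constant[OF this, of s 0] have "E s ** M s = mat 1" by (simp add: E_def 0)
  then have "mexp (cscale s A) ** (E s ** M s) = mexp (cscale s A)" by simp
  then show ?thesis
    by (simp add: E_def cscale_minus_right mexp_minus matrix_mul_assoc)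
qed

definition rot_gen :: "'n \<Rightarrow> 'n \<Rightarrow> complex^'n::finite^'n" where
  "rot_gen i j = (\<chi> k l. if k = i \<and> l = j then - 1 else if k = j \<and> l = i then 1 else 0)"

definition phase_gen :: "'n \<Rightarrow> 'n \<Rightarrow> complex^'n::finite^'n" where
  "phase_gen i j = (\<chi> k l. if k = i \<and> l = i then \<i> else if k = j \<and> l = j then - \<i> else 0)"

lemma rot_gen_mult_nth: "i \<noteq> j \<Longrightarrow> (rot_gen i j ** g) $ k $ l =
    (if k = i then - g $ j $ l else if k = j then g $ i $ l else 0)"
  using sum_two_deltas[of i j 0 "- 1" "\<lambda>m. g $ m $ l"] sum_two_deltas[of i j 1 0 "\<lambda>m. g $ m $ l"]
  by (auto simp: matrix_mult_nth rot_gen_def intro!: sum.neutral elim!: back_subst[of "\<lambda>x. x = _"] intro!: sum.cong)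

lemma phase_gen_mult_nth: "i \<noteq> j \<Longrightarrow> (phase_gen i j ** g) $ k $ l =
    (if k = i then \<i> * g $ i $ l else if k = j then - \<i> * g $ j $ l else 0)"
  using sum_two_deltas[of i j "\<i>" 0 "\<lambda>m. g $ m $ l"] sum_two_deltas[of i j 0 "- \<i>" "\<lambda>m. g $ m $ l"]
  by (auto simp: matrix_mult_nth phase_gen_def intro!: sum.neutral elim!: back_subst[of "\<lambda>x. x = _"] intro!: sum.cong)

lemma plane4_at:
  "plane4 i j a b c d $ k $ l = (if k = i then (if l = i then a else if l = j then b else 0)
     else if k = j then (if l = i then c else if l = j then d else 0) else if k = l then 1 else 0)"
  by (simp add: plane4_def)

lemma rotation_eq_mexp:
  assumes "i \<noteq> j"
  shows "plane_elt i j (of_real (cos t)) (of_real (sin t)) = mexp (t *\<^sub>R rot_gen i j)"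
proof -
  define M where "M s = plane4 i j (cos s) (- sin s) (sin s) (cos s)" for s :: complex
  have "mderiv M (rot_gen i j ** M s) s" for s
    unfolding mderiv_def rot_gen_mult_nth[OF assms] M_def plane4_at using assms
    by (auto intro!: derivative_eq_intros)
  moreover have "M 0 = mat 1" by (auto simp: M_def vec_eq_iff plane4_at mat_nth)
  ultimately have "M (of_real t) = mexp (cscale (of_real t) (rot_gen i j))" by (rule mexp_unique)
  then show ?thesis by (simp add: M_def plane_elt_def scaleR_cscale cos_of_real sin_of_real)
qed

lemma phase_eq_mexp:
  assumes "i \<noteq> j"
  shows "plane_elt i j (cis t) 0 = mexp (t *\<^sub>R phase_gen i j)"
proof -
  define M where "M s = plane4 i j (exp (\<i> * s)) 0 0 (exp (- \<i> * s))" for s :: complex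
  have "mderiv M (phase_gen i j ** M s) s" for s
    unfolding mderiv_def phase_gen_mult_nth[OF assms] M_def plane4_at using assms
    by (auto intro!: derivative_eq_intros)
  moreover have "M 0 = mat 1" by (auto simp: M_def vec_eq_iff plane4_at mat_nth)
  ultimately have "M (of_real t) = mexp (cscale (of_real t) (phase_gen i j))" by (rule mexp_unique)
  then show ?thesis by (simp add: M_def plane_elt_def scaleR_cscale cis_conv_exp exp_cnj)
qed

lemma trace_rot_gen: "i \<noteq> j \<Longrightarrow> trace (rot_gen i j) = 0"
  by (auto simp: trace_def rot_gen_def intro!: sum.neutral)

lemma trace_phase_gen: assumes "i \<noteq> j" shows "trace (phase_gen i j) = 0"
proof -
  have "trace (phase_gen i j) = (\<Sum>k\<in>UNIV. (if k = i then \<i> else if k = j then - \<i> else 0) * 1)"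
    by (auto simp: trace_def phase_gen_def intro!: sum.cong)
  then show ?thesis using sum_two_deltas[OF assms, of "\<i>" "- \<i>" "\<lambda>_. 1"] by simp
qed

text \<open>The Euler angle decomposition of \<open>SU(2)\<close>; without the outer factors in the real case.\<close>

lemma plane_elt_euler:
  assumes "i \<noteq> j" "a \<in> scalars \<kappa>" "b \<in> scalars \<kappa>" "(cmod a)\<^sup>2 + (cmod b)\<^sup>2 = 1"
  obtains u t v where "plane_elt i j a b = plane_elt i j (cis u) 0 **
      plane_elt i j (of_real (cos t)) (of_real (sin t)) ** plane_elt i j (cis v) 0"
    "\<kappa> = Real_Case \<Longrightarrow> u = 0 \<and> v = 0"
proof (cases \<kappa>)
  case Real_Case
  then obtain x y where xy: "a = of_real x" "b = of_real y" using assms(2,3) by (auto simp: Reals_def)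
  then have "x\<^sup>2 + y\<^sup>2 = 1" using assms(4) by simp
  then obtain t where "x = cos t" "y = sin t" using sincos_total_2pi by metis
  then show ?thesis using that[of 0 t 0] xy Real_Case by (simp add: plane_elt_one)
next
  case (Complex_Case l)
  obtain t where t: "cmod a = cos t" "cmod b = sin t"
    using sincos_total_2pi[OF assms(4)] by metis
  let ?u = "(Arg a - Arg b) / 2" and ?v = "(Arg a + Arg b) / 2"
  have "of_real (cos t) * cis (Arg a) = a" "of_real (sin t) * cis (Arg b) = b"
    by (simp_all flip: t rcis_def add: rcis_cmod_Arg)
  moreover have "cis ?u * cis ?v = cis (Arg a)" "cis (- ?u) * cis ?v = cis (Arg b)"
    unfolding cis_mult by (simp_all add: field_simps)
  ultimately have "plane_elt i j a b = plane_elt i j (cis ?u) 0 **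
      plane_elt i j (of_real (cos t)) (of_real (sin t)) ** plane_elt i j (cis ?v) 0"
    using assms(1) by (simp add: plane_elt_mult cis_cnj mult_ac) 
  then show ?thesis using that[of ?u t ?v] Complex_Case by simp
qed

lemma K_groupD:
  assumes "g \<in> K_group \<kappa>"
  shows "g \<in> matrices_over \<kappa>" "det g = 1" "herm g ** g = mat 1" "g ** herm g = mat 1"
  using assms matrix_left_right_inverse[of "herm g" g] by (auto simp: K_group_def SL_group_def)

lemma K_groupI:
  "g \<in> matrices_over \<kappa> \<Longrightarrow> det g = 1 \<Longrightarrow> herm g ** g = mat 1 \<Longrightarrow> g \<in> K_group \<kappa>"
  by (auto simp: K_group_def SL_group_def)

lemma K_group_one: "mat 1 \<in> K_group \<kappa>"
  by (auto intro!: K_groupI simp: matrices_over_mat)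

lemma K_group_mult: "g \<in> K_group \<kappa> \<Longrightarrow> h \<in> K_group \<kappa> \<Longrightarrow> g ** h \<in> K_group \<kappa>"
proof (rule K_groupI)
  assume g: "g \<in> K_group \<kappa>" and h: "h \<in> K_group \<kappa>"
  show "g ** h \<in> matrices_over \<kappa>" "det (g ** h) = 1"
    using K_groupD[OF g] K_groupD[OF h] by (auto simp: matrices_over_mult det_mul)
  have "herm (g ** h) ** (g ** h) = herm h ** (herm g ** g) ** h" by (simp add: herm_mult matrix_mul_assoc)
  then show "herm (g ** h) ** (g ** h) = mat 1" using K_groupD[OF g] K_groupD[OF h] by simp
qed

lemma K_group_herm: "g \<in> K_group \<kappa> \<Longrightarrow> herm g \<in> K_group \<kappa>"
  using K_groupD[of g \<kappa>] by (intro K_groupI) (auto simp: matrices_over_herm det_herm)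

lemma plane_elt_in_K:
  assumes "i \<noteq> j" "a \<in> scalars \<kappa>" "b \<in> scalars \<kappa>" "(cmod a)\<^sup>2 + (cmod b)\<^sup>2 = 1"
  shows "plane_elt i j a b \<in> K_group \<kappa>"
proof (rule K_groupI)
  show "plane_elt i j a b \<in> matrices_over \<kappa>"
    using assms by (auto simp: matrices_over_def plane_elt_def plane4_at intro: scalars_closed)
  show "herm (plane_elt i j a b) ** plane_elt i j a b = mat 1"
    using plane_elt_inverse assms by (simp add: herm_plane_elt)
  obtain u t v where "plane_elt i j a b = plane_elt i j (cis u) 0 **
      plane_elt i j (of_real (cos t)) (of_real (sin t)) ** plane_elt i j (cis v) 0"
    using plane_elt_euler[OF assms] by metis
  moreover have "trace (t *\<^sub>R A) = of_real t * trace A" for t and A :: "complex^'a^'a"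
    by (simp add: scaleR_cscale trace_cscale)
  ultimately show "det (plane_elt i j a b) = 1"
    using assms(1) by (simp add: det_mul phase_eq_mexp rotation_eq_mexp det_mexp trace_rot_gen trace_phase_gen)
qed

lemma K_group_columns:
  assumes "g \<in> K_group \<kappa>"
  shows "(\<Sum>k\<in>UNIV. cnj (g $ k $ s) * g $ k $ i) = (if s = i then 1 else 0)"
  using arg_cong[OF K_groupD(3)[OF assms], of "\<lambda>A. A $ s $ i"] by (simp add: matrix_mult_nth mat_nth)

text \<open>One column is brought to a coordinate vector by Givens rotations in the planes \<open>(i, j)\<close>,
  without disturbing the columns that are already coordinate vectors.\<close>

lemma clear_column:
  fixes g :: "complex^'n::finite^'n"
  assumes step: "\<And>i j a b (g :: complex^'n^'n). i \<noteq> j \<Longrightarrow> a \<in> scalars \<kappa> \<Longrightarrow> b \<in> scalars \<kappa> \<Longrightarrow>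
      (cmod a)\<^sup>2 + (cmod b)\<^sup>2 = 1 \<Longrightarrow> g \<in> K_group \<kappa> \<Longrightarrow> Q g \<Longrightarrow> Q (plane_elt i j a b ** g)"
    and i: "i \<notin> S" "insert i S \<noteq> UNIV"
    and next_column: "\<And>g :: complex^'n^'n. g \<in> K_group \<kappa> \<Longrightarrow>
      \<forall>s\<in>insert i S. \<forall>k. g $ k $ s = (if k = s then 1 else 0) \<Longrightarrow> Q g"
    and g: "g \<in> K_group \<kappa>" "\<forall>s\<in>S. \<forall>k. g $ k $ s = (if k = s then 1 else 0)"
  shows "Q g"
  using g
proof (induction "card {j. j \<noteq> i \<and> g $ j $ i \<noteq> 0}" arbitrary: g rule: less_induct)
  case less
  note g = less.prems
  have sc: "g $ k $ l \<in> scalars \<kappa>" for k l using K_groupD(1)[OF g(1)] by (simp add: matrices_over_def)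
  have gs: "g $ s $ i = 0" if "s \<in> S" for s
  proof -
    have "(\<Sum>k\<in>UNIV. cnj (g $ k $ s) * g $ k $ i) = (\<Sum>k\<in>UNIV. (if s = k then 1 else 0) * g $ k $ i)"
      using g(2) that by (intro sum.cong) auto
    also have "\<dots> = g $ s $ i" by (simp add: sum_delta_left)
    finally show ?thesis using K_group_columns[OF g(1), of s i] that i(1) by (auto split: if_splits)
  qed
  have undo: "Q g" if "Q (plane_elt i j a b ** g)" "i \<noteq> j" "a \<in> scalars \<kappa>" "b \<in> scalars \<kappa>"
      "(cmod a)\<^sup>2 + (cmod b)\<^sup>2 = 1" for j a b
  proof -
    have "Q (plane_elt i j (cnj a) (- b) ** (plane_elt i j a b ** g))"
      by (rule step) (use that in \<open>auto intro!: K_group_mult plane_elt_in_K g(1) intro: scalars_closed\<close>)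
    then show ?thesis unfolding matrix_mul_assoc plane_elt_inverse[OF that(2,5)] by simp
  qed
  show ?case
  proof (cases "\<exists>j. j \<noteq> i \<and> g $ j $ i \<noteq> 0")
    case True
    then obtain j where j: "j \<noteq> i" "g $ j $ i \<noteq> 0" by blast
    then have jS: "j \<notin> S" using gs by auto
    define r where "r = sqrt ((cmod (g $ i $ i))\<^sup>2 + (cmod (g $ j $ i))\<^sup>2)"
    have r2: "r\<^sup>2 = (cmod (g $ i $ i))\<^sup>2 + (cmod (g $ j $ i))\<^sup>2" by (simp add: r_def)
    have r: "r > 0" using j(2) by (simp add: r_def add_nonneg_pos)
    define a b where "a = cnj (g $ i $ i) / of_real r" and "b = - (g $ j $ i) / of_real r"
    have ab: "a \<in> scalars \<kappa>" "b \<in> scalars \<kappa>" unfolding a_def b_def by (auto intro!: scalars_closed sc)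
    have "(cmod a)\<^sup>2 + (cmod b)\<^sup>2 = r\<^sup>2 / r\<^sup>2"
      unfolding a_def b_def norm_divide norm_minus_cancel norm_of_real power_divide power2_abs
        complex_mod_cnj norm_neg_numeral add_divide_distrib[symmetric] r2 ..
    then have n: "(cmod a)\<^sup>2 + (cmod b)\<^sup>2 = 1" using r by simp
    let ?g = "plane_elt i j a b ** g"
    have nth: "?g $ k $ l = (if k = i then a * g $ i $ l - cnj b * g $ j $ l
       else if k = j then b * g $ i $ l + cnj a * g $ j $ l else g $ k $ l)" for k l
      using j(1) by (simp add: plane_elt_mult_nth)
    have gj: "?g $ j $ i = 0" unfolding nth using j(1) by (simp add: a_def b_def)
    have "{k. k \<noteq> i \<and> ?g $ k $ i \<noteq> 0} \<subset> {k. k \<noteq> i \<and> g $ k $ i \<noteq> 0}"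
    proof
      have "?g $ k $ i = g $ k $ i" if "k \<noteq> i" "k \<noteq> j" for k unfolding nth using that by simp
      then show "{k. k \<noteq> i \<and> ?g $ k $ i \<noteq> 0} \<subseteq> {k. k \<noteq> i \<and> g $ k $ i \<noteq> 0}"
        using gj by (intro Collect_mono impI) metis
      show "{k. k \<noteq> i \<and> ?g $ k $ i \<noteq> 0} \<noteq> {k. k \<noteq> i \<and> g $ k $ i \<noteq> 0}" using j gj by blast
    qed
    then have c: "card {k. k \<noteq> i \<and> ?g $ k $ i \<noteq> 0} < card {k. k \<noteq> i \<and> g $ k $ i \<noteq> 0}"
      by (intro psubset_card_mono) auto
    have K: "?g \<in> K_group \<kappa>" using j ab n by (intro K_group_mult plane_elt_in_K g(1)) auto
    have "\<forall>s\<in>S. \<forall>k. ?g $ k $ s = (if k = s then 1 else 0)"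
      unfolding nth using g(2) jS i(1) by auto
    from less.hyps[OF c K this] show ?thesis by (rule undo) (use j ab n in auto)
  next
    case False
    obtain j where j: "j \<noteq> i" "j \<notin> S" using i(2) by blast
    let ?w = "g $ i $ i"
    have "(\<Sum>k\<in>UNIV. cnj (g $ k $ i) * g $ k $ i) = (\<Sum>k\<in>UNIV. (if i = k then cnj ?w else 0) * g $ k $ i)"
      using False by (intro sum.cong) auto
    then have w: "cnj ?w * ?w = 1" using K_group_columns[OF g(1), of i i] by (simp add: sum_delta_left)
    then have "(cmod ?w)\<^sup>2 = 1" by (metis cmod_sq of_real_1 of_real_eq_iff)
    then have n: "(cmod (cnj ?w))\<^sup>2 + (cmod 0)\<^sup>2 = 1" by simp
    let ?g = "plane_elt i j (cnj ?w) 0 ** g"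
    have nth: "?g $ k $ l = (if k = i then cnj ?w * g $ i $ l else if k = j then ?w * g $ j $ l else g $ k $ l)" for k l
      using j(1) by (simp add: plane_elt_mult_nth)
    have K: "?g \<in> K_group \<kappa>"
      using j n sc by (intro K_group_mult plane_elt_in_K g(1)) (auto intro: scalars_closed)
    have "\<forall>s\<in>insert i S. \<forall>k. ?g $ k $ s = (if k = s then 1 else 0)"
      unfolding nth using g(2) j i(1) False w by auto
    from next_column[OF K this] show ?thesis
      by (rule undo) (use j n sc in \<open>auto intro: scalars_closed\<close>)
  qed
qed

text \<open>Induction on the number of columns that are not yet coordinate vectors; once a single one is left,
  orthogonality and the determinant force it to be a coordinate vector as well.\<close>

lemma K_group_plane_induct:
  fixes g :: "complex^'n::finite^'n"
  assumes one: "Q (mat 1)"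
    and step: "\<And>i j a b (g :: complex^'n^'n). i \<noteq> j \<Longrightarrow> a \<in> scalars \<kappa> \<Longrightarrow> b \<in> scalars \<kappa> \<Longrightarrow>
      (cmod a)\<^sup>2 + (cmod b)\<^sup>2 = 1 \<Longrightarrow> g \<in> K_group \<kappa> \<Longrightarrow> Q g \<Longrightarrow> Q (plane_elt i j a b ** g)"
    and g: "g \<in> K_group \<kappa>"
  shows "Q g"
proof -
  have "Q g" if "g \<in> K_group \<kappa>" "\<forall>s\<in>S. \<forall>k. g $ k $ s = (if k = s then 1 else 0)" for g S
    using that
  proof (induction "card (- S)" arbitrary: S g rule: less_induct)
    case less
    note g = less.prems
    show ?case
    proof (cases "S = UNIV")
      case True
      then have "g = mat 1" using g(2) by (simp add: vec_eq_iff mat_nth)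
      then show ?thesis using one by simp
    next
      case False
      then obtain i where i: "i \<notin> S" by blast
      show ?thesis
      proof (cases "insert i S = UNIV")
        case True
        have off: "g $ k $ i = 0" if "k \<noteq> i" for k
        proof -
          have "(\<Sum>m\<in>UNIV. cnj (g $ m $ k) * g $ m $ i) = (\<Sum>m\<in>UNIV. (if k = m then 1 else 0) * g $ m $ i)"
            using g(2) that True by (intro sum.cong) auto
          then show ?thesis using K_group_columns[OF g(1), of k i] that by (simp add: sum_delta_left)
        qed
        have diag: "g $ k $ l = 0" if "k \<noteq> l" for k l
          using that off g(2) True by (cases "l = i") auto
        have "det g = (\<Prod>k\<in>UNIV. g $ k $ k)" by (rule det_diagonal) (rule diag)
        also have "\<dots> = (\<Prod>k\<in>UNIV. if k = i then g $ i $ i else 1)"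
          using g(2) True by (intro prod.cong) auto
        finally have gi: "g $ i $ i = 1" using K_groupD(2)[OF g(1)] by simp
        have "g $ k $ k = 1" for k using gi g(2) True by (cases "k = i") auto
        then have "g = mat 1" using diag by (auto simp: vec_eq_iff mat_nth)
        then show ?thesis using one by simp
      next
        case False
        show ?thesis
        proof (rule clear_column[where Q = Q and g = g, OF step i False _ g])
          fix g' :: "complex^'n^'n"
          assume g': "g' \<in> K_group \<kappa>" "\<forall>s\<in>insert i S. \<forall>k. g' $ k $ s = (if k = s then 1 else 0)"
          have "- insert i S \<subset> - S" using i by auto
          then have "card (- insert i S) < card (- S)" by (intro psubset_card_mono) auto
          then show "Q g'" using less.hyps g' by blast
        qed
      qed
    qed
  qed
  from this[of g "{}"] g show ?thesis by simp
qed

text \<open>The generators that are one-parameter groups: rotations in coordinate planes and, over the complex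
  numbers, the diagonal matrices \<open>diag (e\<^sup>i\<^sup>t, e\<^sup>-\<^sup>i\<^sup>t)\<close>.\<close>

lemma K_group_rotation_induct [consumes 1, case_names one rotation phase]:
  fixes g :: "complex^'n::finite^'n"
  assumes g: "g \<in> K_group \<kappa>" and one: "Q (mat 1)"
    and rot: "\<And>i j t (g :: complex^'n^'n). i \<noteq> j \<Longrightarrow> g \<in> K_group \<kappa> \<Longrightarrow> Q g \<Longrightarrow>
      Q (plane_elt i j (of_real (cos t)) (of_real (sin t)) ** g)"
    and phase: "\<And>i j t (g :: complex^'n^'n). \<kappa> \<noteq> Real_Case \<Longrightarrow> i \<noteq> j \<Longrightarrow> g \<in> K_group \<kappa> \<Longrightarrow> Q g \<Longrightarrow>
      Q (plane_elt i j (cis t) 0 ** g)"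
  shows "Q g"
proof (rule K_group_plane_induct[where Q = Q, OF one _ g])
  fix i j :: 'n and a b and g :: "complex^'n^'n"
  assume h: "i \<noteq> j" "a \<in> scalars \<kappa>" "b \<in> scalars \<kappa>" "(cmod a)\<^sup>2 + (cmod b)\<^sup>2 = 1" "g \<in> K_group \<kappa>" "Q g"
  obtain u t v where e: "plane_elt i j a b = plane_elt i j (cis u) 0 **
      plane_elt i j (of_real (cos t)) (of_real (sin t)) ** plane_elt i j (cis v) 0"
    "\<kappa> = Real_Case \<Longrightarrow> u = 0 \<and> v = 0"
    using plane_elt_euler[OF h(1-4)] by metis
  have R: "plane_elt i j (of_real (cos t)) (of_real (sin t)) \<in> K_group \<kappa>"
    by (intro plane_elt_in_K) (use h in auto)
  show "Q (plane_elt i j a b ** g)"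
  proof (cases "\<kappa> = Real_Case")
    case True
    then show ?thesis using e rot[OF h(1,5,6), of t] by (simp add: plane_elt_one)
  next
    case False
    then obtain l where l: "\<kappa> = Complex_Case l" by (cases \<kappa>) auto
    have D: "plane_elt i j (cis v) 0 \<in> K_group \<kappa>"
      by (intro plane_elt_in_K) (use h l in auto)
    show ?thesis unfolding e(1) matrix_mul_assoc[symmetric]
      using h R D False by (intro phase rot K_group_mult) auto
  qed
qed

section \<open>The Lie algebra of the maximal compact subgroup\<close>

definition lie_K :: "base_case \<Rightarrow> (complex^'n::finite^'n) set" where
  "lie_K \<kappa> = {X \<in> matrices_over \<kappa>. herm X = - X \<and> trace X = 0}"

lemma trace_scaleR: "trace (r *\<^sub>R A) = of_real r * trace A" for A :: "complex^'n::finite^'n"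
  by (simp add: scaleR_cscale trace_cscale)

lemma matrices_over_scaleR: "A \<in> matrices_over \<kappa> \<Longrightarrow> r *\<^sub>R A \<in> matrices_over \<kappa>"
  by (auto simp: matrices_over_def scaleR_cscale intro: scalars_closed)

lemma mexp_one_parameter_inject:
  assumes "\<And>s. mexp (s *\<^sub>R X) = mexp (s *\<^sub>R Y)" shows "X = Y"
  using has_vector_derivative_mexp[of X 0] has_vector_derivative_mexp[of Y 0]
  by (simp add: assms vector_derivative_unique_at)

lemma mexp_lie_K: "X \<in> lie_K \<kappa> \<Longrightarrow> mexp (s *\<^sub>R X) \<in> K_group \<kappa>"
  by (intro K_groupI mexp_matrices_over matrices_over_scaleR)
     (auto simp: lie_K_def det_mexp trace_scaleR herm_mexp herm_scaleR mexp_minus)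

text \<open>A matrix is determined by its one-parameter group, so the defining equations of the group can be
  differentiated.\<close>

lemma lie_algebra_K_group: "lie_algebra (K_group \<kappa>) = (lie_K \<kappa> :: (complex^'n::finite^'n) set)"
proof (intro equalityI subsetI)
  fix X :: "complex^'n^'n" assume "X \<in> lie_algebra (K_group \<kappa>)"
  then have K: "mexp (s *\<^sub>R X) \<in> K_group \<kappa>" for s by (simp add: lie_algebra_def)
  have "herm X = - X"
  proof (rule mexp_one_parameter_inject)
    fix s
    have "mexp (s *\<^sub>R herm X) = herm (mexp (s *\<^sub>R X)) ** (mexp (s *\<^sub>R X) ** mexp (- (s *\<^sub>R X)))"
      by (simp add: herm_mexp herm_scaleR mexp_minus)
    then show "mexp (s *\<^sub>R herm X) = mexp (s *\<^sub>R (- X))"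
      using K_groupD(3)[OF K[of s]] by (simp add: matrix_mul_assoc)
  qed
  moreover have "X \<in> matrices_over \<kappa>"
  proof (cases \<kappa>)
    case Real_Case
    have "mcnj X = X"
      using K_groupD(1)[OF K] unfolding Real_Case matrices_over_Real mcnj_mexp mcnj_scaleR
      by (rule mexp_one_parameter_inject)
    then show ?thesis by (simp add: Real_Case matrices_over_Real)
  qed simp
  moreover have "trace X = 0"
  proof -
    have "exp (of_real s * trace X) = 1" for s
      using K_groupD(2)[OF K[of s]] by (simp add: det_mexp trace_scaleR)
    moreover have "((\<lambda>s::real. exp (of_real s * trace X)) has_vector_derivative trace X) (at 0)"
      by (rule has_vector_derivative_real_field) (auto intro!: derivative_eq_intros)
    ultimately have "((\<lambda>s::real. 1) has_vector_derivative trace X) (at 0)" by simp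
    then show ?thesis using vector_derivative_unique_at has_vector_derivative_const by blast
  qed
  ultimately show "X \<in> lie_K \<kappa>" by (simp add: lie_K_def)
qed (auto simp: lie_algebra_def mexp_lie_K)

text \<open>The group is generated by the exponentials of its Lie algebra; an infinitesimal statement at the
  identity can therefore be propagated along exponentials to the whole group.\<close>

lemma K_group_exp_induct [consumes 1, case_names one exp]:
  fixes g :: "complex^'n::finite^'n"
  assumes g: "g \<in> K_group \<kappa>" and one: "Q (mat 1)"
    and step: "\<And>X (g :: complex^'n^'n). X \<in> lie_K \<kappa> \<Longrightarrow> g \<in> K_group \<kappa> \<Longrightarrow> Q g \<Longrightarrow> Q (mexp X ** g)"
  shows "Q g"
  using g
proof (induction rule: K_group_rotation_induct)
  case (rotation i j t g)
  have "t *\<^sub>R rot_gen i j \<in> lie_K \<kappa>"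
  proof -
    have "herm (rot_gen i j) = - rot_gen i j" "rot_gen i j \<in> matrices_over \<kappa>"
      using rotation by (auto simp: vec_eq_iff rot_gen_def matrices_over_def intro: scalars_closed)
    then show ?thesis
      using rotation by (simp add: lie_K_def trace_scaleR trace_rot_gen herm_scaleR matrices_over_scaleR)
  qed
  from step[OF this rotation(2,3)] show ?case by (simp add: rotation_eq_mexp rotation)
next
  case (phase i j t g)
  have "t *\<^sub>R phase_gen i j \<in> lie_K \<kappa>"
  proof -
    have "herm (phase_gen i j) = - phase_gen i j" "phase_gen i j \<in> matrices_over \<kappa>"
      using phase by (auto simp: vec_eq_iff phase_gen_def, cases \<kappa>, auto)
    then show ?thesis
      using phase by (simp add: lie_K_def trace_scaleR trace_phase_gen herm_scaleR matrices_over_scaleR)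
  qed
  from step[OF this phase(3,4)] show ?case by (simp add: phase_eq_mexp phase)
qed (rule one)

section \<open>The characters\<close>

definition conjugating :: "base_case \<Rightarrow> bool" where
  "conjugating \<kappa> = (case \<kappa> of Real_Case \<Rightarrow> False | Complex_Case l \<Rightarrow> l < 0)"

text \<open>On unit complex numbers the character of weight \<open>l\<close> is \<open>z \<mapsto> z\<^sup>l\<close>, that is the
  \<open>\<bar>l\<bar>\<close>-th power of \<open>z\<close> or of its conjugate.\<close>

definition twist :: "base_case \<Rightarrow> complex \<Rightarrow> complex" where
  "twist \<kappa> z = (if conjugating \<kappa> then cnj z else z)"

definition unit_char :: "base_case \<Rightarrow> complex \<Rightarrow> complex" where
  "unit_char \<kappa> z = twist \<kappa> z ^ min_type \<kappa>"

lemma unit_char_mult: "unit_char \<kappa> (a * b) = unit_char \<kappa> a * unit_char \<kappa> b"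
  by (simp add: unit_char_def twist_def power_mult_distrib)

lemma unit_char_one [simp]: "unit_char \<kappa> 1 = 1"
  by (simp add: unit_char_def twist_def)

lemma norm_unit_char: "norm (unit_char \<kappa> z) = norm z ^ min_type \<kappa>"
  by (simp add: unit_char_def twist_def norm_power)

lemma cnj_unit_char: "cnj (unit_char \<kappa> z) = unit_char \<kappa> (cnj z)"
  by (simp add: unit_char_def twist_def)

lemma unit_char_cis: "unit_char (Complex_Case l) (cis t) = exp (\<i> * of_int l * of_real t)"
proof -
  have "exp (\<i> * of_int l * of_real t) = cis (of_int l * t)"
    by (simp add: cis_conv_exp mult_ac)
  moreover have "unit_char (Complex_Case l) (cis t) = cis (of_int l * t)"
    by (cases "l < 0") (simp_all add: unit_char_def twist_def conjugating_def cis_cnj Complex.DeMoivre)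
  ultimately show ?thesis by simp
qed

lemma mat_mult_cscale: "mat c ** A = cscale c A" "A ** mat c = cscale c A"
  for A :: "complex^'n::finite^'m::finite"
  by (simp_all add: vec_eq_iff matrix_mult_nth mat_nth if_distrib if_distribR cong: if_cong)

lemma det_mat: "det (mat c :: complex^'n::finite^'n) = c ^ CARD('n)"
  by (subst det_diagonal) (auto simp: mat_nth)

lemma det_cscale: "det (cscale c A) = c ^ CARD('n) * det A" for A :: "complex^'n::finite^'n"
  by (simp add: det_mul det_mat flip: mat_mult_cscale(1))

lemma block11_diag [simp]: "block11 (diag_blocks A B) = A" "block22 (diag_blocks A B) = B"
  by (simp_all add: diag_blocks_def)

lemma diag_blocks_eq_iff: "diag_blocks A B = diag_blocks A' B' \<longleftrightarrow> A = A' \<and> B = B'"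
  by (metis block11_diag)

lemma herm_diag_blocks: "herm (diag_blocks A B) = diag_blocks (herm A) (herm B)"
  by (simp add: diag_blocks_def herm_blocks)

lemma matrices_over_diag_blocks:
  "diag_blocks A B \<in> matrices_over \<kappa> \<longleftrightarrow> A \<in> matrices_over \<kappa> \<and> B \<in> matrices_over \<kappa>"
  by (auto simp: diag_blocks_def matrices_over_blocks) (auto simp: matrices_over_def)

lemma L_group_diag: "diag_blocks A B \<in> L_group \<kappa> \<longleftrightarrow> A \<in> matrices_over \<kappa> \<and> B \<in> matrices_over \<kappa> \<and>
    herm A ** A = mat 1 \<and> herm B ** B = mat 1 \<and> det A * det B = 1"
proof -
  have "diag_blocks C D = mat 1 \<longleftrightarrow> C = mat 1 \<and> D = mat 1" for C :: "complex^'a^'a" and D :: "complex^'b^'b"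
    by (metis diag_blocks_one diag_blocks_eq_iff)
  then show ?thesis
    by (auto simp: L_group_def K_group_def SL_group_def matrices_over_diag_blocks det_diag_blocks
        herm_diag_blocks diag_blocks_mult diag_blocks_eq_iff)
qed

lemma L_group_K: "m \<in> L_group \<kappa> \<Longrightarrow> m \<in> K_group \<kappa>"
  by (simp add: L_group_def)

lemma L_group_mult: "a \<in> L_group \<kappa> \<Longrightarrow> b \<in> L_group \<kappa> \<Longrightarrow> a ** b \<in> L_group \<kappa>"
  unfolding L_group_def by (auto intro: K_group_mult simp: diag_blocks_mult[symmetric]) (metis diag_blocks_mult)

lemma L_group_herm: "a \<in> L_group \<kappa> \<Longrightarrow> herm a \<in> L_group \<kappa>"
  unfolding L_group_def using K_group_herm herm_diag_blocks by blast

lemma L_groupE: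
  assumes "m \<in> L_group \<kappa>"
  obtains A B where "m = diag_blocks A B" "A \<in> matrices_over \<kappa>" "B \<in> matrices_over \<kappa>"
    "herm A ** A = mat 1" "herm B ** B = mat 1" "det A * det B = 1"
proof -
  obtain A B where m: "m = diag_blocks A B" using assms by (auto simp: L_group_def)
  then show ?thesis using that[of A B] assms by (simp add: L_group_diag)
qed

lemma L_group_one: "mat 1 \<in> (L_group \<kappa> :: ('p::finite, 'q::finite) bmat set)"
  by (subst diag_blocks_one[symmetric]) (simp add: L_group_diag matrices_over_mat)

lemma block11_one [simp]: "block11 (mat 1) = mat 1"
  by (simp add: vec_eq_iff mat_nth)

lemma cmod_det_unitary: "herm A ** A = mat 1 \<Longrightarrow> cmod (det A) = 1"
proof -
  assume "herm A ** A = mat 1"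
  from arg_cong[OF this, of det] have "of_real ((cmod (det A))\<^sup>2) = (1::complex)"
    unfolding cmod_sq by (simp add: det_mul det_herm)
  then have "(cmod (det A))\<^sup>2 = 1" by (metis of_real_1 of_real_eq_iff)
  then show ?thesis by (metis norm_ge_zero power2_eq_imp_eq one_power2 zero_le_one)
qed

lemma unit_complex_cis:
  assumes "cmod z = 1" obtains t where "z = cis t"
  using assms rcis_cmod_Arg[of z] by (metis mult_1 of_real_1 rcis_def)

lemma mexp_Z_elt: "mexp (t *\<^sub>R (Z_elt :: ('p::finite, 'q::finite) bmat)) =
    diag_blocks (mat (cis (t / CARD('p)))) (mat (cis (- t / CARD('q))))"
proof -
  have "t *\<^sub>R (Z_elt :: ('p, 'q) bmat) =
      diag_blocks (mat (\<i> * of_real (t / CARD('p)))) (mat (\<i> * of_real (- t / CARD('q))))"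
    by (simp add: Z_elt_def diag_blocks_def scaleR_blocks blocks_eq_iff)
       (simp add: scaleR_cscale vec_eq_iff mat_nth)
  then show ?thesis by (simp add: mexp_diag_blocks mexp_mat cis_conv_exp)
qed

lemma det_mat_cis: "det (mat (cis (t / CARD('n))) :: complex^'n::finite^'n) = cis t"
  by (simp add: det_mat Complex.DeMoivre)

lemma group_L_monoid: "group (L_monoid \<kappa> :: ('p::finite, 'q::finite) bmat monoid)"
proof (rule groupI)
  let ?G = "L_monoid \<kappa> :: ('p, 'q) bmat monoid"
  fix x y z assume x: "x \<in> carrier ?G" and y: "y \<in> carrier ?G" and z: "z \<in> carrier ?G"
  show "x \<otimes>\<^bsub>?G\<^esub> y \<in> carrier ?G"
    using x y by (simp add: L_monoid_def L_group_mult)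
  show "x \<otimes>\<^bsub>?G\<^esub> y \<otimes>\<^bsub>?G\<^esub> z = x \<otimes>\<^bsub>?G\<^esub> (y \<otimes>\<^bsub>?G\<^esub> z)"
    by (simp add: L_monoid_def matrix_mul_assoc)
  show "\<one>\<^bsub>?G\<^esub> \<otimes>\<^bsub>?G\<^esub> x = x" by (simp add: L_monoid_def)
  have "herm x \<in> L_group \<kappa>"
    using x by (simp add: L_monoid_def L_group_herm)
  then show "\<exists>y\<in>carrier ?G. y \<otimes>\<^bsub>?G\<^esub> x = \<one>\<^bsub>?G\<^esub>"
    using x K_groupD(3)[OF L_group_K[of x \<kappa>]] by (intro bexI[of _ "herm x"]) (auto simp: L_monoid_def)
next
  show "\<one>\<^bsub>L_monoid \<kappa>\<^esub> \<in> carrier (L_monoid \<kappa> :: ('p, 'q) bmat monoid)"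
    by (simp add: L_monoid_def L_group_one)
qed

lemma inv_L_monoid: "m \<in> L_group \<kappa> \<Longrightarrow> inv\<^bsub>L_monoid \<kappa>\<^esub> m = herm m"
proof (rule group.inv_equality[OF group_L_monoid])
  assume m: "m \<in> L_group \<kappa>"
  show "herm m \<otimes>\<^bsub>L_monoid \<kappa>\<^esub> m = \<one>\<^bsub>L_monoid \<kappa>\<^esub>"
    using m by (auto simp: L_monoid_def L_group_def K_groupD)
  show "m \<in> carrier (L_monoid \<kappa>)" "herm m \<in> carrier (L_monoid \<kappa>)"
    using m by (simp_all add: L_monoid_def L_group_herm)
qed

abbreviation L_derived :: "base_case \<Rightarrow> ('p::finite, 'q::finite) bmat set" where
  "L_derived \<kappa> \<equiv> derived (L_monoid \<kappa>) (carrier (L_monoid \<kappa>))"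

lemma L_derived_mult: "a \<in> L_derived \<kappa> \<Longrightarrow> b \<in> L_derived \<kappa> \<Longrightarrow> a ** b \<in> L_derived \<kappa>"
  using generate.eng[of a "L_monoid \<kappa>" _ b] by (auto simp: derived_def L_monoid_def)

lemma L_derived_one: "mat 1 \<in> L_derived \<kappa>"
  using generate.one[of "L_monoid \<kappa>"] by (auto simp: derived_def L_monoid_def)

lemma L_derived_commutator:
  assumes "a \<in> L_group \<kappa>" "b \<in> L_group \<kappa>" shows "a ** b ** herm a ** herm b \<in> L_derived \<kappa>"
proof -
  have "a \<otimes>\<^bsub>L_monoid \<kappa>\<^esub> b \<otimes>\<^bsub>L_monoid \<kappa>\<^esub> inv\<^bsub>L_monoid \<kappa>\<^esub> a \<otimes>\<^bsub>L_monoid \<kappa>\<^esub> inv\<^bsub>L_monoid \<kappa>\<^esub> b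
      \<in> L_derived \<kappa>"
    unfolding derived_def using assms by (intro generate.incl) (auto simp: L_monoid_def)
  then show ?thesis using assms by (simp add: inv_L_monoid) (simp add: L_monoid_def)
qed

text \<open>The determinants of the two diagonal blocks are characters, hence trivial on commutators.\<close>

lemma L_derived_det:
  assumes "h \<in> L_derived \<kappa>"
  shows "h \<in> L_group \<kappa> \<and> det (block11 h) = 1"
proof -
  have comm: "x \<in> L_group \<kappa> \<and> det (block11 x) = 1"
    if x: "x \<in> derived_set (L_monoid \<kappa>) (carrier (L_monoid \<kappa>))" for x :: "('a, 'b) bmat"
  proof -
    have C: "carrier (L_monoid \<kappa>) = L_group \<kappa>" by (simp add: L_monoid_def)
    obtain a b where ab': "a \<in> L_group \<kappa>" "b \<in> L_group \<kappa>"
      "x = a \<otimes>\<^bsub>L_monoid \<kappa>\<^esub> b \<otimes>\<^bsub>L_monoid \<kappa>\<^esub> inv\<^bsub>L_monoid \<kappa>\<^esub> a \<otimes>\<^bsub>L_monoid \<kappa>\<^esub> inv\<^bsub>L_monoid \<kappa>\<^esub> b"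
      using x unfolding C by blast
    then have ab: "a \<in> L_group \<kappa>" "b \<in> L_group \<kappa>" "x = a ** b ** herm a ** herm b"
      by (simp_all add: inv_L_monoid) (simp add: L_monoid_def)
    have K: "x \<in> K_group \<kappa>" using ab by (auto simp: L_group_def intro!: K_group_mult K_group_herm)
    obtain A B where A: "a = diag_blocks A B" "herm A ** A = mat 1" by (rule L_groupE[OF ab(1)])
    obtain C D where C: "b = diag_blocks C D" "herm C ** C = mat 1" by (rule L_groupE[OF ab(2)])
    have x: "x = diag_blocks (A ** C ** herm A ** herm C) (B ** D ** herm B ** herm D)"
      unfolding ab A C by (simp add: diag_blocks_mult herm_diag_blocks)
    have "det A * cnj (det A) = 1" "det C * cnj (det C) = 1"
      using arg_cong[OF A(2), of det] arg_cong[OF C(2), of det] by (simp_all add: det_mul det_herm mult.commute)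
    moreover have "det (block11 x) = (det A * cnj (det A)) * (det C * cnj (det C))"
      unfolding x by (simp add: det_mul det_herm mult_ac)
    ultimately have "det (block11 x) = 1" by simp
    then show ?thesis using K x by (auto simp: L_group_def)
  qed
  show ?thesis
    using assms unfolding derived_def
  proof (induction rule: generate.induct)
    case one
    show ?case by (simp add: L_monoid_def L_group_one)
  next
    case (incl h)
    then show ?case by (rule comm)
  next
    case (inv h)
    then have h: "h \<in> L_group \<kappa>" "det (block11 h) = 1" using comm by auto
    have "block11 (herm h) = herm (block11 h)" by (simp add: vec_eq_iff)
    then show ?case using h by (auto simp: inv_L_monoid det_herm L_group_herm)
  next
    case (eng h1 h2)
    then have "block11 (h1 ** h2) = block11 h1 ** block11 h2"
      by (auto simp: L_group_def diag_blocks_mult)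
    with eng show ?case by (simp add: L_monoid_def det_mul L_group_mult)
  qed
qed

text \<open>A rotation is a commutator: \<open>R(t) = R(t/2) w R(t/2)\<^sup>-\<^sup>1 w\<^sup>-\<^sup>1\<close> with \<open>w = diag (\<i>, -\<i>)\<close> inverting
  rotations.  Diagonal elements are inverted by the Weyl element instead.\<close>

lemma plane_commutators:
  assumes "i \<noteq> j"
  defines "P \<equiv> plane_elt i j"
  shows "P (of_real (cos t)) (of_real (sin t)) =
      P (of_real (cos (t/2))) (of_real (sin (t/2))) ** P \<i> 0 ** herm (P (of_real (cos (t/2))) (of_real (sin (t/2)))) ** herm (P \<i> 0)"
    and "P (cis t) 0 = P (cis (t/2)) 0 ** P 0 1 ** herm (P (cis (t/2)) 0) ** herm (P 0 1)"
proof -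
  have t: "cos t = cos (t/2) * cos (t/2) - sin (t/2) * sin (t/2)" "sin t = 2 * (sin (t/2) * cos (t/2))"
    using cos_add[of "t/2" "t/2"] sin_add[of "t/2" "t/2"] by simp_all
  show "P (of_real (cos t)) (of_real (sin t)) =
      P (of_real (cos (t/2))) (of_real (sin (t/2))) ** P \<i> 0 ** herm (P (of_real (cos (t/2))) (of_real (sin (t/2)))) ** herm (P \<i> 0)"
    unfolding P_def herm_plane_elt[OF assms(1)] plane_elt_mult[OF assms(1)] t
    by (simp add: algebra_simps)
  have c: "cis t = cis (t/2) * cis (t/2)" by (simp add: cis_mult)
  show "P (cis t) 0 = P (cis (t/2)) 0 ** P 0 1 ** herm (P (cis (t/2)) 0) ** herm (P 0 1)"
    unfolding P_def herm_plane_elt[OF assms(1)] plane_elt_mult[OF assms(1)] c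
    by (simp add: algebra_simps)
qed

text \<open>Each special unitary block is a product of rotations and diagonal elements in coordinate planes,
  which are commutators.\<close>

lemma SU_subset_L_derived:
  assumes A: "A \<in> K_group (Complex_Case l)" and B: "B \<in> K_group (Complex_Case l)"
  shows "diag_blocks A B \<in> L_derived (Complex_Case l)"
proof -
  let ?D = "L_derived (Complex_Case l)"
  have LA: "diag_blocks g (mat 1) \<in> L_group (Complex_Case l)"
    and LB: "diag_blocks (mat 1) h \<in> L_group (Complex_Case l)"
    if "g \<in> K_group (Complex_Case l)" "h \<in> K_group (Complex_Case l)" for g :: "complex^'a^'a" and h :: "complex^'b^'b"
    using that by (auto simp: L_group_diag K_groupD)
  have P: "plane_elt i j a b \<in> K_group (Complex_Case l)"
    if "i \<noteq> j" "(cmod a)\<^sup>2 + (cmod b)\<^sup>2 = 1" for i j :: "'n::finite" and a b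
    using that by (intro plane_elt_in_K) auto
  have "diag_blocks A (mat 1) \<in> ?D"
    using A
  proof (induction rule: K_group_rotation_induct)
    case one
    then show ?case by (simp add: diag_blocks_one L_derived_one)
  next
    case (rotation i j t g)
    note c = L_derived_commutator[OF LA[OF P[OF rotation(1), of "of_real (cos (t/2))" "of_real (sin (t/2))"] K_group_one]
        LA[OF P[OF rotation(1), of \<i> 0] K_group_one]]
    have "diag_blocks (plane_elt i j (of_real (cos t)) (of_real (sin t))) (mat 1) \<in> ?D"
      using c unfolding herm_diag_blocks diag_blocks_mult plane_commutators(1)[OF rotation(1), of t] by simp
    from L_derived_mult[OF this rotation(3)] show ?case by (simp add: diag_blocks_mult)
  next
    case (phase i j t g)
    note c = L_derived_commutator[OF LA[OF P[OF phase(2), of "cis (t/2)" 0] K_group_one]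
        LA[OF P[OF phase(2), of 0 1] K_group_one]]
    have "diag_blocks (plane_elt i j (cis t) 0) (mat 1) \<in> ?D"
      using c unfolding herm_diag_blocks diag_blocks_mult plane_commutators(2)[OF phase(2), of t] by simp
    from L_derived_mult[OF this phase(4)] show ?case by (simp add: diag_blocks_mult)
  qed
  moreover have "diag_blocks (mat 1) B \<in> ?D"
    using B
  proof (induction rule: K_group_rotation_induct)
    case one
    then show ?case by (simp add: diag_blocks_one L_derived_one)
  next
    case (rotation i j t g)
    note c = L_derived_commutator[OF LB[OF K_group_one P[OF rotation(1), of "of_real (cos (t/2))" "of_real (sin (t/2))"]]
        LB[OF K_group_one P[OF rotation(1), of \<i> 0]]]
    have "diag_blocks (mat 1) (plane_elt i j (of_real (cos t)) (of_real (sin t))) \<in> ?D"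
      using c unfolding herm_diag_blocks diag_blocks_mult plane_commutators(1)[OF rotation(1), of t] by simp
    from L_derived_mult[OF this rotation(3)] show ?case by (simp add: diag_blocks_mult)
  next
    case (phase i j t g)
    note c = L_derived_commutator[OF LB[OF K_group_one P[OF phase(2), of "cis (t/2)" 0]]
        LB[OF K_group_one P[OF phase(2), of 0 1]]]
    have "diag_blocks (mat 1) (plane_elt i j (cis t) 0) \<in> ?D"
      using c unfolding herm_diag_blocks diag_blocks_mult plane_commutators(2)[OF phase(2), of t] by simp
    from L_derived_mult[OF this phase(4)] show ?case by (simp add: diag_blocks_mult)
  qed
  ultimately have "diag_blocks A (mat 1) ** diag_blocks (mat 1) B \<in> ?D" by (rule L_derived_mult)
  then show ?thesis by (simp add: diag_blocks_mult)
qed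

text \<open>Dividing \<open>m\<close> by \<open>exp (t Z)\<close> with \<open>det A = e\<^sup>i\<^sup>t\<close> leaves two blocks of determinant one, which lie in
  \<open>[L, L]\<close>.  As \<open>[L, L]\<close> has block determinants one, \<open>e\<^sup>i\<^sup>t\<close>, and with it the value of the character,
  is determined by \<open>m\<close>.\<close>

theorem chi_L_eq:
  fixes m :: "('p::finite, 'q::finite) bmat"
  assumes m: "m \<in> L_group \<kappa>"
  shows "chi_L \<kappa> m = unit_char \<kappa> (det (block11 m))"
proof (cases \<kappa>)
  case Real_Case
  then show ?thesis by (simp add: unit_char_def twist_def conjugating_def)
next
  case (Complex_Case l)
  obtain A B where AB: "m = diag_blocks A B" "herm A ** A = mat 1" "herm B ** B = mat 1" "det A * det B = 1"
    using m by (rule L_groupE)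
  let ?E = "\<lambda>t. mexp (t *\<^sub>R (Z_elt :: ('p, 'q) bmat))"
  have unique: "c = unit_char \<kappa> (det A)"
    if c: "\<exists>t::real. \<exists>h\<in>L_derived (Complex_Case l). m = ?E t ** h \<and> c = exp (\<i> * of_int l * of_real t)" for c
  proof -
    obtain t h where th: "h \<in> L_derived (Complex_Case l)" "m = ?E t ** h" "c = exp (\<i> * of_int l * of_real t)"
      using c by blast
    obtain C D where h: "h = diag_blocks C D" using L_derived_det[OF th(1)] by (auto simp: L_group_def)
    have "det (block11 m) = cis t * det (block11 h)"
      unfolding th(2) h mexp_Z_elt diag_blocks_mult by (simp add: det_mul det_mat_cis)
    then have "det A = cis t" using L_derived_det[OF th(1)] by (simp add: AB)
    then show ?thesis by (simp add: th(3) Complex_Case unit_char_cis)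
  qed
  obtain t where t: "det A = cis t" using cmod_det_unitary[OF AB(2)] by (rule unit_complex_cis)
  define h where "h = ?E (- t) ** m"
  have "?E t ** ?E (- t) = mat 1" using mexp_minus(1)[of "t *\<^sub>R Z_elt"] by simp
  then have mh: "m = ?E t ** h" by (simp add: h_def matrix_mul_assoc)
  have h: "h = diag_blocks (cscale (cis (- t / CARD('p))) A) (cscale (cis (t / CARD('q))) B)"
    unfolding h_def AB mexp_Z_elt diag_blocks_mult mat_mult_cscale by simp
  have cc: "cscale (cnj (cis s)) (herm C) ** cscale (cis s) C = herm C ** C" for s and C :: "complex^'n^'n"
    by (simp add: cscale_mult_left cscale_mult_right cis_cnj cis_mult)
  have "det B = cis (- t)" using AB(4) unfolding t by (metis cis_inverse inverse_unique)
  then have "h \<in> L_derived (Complex_Case l)"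
    unfolding h using AB t
    by (intro SU_subset_L_derived K_groupI)
       (auto simp: det_cscale Complex.DeMoivre cis_mult herm_cscale cc simp del: cis_cnj)
  then show ?thesis
    unfolding Complex_Case chi_L.simps
  proof (intro the_equality)
    assume h: "h \<in> L_derived (Complex_Case l)"
    show "\<exists>t::real. \<exists>h\<in>L_derived (Complex_Case l). m = ?E t ** h \<and>
        unit_char (Complex_Case l) (det (block11 m)) = exp (\<i> * of_int l * of_real t)"
    proof (intro exI[of _ t] bexI[of _ h] conjI)
      have "det (block11 m) = cis t" by (simp add: AB(1) t)
      then show "unit_char (Complex_Case l) (det (block11 m)) = exp (\<i> * of_int l * of_real t)"
        by (simp add: unit_char_cis)
    qed (use h mh in auto)
  next
    fix c assume "\<exists>t::real. \<exists>h\<in>L_derived (Complex_Case l). m = ?E t ** h \<and> c = exp (\<i> * of_int l * of_real t)"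
    from unique[OF this] show "c = unit_char (Complex_Case l) (det (block11 m))" by (simp add: AB(1) Complex_Case)
  qed
qed

lemma M_groupI:
  "a \<in> matrices_over \<kappa> \<Longrightarrow> b \<in> matrices_over \<kappa> \<Longrightarrow> cmod (det a) = 1 \<Longrightarrow> cmod (det b) = 1 \<Longrightarrow>
    det a * det b = 1 \<Longrightarrow> diag_blocks a b \<in> M_group \<kappa>"
  by (auto simp: M_group_def matrices_over_diag_blocks)

lemma M_groupE:
  assumes "m \<in> M_group \<kappa>"
  obtains a b where "m = diag_blocks a b" "a \<in> matrices_over \<kappa>" "b \<in> matrices_over \<kappa>"
    "cmod (det a) = 1" "cmod (det b) = 1" "det a * det b = 1"
  using assms by (auto simp: M_group_def matrices_over_diag_blocks)

text \<open>The Hermitian factor is \<open>exp X\<close> with \<open>2 X = log (m\<^sup>* m)\<close>.  The logarithm is a real polynomial in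
  \<open>m\<^sup>* m\<close>, so it is block diagonal with entries in the base field, and its blocks have trace zero
  because the blocks of \<open>m\<close> have determinants of modulus one.\<close>

lemma polar_decomposition_M:
  fixes m :: "('p::finite, 'q::finite) bmat"
  assumes m: "m \<in> M_group \<kappa>"
  obtains a X where "a \<in> L_group \<kappa>" "X \<in> lie_algebra (M_group \<kappa>)" "herm X = X" "m = a ** mexp X"
proof -
  obtain a b where ab: "m = diag_blocks a b" "a \<in> matrices_over \<kappa>" "b \<in> matrices_over \<kappa>"
    "cmod (det a) = 1" "cmod (det b) = 1" "det a * det b = 1" using m by (rule M_groupE)
  define P where "P = herm m ** m"
  have detm: "det m = 1" by (simp add: ab det_diag_blocks)
  have P: "herm P = P" by (simp add: P_def herm_mult)
  have pos: "(P *v x) \<bullet> x > 0" if "x \<noteq> 0" for x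
  proof -
    have "(P *v x) \<bullet> x = (m *v x) \<bullet> (m *v x)"
      using inner_herm[of "herm m" "m *v x" x] by (simp add: P_def matrix_vector_mul_assoc)
    moreover have "m *v x \<noteq> 0"
      using that detm by (metis det_nz_iff_inj invertible_det_nz matrix_left_invertible_ker invertible_left_inverse zero_neq_one)
    ultimately show ?thesis by simp
  qed
  obtain q where q: "mexp (2 *\<^sub>R matrix_poly q P) = P" using hermitian_log[OF P pos] by blast
  define X where "X = matrix_poly q P"
  have "P ** A ** P = P ** (P ** A)" if "A ** P = P ** A" for A
    unfolding matrix_mul_assoc[symmetric] that ..
  then have X1: "herm X = X \<and> X ** P = P ** X" unfolding X_def
    by (intro matrix_poly_induct[where S = "\<lambda>X. herm X = X \<and> X ** P = P ** X"])
      (simp_all add: herm_mult herm_add herm_scaleR P mm.add_left mm.add_right mm.scaleR_left mm.scaleR_right)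
  have Pd: "P = diag_blocks (herm a ** a) (herm b ** b)"
    by (simp add: P_def ab herm_diag_blocks diag_blocks_mult)
  have "\<exists>Y Z. Y \<in> matrices_over \<kappa> \<and> Z \<in> matrices_over \<kappa> \<and> X = diag_blocks Y Z"
    unfolding X_def
  proof (rule matrix_poly_induct)
    show "\<exists>Y Z. Y \<in> matrices_over \<kappa> \<and> Z \<in> matrices_over \<kappa> \<and> mat 1 = diag_blocks Y Z"
      by (intro exI[of _ "mat 1"]) (simp add: diag_blocks_one matrices_over_mat)
    fix A B :: "('p, 'q) bmat" and r :: real
    assume A: "\<exists>Y Z. Y \<in> matrices_over \<kappa> \<and> Z \<in> matrices_over \<kappa> \<and> A = diag_blocks Y Z"
    then obtain Y Z where Y: "Y \<in> matrices_over \<kappa>" "Z \<in> matrices_over \<kappa>" "A = diag_blocks Y Z" by blast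
    show "\<exists>Y Z. Y \<in> matrices_over \<kappa> \<and> Z \<in> matrices_over \<kappa> \<and> P ** A = diag_blocks Y Z"
      by (intro exI[of _ "herm a ** a ** Y"] exI[of _ "herm b ** b ** Z"])
         (simp add: Pd Y diag_blocks_mult matrices_over_mult matrices_over_herm ab)
    show "\<exists>Y Z. Y \<in> matrices_over \<kappa> \<and> Z \<in> matrices_over \<kappa> \<and> r *\<^sub>R A = diag_blocks Y Z"
      by (intro exI[of _ "r *\<^sub>R Y"] exI[of _ "r *\<^sub>R Z"])
         (simp add: Y matrices_over_scaleR, simp add: diag_blocks_def scaleR_blocks)
    assume "\<exists>Y Z. Y \<in> matrices_over \<kappa> \<and> Z \<in> matrices_over \<kappa> \<and> B = diag_blocks Y Z"
    then obtain Y' Z' where Y': "Y' \<in> matrices_over \<kappa>" "Z' \<in> matrices_over \<kappa>" "B = diag_blocks Y' Z'" by blast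
    show "\<exists>Y Z. Y \<in> matrices_over \<kappa> \<and> Z \<in> matrices_over \<kappa> \<and> A + B = diag_blocks Y Z"
      by (intro exI[of _ "Y + Y'"] exI[of _ "Z + Z'"])
         (use Y Y' in \<open>auto simp: matrices_over_def diag_blocks_def vec_eq_iff all_sum_iff intro!: scalars_closed(1)\<close>)
  qed
  then obtain Y Z where YZ: "Y \<in> matrices_over \<kappa>" "Z \<in> matrices_over \<kappa>" "X = diag_blocks Y Z" by blast
  have hY: "herm Y = Y" "herm Z = Z" using X1 by (auto simp: YZ herm_diag_blocks diag_blocks_eq_iff)
  have sc: "r *\<^sub>R X = diag_blocks (r *\<^sub>R Y) (r *\<^sub>R Z)" for r
    by (simp add: YZ diag_blocks_def scaleR_blocks)
  have m2: "mexp (2 *\<^sub>R Y) = herm a ** a" "mexp (2 *\<^sub>R Z) = herm b ** b"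
  proof -
    have "diag_blocks (mexp (2 *\<^sub>R Y)) (mexp (2 *\<^sub>R Z)) = diag_blocks (herm a ** a) (herm b ** b)"
      using q by (simp add: X_def[symmetric] sc mexp_diag_blocks Pd[symmetric])
    then show "mexp (2 *\<^sub>R Y) = herm a ** a" "mexp (2 *\<^sub>R Z) = herm b ** b"
      by (simp_all add: diag_blocks_eq_iff)
  qed
  have trace0: "trace W = 0" if "mexp (2 *\<^sub>R W) = herm c ** c" "herm W = W" "cmod (det c) = 1"
    for W c :: "complex^'n^'n"
  proof -
    have "cnj (trace W) = trace (herm W)" by (simp add: trace_def)
    then have "trace W \<in> \<real>" using that(2) by (simp add: Reals_cnj_iff)
    then obtain r where r: "trace W = of_real r" by (auto simp: Reals_def)
    have "exp (2 * trace W) = of_real ((cmod (det c))\<^sup>2)"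
      using arg_cong[OF that(1), of det] unfolding cmod_sq by (simp add: det_mexp trace_scaleR det_mul det_herm)
    then have "exp (of_real (2 * r)) = (1::complex)" using that(3) by (simp add: r)
    then have "exp (2 * r) = 1" unfolding exp_of_real by (metis of_real_1 of_real_eq_iff)
    then show ?thesis by (simp add: r)
  qed
  have tr: "trace Y = 0" "trace Z = 0" using trace0 m2 hY ab by blast+
  have X: "X \<in> lie_algebra (M_group \<kappa>)"
    unfolding lie_algebra_def mem_Collect_eq sc mexp_diag_blocks
    by (intro allI M_groupI mexp_matrices_over matrices_over_scaleR YZ)
       (simp_all add: det_mexp trace_scaleR tr)
  define c where "c = m ** mexp (- X)"
  have "mexp (- X) ** (mexp X ** mexp X) ** mexp (- X) = mat 1"
    by (simp add: matrix_mul_assoc mexp_minus)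
  moreover have "mexp X ** mexp X = P"
    using q mexp_add[of X X] by (simp add: X_def[symmetric] scaleR_2)
  ultimately have "herm c ** c = mat 1"
    by (simp add: c_def herm_mult herm_mexp herm_minus X1 P_def matrix_mul_assoc)
  moreover have "c = diag_blocks (a ** mexp (- Y)) (b ** mexp (- Z))"
    using sc[of "-1"] by (simp add: c_def ab mexp_diag_blocks diag_blocks_mult)
  moreover have "trace (- Y) = 0" "trace (- Z) = 0" using tr trace_scaleR[of "-1" Y] trace_scaleR[of "-1" Z] by auto
  moreover have "- Y \<in> matrices_over \<kappa>" "- Z \<in> matrices_over \<kappa>"
    using YZ matrices_over_scaleR[of _ \<kappa> "-1"] by fastforce+
  ultimately have "c \<in> L_group \<kappa>"
    using ab by (auto simp: L_group_def K_group_def SL_group_def matrices_over_diag_blocks det_diag_blocks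
        matrices_over_mult mexp_matrices_over det_mul det_mexp)
  moreover have "m = c ** mexp X"
    by (simp add: c_def mexp_minus flip: matrix_mul_assoc)
  ultimately show ?thesis using X X1 that by blast
qed

text \<open>The factor \<open>exp X\<close> is the square of the Hermitian matrix \<open>exp (X / 2)\<close> of \<open>M\<close>, whose upper left block
  has a real determinant of modulus one; so \<open>exp X\<close> does not change the determinant of that block.\<close>

theorem chi_M_eq:
  fixes m :: "('p::finite, 'q::finite) bmat"
  assumes m: "m \<in> M_group \<kappa>"
  shows "chi_M \<kappa> m = unit_char \<kappa> (det (block11 m))"
proof -
  have det1: "det (block11 m) = det (block11 a)"
    if a: "a \<in> L_group \<kappa>" and X: "X \<in> lie_algebra (M_group \<kappa>)" "herm X = X" and max: "m = a ** mexp X" for a X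
  proof -
    have "mexp ((1/2) *\<^sub>R X) \<in> M_group \<kappa>" using X(1) by (simp add: lie_algebra_def)
    then obtain c d where cd: "mexp ((1/2) *\<^sub>R X) = diag_blocks c d" "cmod (det c) = 1"
      by (rule M_groupE)
    have "herm (mexp ((1/2) *\<^sub>R X)) = mexp ((1/2) *\<^sub>R X)" by (simp add: herm_mexp herm_scaleR X)
    then have "herm c = c" by (simp add: cd herm_diag_blocks diag_blocks_eq_iff)
    then have "cnj (det c) = det c" by (metis det_herm)
    then have "det c * det c = 1" using cd(2) cmod_sq[of "det c"] by simp
    moreover have "mexp X = diag_blocks (c ** c) (d ** d)"
      using mexp_scaleR_add[of "1/2" "1/2" X] by (simp add: cd diag_blocks_mult)
    moreover obtain A B where "a = diag_blocks A B" using a by (rule L_groupE)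
    ultimately show ?thesis unfolding max by (simp add: diag_blocks_mult det_mul)
  qed
  obtain a X where aX: "a \<in> L_group \<kappa>" "X \<in> lie_algebra (M_group \<kappa>)" "herm X = X" "m = a ** mexp X"
    using m by (rule polar_decomposition_M)
  show ?thesis
    unfolding chi_M_def
  proof (rule the_equality)
    show "\<exists>a\<in>L_group \<kappa>. \<exists>X\<in>lie_algebra (M_group \<kappa>).
        herm X = X \<and> m = a ** mexp X \<and> unit_char \<kappa> (det (block11 m)) = chi_L \<kappa> a"
      using aX det1[OF aX] chi_L_eq[OF aX(1)] by metis
  next
    fix c assume "\<exists>a\<in>L_group \<kappa>. \<exists>X\<in>lie_algebra (M_group \<kappa>). herm X = X \<and> m = a ** mexp X \<and> c = chi_L \<kappa> a"
    then show "c = unit_char \<kappa> (det (block11 m))" using det1 chi_L_eq by metis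
  qed
qed

section \<open>The open cell\<close>

lemma mexp_H0: "mexp (t *\<^sub>R (H0 :: ('p::finite, 'q::finite) bmat)) =
    diag_blocks (mat (of_real (exp (t * CARD('q) / CARD('p + 'q)))))
      (mat (of_real (exp (- t * CARD('p) / CARD('p + 'q)))))"
proof -
  have "t *\<^sub>R (H0 :: ('p, 'q) bmat) = diag_blocks (mat (of_real (t * CARD('q) / CARD('p + 'q))))
      (mat (of_real (- t * CARD('p) / CARD('p + 'q))))"
    unfolding H0_def diag_blocks_def scaleR_blocks blocks_eq_iff
    by (simp add: scaleR_cscale vec_eq_iff mat_nth)
  then show ?thesis by (simp only: mexp_diag_blocks mexp_mat exp_of_real)
qed

lemma cell_product:
  "blocks (mat 1) 0 X (mat 1) ** diag_blocks a b ** diag_blocks (mat u) (mat v) ** blocks (mat 1) Y 0 (mat 1) =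
    blocks (cscale u a) (cscale u a ** Y) (X ** cscale u a) (X ** cscale u a ** Y + cscale v b)"
  by (simp add: diag_blocks_def blocks_mult mm.zero_left mm.zero_right mat_mult_cscale cscale_mult_left
      cscale_mult_right matrix_mul_assoc)

text \<open>The factorisation with \<open>t\<close> in place of the element \<open>exp (t H\<^sub>0)\<close> of \<open>A\<close>.\<close>

definition cell_factors ::
  "base_case \<Rightarrow> ('p::finite, 'q::finite) bmat \<Rightarrow> ('p, 'q) bmat \<Rightarrow> real \<Rightarrow> bool" where
  "cell_factors \<kappa> g m t \<longleftrightarrow> m \<in> M_group \<kappa> \<and> (\<exists>nb\<in>Nbar_group \<kappa>. \<exists>n\<in>N_group \<kappa>. g = nb ** m ** mexp (t *\<^sub>R H0) ** n)"

lemma cell_factors_det: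
  fixes g :: "('p::finite, 'q::finite) bmat"
  assumes "cell_factors \<kappa> g m t"
  shows "cmod (det (block11 g)) = exp (t * (CARD('p) * CARD('q)) / CARD('p + 'q))"
    and "det (block11 m) * of_real (cmod (det (block11 g))) = det (block11 g)"
proof -
  obtain X Y where XY: "g = blocks (mat 1) 0 X (mat 1) ** m ** mexp (t *\<^sub>R H0) ** blocks (mat 1) Y 0 (mat 1)"
    and m: "m \<in> M_group \<kappa>"
    using assms by (auto simp: cell_factors_def N_group_def Nbar_group_def)
  obtain a b where ab: "m = diag_blocks a b" "cmod (det a) = 1" using m by (rule M_groupE)
  define u where "u = exp (t * CARD('q) / CARD('p + 'q))"
  have u: "u ^ CARD('p) = exp (t * (CARD('p) * CARD('q)) / CARD('p + 'q))"
    by (simp add: u_def exp_of_nat_mult[symmetric] mult_ac)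
  have "block11 g = cscale (of_real u) a" unfolding XY ab(1) mexp_H0 cell_product u_def by simp
  then have d: "det (block11 g) = of_real (u ^ CARD('p)) * det a" by (simp add: det_cscale)
  then show c: "cmod (det (block11 g)) = exp (t * (CARD('p) * CARD('q)) / CARD('p + 'q))"
    unfolding u by (simp add: norm_mult ab(2) del: card_sum)
  show "det (block11 m) * of_real (cmod (det (block11 g))) = det (block11 g)"
    unfolding c unfolding d u by (simp add: ab)
qed

text \<open>The upper left block gives first \<open>t\<close>, by the modulus of its determinant, then \<open>a\<close>; being invertible
  it can be cancelled from the off-diagonal blocks.\<close>

lemma cell_factors_unique:
  fixes g :: "('p::finite, 'q::finite) bmat"
  assumes "cell_factors \<kappa> g m t" "cell_factors \<kappa> g m' t'"
  shows "m = m' \<and> t = t'"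
proof -
  have t: "t = t'"
    using cell_factors_det(1)[OF assms(1)] cell_factors_det(1)[OF assms(2)] by (simp del: card_sum)
  obtain X Y where XY: "g = blocks (mat 1) 0 X (mat 1) ** m ** mexp (t *\<^sub>R H0) ** blocks (mat 1) Y 0 (mat 1)"
    and m: "m \<in> M_group \<kappa>"
    using assms(1) by (auto simp: cell_factors_def N_group_def Nbar_group_def)
  obtain X' Y' where XY': "g = blocks (mat 1) 0 X' (mat 1) ** m' ** mexp (t *\<^sub>R H0) ** blocks (mat 1) Y' 0 (mat 1)"
    and m': "m' \<in> M_group \<kappa>"
    using assms(2) by (auto simp: cell_factors_def N_group_def Nbar_group_def t)
  obtain a b where ab: "m = diag_blocks a b" "cmod (det a) = 1" using m by (rule M_groupE)
  obtain a' b' where ab': "m' = diag_blocks a' b'" using m' by (rule M_groupE)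
  define u v where "u = complex_of_real (exp (t * CARD('q) / CARD('p + 'q)))"
    and "v = complex_of_real (exp (- t * CARD('p) / CARD('p + 'q)))"
  have uv: "u \<noteq> 0" "v \<noteq> 0" by (simp_all add: u_def v_def)
  have cs: "c \<noteq> 0 \<Longrightarrow> cscale c A = cscale c B \<longleftrightarrow> A = B" for c and A B :: "complex^'n^'m"
    by (simp add: vec_eq_iff)
  have e: "a = a'" "cscale u a ** Y = cscale u a' ** Y'" "X ** cscale u a = X' ** cscale u a'"
    "X ** cscale u a ** Y + cscale v b = X' ** cscale u a' ** Y' + cscale v b'"
    using XY XY' unfolding ab(1) ab' mexp_H0 cell_product u_def[symmetric] v_def[symmetric]
    by (auto simp: blocks_eq_iff cs uv)
  have "det (cscale u a) \<noteq> 0" using ab(2) uv by (auto simp: det_cscale)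
  then obtain c where c: "c ** cscale u a = mat 1"
    using invertible_det_nz invertible_left_inverse by blast
  have "c ** (cscale u a ** Y) = c ** (cscale u a ** Y')" using e(1,2) by simp
  then have "Y = Y'" by (simp add: matrix_mul_assoc c)
  then have "cscale v b = cscale v b'" using e(3,4) by simp
  then show ?thesis using t e(1) by (simp add: ab(1) ab' cs uv)
qed

lemma big_cell_iff: "g \<in> big_cell \<kappa> \<longleftrightarrow> (\<exists>m t. cell_factors \<kappa> g m t)"
  unfolding big_cell_def cell_factors_def A_group_def by blast

text \<open>Block Gaussian elimination with the Schur complement \<open>S\<close>; the remaining scalars that make the
  determinants of both diagonal blocks have modulus one form an element of \<open>A\<close>.\<close>

lemma cell_factors_exist:
  fixes g :: "('p::finite, 'q::finite) bmat"
  assumes g: "g \<in> matrices_over \<kappa>" "det g = 1" and d: "det (block11 g) \<noteq> 0"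
  obtains m t where "cell_factors \<kappa> g m t"
proof -
  let ?A = "block11 g" and ?B = "block12 g" and ?C = "block21 g" and ?D = "block22 g"
  have over: "?A \<in> matrices_over \<kappa>" "?B \<in> matrices_over \<kappa>" "?C \<in> matrices_over \<kappa>" "?D \<in> matrices_over \<kappa>"
    using g(1) by (simp_all add: matrices_over_def)
  obtain A' where A': "A' ** ?A = mat 1" "?A ** A' = mat 1"
    using d invertible_det_nz[of ?A] unfolding invertible_def by blast
  have A'o: "A' \<in> matrices_over \<kappa>"
  proof (cases \<kappa>)
    case Real_Case
    have "mcnj A' ** ?A = mat 1"
      using arg_cong[OF A'(1), of mcnj] over(1) by (simp add: mcnj_mult Real_Case matrices_over_Real)
    then have "mcnj A' = A'" by (metis A'(2) matrix_mul_assoc matrix_mul_lid matrix_mul_rid)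
    then show ?thesis by (simp add: Real_Case matrices_over_Real)
  qed simp
  define S where "S = ?D - ?C ** A' ** ?B"
  have minus: "U \<in> matrices_over \<kappa> \<Longrightarrow> V \<in> matrices_over \<kappa> \<Longrightarrow> U - V \<in> matrices_over \<kappa>" for U V :: "complex^'n^'m"
    by (auto simp: matrices_over_def scalars_closed)
  have So: "S \<in> matrices_over \<kappa>" unfolding S_def by (intro minus matrices_over_mult over A'o)
  have gm: "g = blocks (mat 1) 0 (?C ** A') (mat 1) ** diag_blocks ?A S ** blocks (mat 1) (A' ** ?B) 0 (mat 1)"
  proof -
    have "blocks (mat 1) 0 (?C ** A') (mat 1) ** diag_blocks ?A S ** blocks (mat 1) (A' ** ?B) 0 (mat 1) =
        blocks ?A (?A ** A' ** ?B) (?C ** (A' ** ?A)) (?C ** (A' ** ?A) ** A' ** ?B + S)"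
      by (simp add: diag_blocks_def blocks_mult mm.zero_left mm.zero_right matrix_mul_assoc)
    then show ?thesis by (simp add: A' S_def blocks_eta)
  qed
  have dS: "det ?A * det S = 1"
    using arg_cong[OF gm, of det] g(2) by (simp add: det_mul det_block_unipotent det_diag_blocks)
  (* Chosen such that exp (t H_0) contributes exactly the modulus of the determinant. *)
  define t where "t = ln (cmod (det ?A)) * CARD('p + 'q) / (CARD('p) * CARD('q))"
  define u v where "u = exp (t * CARD('q) / CARD('p + 'q))" and "v = exp (- t * CARD('p) / CARD('p + 'q))"
  have pos: "u > 0" "v > 0" by (simp_all add: u_def v_def)
  have "t * (CARD('p) * CARD('q)) / CARD('p + 'q) = ln (cmod (det ?A))"
    by (simp add: t_def del: card_sum)
  moreover have "u ^ CARD('p) = exp (t * (CARD('p) * CARD('q)) / CARD('p + 'q))"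
    "v ^ CARD('q) = exp (- (t * (CARD('p) * CARD('q)) / CARD('p + 'q)))"
    by (simp_all add: u_def v_def exp_of_nat_mult[symmetric] mult_ac)
  ultimately have uv: "u ^ CARD('p) = cmod (det ?A)" "v ^ CARD('q) = inverse (cmod (det ?A))"
    using d by (simp_all add: exp_minus)
  have cS: "cmod (det ?A) * cmod (det S) = 1" using arg_cong[OF dS, of cmod] by (simp add: norm_mult)
  let ?a = "cscale (of_real (inverse u)) ?A" and ?b = "cscale (of_real (inverse v)) S"
  have da: "det ?a = of_real (inverse (cmod (det ?A))) * det ?A" "det ?b = of_real (cmod (det ?A)) * det S"
    by (simp_all add: det_cscale power_inverse flip: uv of_real_power) (simp_all add: uv power_inverse)
  have M: "diag_blocks ?a ?b \<in> M_group \<kappa>"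
  proof (rule M_groupI)
    show "?a \<in> matrices_over \<kappa>" "?b \<in> matrices_over \<kappa>"
      using over(1) So by (auto simp: matrices_over_def intro!: scalars_closed(3) simp del: of_real_inverse)
    show "cmod (det ?a) = 1" unfolding da using d by (simp add: norm_mult norm_inverse)
    show "cmod (det ?b) = 1" unfolding da using d cS by (simp add: norm_mult)
    have "det ?a * det ?b = (inverse (of_real (cmod (det ?A))) * of_real (cmod (det ?A))) * (det ?A * det S)"
      unfolding da by (simp add: mult_ac)
    then show "det ?a * det ?b = 1" using d dS by simp
  qed
  have "g = blocks (mat 1) 0 (?C ** A') (mat 1) ** diag_blocks ?a ?b ** mexp (t *\<^sub>R H0) ** blocks (mat 1) (A' ** ?B) 0 (mat 1)"
    unfolding mexp_H0 cell_product u_def[symmetric] v_def[symmetric]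
    using pos by (subst gm) (simp add: diag_blocks_def blocks_mult mm.zero_left mm.zero_right matrix_mul_assoc)
  moreover have "?C ** A' \<in> matrices_over \<kappa>" "A' ** ?B \<in> matrices_over \<kappa>"
    by (intro matrices_over_mult over A'o)+
  ultimately have "cell_factors \<kappa> g (diag_blocks ?a ?b) t"
    unfolding cell_factors_def N_group_def Nbar_group_def using M by blast
  then show ?thesis by (rule that)
qed

lemma H0_inject:
  fixes t t' :: real
  assumes "mexp (t *\<^sub>R (H0 :: ('p::finite, 'q::finite) bmat)) = mexp (t' *\<^sub>R H0)" shows "t = t'"
proof -
  have "mat (complex_of_real (exp (t * CARD('q) / CARD('p + 'q)))) =
      (mat (of_real (exp (t' * CARD('q) / CARD('p + 'q)))) :: complex^'p^'p)"
    using assms unfolding mexp_H0 diag_blocks_eq_iff by simp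
  then have "complex_of_real (exp (t * CARD('q) / CARD('p + 'q))) = of_real (exp (t' * CARD('q) / CARD('p + 'q)))"
    by (auto simp: vec_eq_iff mat_nth simp del: card_sum split: if_splits)
  then show ?thesis by (simp del: card_sum)
qed

text \<open>In the product of the four factors the upper left block is \<open>u a\<close>, where \<open>a\<close> is the block of \<open>m\<close> and
  the scalar \<open>u\<close> is the upper entry of \<open>exp (t H\<^sub>0)\<close>.  So its determinant has modulus \<open>u\<^sup>p\<close> and the phase
  \<open>det a\<close>, which are the data that \<open>A_power\<close> and \<open>chi_M\<close> read off.\<close>

theorem cell_kernel:
  fixes g :: "('p::finite, 'q::finite) bmat"
  assumes g: "g \<in> matrices_over \<kappa>" "det g = 1"
  shows "g \<in> big_cell \<kappa> \<longleftrightarrow> det (block11 g) \<noteq> 0"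
    and "det (block11 g) \<noteq> 0 \<Longrightarrow>
      A_power (a_part \<kappa> g) z = exp (of_real (ln (cmod (det (block11 g)))) * z)"
    and "det (block11 g) \<noteq> 0 \<Longrightarrow>
      chi_M \<kappa> (m_part \<kappa> g) = unit_char \<kappa> (det (block11 g) / of_real (cmod (det (block11 g))))"
proof -
  show "g \<in> big_cell \<kappa> \<longleftrightarrow> det (block11 g) \<noteq> 0"
    using cell_factors_exist[OF g] cell_factors_det(1)[of \<kappa> g]
    unfolding big_cell_iff by (metis exp_not_eq_zero norm_zero)
  assume d: "det (block11 g) \<noteq> 0"
  obtain m t where mt: "cell_factors \<kappa> g m t" using cell_factors_exist[OF g d] .
  note u = cell_factors_unique[OF _ mt]
  have m: "m_part \<kappa> g = m"
    unfolding m_part_def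
  proof (rule the_equality)
    show "m \<in> M_group \<kappa> \<and> (\<exists>nb\<in>Nbar_group \<kappa>. \<exists>a\<in>A_group. \<exists>n\<in>N_group \<kappa>. g = nb ** m ** a ** n)"
      using mt by (auto simp: cell_factors_def A_group_def)
  next
    fix m' assume "m' \<in> M_group \<kappa> \<and> (\<exists>nb\<in>Nbar_group \<kappa>. \<exists>a\<in>A_group. \<exists>n\<in>N_group \<kappa>. g = nb ** m' ** a ** n)"
    then obtain t' where "cell_factors \<kappa> g m' t'" by (auto simp: cell_factors_def A_group_def)
    then show "m' = m" using u by blast
  qed
  have a: "a_part \<kappa> g = mexp (t *\<^sub>R H0)"
    unfolding a_part_def
  proof (rule the_equality)
    show "mexp (t *\<^sub>R H0) \<in> A_group \<and> (\<exists>nb\<in>Nbar_group \<kappa>. \<exists>m\<in>M_group \<kappa>. \<exists>n\<in>N_group \<kappa>.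
        g = nb ** m ** mexp (t *\<^sub>R H0) ** n)"
      using mt by (auto simp: cell_factors_def A_group_def)
  next
    fix a assume a: "a \<in> A_group \<and> (\<exists>nb\<in>Nbar_group \<kappa>. \<exists>m\<in>M_group \<kappa>. \<exists>n\<in>N_group \<kappa>. g = nb ** m ** a ** n)"
    then obtain t' where t': "a = mexp (t' *\<^sub>R H0)" by (auto simp: A_group_def)
    then obtain m' where "cell_factors \<kappa> g m' t'" using a by (auto simp: cell_factors_def)
    then show "a = mexp (t *\<^sub>R H0)" using u t' by blast
  qed
  have "A_log (mexp (t *\<^sub>R H0) :: ('p, 'q) bmat) = t"
    unfolding A_log_def by (rule the_equality) (auto dest: H0_inject)
  then show "A_power (a_part \<kappa> g) z = exp (of_real (ln (cmod (det (block11 g)))) * z)"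
    unfolding a A_power_def cell_factors_det(1)[OF mt] by (simp add: mult_ac)
  have "det (block11 m) = det (block11 g) / of_real (cmod (det (block11 g)))"
    using cell_factors_det(2)[OF mt] d by (simp add: field_simps)
  moreover have "m \<in> M_group \<kappa>" using mt by (simp add: cell_factors_def)
  ultimately show "chi_M \<kappa> (m_part \<kappa> g) = unit_char \<kappa> (det (block11 g) / of_real (cmod (det (block11 g))))"
    unfolding m by (simp add: chi_M_eq)
qed

section \<open>Haar measure\<close>

lemma haar_sets:
  assumes "normalized_Haar (K_group \<kappa>) \<nu>"
  shows "prob_space \<nu>" "sets \<nu> = sets (restrict_space borel (K_group \<kappa>))" "space \<nu> = K_group \<kappa>"
  using assms sets_eq_imp_space_eq[of \<nu> "restrict_space borel (K_group \<kappa>)"]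
  by (auto simp: normalized_Haar_def space_restrict_space)

lemma haar_measurable_continuous:
  assumes "normalized_Haar (K_group \<kappa>) \<nu>" "continuous_on (K_group \<kappa>) f"
  shows "f \<in> borel_measurable \<nu>"
  using borel_measurable_continuous_on_restrict[OF assms(2)] measurable_cong_sets[OF haar_sets(2)[OF assms(1)] refl]
  by blast

lemma haar_measurable_left:
  assumes "normalized_Haar (K_group \<kappa>) \<nu>" "k \<in> K_group \<kappa>"
  shows "(\<lambda>g. k ** g) \<in> measurable \<nu> \<nu>"
proof -
  let ?K = "K_group \<kappa> :: (complex^'a^'a) set"
  have "(\<lambda>g. k ** g) \<in> borel_measurable borel"
    by (intro borel_measurable_continuous_onI linear_continuous_on mm.bounded_linear_right)
  then have "(\<lambda>g. k ** g) \<in> measurable (restrict_space borel ?K) (restrict_space borel ?K)"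
    using assms(2) by (intro measurable_restrict_space2 measurable_restrict_space1)
      (auto simp: space_restrict_space K_group_mult)
  then show ?thesis
    using measurable_cong_sets[OF haar_sets(2)[OF assms(1)] haar_sets(2)[OF assms(1)]] by blast
qed

lemma haar_left:
  fixes f :: "complex^'n::finite^'n \<Rightarrow> 'b::{banach, second_countable_topology}"
  assumes "normalized_Haar (K_group \<kappa>) \<nu>" "k \<in> K_group \<kappa>" "f \<in> borel_measurable \<nu>"
  shows "(\<integral>g. f (k ** g) \<partial>\<nu>) = (\<integral>g. f g \<partial>\<nu>)"
proof -
  have d: "distr \<nu> \<nu> (\<lambda>g. k ** g) = \<nu>" using assms by (simp add: normalized_Haar_def)
  have "(\<integral>g. f g \<partial>\<nu>) = (\<integral>g. f g \<partial>distr \<nu> \<nu> (\<lambda>g. k ** g))" by (simp only: d)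
  also have "\<dots> = (\<integral>g. f (k ** g) \<partial>\<nu>)"
    by (rule integral_distr[OF haar_measurable_left[OF assms(1,2)] assms(3)])
  finally show ?thesis ..
qed

lemma haar_measurable_entry:
  assumes "normalized_Haar (K_group \<kappa>) \<nu>"
  shows "(\<lambda>g. g $ i $ j) \<in> borel_measurable \<nu>"
  by (rule haar_measurable_continuous[OF assms]) (intro continuous_intros)

lemma measurable_cnj [measurable (raw)]: "f \<in> borel_measurable M \<Longrightarrow> (\<lambda>x. cnj (f x)) \<in> borel_measurable M"
  by (rule measurable_compose[of f M borel cnj borel])
     (auto intro!: borel_measurable_continuous_onI continuous_intros)

section \<open>Gram-Schmidt reduction of the upper left determinant\<close>

definition top_row :: "('p::finite, 'q::finite) bmat \<Rightarrow> 'p + 'q \<Rightarrow> complex^'p" where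
  "top_row g i = (\<chi> b. g $ i $ Inl b)"

definition outer :: "complex^'n \<Rightarrow> complex^'n^'n" where
  "outer x = (\<chi> a b. x $ a * cnj (x $ b))"

lemma norm_sq_vec: "(norm x)\<^sup>2 = (\<Sum>a\<in>UNIV. (cmod (x $ a))\<^sup>2)" for x :: "complex^'n::finite"
  by (simp add: norm_vec_def L2_set_def sum_nonneg)

lemma cip_self: "cip x x = of_real ((norm x)\<^sup>2)"
  by (simp add: cip_def norm_sq_vec cmod_sq mult.commute del: of_real_power)

lemma outer_mult_vec: "outer x *v z = cip z x *s x"
  by (simp add: vec_eq_iff outer_def matrix_vector_mult_def cip_def sum_distrib_left mult_ac)

lemma mult_outer: "A ** outer x = (\<chi> a b. (A *v x) $ a * cnj (x $ b))" for A :: "complex^'n::finite^'n"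
  by (simp add: vec_eq_iff outer_def matrix_mult_nth matrix_vector_mult_def sum_distrib_left mult_ac)

lemma herm_outer: "herm (outer x) = outer x"
  by (simp add: vec_eq_iff outer_def mult.commute)

lemma outer_outer: "outer x ** outer x = cscale (of_real ((norm x)\<^sup>2)) (outer x)"
  unfolding mult_outer outer_mult_vec cip_self by (simp add: vec_eq_iff outer_def mult_ac)

lemma trace_outer: "trace (outer x) = of_real ((norm x)\<^sup>2)"
  by (simp add: trace_def outer_def norm_sq_vec cmod_sq mult.commute del: of_real_power)

definition orth_proj :: "complex^'n::finite^'n \<Rightarrow> bool" where
  "orth_proj P \<longleftrightarrow> herm P = P \<and> P ** P = P"

text \<open>The projection onto the part of the range of \<open>P\<close> that is orthogonal to \<open>x\<close>.  For \<open>x = 0\<close> the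
  division by zero leaves \<open>P\<close> unchanged.\<close>

definition remove_direction :: "complex^'n::finite^'n \<Rightarrow> complex^'n \<Rightarrow> complex^'n^'n" where
  "remove_direction P x = P - cscale (1 / of_real ((norm x)\<^sup>2)) (outer x)"

lemma remove_direction_zero [simp]: "remove_direction P 0 = P"
  by (simp add: remove_direction_def)

lemma orth_proj_cip: "orth_proj P \<Longrightarrow> cip (P *v v) (P *v w) = cip v (P *v w)"
  unfolding cip_adjoint orth_proj_def by (simp add: matrix_vector_mul_assoc)

lemma cip_linear: "cip (c *s v) w = c * cip v w" "cip v (c *s w) = cnj c * cip v w"
  "cip (v + v') w = cip v w + cip v' w" "cip v (w + w') = cip v w + cip v w'"
  "cip (v - v') w = cip v w - cip v' w" "cip v (w - w') = cip v w - cip v w'"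
  "cip 0 w = 0" "cip v 0 = 0"
  by (simp_all add: cip_def sum_distrib_left sum.distrib sum_subtractf algebra_simps)

lemma cip_commute: "cnj (cip v w) = cip w v"
  by (simp add: cip_def mult.commute)

lemma orth_proj_remove:
  assumes P: "orth_proj P"
  defines "P' v \<equiv> remove_direction P (P *v v)"
  shows "orth_proj (P' v)" "P' v *v v = 0" "P *v y = 0 \<Longrightarrow> P' v *v y = 0"
    and "P *v v \<noteq> 0 \<Longrightarrow> trace (P' v) = trace P - 1"
proof -
  let ?x = "P *v v"
  have PP: "herm P = P" "P ** P = P" using P by (auto simp: orth_proj_def)
  have Px: "P *v ?x = ?x" by (simp add: matrix_vector_mul_assoc PP)
  have Po: "P ** outer ?x = outer ?x" unfolding mult_outer Px by (simp add: outer_def)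
  have oP: "outer ?x ** P = outer ?x"
    using arg_cong[OF Po, of herm] by (simp add: herm_mult herm_outer PP)
  let ?c = "1 / complex_of_real ((norm ?x)\<^sup>2)"
  show "orth_proj (P' v)"
    unfolding orth_proj_def
  proof
    show "herm (P' v) = P' v"
      by (simp add: P'_def remove_direction_def herm_diff herm_cscale herm_outer PP)
    have "?c * (?c * of_real ((norm ?x)\<^sup>2)) = ?c" by (cases "?x = 0") simp_all
    then show "P' v ** P' v = P' v"
      by (simp add: P'_def remove_direction_def mm.diff_left mm.diff_right cscale_mult_left cscale_mult_right
          Po oP outer_outer PP(2) del: of_real_power)
  qed
  show "P' v *v v = 0"
  proof (cases "?x = 0")
    case False
    have "cip v ?x = of_real ((norm ?x)\<^sup>2)" using orth_proj_cip[OF P, of v v] by (simp add: cip_self)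
    then show ?thesis using False
      by (simp add: P'_def remove_direction_def mv.diff_left cscale_vector_mult outer_mult_vec
          vector_smult_assoc del: of_real_power)
  qed (simp add: P'_def)
  show "P' v *v y = 0" if "P *v y = 0"
    using orth_proj_cip[OF P, of y v] that
    by (simp add: P'_def remove_direction_def mv.diff_left cscale_vector_mult outer_mult_vec cip_linear)
  show "trace (P' v) = trace P - 1" if "?x \<noteq> 0"
    using that by (simp add: P'_def remove_direction_def trace_sub trace_cscale trace_outer del: of_real_power)
qed

lemma orth_proj_contraction: "orth_proj P \<Longrightarrow> norm (P *v v) \<le> norm v"
proof -
  assume P: "orth_proj P"
  have "of_real ((norm (P *v v))\<^sup>2) = cip v (P *v v)"
    using orth_proj_cip[OF P, of v v] by (simp add: cip_self)
  then have "(norm (P *v v))\<^sup>2 = v \<bullet> (P *v v)" by (metis Re_complex_of_real inner_cip)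
  also have "\<dots> \<le> norm v * norm (P *v v)" by (rule norm_cauchy_schwarz)
  finally show ?thesis by (cases "norm (P *v v) = 0") (auto simp: power2_eq_square)
qed

text \<open>Gram-Schmidt orthogonalisation of the rows of the upper left block, where the last element of the
  list is processed first: \<open>rowproj js g\<close> projects onto the orthogonal complement of the rows with
  index in \<open>js\<close>.\<close>

primrec rowproj :: "'p::finite list \<Rightarrow> ('p, 'q::finite) bmat \<Rightarrow> complex^'p^'p" where
  "rowproj [] g = mat 1"
| "rowproj (j # js) g = remove_direction (rowproj js g) (rowproj js g *v top_row g (Inl j))"

definition residual :: "'p::finite list \<Rightarrow> 'p + 'q \<Rightarrow> ('p, 'q::finite) bmat \<Rightarrow> complex^'p" where
  "residual js i g = rowproj js g *v top_row g i"

lemma rowproj_Cons: "rowproj (j # js) g = remove_direction (rowproj js g) (residual js (Inl j) g)"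
  by (simp add: residual_def)

lemma orth_proj_rowproj: "orth_proj (rowproj js g)"
  by (induction js) (auto simp: orth_proj_remove(1), simp add: orth_proj_def)

lemma residual_processed: "j \<in> set js \<Longrightarrow> residual js (Inl j) g = 0"
  by (induction js) (auto simp: residual_def orth_proj_remove orth_proj_rowproj)

text \<open>While all residuals are nonzero, each step lowers the rank, which is the trace, by one.\<close>

lemma trace_rowproj:
  "(\<And>i. i < length js \<Longrightarrow> residual (drop (Suc i) js) (Inl (js ! i)) g \<noteq> 0) \<Longrightarrow>
    trace (rowproj js g) = of_nat CARD('p) - of_nat (length js)"
  for g :: "('p::finite, 'q::finite) bmat"
proof (induction js)
  case (Cons j js)
  have "residual js (Inl j) g \<noteq> 0" using Cons.prems[of 0] by simp
  moreover have "trace (rowproj js g) = of_nat CARD('p) - of_nat (length js)"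
    using Cons.prems[of "Suc _"] by (intro Cons.IH) auto
  ultimately show ?case
    by (simp add: orth_proj_remove(4)[OF orth_proj_rowproj] residual_def)
qed (simp add: trace_def mat_nth)

lemma rowproj_scalars: "g \<in> matrices_over \<kappa> \<Longrightarrow> rowproj js g $ a $ b \<in> scalars \<kappa>"
  and residual_scalars: "g \<in> matrices_over \<kappa> \<Longrightarrow> residual js i g $ a \<in> scalars \<kappa>"
proof -
  assume g: "g \<in> matrices_over \<kappa>"
  have R: "residual js i g $ a \<in> scalars \<kappa>" if "\<And>a b. rowproj js g $ a $ b \<in> scalars \<kappa>" for js i a
    using that g unfolding residual_def matrix_vector_mult_def
    by (auto simp: top_row_def matrices_over_def intro!: scalars_sum scalars_closed)
  have P: "rowproj js g $ a $ b \<in> scalars \<kappa>" for js a b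
  proof (induction js arbitrary: a b)
    case (Cons j js)
    then show ?case
      unfolding rowproj_Cons remove_direction_def using R[of js]
      by (auto simp: outer_def intro!: scalars_closed simp del: of_real_power)
  qed (simp add: mat_nth)
  show "rowproj js g $ a $ b \<in> scalars \<kappa>" by (rule P)
  show "residual js i g $ a \<in> scalars \<kappa>" by (rule R) (rule P)
qed

lemma rowproj_cong:
  "(\<And>j. j \<in> set js \<Longrightarrow> top_row g (Inl j) = top_row g' (Inl j)) \<Longrightarrow> rowproj js g = rowproj js g'"
  by (induction js) auto

lemma measurable_rowproj:
  assumes "normalized_Haar (K_group \<kappa>) \<nu>"
  shows "(\<lambda>g. rowproj js g $ a $ b) \<in> borel_measurable \<nu>"
    and "(\<lambda>g. residual js i g $ a) \<in> borel_measurable \<nu>"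
proof -
  note [measurable] = haar_measurable_entry[OF assms]
  have R: "(\<lambda>g. residual js i g $ a) \<in> borel_measurable \<nu>"
    if [measurable]: "\<And>a b. (\<lambda>g. rowproj js g $ a $ b) \<in> borel_measurable \<nu>" for js i a
    unfolding residual_def matrix_vector_mult_def top_row_def by simp
  have P: "(\<lambda>g. rowproj js g $ a $ b) \<in> borel_measurable \<nu>" for js a b
  proof (induction js arbitrary: a b)
    case (Cons j js)
    note [measurable] = R[OF Cons]  Cons
    show ?case unfolding rowproj_Cons remove_direction_def norm_sq_vec outer_def by simp
  qed simp
  show "(\<lambda>g. rowproj js g $ a $ b) \<in> borel_measurable \<nu>" by (rule P)
  show "(\<lambda>g. residual js i g $ a) \<in> borel_measurable \<nu>" by (rule R) (rule P)
qed

text \<open>The first \<open>p\<close> columns of a unitary matrix are orthonormal; read by rows this is a Parseval frame of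
  \<open>p + q\<close> vectors in dimension \<open>p\<close>.\<close>

lemma top_row_frame:
  assumes g: "g \<in> K_group \<kappa>"
  shows "(\<Sum>i\<in>UNIV. (cmod (cip x (top_row g i)))\<^sup>2) = (norm x)\<^sup>2"
    and "(\<Sum>i\<in>UNIV. cip (P *v top_row g i) (top_row g i)) = trace P"
    and "norm (top_row g i) \<le> 1"
proof -
  have col: "(\<Sum>i\<in>UNIV. cnj (g $ i $ Inl a) * g $ i $ Inl b) = (if a = b then 1 else 0)" for a b
    using K_group_columns[OF g, of "Inl a" "Inl b"] by simp
  have "of_real (\<Sum>i\<in>UNIV. (cmod (cip x (top_row g i)))\<^sup>2) =
      (\<Sum>i\<in>UNIV. \<Sum>a\<in>UNIV. \<Sum>b\<in>UNIV. x $ a * cnj (x $ b) * (cnj (g $ i $ Inl a) * g $ i $ Inl b))"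
    unfolding of_real_sum cmod_sq
    by (simp add: cip_def top_row_def sum_product mult_ac)
  also have "\<dots> = (\<Sum>a\<in>UNIV. \<Sum>b\<in>UNIV. x $ a * cnj (x $ b) * (\<Sum>i\<in>UNIV. cnj (g $ i $ Inl a) * g $ i $ Inl b))"
    unfolding sum_distrib_left
    by (subst sum.swap, rule sum.cong[OF refl], subst sum.swap, simp)
  also have "\<dots> = of_real ((norm x)\<^sup>2)"
    unfolding col cip_self[symmetric] by (simp add: cip_def if_distrib cong: if_cong)
  finally show "(\<Sum>i\<in>UNIV. (cmod (cip x (top_row g i)))\<^sup>2) = (norm x)\<^sup>2"
    using of_real_eq_iff by blast
  have "(\<Sum>i\<in>UNIV. cip (P *v top_row g i) (top_row g i)) =
      (\<Sum>i\<in>UNIV. \<Sum>a\<in>UNIV. \<Sum>b\<in>UNIV. P $ a $ b * (cnj (g $ i $ Inl a) * g $ i $ Inl b))"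
    by (simp add: cip_def top_row_def matrix_vector_mult_def sum_distrib_right sum_distrib_left mult_ac)
  also have "\<dots> = (\<Sum>a\<in>UNIV. \<Sum>b\<in>UNIV. P $ a $ b * (\<Sum>i\<in>UNIV. cnj (g $ i $ Inl a) * g $ i $ Inl b))"
    unfolding sum_distrib_left
    by (subst sum.swap, rule sum.cong[OF refl], subst sum.swap, simp)
  also have "\<dots> = trace P" unfolding col by (simp add: trace_def if_distrib cong: if_cong)
  finally show "(\<Sum>i\<in>UNIV. cip (P *v top_row g i) (top_row g i)) = trace P" .
  have "(g ** herm g) $ i $ i = 1" by (simp add: K_groupD(4)[OF g] mat_nth)
  then have "(\<Sum>k\<in>UNIV. of_real ((cmod (g $ i $ k))\<^sup>2)) = (1::complex)"
    unfolding cmod_sq by (simp add: matrix_mult_nth mult.commute)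
  then have "complex_of_real (\<Sum>k\<in>UNIV. (cmod (g $ i $ k))\<^sup>2) = of_real 1" by simp
  then have "(\<Sum>k\<in>UNIV. (cmod (g $ i $ k))\<^sup>2) = 1" unfolding of_real_eq_iff .
  moreover have "(norm (top_row g i))\<^sup>2 = (\<Sum>a\<in>UNIV. (cmod (g $ i $ Inl a))\<^sup>2)"
    by (simp add: norm_sq_vec top_row_def)
  moreover have "0 \<le> (\<Sum>b\<in>UNIV. (cmod (g $ i $ Inr b))\<^sup>2)" by (simp add: sum_nonneg)
  ultimately have "(norm (top_row g i))\<^sup>2 \<le> 1" unfolding sum_UNIV_sum by linarith
  then show "norm (top_row g i) \<le> 1" by (simp add: power_le_one_iff abs_square_le_1)
qed

lemma residual_le_1: "g \<in> K_group \<kappa> \<Longrightarrow> norm (residual js i g) \<le> 1"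
  unfolding residual_def
  using orth_proj_contraction[OF orth_proj_rowproj] top_row_frame(3) order_trans by blast

text \<open>The first-order identity: the integral of \<open>w (X \<bullet> Z) (X \<bullet> X)\<^sup>k\<close> does not change when the
  residuals \<open>X\<close> and \<open>Z\<close> of two unprocessed rows are rotated into each other, so its derivative
  along the rotation integrates to zero.\<close>

lemma rotation_identity:
  fixes \<nu> :: "('p::finite, 'q::finite) bmat measure" and w :: "('p, 'q) bmat \<Rightarrow> real"
  assumes haar: "normalized_Haar (K_group \<kappa>) \<nu>"
    and c: "c \<notin> set js" and j: "j \<notin> Inl ` set js" "j \<noteq> Inl c"
    and \<epsilon>: "\<epsilon> \<in> scalars \<kappa>" "cmod \<epsilon> = 1"
    and w: "integrable \<nu> w"
    and winv: "\<And>g a b. g \<in> K_group \<kappa> \<Longrightarrow> w (plane_elt (Inl c) j a b ** g) = w g"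
  defines "X \<equiv> residual js (Inl c)" and "Z \<equiv> residual js j"
  shows "(\<integral>g. w g * ((Z g \<bullet> Z g - X g \<bullet> X g) * (X g \<bullet> X g) ^ k +
      2 * real k * (X g \<bullet> (\<epsilon> *s Z g))\<^sup>2 * (X g \<bullet> X g) ^ (k - 1)) \<partial>\<nu>) = 0"
proof -
  interpret prob_space \<nu> by (rule haar_sets(1)[OF haar])
  have ee: "\<epsilon> * cnj \<epsilon> = 1" using \<epsilon>(2) cmod_sq[of \<epsilon>] by (simp add: mult.commute)
  define A B C where "A g = X g \<bullet> X g" and "B g = X g \<bullet> (\<epsilon> *s Z g)" and "C g = Z g \<bullet> Z g" for g
  have C2: "C g = (\<epsilon> *s Z g) \<bullet> (\<epsilon> *s Z g)" for g
  proof -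
    have "cip (\<epsilon> *s Z g) (\<epsilon> *s Z g) = (\<epsilon> * cnj \<epsilon>) * cip (Z g) (Z g)" by (simp add: cip_linear mult_ac)
    then show ?thesis by (simp add: C_def inner_cip ee)
  qed
  note [measurable] = measurable_rowproj[OF haar] borel_measurable_integrable[OF w]
  have [measurable]: "A \<in> borel_measurable \<nu>" "B \<in> borel_measurable \<nu>" "C \<in> borel_measurable \<nu>"
    unfolding A_def B_def C_def X_def Z_def inner_cip cip_def by simp_all
  have nX: "norm (X g) \<le> 1" and nZ: "norm (Z g) \<le> 1" if "g \<in> K_group \<kappa>" for g
    using residual_le_1[OF that] by (simp_all add: X_def Z_def)
  have nZ': "norm (\<epsilon> *s Z g) = norm (Z g)" for g
    using C2[of g] by (simp add: C_def norm_eq_sqrt_inner)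
  have bd: "\<bar>A g\<bar> \<le> 1" "\<bar>B g\<bar> \<le> 1" "\<bar>C g\<bar> \<le> 1" if "g \<in> K_group \<kappa>" for g
  proof -
    have *: "\<bar>x \<bullet> y\<bar> \<le> 1" if "norm x \<le> 1" "norm y \<le> 1" for x y :: "complex^'p"
      using Cauchy_Schwarz_ineq2[of x y] mult_mono[OF that] by simp
    show "\<bar>A g\<bar> \<le> 1" "\<bar>B g\<bar> \<le> 1" "\<bar>C g\<bar> \<le> 1"
      unfolding A_def B_def C_def using nX[OF that] nZ[OF that] nZ' by (intro *; simp)+
  qed
  define u v where "u g t = (cos t)\<^sup>2 * A g + 2 * cos t * sin t * B g + (sin t)\<^sup>2 * C g"
    and "v g t = cos t * sin t * (C g - A g) + ((cos t)\<^sup>2 - (sin t)\<^sup>2) * B g" for g t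
  define v' where "v' g t = ((cos t)\<^sup>2 - (sin t)\<^sup>2) * (C g - A g) - 4 * cos t * sin t * B g" for g t
  define F where "F g t = v g t * u g t ^ k" for g t
  define F' where "F' g t = v' g t * u g t ^ k + v g t * (real k * u g t ^ (k - 1) * (2 * v g t))" for g t
  have du: "((\<lambda>t. u g t) has_real_derivative 2 * v g t) (at t)" for g t
    unfolding u_def v_def by (auto intro!: derivative_eq_intros simp: algebra_simps power2_eq_square)
  have dv: "((\<lambda>t. v g t) has_real_derivative v' g t) (at t)" for g t
    unfolding v_def v'_def by (auto intro!: derivative_eq_intros simp: algebra_simps power2_eq_square)
  have dF: "((\<lambda>t. F g t) has_real_derivative F' g t) (at t)" for g t
    unfolding F_def F'_def by (rule derivative_eq_intros du dv refl)+ (simp add: algebra_simps)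
  \<comment> \<open>The bounds below are crude; any bound uniform in \<open>g\<close> and \<open>t\<close> would do.\<close>
  define M where "M = 6 * 4 ^ k + 3 * (real k * 4 ^ (k - 1) * (2 * 3))"
  have M: "\<bar>F' g t\<bar> \<le> M" if "g \<in> K_group \<kappa>" for g t
  proof -
    have cs: "\<bar>cos t\<bar> \<le> 1" "\<bar>sin t\<bar> \<le> 1" "(cos t)\<^sup>2 \<le> 1" "(sin t)\<^sup>2 \<le> 1" "\<bar>cos t * sin t\<bar> \<le> 1"
      using mult_mono[of "\<bar>cos t\<bar>" 1 "\<bar>sin t\<bar>" 1] by (auto simp: abs_square_le_1 abs_mult)
    have p: "\<bar>x * y\<bar> \<le> 1 * b" if "\<bar>x\<bar> \<le> 1" "\<bar>y\<bar> \<le> b" for x y b :: real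
      unfolding abs_mult using that by (intro mult_mono) auto
    have c2: "\<bar>(cos t)\<^sup>2\<bar> \<le> 1" "\<bar>(sin t)\<^sup>2\<bar> \<le> 1" "\<bar>(cos t)\<^sup>2 - (sin t)\<^sup>2\<bar> \<le> 1"
      by (rule abs_leI; use cs(3,4) zero_le_power2[of "cos t"] zero_le_power2[of "sin t"] in linarith)+
    note b = bd[OF that]
    have CA: "\<bar>C g - A g\<bar> \<le> 2" using b by linarith
    have u: "\<bar>u g t\<bar> \<le> 4"
      using p[OF c2(1) b(1)] p[OF cs(5) b(2)] p[OF c2(2) b(3)] unfolding u_def
      by (simp only: abs_le_iff) (auto simp: mult.assoc)
    have v: "\<bar>v g t\<bar> \<le> 3"
      using p[OF cs(5) CA] p[OF c2(3) b(2)] unfolding v_def by (simp only: abs_le_iff) auto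
    have v'b: "\<bar>v' g t\<bar> \<le> 6"
      using p[OF c2(3) CA] p[OF cs(5) b(2)] unfolding v'_def
      by (simp only: abs_le_iff) (auto simp: mult.assoc)
    have "\<bar>F' g t\<bar> \<le> \<bar>v' g t\<bar> * \<bar>u g t\<bar> ^ k + \<bar>v g t\<bar> * (real k * \<bar>u g t\<bar> ^ (k - 1) * (2 * \<bar>v g t\<bar>))"
      unfolding F'_def by (rule order_trans[OF abs_triangle_ineq]) (simp add: abs_mult power_abs)
    also have "\<dots> \<le> M"
      unfolding M_def using u v v'b by (intro add_mono mult_mono power_mono) auto
    finally show ?thesis .
  qed
  have Fb: "\<bar>F g t - F g 0\<bar> \<le> M * \<bar>t\<bar>" if "g \<in> K_group \<kappa>" for g t
    using field_differentiable_bound[of UNIV "F g" "F' g" M t 0] dF M[OF that] by simp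
  have [measurable]: "(\<lambda>g. F g t) \<in> borel_measurable \<nu>" for t
    unfolding F_def u_def v_def by measurable
  have rot: "(\<integral>g. w g * F g t \<partial>\<nu>) = (\<integral>g. w g * F g 0 \<partial>\<nu>)" for t
  proof -
    let ?k = "plane_elt (Inl c) j (of_real (cos t)) (- (cnj \<epsilon> * of_real (sin t))) :: ('p, 'q) bmat"
    have "(cmod (of_real (cos t)))\<^sup>2 + (cmod (- (cnj \<epsilon> * of_real (sin t))))\<^sup>2 = 1"
      using \<epsilon>(2) by (simp add: norm_mult)
    then have kK: "?k \<in> K_group \<kappa>"
      using j \<epsilon>(1) by (intro plane_elt_in_K) (auto intro!: scalars_closed)
    have row: "top_row (?k ** g) (Inl c) = of_real (cos t) *s top_row g (Inl c) + (\<epsilon> * of_real (sin t)) *s top_row g j"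
      "top_row (?k ** g) j = - (cnj \<epsilon> * of_real (sin t)) *s top_row g (Inl c) + of_real (cos t) *s top_row g j"
      for g using j by (simp_all add: vec_eq_iff top_row_def plane_elt_mult_nth)
    have P: "rowproj js (?k ** g) = rowproj js g" for g
      using j c by (intro rowproj_cong) (auto simp: vec_eq_iff top_row_def plane_elt_mult_nth)
    have X: "X (?k ** g) = of_real (cos t) *s X g + of_real (sin t) *s (\<epsilon> *s Z g)" for g
      unfolding X_def Z_def residual_def P row mv.add_right cscale_vector_mult' by (simp add: vector_smult_assoc mult.commute)
    have Z: "\<epsilon> *s Z (?k ** g) = - of_real (sin t) *s X g + of_real (cos t) *s (\<epsilon> *s Z g)" for g
      unfolding X_def Z_def residual_def P row mv.add_right cscale_vector_mult' vec.scale_right_distrib vector_smult_assoc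
      using ee by (simp add: mult.assoc[symmetric] mult.commute[of \<epsilon>])
    have A: "A (?k ** g) = u g t" for g
      unfolding A_def X u_def B_def C2 scaleR_smult[symmetric]
      by (simp add: inner_add_left inner_add_right inner_commute power2_eq_square)
    have B: "B (?k ** g) = v g t" for g
      unfolding B_def X Z v_def A_def C2 scaleR_smult[symmetric] of_real_minus[symmetric]
      by (simp add: inner_add_left inner_add_right inner_commute power2_eq_square algebra_simps)
    have "(\<integral>g. w g * F g t \<partial>\<nu>) = (\<integral>g. w (?k ** g) * (B (?k ** g) * A (?k ** g) ^ k) \<partial>\<nu>)"
      by (intro Bochner_Integration.integral_cong refl) (simp add: haar_sets(3)[OF haar] winv A B F_def)
    also have "\<dots> = (\<integral>g. w g * (B g * A g ^ k) \<partial>\<nu>)"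
      by (rule haar_left[OF haar kK, of "\<lambda>g. w g * (B g * A g ^ k)"]) simp
    finally show ?thesis by (simp add: F_def u_def v_def)
  qed
  define T where "T n g = w g * ((F g (1 / real (Suc n)) - F g 0) / (1 / real (Suc n)))" for n g
  have intF: "integrable \<nu> (\<lambda>g. w g * F g t)" for t
  proof (rule Bochner_Integration.integrable_bound[where f = "\<lambda>g. (M * \<bar>t\<bar> + 1) * w g"])
    have "\<bar>F g t\<bar> \<le> M * \<bar>t\<bar> + 1" if g: "g \<in> K_group \<kappa>" for g
    proof -
      have "\<bar>F g 0\<bar> \<le> 1" using bd[OF g] by (simp add: F_def u_def v_def abs_mult power_abs mult_le_one power_le_one)
      then show ?thesis using Fb[OF g, of t] by linarith
    qed
    then show "AE g in \<nu>. norm (w g * F g t) \<le> norm ((M * \<bar>t\<bar> + 1) * w g)"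
    proof (intro AE_I2)
      fix g assume "g \<in> space \<nu>" and F: "\<And>g. g \<in> K_group \<kappa> \<Longrightarrow> \<bar>F g t\<bar> \<le> M * \<bar>t\<bar> + 1"
      then have "\<bar>F g t\<bar> * \<bar>w g\<bar> \<le> \<bar>M * \<bar>t\<bar> + 1\<bar> * \<bar>w g\<bar>"
        by (intro mult_right_mono order_trans[OF F abs_ge_self]) (simp_all add: haar_sets(3)[OF haar])
      then show "norm (w g * F g t) \<le> norm ((M * \<bar>t\<bar> + 1) * w g)" by (simp add: abs_mult mult.commute)
    qed
  qed (use w in auto)
  have T0: "(\<integral>g. T n g \<partial>\<nu>) = 0" for n
  proof -
    have "(\<integral>g. T n g \<partial>\<nu>) = (\<integral>g. real (Suc n) * (w g * F g (1 / real (Suc n)) - w g * F g 0) \<partial>\<nu>)"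
      by (intro Bochner_Integration.integral_cong refl) (simp add: T_def algebra_simps)
    also have "\<dots> = real (Suc n) * ((\<integral>g. w g * F g (1 / real (Suc n)) \<partial>\<nu>) - (\<integral>g. w g * F g 0 \<partial>\<nu>))"
      by (simp add: Bochner_Integration.integral_diff intF)
    also have "\<dots> = 0" by (subst rot) simp
    finally show ?thesis .
  qed
  have "(\<lambda>n. \<integral>g. T n g \<partial>\<nu>) \<longlonglongrightarrow> (\<integral>g. w g * F' g 0 \<partial>\<nu>)"
  proof (rule integral_dominated_convergence[where w = "\<lambda>g. M * \<bar>w g\<bar>"])
    show "(\<lambda>g. w g * F' g 0) \<in> borel_measurable \<nu>" unfolding F'_def u_def v_def v'_def by measurable
    show "\<And>n. T n \<in> borel_measurable \<nu>" unfolding T_def by measurable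
    show "integrable \<nu> (\<lambda>g. M * \<bar>w g\<bar>)" using w by auto
    show "AE g in \<nu>. (\<lambda>n. T n g) \<longlonglongrightarrow> w g * F' g 0"
    proof (rule AE_I2)
      fix g
      have "((\<lambda>h. (F g (0 + h) - F g 0) / h) \<longlongrightarrow> F' g 0) (at 0)" using dF[of g 0] by (simp add: DERIV_def)
      moreover have "filterlim (\<lambda>n. 1 / real (Suc n)) (at 0) sequentially"
        using LIMSEQ_inverse_real_of_nat by (intro filterlim_atI) (auto simp: divide_inverse)
      ultimately have "(\<lambda>n. (F g (0 + 1 / real (Suc n)) - F g 0) / (1 / real (Suc n))) \<longlonglongrightarrow> F' g 0"
        by (rule filterlim_compose)
      then show "(\<lambda>n. T n g) \<longlonglongrightarrow> w g * F' g 0" unfolding T_def by (intro tendsto_mult tendsto_const) simp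
    qed
    show "AE g in \<nu>. norm (T n g) \<le> M * \<bar>w g\<bar>" for n
    proof (rule AE_I2)
      fix g assume "g \<in> space \<nu>"
      then have "\<bar>F g (1 / real (Suc n)) - F g 0\<bar> \<le> M * \<bar>1 / real (Suc n)\<bar>"
        by (intro Fb) (simp add: haar_sets(3)[OF haar])
      then have "\<bar>(F g (1 / real (Suc n)) - F g 0) / (1 / real (Suc n))\<bar> \<le> M"
      proof -
        have h: "1 / real (Suc n) > 0" by simp
        show ?thesis using \<open>\<bar>F g (1 / real (Suc n)) - F g 0\<bar> \<le> M * \<bar>1 / real (Suc n)\<bar>\<close>
          unfolding abs_divide[of _ "1 / real (Suc n)"] abs_of_pos[OF h] pos_divide_le_eq[OF h] .
      qed
      then show "norm (T n g) \<le> M * \<bar>w g\<bar>"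
        unfolding T_def real_norm_def abs_mult[of "w g"] mult.commute[of M] by (rule mult_left_mono) simp
    qed
  qed
  then have "(\<integral>g. w g * F' g 0 \<partial>\<nu>) = 0" unfolding T0 by (simp add: LIMSEQ_const_iff)
  moreover have "F' g 0 = (C g - A g) * A g ^ k + 2 * real k * (B g)\<^sup>2 * A g ^ (k - 1)" for g
    by (simp add: F'_def u_def v_def v'_def power2_eq_square)
  ultimately show ?thesis by (simp add: A_def B_def C_def)
qed

text \<open>An orthonormal basis of the base field over the real numbers: rotations multiplied by these units
  reach all real directions.\<close>

definition units_of_base :: "base_case \<Rightarrow> complex set" where
  "units_of_base \<kappa> = (case \<kappa> of Real_Case \<Rightarrow> {1} | Complex_Case l \<Rightarrow> {1, \<i>})"

lemma units_of_base:
  "finite (units_of_base \<kappa>)" "card (units_of_base \<kappa>) = dim_base \<kappa>"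
  "\<epsilon> \<in> units_of_base \<kappa> \<Longrightarrow> \<epsilon> \<in> scalars \<kappa> \<and> cmod \<epsilon> = 1"
  "z \<in> scalars \<kappa> \<Longrightarrow> (\<Sum>\<epsilon>\<in>units_of_base \<kappa>. (Re (cnj \<epsilon> * z))\<^sup>2) = (cmod z)\<^sup>2"
  by (cases \<kappa>; auto simp: units_of_base_def cmod_power2 complex_is_Real_iff)+

text \<open>Summing the first-order identity over all unprocessed rows and all units gives the recursion
  that characterizes the moments of a Beta distribution.\<close>

lemma moment_recursion:
  fixes \<nu> :: "('p::finite, 'q::finite) bmat measure" and w :: "('p, 'q) bmat \<Rightarrow> real"
  assumes haar: "normalized_Haar (K_group \<kappa>) \<nu>"
    and js: "distinct js" "c \<notin> set js"
    and w: "integrable \<nu> w"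
    and winv: "\<And>g j a b. g \<in> K_group \<kappa> \<Longrightarrow> j \<notin> Inl ` set js \<Longrightarrow> j \<noteq> Inl c \<Longrightarrow>
      w (plane_elt (Inl c) j a b ** g) = w g"
    and wtr: "\<And>g. w g \<noteq> 0 \<Longrightarrow> trace (rowproj js g) = of_nat (CARD('p) - length js)"
  defines "r \<equiv> \<lambda>g. (norm (residual js (Inl c) g))\<^sup>2"
  shows "integrable \<nu> (\<lambda>g. w g * r g ^ k)"
    and "(real (dim_base \<kappa> * (CARD('p) - length js)) / 2 + k) * (\<integral>g. w g * r g ^ k \<partial>\<nu>) =
      (real (dim_base \<kappa> * (CARD('p) - length js)) / 2 + real (dim_base \<kappa> * CARD('q)) / 2 + k) *
        (\<integral>g. w g * r g ^ Suc k \<partial>\<nu>)"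
proof -
  interpret prob_space \<nu> by (rule haar_sets(1)[OF haar])
  note [measurable] = measurable_rowproj[OF haar] borel_measurable_integrable[OF w]
  have [measurable]: "r \<in> borel_measurable \<nu>" unfolding r_def norm_sq_vec by simp
  have r01: "0 \<le> r g" "g \<in> K_group \<kappa> \<Longrightarrow> r g \<le> 1" for g
    using residual_le_1[of g \<kappa> js "Inl c"] by (simp_all add: r_def power_le_one)
  show int: "integrable \<nu> (\<lambda>g. w g * r g ^ k)" for k
    using r01 by (intro Bochner_Integration.integrable_bound[OF w] AE_I2)
      (auto simp: haar_sets(3)[OF haar] abs_mult power_abs intro!: mult_left_le power_le_one)
  define J where "J = UNIV - Inl ` set js - {Inl c :: 'p + 'q}"
  define Z where "Z j = residual js j" for j :: "'p + 'q"
  define X where "X = residual js (Inl c :: 'p + 'q)"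
  define d where "d = dim_base \<kappa>"
  define \<tau> where "\<tau> = CARD('p) - length js"
  have lenle: "length js + 1 \<le> CARD('p)"
    using js card_mono[of UNIV "set (c # js)"] by (simp add: distinct_card del: set_simps)
  have cardJ: "card J = CARD('p) + CARD('q) - length js - 1"
    using js by (simp add: J_def card_Diff_subset inj_image_mem_iff card_image distinct_card)
  have rX: "r g = X g \<bullet> X g" for g by (simp add: r_def X_def dot_square_norm)
  have id0: "(\<integral>g. w g * ((Z j g \<bullet> Z j g - r g) * r g ^ k + 2 * real k * (X g \<bullet> (\<epsilon> *s Z j g))\<^sup>2 * r g ^ (k - 1)) \<partial>\<nu>) = 0"
    if "j \<in> J" "\<epsilon> \<in> units_of_base \<kappa>" for j \<epsilon>
    using rotation_identity[OF haar js(2) _ _ _ _ w winv, of j \<epsilon> k] that units_of_base(3)[of \<epsilon> \<kappa>]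
    unfolding rX X_def Z_def by (auto simp: J_def)
  have intid: "integrable \<nu> (\<lambda>g. w g * ((Z j g \<bullet> Z j g - r g) * r g ^ k + 2 * real k * (X g \<bullet> (\<epsilon> *s Z j g))\<^sup>2 * r g ^ (k - 1)))"
    if "\<epsilon> \<in> units_of_base \<kappa>" for j \<epsilon>
  proof (rule Bochner_Integration.integrable_bound[where f = "\<lambda>g. (2 + 2 * real k) * w g"])
    show "AE g in \<nu>. norm (w g * ((Z j g \<bullet> Z j g - r g) * r g ^ k + 2 * real k * (X g \<bullet> (\<epsilon> *s Z j g))\<^sup>2 * r g ^ (k - 1)))
        \<le> norm ((2 + 2 * real k) * w g)"
    proof (rule AE_I2)
      fix g assume "g \<in> space \<nu>"
      then have g: "g \<in> K_group \<kappa>" by (simp add: haar_sets(3)[OF haar])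
      have nZ: "norm (Z j g) \<le> 1" "norm (X g) \<le> 1" using residual_le_1[OF g] by (simp_all add: Z_def X_def)
      have "(norm (\<epsilon> *s Z j g))\<^sup>2 = (norm (Z j g))\<^sup>2"
        unfolding norm_sq_vec using units_of_base(3)[OF that] by (simp add: norm_mult)
      then have "norm (\<epsilon> *s Z j g) = norm (Z j g)" by simp
      then have "\<bar>X g \<bullet> (\<epsilon> *s Z j g)\<bar> \<le> 1"
        using Cauchy_Schwarz_ineq2[of "X g" "\<epsilon> *s Z j g"] nZ mult_mono[OF nZ(2,1)] by simp
      then have 1: "(X g \<bullet> (\<epsilon> *s Z j g))\<^sup>2 \<le> 1" by (simp add: abs_square_le_1)
      have "Z j g \<bullet> Z j g \<le> 1" using nZ by (simp add: dot_square_norm power_le_one)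
      then have 2: "\<bar>Z j g \<bullet> Z j g - r g\<bar> \<le> 2"
        by (intro abs_leI; use r01(1)[of g] r01(2)[OF g] inner_ge_zero[of "Z j g"] in linarith)
      have rk: "0 \<le> r g ^ i" "r g ^ i \<le> 1" for i using r01[of g] g by (simp_all add: power_le_one)
      have "\<bar>(Z j g \<bullet> Z j g - r g) * r g ^ k\<bar> \<le> 2 * 1"
        unfolding abs_mult using 2 rk[of k] by (intro mult_mono) auto
      moreover have "\<bar>2 * real k * (X g \<bullet> (\<epsilon> *s Z j g))\<^sup>2 * r g ^ (k - 1)\<bar> \<le> (2 * real k * 1) * 1"
        unfolding abs_mult using 1 rk[of "k - 1"] by (intro mult_mono) auto
      ultimately have "\<bar>(Z j g \<bullet> Z j g - r g) * r g ^ k + 2 * real k * (X g \<bullet> (\<epsilon> *s Z j g))\<^sup>2 * r g ^ (k - 1)\<bar>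
          \<le> 2 + 2 * real k" by linarith
      then show "norm (w g * ((Z j g \<bullet> Z j g - r g) * r g ^ k + 2 * real k * (X g \<bullet> (\<epsilon> *s Z j g))\<^sup>2 * r g ^ (k - 1)))
        \<le> norm ((2 + 2 * real k) * w g)"
        by (simp add: abs_mult mult.commute[of "\<bar>w g\<bar>"] mult_right_mono)
    qed
    have [measurable]: "(\<lambda>g. Z j g \<bullet> Z j g) \<in> borel_measurable \<nu>" "(\<lambda>g. X g \<bullet> (\<epsilon> *s Z j g)) \<in> borel_measurable \<nu>"
      unfolding X_def Z_def inner_cip cip_def by simp_all
    show "(\<lambda>g. w g * ((Z j g \<bullet> Z j g - r g) * r g ^ k + 2 * real k * (X g \<bullet> (\<epsilon> *s Z j g))\<^sup>2 * r g ^ (k - 1)))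
        \<in> borel_measurable \<nu>" by measurable
  qed (use w in auto)
  have pointwise: "(\<Sum>j\<in>J. \<Sum>\<epsilon>\<in>units_of_base \<kappa>. w g * ((Z j g \<bullet> Z j g - r g) * r g ^ k +
        2 * real k * (X g \<bullet> (\<epsilon> *s Z j g))\<^sup>2 * r g ^ (k - 1))) =
      (real (d * \<tau>) + 2 * k) * (w g * r g ^ k) - (real (d * \<tau>) + real (d * CARD('q)) + 2 * k) * (w g * r g ^ Suc k)"
    if g: "g \<in> K_group \<kappa>" for g
  proof (cases "w g = 0")
    case False
    note tr = wtr[OF False]
    have P: "orth_proj (rowproj js g)" by (rule orth_proj_rowproj)
    have proc: "Z i g = 0" if "i \<in> Inl ` set js" for i using that residual_processed by (auto simp: Z_def)
    have split: "(\<Sum>i\<in>UNIV. f i) = f (Inl c) + (\<Sum>j\<in>J. f j)"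
      if "\<And>i. i \<in> Inl ` set js \<Longrightarrow> f i = 0" for f :: "'p + 'q \<Rightarrow> real"
    proof -
      have "(\<Sum>i\<in>UNIV. f i) = (\<Sum>i\<in>insert (Inl c) J. f i)"
        by (rule sum.mono_neutral_right) (auto simp: J_def intro: that)
      moreover have "Inl c \<notin> J" "finite J" by (simp_all add: J_def)
      ultimately show ?thesis using sum.insert[of J "Inl c" f] by simp
    qed
    have "complex_of_real (\<Sum>i\<in>UNIV. Z i g \<bullet> Z i g) = (\<Sum>i\<in>UNIV. cip (rowproj js g *v top_row g i) (top_row g i))"
      using orth_proj_cip[OF P] cip_adjoint[of "rowproj js g"] P
      by (simp add: Z_def residual_def dot_square_norm cip_self[symmetric] orth_proj_def del: of_real_power)
    also have "\<dots> = of_real (real \<tau>)" by (simp add: top_row_frame(2)[OF g] tr \<tau>_def)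
    finally have "(\<Sum>i\<in>UNIV. Z i g \<bullet> Z i g) = real \<tau>" using of_real_eq_iff by blast
    then have sZ: "(\<Sum>j\<in>J. Z j g \<bullet> Z j g) = real \<tau> - r g"
      using split[of "\<lambda>i. Z i g \<bullet> Z i g"] proc by (simp add: rX X_def Z_def)
    have PX: "cip (X g) (Z i g) = cip (X g) (top_row g i)" for i
      using orth_proj_cip[OF P, of "top_row g (Inl c)" "top_row g i"] P
      by (simp add: X_def Z_def residual_def cip_adjoint orth_proj_def)
    have "(\<Sum>i\<in>UNIV. (cmod (cip (X g) (Z i g)))\<^sup>2) = r g"
      unfolding PX top_row_frame(1)[OF g] by (simp add: r_def X_def)
    moreover have "(cmod (cip (X g) (Z (Inl c) g)))\<^sup>2 = (r g)\<^sup>2"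
      by (simp add: X_def Z_def cip_self r_def norm_power)
    ultimately have sXZ: "(\<Sum>j\<in>J. (cmod (cip (X g) (Z j g)))\<^sup>2) = r g - (r g)\<^sup>2"
      using split[of "\<lambda>i. (cmod (cip (X g) (Z i g)))\<^sup>2"] proc by (simp add: cip_linear)
    have inner: "(\<Sum>\<epsilon>\<in>units_of_base \<kappa>. (X g \<bullet> (\<epsilon> *s Z j g))\<^sup>2) = (cmod (cip (X g) (Z j g)))\<^sup>2" for j
    proof -
      have "cip (X g) (Z j g) \<in> scalars \<kappa>"
        unfolding cip_def X_def Z_def using residual_scalars[OF K_groupD(1)[OF g]]
        by (intro scalars_sum scalars_closed) auto
      then show ?thesis
        using units_of_base(4) by (simp add: inner_cip cip_linear)
    qed
    have "(\<Sum>j\<in>J. \<Sum>\<epsilon>\<in>units_of_base \<kappa>. w g * ((Z j g \<bullet> Z j g - r g) * r g ^ k +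
        2 * real k * (X g \<bullet> (\<epsilon> *s Z j g))\<^sup>2 * r g ^ (k - 1))) =
      w g * ((\<Sum>j\<in>J. real d * ((Z j g \<bullet> Z j g - r g) * r g ^ k)) +
        2 * real k * (\<Sum>j\<in>J. (\<Sum>\<epsilon>\<in>units_of_base \<kappa>. (X g \<bullet> (\<epsilon> *s Z j g))\<^sup>2)) * r g ^ (k - 1))"
      by (simp add: sum.distrib sum_subtractf sum_distrib_left sum_distrib_right units_of_base(2) d_def algebra_simps)
    also have "(\<Sum>j\<in>J. real d * ((Z j g \<bullet> Z j g - r g) * r g ^ k)) =
        real d * ((\<Sum>j\<in>J. Z j g \<bullet> Z j g) - real (card J) * r g) * r g ^ k"
      by (simp add: sum_distrib_left[symmetric] sum_distrib_right[symmetric] sum_subtractf mult.assoc)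
    also have "(\<Sum>j\<in>J. (\<Sum>\<epsilon>\<in>units_of_base \<kappa>. (X g \<bullet> (\<epsilon> *s Z j g))\<^sup>2)) = r g - (r g)\<^sup>2"
      unfolding inner by (rule sXZ)
    also have "2 * real k * (r g - (r g)\<^sup>2) * r g ^ (k - 1) = 2 * real k * (r g ^ k - r g ^ Suc k)"
      by (cases k) (simp_all add: algebra_simps power2_eq_square)
    also have "real (card J) = real \<tau> + real CARD('q) - 1"
      using lenle by (simp add: cardJ \<tau>_def of_nat_diff)
    finally show ?thesis unfolding sZ by (simp add: algebra_simps)
  qed simp
  have "0 = (\<integral>g. (\<Sum>j\<in>J. \<Sum>\<epsilon>\<in>units_of_base \<kappa>. w g * ((Z j g \<bullet> Z j g - r g) * r g ^ k +
        2 * real k * (X g \<bullet> (\<epsilon> *s Z j g))\<^sup>2 * r g ^ (k - 1))) \<partial>\<nu>)"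
    using id0 intid by (simp add: Bochner_Integration.integral_sum)
  also have "\<dots> = (\<integral>g. (real (d * \<tau>) + 2 * k) * (w g * r g ^ k) -
      (real (d * \<tau>) + real (d * CARD('q)) + 2 * k) * (w g * r g ^ Suc k) \<partial>\<nu>)"
    by (intro Bochner_Integration.integral_cong refl pointwise) (simp add: haar_sets(3)[OF haar])
  also have "\<dots> = (real (d * \<tau>) + 2 * k) * (\<integral>g. w g * r g ^ k \<partial>\<nu>) -
      (real (d * \<tau>) + real (d * CARD('q)) + 2 * k) * (\<integral>g. w g * r g ^ Suc k \<partial>\<nu>)"
    by (subst Bochner_Integration.integral_diff) (use int[of k] int[of "Suc k"] in auto)
  finally show "(real (dim_base \<kappa> * (CARD('p) - length js)) / 2 + k) * (\<integral>g. w g * r g ^ k \<partial>\<nu>) =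
      (real (dim_base \<kappa> * (CARD('p) - length js)) / 2 + real (dim_base \<kappa> * CARD('q)) / 2 + k) *
        (\<integral>g. w g * r g ^ Suc k \<partial>\<nu>)"
    by (simp add: d_def \<tau>_def algebra_simps add_divide_distrib)
qed

text \<open>The recursion determines all moments, and by Weierstrass approximation the moments determine the
  integral of every continuous function on \<open>[0, 1]\<close>; those of the Beta distribution are known.\<close>

lemma beta_moments_imp_powr:
  fixes M :: "'m measure" and w r :: "'m \<Rightarrow> real" and a b \<sigma> :: real
  assumes w: "integrable M w" "\<And>x. x \<in> space M \<Longrightarrow> w x \<ge> 0"
    and r: "r \<in> borel_measurable M" "\<And>x. x \<in> space M \<Longrightarrow> 0 \<le> r x \<and> r x \<le> 1"
    and ab: "a > 0" "b > 0" and \<sigma>: "\<sigma> > 0"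
    and rec: "\<And>k. (a + real k) * (\<integral>x. w x * r x ^ k \<partial>M) = (a + b + real k) * (\<integral>x. w x * r x ^ Suc k \<partial>M)"
  shows "(\<integral>x. w x * r x powr \<sigma> \<partial>M) = Beta (a + \<sigma>) b / Beta a b * (\<integral>x. w x \<partial>M)"
proof -
  define W where "W = (\<integral>x. w x \<partial>M)"
  have W0: "W \<ge> 0" unfolding W_def using w(2) by (intro Bochner_Integration.integral_nonneg_AE AE_I2)
  have Bpos: "Beta x b > 0" if "x > 0" for x using that ab by (simp add: Beta_def Gamma_real_pos)
  note [measurable] = borel_measurable_integrable[OF w(1)] r(1)
  have int: "integrable M (\<lambda>x. w x * f (r x))" if [measurable]: "f \<in> borel_measurable borel"
    and "\<And>t. 0 \<le> t \<Longrightarrow> t \<le> 1 \<Longrightarrow> \<bar>f t\<bar> \<le> C" for f C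
  proof (rule Bochner_Integration.integrable_bound[where f = "\<lambda>x. C * w x"])
    show "AE x in M. norm (w x * f (r x)) \<le> norm (C * w x)"
      using that(2) r(2) w(2) by (intro AE_I2) (auto simp: abs_mult mult.commute[of "w _"]
          intro!: mult_right_mono order_trans[OF _ abs_ge_self])
  qed (use w in auto)
  have mom: "(\<integral>x. w x * r x ^ k \<partial>M) * Beta a b = W * Beta (a + k) b" for k
  proof (induction k)
    case (Suc k)
    have "(a + k + b) * Beta (a + k + 1) b = (a + k) * Beta (a + k) b"
      using ab by (intro Beta_plus1_left) (auto elim!: nonpos_Ints_cases)
    then have B: "(a + b + k) * Beta (a + Suc k) b = (a + k) * Beta (a + k) b" by (simp add: algebra_simps)
    have "(a + b + k) * ((\<integral>x. w x * r x ^ Suc k \<partial>M) * Beta a b) = (a + k) * ((\<integral>x. w x * r x ^ k \<partial>M) * Beta a b)"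
      using rec[of k] by (simp add: mult.assoc[symmetric])
    also have "\<dots> = (a + b + k) * (W * Beta (a + Suc k) b)"
      unfolding Suc using B by (metis mult.left_commute)
    finally show ?case using ab by simp
  qed (simp add: W_def)
  define D where "D x = x powr (a - 1) * (1 - x) powr (b - 1)" for x :: real
  have D0: "D x \<ge> 0" for x by (simp add: D_def)
  have D: "((\<lambda>x. x powr \<theta> * D x) has_integral Beta (a + \<theta>) b) {0..1}" if "\<theta> \<ge> 0" for \<theta>
  proof -
    have "((\<lambda>x. x powr (a + \<theta> - 1) * (1 - x) powr (b - 1)) has_integral Beta (a + \<theta>) b) {0..1}"
      by (rule has_integral_Beta_real) (use ab that in auto)
    then show ?thesis
      by (rule has_integral_eq[rotated]) (simp add: D_def powr_add[symmetric] mult.assoc[symmetric] algebra_simps)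
  qed
  have Dk: "((\<lambda>x. x ^ k * D x) has_integral Beta (a + k) b) {0..1}" for k
  proof (rule has_integral_spike[OF _ _ D[of "real k"]])
    show "negligible {0::real}" by simp
  qed (auto simp: powr_realpow)
  have key: "\<bar>(\<integral>x. w x * r x powr \<sigma> \<partial>M) * Beta a b - W * Beta (a + \<sigma>) b\<bar> \<le> e * (2 * W * Beta a b)"
    if e: "e > 0" for e
  proof -
    have "continuous_on {0..1} (\<lambda>x::real. x powr \<sigma>)"
      using \<sigma> by (intro continuous_on_powr') (auto intro!: continuous_intros)
    then obtain q where q: "real_polynomial_function q" "\<And>x. x \<in> {0..1} \<Longrightarrow> \<bar>x powr \<sigma> - q x\<bar> < e"
      using Stone_Weierstrass_real_polynomial_function[of "{0..1}" "\<lambda>x. x powr \<sigma>" e] e by auto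
    obtain c n where qs: "q = (\<lambda>x. \<Sum>i\<le>n. c i * x ^ i)"
      using q(1) real_polynomial_function_iff_sum by blast
    have qi: "(\<integral>x. w x * q (r x) \<partial>M) = (\<Sum>i\<le>n. c i * (\<integral>x. w x * r x ^ i \<partial>M))"
    proof -
      have "(\<integral>x. w x * q (r x) \<partial>M) = (\<integral>x. (\<Sum>i\<le>n. c i * (w x * r x ^ i)) \<partial>M)"
        unfolding qs by (simp add: sum_distrib_left mult_ac)
      also have "\<dots> = (\<Sum>i\<le>n. (\<integral>x. c i * (w x * r x ^ i) \<partial>M))"
        using int[of "\<lambda>t. t ^ _" 1] by (intro Bochner_Integration.integral_sum) (auto simp: power_le_one)
      finally show ?thesis by simp
    qed
    have qD: "((\<lambda>x. q x * D x) has_integral (\<Sum>i\<le>n. c i * Beta (a + i) b)) {0..1}"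
    proof -
      have "((\<lambda>x. \<Sum>i\<le>n. c i * (x ^ i * D x)) has_integral (\<Sum>i\<le>n. c i * Beta (a + i) b)) {0..1}"
        by (intro has_integral_sum has_integral_mult_right Dk) auto
      then show ?thesis unfolding qs by (simp add: sum_distrib_right mult.assoc)
    qed
    have same: "(\<integral>x. w x * q (r x) \<partial>M) * Beta a b = W * (\<Sum>i\<le>n. c i * Beta (a + i) b)"
      unfolding qi sum_distrib_right sum_distrib_left
      by (rule sum.cong[OF refl]) (simp add: mult.assoc mom mult.left_commute)
    have pb: "\<bar>t powr \<sigma>\<bar> \<le> 1" if "0 \<le> t" "t \<le> 1" for t :: real
      using that \<sigma> powr_mono2[of \<sigma> t 1] by simp
    have qb: "\<bar>q t\<bar> \<le> 1 + e" if "0 \<le> t" "t \<le> 1" for t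
    proof -
      have "\<bar>t powr \<sigma> - q t\<bar> < e" using q(2)[of t] that by simp
      with pb[OF that] show ?thesis unfolding abs_le_iff abs_less_iff by linarith
    qed
    have [measurable]: "q \<in> borel_measurable borel" unfolding qs by measurable
    have i1: "integrable M (\<lambda>x. w x * r x powr \<sigma>)" by (rule int[of "\<lambda>t. t powr \<sigma>" 1]) (use pb in auto)
    have i2: "integrable M (\<lambda>x. w x * q (r x))" by (rule int[of q "1 + e"]) (use qb in auto)
    have "\<bar>(\<integral>x. w x * r x powr \<sigma> \<partial>M) - (\<integral>x. w x * q (r x) \<partial>M)\<bar> = \<bar>\<integral>x. w x * (r x powr \<sigma> - q (r x)) \<partial>M\<bar>"
      using i1 i2 by (simp add: right_diff_distrib)
    also have "\<dots> \<le> (\<integral>x. \<bar>w x * (r x powr \<sigma> - q (r x))\<bar> \<partial>M)" by (rule integral_abs_bound)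
    also have "\<dots> \<le> (\<integral>x. e * w x \<partial>M)"
    proof (rule integral_mono)
      show "integrable M (\<lambda>x. \<bar>w x * (r x powr \<sigma> - q (r x))\<bar>)" using i1 i2 by (simp add: right_diff_distrib)
      show "\<bar>w x * (r x powr \<sigma> - q (r x))\<bar> \<le> e * w x" if "x \<in> space M" for x
        using q(2)[of "r x"] r(2)[OF that] w(2)[OF that]
        by (simp add: abs_mult mult.commute[of "w x"] mult_right_mono)
    qed (use w in auto)
    also have "\<dots> = e * W" by (simp add: W_def)
    finally have E1: "\<bar>(\<integral>x. w x * r x powr \<sigma> \<partial>M) - (\<integral>x. w x * q (r x) \<partial>M)\<bar> \<le> e * W" .
    have "((\<lambda>x. (x powr \<sigma> - q x) * D x) has_integral (Beta (a + \<sigma>) b - (\<Sum>i\<le>n. c i * Beta (a + i) b))) {0..1}"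
      using has_integral_diff[OF D[of \<sigma>] qD] \<sigma> by (simp add: left_diff_distrib)
    moreover have "((\<lambda>x. e * D x) has_integral e * Beta a b) {0..1}"
      using has_integral_mult_right[OF Dk[of 0], of e] by simp
    moreover have "((\<lambda>x. - (e * D x)) has_integral - (e * Beta a b)) {0..1}"
      using calculation(2) by (rule has_integral_neg)
    moreover have "(x powr \<sigma> - q x) * D x \<le> e * D x" "- (e * D x) \<le> (x powr \<sigma> - q x) * D x" if "x \<in> {0..1}" for x
    proof -
      have "\<bar>(x powr \<sigma> - q x) * D x\<bar> \<le> e * D x"
        unfolding abs_mult using q(2)[OF that] D0[of x] by (simp add: mult_right_mono)
      then show "(x powr \<sigma> - q x) * D x \<le> e * D x" "- (e * D x) \<le> (x powr \<sigma> - q x) * D x" by linarith+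
    qed
    ultimately have "Beta (a + \<sigma>) b - (\<Sum>i\<le>n. c i * Beta (a + i) b) \<le> e * Beta a b"
      "- (e * Beta a b) \<le> Beta (a + \<sigma>) b - (\<Sum>i\<le>n. c i * Beta (a + i) b)"
      by (blast intro: has_integral_le)+
    then have E2: "\<bar>(\<Sum>i\<le>n. c i * Beta (a + i) b) - Beta (a + \<sigma>) b\<bar> \<le> e * Beta a b" by linarith
    have "(\<integral>x. w x * r x powr \<sigma> \<partial>M) * Beta a b - W * Beta (a + \<sigma>) b =
        ((\<integral>x. w x * r x powr \<sigma> \<partial>M) - (\<integral>x. w x * q (r x) \<partial>M)) * Beta a b +
        W * ((\<Sum>i\<le>n. c i * Beta (a + i) b) - Beta (a + \<sigma>) b)"
      using same by (simp add: algebra_simps)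
    also have "\<bar>\<dots>\<bar> \<le> (e * W) * Beta a b + W * (e * Beta a b)"
      by (rule order_trans[OF abs_triangle_ineq], unfold abs_mult)
         (use E1 E2 W0 Bpos[OF ab(1)] in \<open>intro add_mono mult_mono; simp\<close>)
    finally show ?thesis by (simp add: algebra_simps)
  qed
  have "(\<integral>x. w x * r x powr \<sigma> \<partial>M) * Beta a b - W * Beta (a + \<sigma>) b = 0"
  proof (rule ccontr)
    let ?d = "\<bar>(\<integral>x. w x * r x powr \<sigma> \<partial>M) * Beta a b - W * Beta (a + \<sigma>) b\<bar>" and ?C = "2 * W * Beta a b + 1"
    assume "(\<integral>x. w x * r x powr \<sigma> \<partial>M) * Beta a b - W * Beta (a + \<sigma>) b \<noteq> 0"
    then have d: "?d > 0" by simp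
    have C: "?C > 0" using W0 Bpos[OF ab(1)] by (simp add: add_nonneg_pos)
    have "?d \<le> ?d / ?C * (2 * W * Beta a b)" using d C by (intro key) simp
    also have "\<dots> < ?d / ?C * ?C" using d C by (intro mult_strict_left_mono) auto
    finally show False using C by simp
  qed
  then show ?thesis using Bpos[OF ab(1)] by (simp add: W_def field_simps)
qed

text \<open>The rows of the upper left block, of which those with index in \<open>js\<close> are replaced by their
  Gram-Schmidt residuals.\<close>

primrec orth_row :: "'p::finite list \<Rightarrow> ('p, 'q::finite) bmat \<Rightarrow> 'p \<Rightarrow> complex^'p" where
  "orth_row [] g a = top_row g (Inl a)"
| "orth_row (j # js) g a = (if a = j then residual js (Inl j) g else orth_row js g a)"

lemma orth_row_unprocessed: "a \<notin> set js \<Longrightarrow> orth_row js g a = top_row g (Inl a)"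
  by (induction js) auto

lemma rowproj_orth_row: "a \<in> set js \<Longrightarrow> distinct js \<Longrightarrow> rowproj js g *v orth_row js g a = 0"
proof (induction js)
  case (Cons j js)
  note P = orth_proj_rowproj[of js g]
  show ?case
  proof (cases "a = j")
    case True
    have "rowproj js g *v residual js (Inl j) g = residual js (Inl j) g"
      using P by (simp add: residual_def matrix_vector_mul_assoc orth_proj_def)
    then show ?thesis
      using orth_proj_remove(2)[OF P, of "residual js (Inl j) g"] True by (simp add: residual_def)
  next
    case False
    then show ?thesis using Cons orth_proj_remove(3)[OF P] by auto
  qed
qed simp

lemma orth_row_orthogonal:
  "distinct js \<Longrightarrow> a \<in> set js \<Longrightarrow> b \<in> set js \<Longrightarrow> a \<noteq> b \<Longrightarrow> cip (orth_row js g a) (orth_row js g b) = 0"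
proof (induction js)
  case (Cons j js)
  note P = orth_proj_rowproj[of js g]
  have j: "cip (residual js (Inl j) g) (orth_row js g c) = 0" if "c \<in> set js" for c
    using rowproj_orth_row[OF that, of g] Cons.prems P
    by (simp add: residual_def cip_adjoint orth_proj_def cip_linear)
  then have j': "cip (orth_row js g c) (residual js (Inl j) g) = 0" if "c \<in> set js" for c
    using that by (metis cip_commute complex_cnj_zero)
  show ?case using Cons j j' by auto
qed simp

lemma rowproj_span:
  "distinct js \<Longrightarrow> rowproj js g *v v - v \<in> vec.span {orth_row js g a |a. a \<in> set js}"
proof (induction js)
  case (Cons j js)
  let ?S = "{orth_row (j # js) g a |a. a \<in> set (j # js)}"
  have sub: "{orth_row js g a |a. a \<in> set js} \<subseteq> ?S" using Cons.prems by auto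
  have "rowproj js g *v v - v \<in> vec.span {orth_row js g a |a. a \<in> set js}" using Cons by simp
  then have "rowproj js g *v v - v \<in> vec.span ?S" by (rule subsetD[OF vec.span_mono[OF sub]])
  moreover have "residual js (Inl j) g \<in> ?S" by auto
  then have "c *s residual js (Inl j) g \<in> vec.span ?S" for c by (intro vec.span_scale vec.span_base)
  moreover have "rowproj (j # js) g *v v - v = (rowproj js g *v v - v) -
      (1 / of_real ((norm (residual js (Inl j) g))\<^sup>2) * cip v (residual js (Inl j) g)) *s residual js (Inl j) g"
    unfolding rowproj_Cons remove_direction_def mv.diff_left cscale_vector_mult outer_mult_vec vector_smult_assoc
    by simp
  ultimately show ?case by (simp only: vec.span_diff)
qed (simp add: vec.span_zero)

text \<open>Each replacement adds to one row a combination of other rows.\<close>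

lemma det_orth_row: "distinct js \<Longrightarrow> det (\<chi> a. orth_row js g a) = det (block11 g)"
proof (induction js)
  case Nil
  have "(\<chi> a. top_row g (Inl a)) = block11 g" by (simp add: vec_eq_iff top_row_def)
  then show ?case by simp
next
  case (Cons j js)
  let ?A = "\<chi> a. orth_row js g a"
  let ?x = "residual js (Inl j) g - top_row g (Inl j)"
  have row: "row i ?A = orth_row js g i" for i by (simp add: row_def vec_eq_iff)
  have "{orth_row js g a |a. a \<in> set js} \<subseteq> {row i ?A |i. i \<noteq> j}" using Cons.prems by (auto simp: row)
  moreover have "?x \<in> vec.span {orth_row js g a |a. a \<in> set js}"
    using rowproj_span[of js g "top_row g (Inl j)"] Cons.prems unfolding residual_def by simp
  ultimately have "?x \<in> vec.span {row i ?A |i. i \<noteq> j}" by (meson subsetD vec.span_mono)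
  from det_row_span[OF this] have "det (\<chi> k. if k = j then row j ?A + ?x else row k ?A) = det ?A" .
  moreover have "(\<chi> k. if k = j then row j ?A + ?x else row k ?A) = (\<chi> a. orth_row (j # js) g a)"
    using Cons.prems by (simp add: row orth_row_unprocessed vec_eq_iff)
  ultimately show ?case using Cons by simp
qed

lemma det_eq_prod_residuals:
  assumes "distinct js" "set js = UNIV"
  shows "(cmod (det (block11 g)))\<^sup>2 = (\<Prod>a\<in>UNIV. (norm (orth_row js g a))\<^sup>2)"
proof -
  let ?A = "\<chi> a. orth_row js g a"
  have AA: "?A ** herm ?A = (\<chi> a b. cip (orth_row js g a) (orth_row js g b))"
    by (simp add: vec_eq_iff matrix_mult_nth cip_def)
  have "of_real ((cmod (det ?A))\<^sup>2) = det (?A ** herm ?A)"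
    unfolding cmod_sq by (simp add: det_mul det_herm mult.commute)
  also have "\<dots> = (\<Prod>a\<in>UNIV. (?A ** herm ?A) $ a $ a)"
    by (rule det_diagonal) (use assms orth_row_orthogonal[of js _ _ g] in \<open>simp add: AA\<close>)
  also have "\<dots> = of_real (\<Prod>a\<in>UNIV. (norm (orth_row js g a))\<^sup>2)"
    by (simp add: AA cip_self del: of_real_power)
  finally show ?thesis using det_orth_row[OF assms(1), of g] of_real_eq_iff by metis
qed

text \<open>The product of the \<open>s\<close>-th powers of the lengths of the residuals, as a recursion along the
  Gram-Schmidt process.  For the full list of rows it is \<open>\<bar>det\<bar>\<^sup>s\<close>.\<close>

primrec row_weight :: "real \<Rightarrow> 'p::finite list \<Rightarrow> ('p, 'q::finite) bmat \<Rightarrow> real" where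
  "row_weight s [] g = 1"
| "row_weight s (j # js) g = row_weight s js g * ((norm (residual js (Inl j) g))\<^sup>2) powr (s / 2)"

lemma row_weight_prod: "distinct js \<Longrightarrow>
    row_weight s js g = (\<Prod>a\<in>set js. ((norm (orth_row js g a))\<^sup>2) powr (s / 2))"
proof (induction js)
  case (Cons j js)
  then have "(\<Prod>a\<in>set js. ((norm (orth_row (j # js) g a))\<^sup>2) powr (s / 2)) = row_weight s js g"
    by (simp, intro prod.cong) auto
  then show ?case using Cons.prems by (simp add: mult.commute)
qed simp

lemma row_weight_det:
  assumes "distinct js" "set js = UNIV"
  shows "row_weight s js g = cmod (det (block11 g)) powr s"
proof -
  have "row_weight s js g = (\<Prod>a\<in>UNIV. (norm (orth_row js g a))\<^sup>2) powr (s / 2)"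
    by (simp add: row_weight_prod assms prod_powr_distrib)
  also have "\<dots> = ((cmod (det (block11 g)))\<^sup>2) powr (s / 2)" by (simp add: det_eq_prod_residuals[OF assms])
  also have "\<dots> = cmod (det (block11 g)) powr s"
    by (cases "det (block11 g) = 0") (simp_all add: powr_powr flip: powr_numeral)
  finally show ?thesis .
qed

lemma row_weight_cong:
  "(\<And>j. j \<in> set js \<Longrightarrow> top_row g (Inl j) = top_row g' (Inl j)) \<Longrightarrow> row_weight s js g = row_weight s js g'"
proof (induction js)
  case (Cons j js)
  have "rowproj js g = rowproj js g'" using Cons.prems by (intro rowproj_cong) auto
  then show ?case using Cons by (auto simp: residual_def)
qed simp

lemma row_weight_nonzero:
  "row_weight s js g \<noteq> 0 \<Longrightarrow> i < length js \<Longrightarrow> residual (drop (Suc i) js) (Inl (js ! i)) g \<noteq> 0"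
proof (induction js arbitrary: i)
  case (Cons j js)
  then show ?case by (cases i) auto
qed simp

lemma row_weight_bounds:
  "s > 0 \<Longrightarrow> g \<in> K_group \<kappa> \<Longrightarrow> 0 \<le> row_weight s js g \<and> row_weight s js g \<le> 1"
proof (induction js)
  case (Cons j js)
  have "(norm (residual js (Inl j) g))\<^sup>2 \<le> 1"
    using residual_le_1[OF Cons.prems(2)] by (simp add: power_le_one)
  then have "((norm (residual js (Inl j) g))\<^sup>2) powr (s / 2) \<le> 1"
    using powr_mono2[of "s / 2" "(norm (residual js (Inl j) g))\<^sup>2" 1] Cons.prems by simp
  then show ?case using Cons by (auto intro: mult_le_one)
qed simp

lemma dim_base_pos: "dim_base \<kappa> > 0"
  by (cases \<kappa>) auto

text \<open>The weight of the rows processed so far is invariant under rotations among the remaining rows, so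
  the next squared residual is Beta distributed with respect to it.  Its parameters are half the real
  dimensions of the remaining \<open>p - i\<close> coordinates and of the other \<open>q\<close>.\<close>

lemma integral_row_weight:
  fixes \<nu> :: "('p::finite, 'q::finite) bmat measure"
  assumes haar: "normalized_Haar (K_group \<kappa>) \<nu>" and s: "s > 0" and js: "distinct js"
  defines "d \<equiv> real (dim_base \<kappa>)"
  shows "integrable \<nu> (row_weight s js) \<and> (\<integral>g. row_weight s js g \<partial>\<nu>) =
    (\<Prod>i<length js. Beta (d * real (CARD('p) - i) / 2 + s / 2) (d * CARD('q) / 2) /
      Beta (d * real (CARD('p) - i) / 2) (d * CARD('q) / 2))"
  using js
proof (induction js)
  case Nil
  interpret prob_space \<nu> by (rule haar_sets(1)[OF haar])
  show ?case by (simp add: prob_space)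
next
  case (Cons j js)
  interpret prob_space \<nu> by (rule haar_sets(1)[OF haar])
  have js: "distinct js" "j \<notin> set js" using Cons.prems by auto
  have IH: "integrable \<nu> (row_weight s js)" using Cons.IH js by auto
  have len: "length js < CARD('p)"
    using card_mono[of UNIV "set (j # js)"] distinct_card[OF Cons.prems] by simp
  have inv: "row_weight s js (plane_elt (Inl j) i a b ** g) = row_weight s js g"
    if "i \<notin> Inl ` set js" "i \<noteq> Inl j" for g :: "('p, 'q) bmat" and i a b
    using that js by (intro row_weight_cong) (auto simp: vec_eq_iff top_row_def plane_elt_mult_nth)
  have tr: "trace (rowproj js g) = of_nat (CARD('p) - length js)" if "row_weight s js g \<noteq> 0" for g :: "('p, 'q) bmat"
    using trace_rowproj[of js g] row_weight_nonzero[OF that] len by (simp add: of_nat_diff)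
  note M = moment_recursion[OF haar js IH inv tr]
  note [measurable] = measurable_rowproj[OF haar] borel_measurable_integrable[OF IH]
  let ?r = "\<lambda>g::('p, 'q) bmat. (norm (residual js (Inl j) g))\<^sup>2"
  have [measurable]: "?r \<in> borel_measurable \<nu>" unfolding norm_sq_vec by simp
  have r: "0 \<le> ?r g \<and> ?r g \<le> 1" if "g \<in> space \<nu>" for g
    using residual_le_1[of g \<kappa> js "Inl j"] that by (simp add: haar_sets(3)[OF haar] power_le_one)
  have bound: "norm (row_weight s (j # js) g) \<le> 1" if "g \<in> space \<nu>" for g
    using row_weight_bounds[OF s, of g \<kappa> "j # js"] that by (simp add: haar_sets(3)[OF haar])
  have int: "integrable \<nu> (row_weight s (j # js))"
  proof (rule integrable_const_bound[where B = 1])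
    show "AE g in \<nu>. norm (row_weight s (j # js) g) \<le> 1" using bound by (intro AE_I2)
    have "(\<lambda>g. row_weight s js g * ?r g powr (s / 2)) \<in> borel_measurable \<nu>" by measurable
    then show "row_weight s (j # js) \<in> borel_measurable \<nu>"
      by (rule measurable_cong[THEN iffD1, rotated]) simp
  qed
  have "(\<integral>g. row_weight s js g * ?r g powr (s / 2) \<partial>\<nu>) =
      Beta (real (dim_base \<kappa> * (CARD('p) - length js)) / 2 + s / 2) (real (dim_base \<kappa> * CARD('q)) / 2) /
      Beta (real (dim_base \<kappa> * (CARD('p) - length js)) / 2) (real (dim_base \<kappa> * CARD('q)) / 2) *
      (\<integral>g. row_weight s js g \<partial>\<nu>)"
  proof (rule beta_moments_imp_powr[OF IH])
    show "row_weight s js g \<ge> 0" if "g \<in> space \<nu>" for g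
      using row_weight_bounds[OF s, of g \<kappa> js] that by (simp add: haar_sets(3)[OF haar])
  qed (use r len s M(2) dim_base_pos[of \<kappa>] in auto)
  moreover have e: "row_weight s (j # js) = (\<lambda>g. row_weight s js g * ?r g powr (s / 2))" by (simp add: fun_eq_iff)
  ultimately show ?case using int Cons.IH js unfolding e by (simp add: d_def)
qed

text \<open>The power of a nonnegative real number with complex exponent.  The value \<open>0\<close> at \<open>0\<close>, which is the
  limit for exponents with positive real part, matches the convention that the kernel of the
  intertwining operator vanishes off the open cell.\<close>

definition real_cpow :: "real \<Rightarrow> complex \<Rightarrow> complex" where
  "real_cpow r s = (if r = 0 then 0 else exp (s * of_real (ln r)))"

lemma real_cpow_of_real: "r \<ge> 0 \<Longrightarrow> real_cpow r (of_real s) = of_real (r powr s)"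
  unfolding real_cpow_def powr_def of_real_mult[symmetric] exp_of_real by simp

lemma norm_real_cpow: "r \<ge> 0 \<Longrightarrow> norm (real_cpow r s) = r powr Re s"
  by (simp add: real_cpow_def powr_def norm_exp_eq_Re)

lemma real_cpow_add_nat: "r \<ge> 0 \<Longrightarrow> real_cpow r s * of_real (r ^ n) = real_cpow r (s + of_nat n)"
  by (cases "r = 0") (simp_all add: real_cpow_def distrib_right exp_add exp_of_nat_mult exp_of_real)

lemma norm_exp_minus_1_le: "norm (exp z - 1) \<le> norm z * exp (norm z)" for z :: complex
proof -
  have "norm (exp z - exp 0) \<le> exp (norm z) * norm (z - 0)"
  proof (rule field_differentiable_bound[of "cball 0 (norm z)" exp exp])
    show "norm (exp w) \<le> exp (norm z)" if "w \<in> cball 0 (norm z)" for w :: complex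
      using complex_Re_le_cmod[of w] that by (simp add: norm_exp_eq_Re)
  qed (auto intro: DERIV_subset[OF DERIV_exp])
  then show ?thesis by (simp add: mult.commute)
qed

lemma exp_difference_quotient_bound:
  assumes r: "0 < r" "r \<le> 1" and h: "h \<noteq> 0" "norm h \<le> \<delta>" and s: "Re s \<ge> 2 * \<delta>" and \<delta>: "\<delta> > 0"
  shows "norm ((exp ((s + h) * of_real (ln r)) - exp (s * of_real (ln r))) / h) \<le> 1 / \<delta>"
proof -
  define y where "y = - ln r"
  have y: "y \<ge> 0" using r by (simp add: y_def)
  have "(exp ((s + h) * of_real (ln r)) - exp (s * of_real (ln r))) =
      exp (s * of_real (ln r)) * (exp (h * of_real (ln r)) - 1)"
    by (simp add: distrib_right exp_add algebra_simps)
  then have "norm ((exp ((s + h) * of_real (ln r)) - exp (s * of_real (ln r))) / h) =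
      exp (- (Re s * y)) * norm (exp (h * of_real (ln r)) - 1) / norm h"
    by (simp add: norm_mult norm_divide norm_exp_eq_Re y_def)
  also have "\<dots> \<le> exp (- (Re s * y)) * ((norm h * y) * exp (norm h * y)) / norm h"
    using norm_exp_minus_1_le[of "h * of_real (ln r)"] y
    by (intro divide_right_mono mult_left_mono) (auto simp: norm_mult y_def)
  also have "\<dots> = y * exp ((norm h - Re s) * y)"
    using h by (simp add: exp_add[symmetric] mult_ac algebra_simps flip: exp_add)
  also have "\<dots> \<le> y * exp (- (\<delta> * y))"
  proof (intro mult_left_mono y)
    have "(norm h - Re s) * y \<le> (- \<delta>) * y" using y h s by (intro mult_right_mono) auto
    then show "exp ((norm h - Re s) * y) \<le> exp (- (\<delta> * y))" by simp
  qed
  also have "\<dots> \<le> 1 / \<delta>"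
  proof -
    have "\<delta> * y \<le> exp (\<delta> * y)" using exp_ge_add_one_self[of "\<delta> * y"] by linarith
    then show ?thesis using \<delta> by (simp add: exp_minus field_simps)
  qed
  finally show ?thesis .
qed

text \<open>Difference quotients in \<open>s\<close> are bounded uniformly on \<open>[0, 1]\<close> as long as the real part of \<open>s\<close>
  stays away from zero, so dominated convergence applies.\<close>

lemma holomorphic_integral_real_cpow:
  fixes M :: "'m measure" and r :: "'m \<Rightarrow> real"
  assumes "prob_space M" and r [measurable]: "r \<in> borel_measurable M"
    and r01: "\<And>x. x \<in> space M \<Longrightarrow> 0 \<le> r x \<and> r x \<le> 1"
  shows "(\<lambda>s. \<integral>x. real_cpow (r x) s \<partial>M) holomorphic_on {s. Re s > 0}"
proof -
  interpret prob_space M by fact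
  have [measurable]: "(\<lambda>x. real_cpow (r x) s) \<in> borel_measurable M" for s
    unfolding real_cpow_def by measurable
  have int: "integrable M (\<lambda>x. real_cpow (r x) s)" if "Re s > 0" for s
    using r01 that powr_mono2[of "Re s" _ 1]
    by (intro integrable_const_bound[where B = 1] AE_I2) (auto simp: norm_real_cpow)
  let ?J = "\<lambda>s. \<integral>x. real_cpow (r x) s \<partial>M"
  show ?thesis
    unfolding holomorphic_on_def
  proof
    fix s :: complex assume "s \<in> {s. Re s > 0}"
    then have s: "Re s > 0" by simp
    define \<delta> where "\<delta> = Re s / 2"
    have \<delta>: "\<delta> > 0" "Re s \<ge> 2 * \<delta>" using s by (simp_all add: \<delta>_def)
    define h where "h x = (if r x = 0 then 0 else exp (s * of_real (ln (r x))) * of_real (ln (r x)))" for x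
    have "((\<lambda>k. (?J (s + k) - ?J s) / k) \<longlongrightarrow> (\<integral>x. h x \<partial>M)) (at 0 within ball 0 \<delta>)"
      unfolding tendsto_at_iff_sequentially comp_def
    proof (intro allI impI)
      fix X :: "nat \<Rightarrow> complex" assume X: "\<forall>i. X i \<in> ball 0 \<delta> - {0}" "X \<longlonglongrightarrow> 0"
      have Xs: "Re (s + X i) > 0" for i
        using X(1) abs_Re_le_cmod[of "X i"] \<delta> by (auto simp: dist_norm) (smt (verit))
      have "(\<lambda>i. \<integral>x. (real_cpow (r x) (s + X i) - real_cpow (r x) s) / X i \<partial>M) \<longlonglongrightarrow> (\<integral>x. h x \<partial>M)"
      proof (rule integral_dominated_convergence[where w = "\<lambda>_. 1 / \<delta>"])
        show "h \<in> borel_measurable M" unfolding h_def by measurable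
        show "AE x in M. (\<lambda>i. (real_cpow (r x) (s + X i) - real_cpow (r x) s) / X i) \<longlonglongrightarrow> h x"
        proof (rule AE_I2)
          fix x
          let ?f = "\<lambda>s. real_cpow (r x) s"
          have "(?f has_field_derivative h x) (at s)"
            unfolding real_cpow_def h_def by (cases "r x = 0") (auto intro!: derivative_eq_intros)
          then have "((\<lambda>k. (?f (s + k) - ?f s) / k) \<longlongrightarrow> h x) (at 0)" by (simp add: DERIV_def)
          moreover have "filterlim X (at 0) sequentially"
            using X by (intro filterlim_atI) auto
          ultimately show "(\<lambda>i. (real_cpow (r x) (s + X i) - real_cpow (r x) s) / X i) \<longlonglongrightarrow> h x"
            by (rule filterlim_compose)
        qed
        show "AE x in M. norm ((real_cpow (r x) (s + X i) - real_cpow (r x) s) / X i) \<le> 1 / \<delta>" for i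
        proof (rule AE_I2)
          fix x assume "x \<in> space M"
          then show "norm ((real_cpow (r x) (s + X i) - real_cpow (r x) s) / X i) \<le> 1 / \<delta>"
            using exp_difference_quotient_bound[of "r x" "X i" \<delta> s] r01[of x] X(1) \<delta>
            by (auto simp: real_cpow_def less_le)
        qed
      qed auto
      then show "(\<lambda>i. (?J (s + X i) - ?J s) / X i) \<longlonglongrightarrow> (\<integral>x. h x \<partial>M)"
        using int[OF s] int[OF Xs] by simp
    qed
    moreover have "at (0::complex) within ball 0 \<delta> = at 0" using \<delta> by (intro at_within_open) auto
    ultimately have "(?J has_field_derivative (\<integral>x. h x \<partial>M)) (at s)" by (simp add: DERIV_def)
    then show "?J field_differentiable at s within {s. Re s > 0}"
      using field_differentiable_at_within field_differentiable_def by blast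
  qed
qed

text \<open>For real \<open>s\<close> this is \<open>B (a + s/2, b) / B (a, b)\<close>, the moment of order \<open>s/2\<close> of the Beta
  distribution with parameters \<open>a\<close> and \<open>b\<close>.\<close>

definition gamma_quotient :: "complex \<Rightarrow> complex \<Rightarrow> complex \<Rightarrow> complex" where
  "gamma_quotient a b s = Gamma (a + s / 2) * Gamma (a + b) / (Gamma (a + s / 2 + b) * Gamma a)"

lemma gamma_quotient_of_real:
  fixes a b t :: real
  assumes "a > 0" "b > 0" "t > 0"
  shows "gamma_quotient (of_real a) (of_real b) (of_real t) = of_real (Beta (a + t / 2) b / Beta a b)"
proof -
  have c: "complex_of_real t / 2 = of_real (t / 2)" by simp
  have "Gamma b \<noteq> 0" using Gamma_real_pos[OF assms(2)] by linarith
  then have "Beta (a + t / 2) b / Beta a b = Gamma (a + t / 2) * Gamma (a + b) / (Gamma (a + t / 2 + b) * Gamma a)"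
    by (simp add: Beta_def)
  then show ?thesis
    by (simp only: gamma_quotient_def c of_real_add[symmetric] Gamma_complex_of_real of_real_mult[symmetric]
        of_real_divide[symmetric])
qed

lemma holomorphic_gamma_quotient:
  fixes a b :: complex
  assumes a: "Re a > 0" and b: "Re b \<ge> 0"
  shows "gamma_quotient a b holomorphic_on {s. Re s > 0}"
proof -
  have G: "(\<lambda>s. Gamma (c + s / 2)) holomorphic_on {s. Re s > 0}" if c: "Re c > 0" for c
  proof (rule holomorphic_Gamma')
    show "(\<lambda>s. c + s / 2) holomorphic_on {s. Re s > 0}" by (intro holomorphic_intros) simp
    show "c + z / 2 \<notin> \<int>\<^sub>\<le>\<^sub>0" if z: "z \<in> {s. Re s > 0}" for z
    proof
      assume "c + z / 2 \<in> \<int>\<^sub>\<le>\<^sub>0"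
      then obtain n where n: "c + z / 2 = of_int n" "n \<le> 0" by (rule nonpos_Ints_cases)
      then have "Re (c + z / 2) \<le> 0" by (simp only: n(1)) simp
      then show False using z c by simp
    qed
  qed
  have G0: "Gamma w \<noteq> 0" if "Re w > 0" for w :: complex
    using that by (auto simp: Gamma_eq_zero_iff elim!: nonpos_Ints_cases)
  have "(\<lambda>s. Gamma (a + s / 2) * Gamma (a + b) / (Gamma ((a + b) + s / 2) * Gamma a)) holomorphic_on {s. Re s > 0}"
  proof (rule holomorphic_on_divide)
    show "(\<lambda>s. Gamma (a + s / 2) * Gamma (a + b)) holomorphic_on {s. Re s > 0}"
      by (rule holomorphic_on_mult[OF G[OF a] holomorphic_on_const])
    show "(\<lambda>s. Gamma ((a + b) + s / 2) * Gamma a) holomorphic_on {s. Re s > 0}"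
      by (rule holomorphic_on_mult[OF G holomorphic_on_const]) (use a b in simp)
    show "Gamma (a + b + z / 2) * Gamma a \<noteq> 0" if "z \<in> {s. Re s > 0}" for z
      using G0[of "a + b + z / 2"] G0[OF a] a b that by simp
  qed
  then show ?thesis by (simp add: gamma_quotient_def[abs_def] add_ac)
qed

text \<open>The Beta quotients of the successive Gram-Schmidt steps become quotients of Gamma functions.
  Both sides are holomorphic in the right half plane and agree on the positive reals.\<close>

theorem haar_integral_det_power:
  fixes \<nu> :: "('p::finite, 'q::finite) bmat measure"
  assumes haar: "normalized_Haar (K_group \<kappa>) \<nu>" and s: "Re s > 0"
  shows "(\<integral>g. real_cpow (cmod (det (block11 g))) s \<partial>\<nu>) =
    (\<Prod>i<CARD('p). gamma_quotient (of_nat (dim_base \<kappa>) * of_nat (CARD('p) - i) / 2)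
      (of_nat (dim_base \<kappa>) * of_nat CARD('q) / 2) s)"
proof -
  interpret prob_space \<nu> by (rule haar_sets(1)[OF haar])
  obtain js :: "'p list" where js: "set js = UNIV" "distinct js" using finite_distinct_list[of "UNIV :: 'p set"] by auto
  have len: "length js = CARD('p)" using distinct_card[OF js(2)] js(1) by simp
  define D where "D g = cmod (det (block11 g))" for g :: "('p, 'q) bmat"
  define a b where "a i = real (dim_base \<kappa>) * real (CARD('p) - i) / 2" and "b = real (dim_base \<kappa>) * real CARD('q) / 2" for i
  have ab: "of_nat (dim_base \<kappa>) * of_nat (CARD('p) - i) / 2 = complex_of_real (a i)"
    "of_nat (dim_base \<kappa>) * of_nat CARD('q) / 2 = complex_of_real b" for i
    by (simp_all add: a_def b_def)
  have a0: "a i > 0" if "i < CARD('p)" for i using that dim_base_pos[of \<kappa>] by (simp add: a_def)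
  have b0: "b > 0" using dim_base_pos[of \<kappa>] by (simp add: b_def)
  define F where "F s = (\<Prod>i<CARD('p). gamma_quotient (of_real (a i)) (of_real b) s)" for s
  have D01: "0 \<le> D g \<and> D g \<le> 1" if "g \<in> space \<nu>" for g
    using row_weight_bounds[of 1 g \<kappa> js] row_weight_det[OF js(2,1), of 1 g] that
    by (simp add: haar_sets(3)[OF haar] D_def)
  have Dm: "D \<in> borel_measurable \<nu>"
  proof -
    note [measurable] = haar_measurable_entry[OF haar]
    show ?thesis unfolding D_def[abs_def] det_def by simp
  qed
  have real: "(\<integral>g. real_cpow (D g) (of_real t) \<partial>\<nu>) = F (of_real t)" if t: "t > 0" for t
  proof -
    have "(\<integral>g. real_cpow (D g) (of_real t) \<partial>\<nu>) = of_real (\<integral>g. row_weight t js g \<partial>\<nu>)"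
      by (simp add: real_cpow_of_real row_weight_det[OF js(2,1)] D_def)
    also have "(\<integral>g. row_weight t js g \<partial>\<nu>) = (\<Prod>i<CARD('p). Beta (a i + t / 2) b / Beta (a i) b)"
      using integral_row_weight[OF haar t js(2)] by (simp add: len a_def b_def)
    also have "complex_of_real \<dots> = F (of_real t)"
      unfolding F_def of_real_prod using a0 b0 t by (intro prod.cong refl) (simp add: gamma_quotient_of_real del: of_real_divide)
    finally show ?thesis .
  qed
  have "(\<lambda>s. (\<integral>g. real_cpow (D g) s \<partial>\<nu>) - F s) holomorphic_on {s. Re s > 0}"
  proof (rule holomorphic_on_diff)
    show "(\<lambda>s. \<integral>g. real_cpow (D g) s \<partial>\<nu>) holomorphic_on {s. Re s > 0}"
      by (rule holomorphic_integral_real_cpow[OF prob_space_axioms Dm D01])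
    show "F holomorphic_on {s. Re s > 0}"
      unfolding F_def[abs_def] using a0 b0 by (intro holomorphic_on_prod holomorphic_gamma_quotient) auto
  qed
  then have "(\<integral>g. real_cpow (D g) s \<partial>\<nu>) - F s = 0"
  proof (rule analytic_continuation[where U = "complex_of_real ` {0<..}" and \<xi> = 1])
    show "open {s. Re s > 0}" by (rule open_halfspace_Re_gt)
    show "connected {s. Re s > 0}" by (intro convex_connected convex_halfspace_Re_gt)
    show "complex_of_real ` {0<..} \<subseteq> {s. Re s > 0}" by auto
    have "(\<lambda>n. complex_of_real (1 + 1 / real (Suc n))) \<longlonglongrightarrow> of_real (1 + 0)"
      using LIMSEQ_inverse_real_of_nat by (intro tendsto_of_real tendsto_add tendsto_const) (simp add: divide_inverse)
    then show "1 islimpt complex_of_real ` {0<..}"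
      unfolding islimpt_sequential
      by (intro exI[of _ "\<lambda>n. complex_of_real (1 + 1 / real (Suc n))"])
         (simp add: add_pos_pos image_iff del: of_real_add)
  qed (use real s in auto)
  then show ?thesis unfolding ab by (simp add: D_def F_def)
qed

section \<open>The differential of a unitary representation\<close>

lemma continuous_on_det: "continuous_on S (det :: complex^'n::finite^'n \<Rightarrow> complex)"
  unfolding det_def by (intro continuous_intros)

lemma compact_K_group: "compact (K_group \<kappa> :: (complex^'n::finite^'n) set)"
proof -
  have "closed {A :: complex^'n^'n. mcnj A = A}"
    by (intro closed_Collect_eq linear_continuous_on bounded_linear_mcnj continuous_on_id)
  then have "closed (matrices_over \<kappa> :: (complex^'n^'n) set)"
    by (cases \<kappa>) (auto simp: matrices_over_Real[abs_def] Collect_mem_eq matrices_over_def simp flip: matrices_over_Real)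
  moreover have "closed {g :: complex^'n^'n. det g = 1}"
    by (intro closed_Collect_eq continuous_on_det continuous_on_const)
  moreover have "closed {g :: complex^'n^'n. herm g ** g = mat 1}"
    by (intro closed_Collect_eq mm.continuous_on linear_continuous_on bounded_linear_herm continuous_on_id continuous_on_const)
  moreover have "(K_group \<kappa> :: (complex^'n^'n) set) =
      matrices_over \<kappa> \<inter> {g. det g = 1} \<inter> {g. herm g ** g = mat 1}"
    by (auto simp: K_group_def SL_group_def)
  ultimately have "closed (K_group \<kappa> :: (complex^'n^'n) set)" by (simp add: closed_Int)
  moreover have "bounded (K_group \<kappa> :: (complex^'n^'n) set)"
    unfolding bounded_iff
  proof (intro exI ballI)
    fix g :: "complex^'n^'n" assume g: "g \<in> K_group \<kappa>"
    have "norm (g $ k) \<le> 1" for k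
    proof -
      have "(g ** herm g) $ k $ k = 1" by (simp add: K_groupD(4)[OF g] mat_nth)
      then have "of_real ((norm (g $ k))\<^sup>2) = (1::complex)"
        unfolding norm_sq_vec of_real_sum cmod_sq by (simp add: matrix_mult_nth mult.commute)
      then have "(norm (g $ k))\<^sup>2 = 1" by (metis of_real_1 of_real_eq_iff)
      then show ?thesis by (simp add: abs_square_eq_1)
    qed
    then have "norm g \<le> (\<Sum>k\<in>(UNIV :: 'n set). 1)"
      unfolding norm_vec_def[of g] by (intro order_trans[OF L2_set_le_sum] sum_mono) auto
    then show "norm g \<le> real CARD('n)" by simp
  qed
  ultimately show ?thesis by (simp add: compact_eq_bounded_closed)
qed

lemma haar_integrable_continuous:
  fixes f :: "complex^'n::finite^'n \<Rightarrow> 'b::euclidean_space"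
  assumes haar: "normalized_Haar (K_group \<kappa>) \<nu>" and f: "continuous_on (K_group \<kappa>) f"
  shows "integrable \<nu> f"
proof -
  interpret prob_space \<nu> by (rule haar_sets(1)[OF haar])
  have "bounded (f ` K_group \<kappa>)" using compact_continuous_image[OF f compact_K_group] by (rule compact_imp_bounded)
  then obtain B where "\<And>g. g \<in> K_group \<kappa> \<Longrightarrow> norm (f g) \<le> B" by (auto simp: bounded_iff)
  then show ?thesis
    using haar_measurable_continuous[OF haar f]
    by (intro integrable_const_bound[where B = B] AE_I2) (auto simp: haar_sets(3)[OF haar])
qed

text \<open>Finite sums of products \<open>a(g) q(h)\<close>; polynomial functions of \<open>g\<^sup>* h\<close> are of this form, which
  makes integrals over \<open>g\<close> differentiable in \<open>h\<close>.\<close>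

inductive separable :: "('a::euclidean_space \<Rightarrow> 'a \<Rightarrow> real) \<Rightarrow> bool" where
  prod: "continuous_on UNIV a \<Longrightarrow> (\<And>h. q differentiable at h) \<Longrightarrow> separable (\<lambda>g h. a g * q h)"
| add: "separable F \<Longrightarrow> separable G \<Longrightarrow> separable (\<lambda>g h. F g h + G g h)"

lemma separable_const: "separable (\<lambda>g h. c)"
  using separable.prod[of "\<lambda>_. c" "\<lambda>_. 1"] by simp

lemma separable_sum: "finite I \<Longrightarrow> (\<And>i. i \<in> I \<Longrightarrow> separable (F i)) \<Longrightarrow> separable (\<lambda>g h. \<Sum>i\<in>I. F i g h)"
  by (induction rule: finite_induct) (auto simp: separable_const intro: separable.add)

lemma separable_mult: "separable F \<Longrightarrow> separable G \<Longrightarrow> separable (\<lambda>g h. F g h * G g h)"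
proof (induction rule: separable.induct)
  case (prod a q)
  from prod(3) show ?case
  proof (induction rule: separable.induct)
    case (prod a' q')
    have "separable (\<lambda>g h. (a g * a' g) * (q h * q' h))"
      using \<open>continuous_on UNIV a\<close> \<open>\<And>h. q differentiable at h\<close> prod
      by (intro separable.prod continuous_on_mult differentiable_mult)
    then show ?case by (simp add: mult_ac)
  qed (auto simp: distrib_left intro: separable.add)
qed (auto simp: distrib_right intro: separable.add)

lemma separable_polynomial:
  fixes P :: "complex^'n::finite^'n \<Rightarrow> real"
  assumes "real_polynomial_function P"
  shows "separable (\<lambda>(g :: complex^'n^'n) h. P (herm g ** h))"
  using assms
proof (induction rule: real_polynomial_function.induct)
  case (linear f)
  interpret f: bounded_linear f by fact
  have expand: "f (herm g ** h) = (\<Sum>b\<in>Basis. f (herm g ** b) * (h \<bullet> b))" for g h :: "complex^'n^'n"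
  proof -
    have "f (herm g ** h) = f (herm g ** (\<Sum>b\<in>Basis. (h \<bullet> b) *\<^sub>R b))" by (simp add: euclidean_representation)
    then show ?thesis by (simp add: mm.sum_right mm.scaleR_right f.sum f.scaleR mult.commute)
  qed
  have sep: "separable (\<lambda>g h. f (herm g ** b) * (h \<bullet> b))" for b :: "complex^'n^'n"
  proof (rule separable.prod)
    show "continuous_on UNIV (\<lambda>g. f (herm g ** b))"
      by (intro linear_continuous_on bounded_linear_compose[OF linear] bounded_linear_compose[OF mm.bounded_linear_left]
          bounded_linear_herm)
    show "(\<lambda>h. h \<bullet> b) differentiable at h" for h :: "complex^'n^'n"
      by (intro bounded_linear_imp_differentiable bounded_linear_inner_left)
  qed
  have "separable (\<lambda>g h. \<Sum>b\<in>(Basis :: (complex^'n^'n) set). f (herm g ** b) * (h \<bullet> b))"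
    by (rule separable_sum[OF finite_Basis sep])
  moreover have "(\<lambda>g h. f (herm g ** h)) = (\<lambda>g h. \<Sum>b\<in>(Basis :: (complex^'n^'n) set). f (herm g ** b) * (h \<bullet> b))"
    by (intro ext expand)
  ultimately show ?case by (simp only:)
next
  case (const c)
  then show ?case by (rule separable_const)
qed (auto intro: separable.add separable_mult)

lemma separable_continuous: "separable F \<Longrightarrow> continuous_on S (\<lambda>g. F g h)"
proof (induction rule: separable.induct)
  case (prod a q)
  then show ?case by (intro continuous_on_mult continuous_on_const) (auto intro: continuous_on_subset)
qed (rule continuous_on_add)

lemma differentiable_separable_integral:
  fixes A :: "complex^'n::finite^'n \<Rightarrow> 'b::euclidean_space"
  assumes haar: "normalized_Haar (K_group \<kappa>) \<nu>" and A: "continuous_on (K_group \<kappa>) A" and F: "separable F"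
  shows "(\<lambda>h. \<integral>g. F g h *\<^sub>R A g \<partial>\<nu>) differentiable at h"
  using F
proof (induction rule: separable.induct)
  case (prod a q)
  have "(\<integral>g. (a g * q h) *\<^sub>R A g \<partial>\<nu>) = (\<integral>g. q h *\<^sub>R (a g *\<^sub>R A g) \<partial>\<nu>)" for h
    by (intro Bochner_Integration.integral_cong refl) (simp add: mult.commute)
  then have "(\<lambda>h. \<integral>g. (a g * q h) *\<^sub>R A g \<partial>\<nu>) = (\<lambda>h. q h *\<^sub>R (\<integral>g. a g *\<^sub>R A g \<partial>\<nu>))"
    by (simp only: integral_scaleR_right)
  then show ?case using prod by (simp add: differentiable_scaleR)
next
  case (add F G)
  have "integrable \<nu> (\<lambda>g. F g h *\<^sub>R A g)" "integrable \<nu> (\<lambda>g. G g h *\<^sub>R A g)" for h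
    using add by (intro haar_integrable_continuous[OF haar] continuous_on_scaleR separable_continuous A; simp)+
  then have "(\<lambda>h. \<integral>g. (F g h + G g h) *\<^sub>R A g \<partial>\<nu>) = (\<lambda>h. (\<integral>g. F g h *\<^sub>R A g \<partial>\<nu>) + (\<integral>g. G g h *\<^sub>R A g \<partial>\<nu>))"
    by (simp add: scaleR_add_left)
  then show ?case using add by (simp add: differentiable_add)
qed

locale haar_unitary_rep =
  fixes \<kappa> :: base_case and \<nu> :: "(complex^'n::finite^'n) measure"
    and \<pi> :: "complex^'n^'n \<Rightarrow> complex^'v::finite^'v"
  assumes haar: "normalized_Haar (K_group \<kappa>) \<nu>" and rep: "unitary_rep (K_group \<kappa>) \<pi>"
begin

lemma rep_cont: "continuous_on (K_group \<kappa>) \<pi>"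
  and rep_one: "\<pi> (mat 1) = mat 1"
  and rep_mult: "g \<in> K_group \<kappa> \<Longrightarrow> h \<in> K_group \<kappa> \<Longrightarrow> \<pi> (g ** h) = \<pi> g ** \<pi> h"
  and rep_cip: "g \<in> K_group \<kappa> \<Longrightarrow> cip (\<pi> g *v v) (\<pi> g *v w) = cip v w"
  using rep by (auto simp: unitary_rep_def)

lemma rep_herm: assumes "g \<in> K_group \<kappa>" shows "\<pi> (herm g) ** \<pi> g = mat 1" "\<pi> g ** \<pi> (herm g) = mat 1"
  using assms rep_mult[of "herm g" g] rep_mult[of g "herm g"] K_group_herm[OF assms] K_groupD[OF assms] rep_one by auto

lemma cip_rep: "g \<in> K_group \<kappa> \<Longrightarrow> cip (\<pi> g *v v) w = cip v (\<pi> (herm g) *v w)"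
  using rep_cip[of g v "\<pi> (herm g) *v w"] rep_herm(2) by (simp add: matrix_vector_mul_assoc)

text \<open>On the group, \<open>\<pi>\<close> agrees up to an invertible constant with its convolution with a polynomial
  approximation of itself, and the latter is differentiable on the whole matrix space.  The integral
  reproduces \<open>\<pi>\<close> by invariance of the measure.\<close>

lemma rep_smooth_extension:
  obtains Q where "\<And>h. Q differentiable at h" "\<And>g. g \<in> K_group \<kappa> \<Longrightarrow> Q g = \<pi> g"
proof -
  interpret prob_space \<nu> by (rule haar_sets(1)[OF haar])
  have "open {A :: complex^'v^'v. det A \<noteq> 0}"
    by (intro open_Collect_neq continuous_on_det continuous_on_const)
  then obtain \<delta> where \<delta>: "\<delta> > 0" "\<And>A :: complex^'v^'v. dist A (mat 1) < \<delta> \<Longrightarrow> det A \<noteq> 0"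
    unfolding open_dist using det_I by (metis (mono_tags, lifting) mem_Collect_eq zero_neq_one)
  obtain C where C: "C > 0" "\<And>(X :: complex^'v^'v) (Y :: complex^'v^'v). norm (X ** Y) \<le> norm X * norm Y * C"
    using mm.pos_bounded by blast
  have "bounded (\<pi> ` K_group \<kappa>)" using compact_continuous_image[OF rep_cont compact_K_group] by (rule compact_imp_bounded)
  then obtain B where B: "B > 0" "\<And>g. g \<in> K_group \<kappa> \<Longrightarrow> norm (\<pi> g) \<le> B" unfolding bounded_pos by auto
  (* With this accuracy of the approximation p of \<pi> the matrix Q 1 is within \<delta> / 2 of the identity. *)
  define e where "e = \<delta> / (2 * B * C)"
  have e: "e > 0" using \<delta> B C by (simp add: e_def)
  obtain p where p: "polynomial_function p" "\<And>g. g \<in> K_group \<kappa> \<Longrightarrow> norm (\<pi> g - p g) < e"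
    using Stone_Weierstrass_polynomial_function[OF compact_K_group rep_cont e] by blast
  have pc: "continuous_on S p" for S using continuous_on_polymonial_function[OF p(1)] .
  define Q where "Q h = (\<integral>g. \<pi> g ** p (herm g ** h) \<partial>\<nu>)" for h
  have cont: "continuous_on (K_group \<kappa>) (\<lambda>g. \<pi> g ** p (herm g ** h))" for h
    by (intro mm.continuous_on rep_cont continuous_on_compose2[OF pc[of UNIV]] linear_continuous_on
        bounded_linear_compose[OF mm.bounded_linear_left] bounded_linear_herm) auto
  have Q_eq: "Q h = (\<Sum>b\<in>Basis. \<integral>g. (p (herm g ** h) \<bullet> b) *\<^sub>R (\<pi> g ** b) \<partial>\<nu>)" for h
  proof -
    have "\<pi> g ** p (herm g ** h) = (\<Sum>b\<in>Basis. (p (herm g ** h) \<bullet> b) *\<^sub>R (\<pi> g ** b))" for g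
    proof -
      have "\<pi> g ** p (herm g ** h) = \<pi> g ** (\<Sum>b\<in>Basis. (p (herm g ** h) \<bullet> b) *\<^sub>R b)"
        by (simp add: euclidean_representation)
      then show ?thesis by (simp add: mm.sum_right mm.scaleR_right)
    qed
    moreover have "integrable \<nu> (\<lambda>g. (p (herm g ** h) \<bullet> b) *\<^sub>R (\<pi> g ** b))" for b
      by (intro haar_integrable_continuous[OF haar] continuous_on_scaleR continuous_on_inner mm.continuous_on rep_cont
          continuous_on_const continuous_on_compose2[OF pc[of UNIV]] linear_continuous_on
          bounded_linear_compose[OF mm.bounded_linear_left] bounded_linear_herm) auto
    ultimately show ?thesis unfolding Q_def by simp
  qed
  have Qd: "Q differentiable at h" for h
    unfolding Q_eq
  proof (intro differentiable_sum ballI)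
    fix b :: "complex^'v^'v"
    have "real_polynomial_function (\<lambda>x. p x \<bullet> b)"
      using p(1) bounded_linear_inner_left[of b] by (auto simp: polynomial_function_def comp_def)
    from separable_polynomial[OF this]
    show "(\<lambda>h. \<integral>g. (p (herm g ** h) \<bullet> b) *\<^sub>R (\<pi> g ** b) \<partial>\<nu>) differentiable at h"
      by (intro differentiable_separable_integral[OF haar] mm.continuous_on rep_cont continuous_on_const)
  qed simp
  have Qx: "Q x = \<pi> x ** Q (mat 1)" if x: "x \<in> K_group \<kappa>" for x
  proof -
    have "Q x = (\<integral>g. \<pi> (x ** g) ** p (herm (x ** g) ** x) \<partial>\<nu>)"
      unfolding Q_def using haar_left[OF haar x haar_measurable_continuous[OF haar cont]] by simp
    also have "\<dots> = (\<integral>g. \<pi> x ** (\<pi> g ** p (herm g)) \<partial>\<nu>)"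
    proof (intro Bochner_Integration.integral_cong refl)
      fix g assume "g \<in> space \<nu>"
      then have g: "g \<in> K_group \<kappa>" by (simp add: haar_sets(3)[OF haar])
      have "herm (x ** g) ** x = herm g ** (herm x ** x)" by (simp add: herm_mult matrix_mul_assoc)
      then show "\<pi> (x ** g) ** p (herm (x ** g) ** x) = \<pi> x ** (\<pi> g ** p (herm g))"
        using K_groupD(3)[OF x] rep_mult[OF x g] by (simp add: matrix_mul_assoc)
    qed
    also have "\<dots> = \<pi> x ** Q (mat 1)"
      unfolding Q_def using haar_integrable_continuous[OF haar cont[of "mat 1"]]
      by (simp add: integral_bounded_linear[OF mm.bounded_linear_right])
    finally show ?thesis .
  qed
  have "norm (Q (mat 1) - mat 1) \<le> \<delta> / 2"
  proof -
    have "Q (mat 1) - mat 1 = (\<integral>g. \<pi> g ** p (herm g) - mat 1 \<partial>\<nu>)"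
      unfolding Q_def using haar_integrable_continuous[OF haar cont[of "mat 1"]] by (simp add: prob_space)
    also have "norm \<dots> \<le> (\<integral>g. norm (\<pi> g ** p (herm g) - mat 1) \<partial>\<nu>)" by (rule integral_norm_bound)
    also have "\<dots> \<le> (\<integral>g. \<delta> / 2 \<partial>\<nu>)"
    proof (rule integral_mono)
      show "integrable \<nu> (\<lambda>g. norm (\<pi> g ** p (herm g) - mat 1))"
        using haar_integrable_continuous[OF haar cont[of "mat 1"]] by simp
      fix g assume "g \<in> space \<nu>"
      then have g: "g \<in> K_group \<kappa>" by (simp add: haar_sets(3)[OF haar])
      have "\<pi> g ** p (herm g) - mat 1 = \<pi> g ** (p (herm g) - \<pi> (herm g))"
        by (simp add: mm.diff_right rep_herm(2)[OF g])
      also have "norm \<dots> \<le> norm (\<pi> g) * norm (p (herm g) - \<pi> (herm g)) * C" by (rule C(2))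
      also have "\<dots> \<le> B * e * C"
        using B(2)[OF g] p(2)[OF K_group_herm[OF g]] B(1) C(1)
        by (intro mult_right_mono mult_mono) (auto simp: norm_minus_commute)
      also have "\<dots> = \<delta> / 2" using B(1) C(1) by (simp add: e_def)
      finally show "norm (\<pi> g ** p (herm g) - mat 1) \<le> \<delta> / 2" .
    qed simp
    finally show ?thesis by (simp add: prob_space)
  qed
  then have "det (Q (mat 1)) \<noteq> 0" using \<delta> by (intro \<delta>(2)) (simp add: dist_norm)
  then obtain S where S: "Q (mat 1) ** S = mat 1" using invertible_det_nz invertible_right_inverse by blast
  show ?thesis
  proof (rule that[of "\<lambda>h. Q h ** S"])
    show "(\<lambda>h. Q h ** S) differentiable at h" for h
      using Qd[of h] mm.FDERIV[of Q _ h UNIV "\<lambda>_. S" "\<lambda>_. 0"] unfolding differentiable_def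
      by (metis has_derivative_const)
    show "Q g ** S = \<pi> g" if "g \<in> K_group \<kappa>" for g
      using Qx[OF that] S by (simp flip: matrix_mul_assoc)
  qed
qed

lemma drep_facts:
  obtains L where "linear L" "\<And>X s. X \<in> lie_K \<kappa> \<Longrightarrow>
    ((\<lambda>s. \<pi> (mexp (s *\<^sub>R X))) has_vector_derivative \<pi> (mexp (s *\<^sub>R X)) ** L X) (at s)"
proof -
  obtain Q where Q: "\<And>h. Q differentiable at h" "\<And>g. g \<in> K_group \<kappa> \<Longrightarrow> Q g = \<pi> g"
    using rep_smooth_extension by blast
  obtain L where L: "(Q has_derivative L) (at (mat 1))" using Q(1) by (auto simp: differentiable_def)
  have lin: "linear L" using L has_derivative_linear by blast
  have d0: "((\<lambda>s. \<pi> (mexp (s *\<^sub>R X))) has_vector_derivative L X) (at 0)" if X: "X \<in> lie_K \<kappa>" for X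
  proof -
    have "((\<lambda>s. mexp (s *\<^sub>R X)) has_vector_derivative X) (at 0)" using has_vector_derivative_mexp[of X 0] by simp
    then have "((\<lambda>s. Q (mexp (s *\<^sub>R X))) has_derivative (\<lambda>s. L (s *\<^sub>R X))) (at 0)"
      unfolding has_vector_derivative_def
      by (rule has_derivative_compose) (use L in simp)
    then show ?thesis
      unfolding has_vector_derivative_def using Q(2)[OF mexp_lie_K[OF X]] linear_scale[OF lin] by simp
  qed
  have "((\<lambda>s. \<pi> (mexp (s *\<^sub>R X))) has_vector_derivative \<pi> (mexp (s *\<^sub>R X)) ** L X) (at s)" if X: "X \<in> lie_K \<kappa>" for X s
  proof -
    have e: "\<pi> (mexp (t *\<^sub>R X)) = \<pi> (mexp (s *\<^sub>R X)) ** \<pi> (mexp ((t - s) *\<^sub>R X))" for t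
      using mexp_scaleR_add[of s "t - s" X] rep_mult[OF mexp_lie_K[OF X] mexp_lie_K[OF X]] by simp
    have "((\<lambda>t. t - s) has_vector_derivative 1) (at s)" by (auto intro!: derivative_eq_intros)
    moreover have "((\<lambda>u. \<pi> (mexp (u *\<^sub>R X))) has_vector_derivative L X) (at (s - s))" using d0[OF X] by simp
    ultimately have "((\<lambda>t. \<pi> (mexp ((t - s) *\<^sub>R X))) has_vector_derivative L X) (at s)"
      using vector_diff_chain_at[of "\<lambda>t. t - s" 1 s "\<lambda>u. \<pi> (mexp (u *\<^sub>R X))" "L X"] by (simp add: comp_def)
    from bounded_linear.has_vector_derivative[OF mm.bounded_linear_right this, of "\<pi> (mexp (s *\<^sub>R X))"]
    show ?thesis by (simp add: e[symmetric])
  qed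
  with lin show ?thesis by (rule that)
qed

definition dpi :: "complex^'n^'n \<Rightarrow> complex^'v^'v" where
  "dpi = (SOME L. linear L \<and> (\<forall>X\<in>lie_K \<kappa>. \<forall>s.
    ((\<lambda>s. \<pi> (mexp (s *\<^sub>R X))) has_vector_derivative \<pi> (mexp (s *\<^sub>R X)) ** L X) (at s)))"

lemma linear_dpi: "linear dpi"
  and dpi_derivative: "X \<in> lie_K \<kappa> \<Longrightarrow>
    ((\<lambda>s. \<pi> (mexp (s *\<^sub>R X))) has_vector_derivative \<pi> (mexp (s *\<^sub>R X)) ** dpi X) (at s)"
proof -
  have "\<exists>L. linear L \<and> (\<forall>X\<in>lie_K \<kappa>. \<forall>s.
    ((\<lambda>s. \<pi> (mexp (s *\<^sub>R X))) has_vector_derivative \<pi> (mexp (s *\<^sub>R X)) ** L X) (at s))"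
    using drep_facts by metis
  from someI_ex[OF this] show "linear dpi" "X \<in> lie_K \<kappa> \<Longrightarrow>
    ((\<lambda>s. \<pi> (mexp (s *\<^sub>R X))) has_vector_derivative \<pi> (mexp (s *\<^sub>R X)) ** dpi X) (at s)"
    by (auto simp: dpi_def)
qed

lemma dpi_derivative_0: "X \<in> lie_K \<kappa> \<Longrightarrow> ((\<lambda>s. \<pi> (mexp (s *\<^sub>R X))) has_vector_derivative dpi X) (at 0)"
  using dpi_derivative[of X 0] by (simp add: rep_one)

lemma drep_eq_dpi: "X \<in> lie_K \<kappa> \<Longrightarrow> drep \<pi> X = dpi X"
  unfolding drep_def by (rule vector_derivative_at) (rule dpi_derivative_0)

text \<open>The product \<open>\<pi> (exp (s X)) exp (- s d\<pi>(X))\<close> has derivative zero.\<close>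

lemma rep_mexp: assumes X: "X \<in> lie_K \<kappa>" shows "\<pi> (mexp X) = mexp (dpi X)"
proof -
  define G where "G s = \<pi> (mexp (s *\<^sub>R X)) ** mexp (s *\<^sub>R (- dpi X))" for s
  have "(G has_vector_derivative 0) (at s)" for s
  proof -
    have "(G has_vector_derivative \<pi> (mexp (s *\<^sub>R X)) ** (- dpi X ** mexp (s *\<^sub>R (- dpi X))) +
        (\<pi> (mexp (s *\<^sub>R X)) ** dpi X) ** mexp (s *\<^sub>R (- dpi X))) (at s)"
      unfolding G_def
      by (rule mm.has_vector_derivative[OF dpi_derivative[OF X] has_vector_derivative_mexp])
    then show ?thesis by (simp add: mm.minus_left mm.minus_right matrix_mul_assoc)
  qed
  then obtain c where "\<And>s. G s = c"
    using has_vector_derivative_zero_constant[of UNIV G] by auto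
  then have "G 1 = G 0" by simp
  then have "\<pi> (mexp X) ** mexp (- dpi X) = mat 1" by (simp add: G_def rep_one)
  then have "\<pi> (mexp X) ** (mexp (- dpi X) ** mexp (dpi X)) = mexp (dpi X)" by (simp add: matrix_mul_assoc)
  then show ?thesis by (simp add: mexp_minus)
qed

lemma lie_K_conj: "g \<in> K_group \<kappa> \<Longrightarrow> X \<in> lie_K \<kappa> \<Longrightarrow> g ** X ** herm g \<in> lie_K \<kappa>"
proof -
  assume g: "g \<in> K_group \<kappa>" and X: "X \<in> lie_K \<kappa>"
  have "trace (g ** X ** herm g) = trace (herm g ** (g ** X))" by (rule trace_mul_sym)
  also have "\<dots> = 0" using X by (simp add: matrix_mul_assoc K_groupD(3)[OF g] lie_K_def)
  finally show ?thesis using K_groupD[OF g] X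
    by (auto simp: lie_K_def matrices_over_mult matrices_over_herm herm_mult mm.minus_left mm.minus_right matrix_mul_assoc)
qed

lemma dpi_conj:
  assumes g: "g \<in> K_group \<kappa>" and X: "X \<in> lie_K \<kappa>"
  shows "\<pi> g ** dpi X ** \<pi> (herm g) = dpi (g ** X ** herm g)"
proof -
  have e: "\<pi> (mexp (s *\<^sub>R (g ** X ** herm g))) = \<pi> g ** \<pi> (mexp (s *\<^sub>R X)) ** \<pi> (herm g)" for s
  proof -
    have "mexp (s *\<^sub>R (g ** X ** herm g)) = g ** mexp (s *\<^sub>R X) ** herm g"
      using mexp_similar[OF K_groupD(3)[OF g], of "s *\<^sub>R X"] by (simp add: mm.scaleR_left mm.scaleR_right)
    then show ?thesis
      by (simp add: rep_mult K_group_mult K_group_herm g mexp_lie_K[OF X])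
  qed
  have "((\<lambda>s. \<pi> g ** \<pi> (mexp (s *\<^sub>R X)) ** \<pi> (herm g)) has_vector_derivative \<pi> g ** dpi X ** \<pi> (herm g)) (at 0)"
    by (rule bounded_linear.has_vector_derivative[OF mm.bounded_linear_left])
       (rule bounded_linear.has_vector_derivative[OF mm.bounded_linear_right dpi_derivative_0[OF X]])
  moreover have "((\<lambda>s. \<pi> g ** \<pi> (mexp (s *\<^sub>R X)) ** \<pi> (herm g)) has_vector_derivative dpi (g ** X ** herm g)) (at 0)"
    using dpi_derivative_0[OF lie_K_conj[OF g X]] by (simp add: e)
  ultimately show ?thesis by (rule vector_derivative_unique_at)
qed

text \<open>Both sides are the derivative at \<open>0\<close> of \<open>\<pi>(exp (s X)) d\<pi>(Y) \<pi>(exp (- s X))\<close>.\<close>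

lemma dpi_bracket:
  assumes X: "X \<in> lie_K \<kappa>" and Y: "Y \<in> lie_K \<kappa>"
  shows "dpi (X ** Y - Y ** X) = dpi X ** dpi Y - dpi Y ** dpi X"
proof -
  let ?E = "\<lambda>s. mexp (s *\<^sub>R X)" and ?E' = "\<lambda>s. mexp (s *\<^sub>R (- X))"
  have hE: "herm (?E s) = ?E' s" for s using X by (simp add: herm_mexp herm_scaleR lie_K_def)
  have mX: "- X \<in> lie_K \<kappa>" using X matrices_over_scaleR[of X \<kappa> "-1"] trace_scaleR[of "-1" X]
    by (simp add: lie_K_def herm_minus)
  have dm: "dpi (- X) = - dpi X" using linear_neg[OF linear_dpi] .
  have "((\<lambda>s. ?E s ** Y ** ?E' s) has_vector_derivative ?E 0 ** Y ** (- X ** ?E' 0) + (X ** ?E 0) ** Y ** ?E' 0) (at 0)"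
    by (rule mm.has_vector_derivative[OF bounded_linear.has_vector_derivative[OF mm.bounded_linear_left
        has_vector_derivative_mexp] has_vector_derivative_mexp])
  then have "((\<lambda>s. ?E s ** Y ** ?E' s) has_vector_derivative X ** Y - Y ** X) (at 0)"
    by (simp add: mm.minus_right)
  from bounded_linear.has_vector_derivative[OF linear_dpi[unfolded linear_conv_bounded_linear] this]
  have "((\<lambda>s. dpi (?E s ** Y ** ?E' s)) has_vector_derivative dpi (X ** Y - Y ** X)) (at 0)" .
  moreover have "((\<lambda>s. \<pi> (?E s) ** dpi Y ** \<pi> (?E' s)) has_vector_derivative
      \<pi> (?E 0) ** dpi Y ** dpi (- X) + dpi X ** dpi Y ** \<pi> (?E' 0)) (at 0)"
    by (rule mm.has_vector_derivative[OF bounded_linear.has_vector_derivative[OF mm.bounded_linear_left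
        dpi_derivative_0[OF X]] dpi_derivative_0[OF mX]])
  then have "((\<lambda>s. dpi (?E s ** Y ** ?E' s)) has_vector_derivative dpi X ** dpi Y - dpi Y ** dpi X) (at 0)"
    using dpi_conj[OF mexp_lie_K[OF X] Y] by (simp add: hE rep_one dm mm.minus_right)
  ultimately show ?thesis by (rule vector_derivative_unique_at)
qed

end

section \<open>Polynomial functions of a matrix and their invariant derivations\<close>

inductive matpoly :: "(complex^'n::finite^'n \<Rightarrow> complex) \<Rightarrow> bool" where
  const: "matpoly (\<lambda>_. c)"
| entry: "matpoly (\<lambda>g. g $ i $ j)"
| add: "matpoly F \<Longrightarrow> matpoly G \<Longrightarrow> matpoly (\<lambda>g. F g + G g)"
| mult: "matpoly F \<Longrightarrow> matpoly G \<Longrightarrow> matpoly (\<lambda>g. F g * G g)"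

lemma matpoly_sum: "finite I \<Longrightarrow> (\<And>i. i \<in> I \<Longrightarrow> matpoly (F i)) \<Longrightarrow> matpoly (\<lambda>g. \<Sum>i\<in>I. F i g)"
  by (induction rule: finite_induct) (auto intro: matpoly.intros)

lemma matpoly_prod: "finite I \<Longrightarrow> (\<And>i. i \<in> I \<Longrightarrow> matpoly (F i)) \<Longrightarrow> matpoly (\<lambda>g. \<Prod>i\<in>I. F i g)"
  by (induction rule: finite_induct) (auto intro: matpoly.intros)

lemma matpoly_power: "matpoly F \<Longrightarrow> matpoly (\<lambda>g. F g ^ n)"
  by (induction n) (auto intro: matpoly.intros)

text \<open>The derivation by the left invariant vector field of \<open>Z\<close>.\<close>

definition mder :: "complex^'n::finite^'n \<Rightarrow> (complex^'n^'n \<Rightarrow> complex) \<Rightarrow> complex^'n^'n \<Rightarrow> complex" where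
  "mder Z F g = deriv (\<lambda>s. F (g + cscale s (g ** Z))) 0"

lemma matpoly_derivative:
  "matpoly F \<Longrightarrow> \<exists>F'. matpoly F' \<and> (\<forall>c s. mderiv c (c s ** Z) s \<longrightarrow>
    ((\<lambda>s. F (c s)) has_field_derivative F' (c s)) (at s))"
proof (induction rule: matpoly.induct)
  case (const c)
  show ?case by (intro exI[of _ "\<lambda>_. 0"]) (auto intro: matpoly.intros)
next
  case (entry i j)
  show ?case
  proof (intro exI[of _ "\<lambda>g. (g ** Z) $ i $ j"] conjI allI impI)
    show "matpoly (\<lambda>g. (g ** Z) $ i $ j)"
      unfolding matrix_mult_nth by (intro matpoly_sum matpoly.intros) auto
  qed (simp add: mderiv_def)
next
  case (add F G)
  then obtain F' G' where "matpoly F'" "matpoly G'"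
    "\<And>c s. mderiv c (c s ** Z) s \<Longrightarrow> ((\<lambda>s. F (c s)) has_field_derivative F' (c s)) (at s)"
    "\<And>c s. mderiv c (c s ** Z) s \<Longrightarrow> ((\<lambda>s. G (c s)) has_field_derivative G' (c s)) (at s)" by metis
  then show ?case
    by (intro exI[of _ "\<lambda>g. F' g + G' g"]) (auto intro!: matpoly.intros derivative_intros)
next
  case (mult F G)
  then obtain F' G' where FG: "matpoly F'" "matpoly G'"
    "\<And>c s. mderiv c (c s ** Z) s \<Longrightarrow> ((\<lambda>s. F (c s)) has_field_derivative F' (c s)) (at s)"
    "\<And>c s. mderiv c (c s ** Z) s \<Longrightarrow> ((\<lambda>s. G (c s)) has_field_derivative G' (c s)) (at s)" by metis
  show ?case
  proof (intro exI[of _ "\<lambda>g. F' g * G g + G' g * F g"] conjI allI impI)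
    show "matpoly (\<lambda>g. F' g * G g + G' g * F g)" using FG mult by (intro matpoly.intros)
    show "((\<lambda>s. F (c s) * G (c s)) has_field_derivative F' (c s) * G (c s) + G' (c s) * F (c s)) (at s)"
      if "mderiv c (c s ** Z) s" for c s
      by (rule DERIV_mult[OF FG(3)[OF that] FG(4)[OF that]])
  qed
qed

lemma mderiv_line: "mderiv (\<lambda>s. g + cscale s (g ** Z)) (g ** Z) s"
  using mderiv_add[OF mderiv_const[of g s] mderiv_cscale[of "g ** Z" s]] by simp

lemma mder_curve:
  assumes F: "matpoly F"
  shows "mderiv c (c s ** Z) s \<Longrightarrow> ((\<lambda>s. F (c s)) has_field_derivative mder Z F (c s)) (at s)"
  and matpoly_mder: "matpoly (mder Z F)"
proof -
  obtain F' where F': "matpoly F'" "\<And>c s. mderiv c (c s ** Z) s \<Longrightarrow> ((\<lambda>s. F (c s)) has_field_derivative F' (c s)) (at s)"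
    using matpoly_derivative[OF F] by metis
  have "mder Z F g = F' g" for g
  proof -
    have "mderiv (\<lambda>s. g + cscale s (g ** Z)) ((g + cscale 0 (g ** Z)) ** Z) 0"
      using mderiv_line[of g Z 0] by simp
    from F'(2)[OF this] show ?thesis unfolding mder_def by (intro DERIV_imp_deriv) simp
  qed
  then have "mder Z F = F'" by (rule ext)
  then show "mderiv c (c s ** Z) s \<Longrightarrow> ((\<lambda>s. F (c s)) has_field_derivative mder Z F (c s)) (at s)"
    "matpoly (mder Z F)"
    using F' by auto
qed

lemma mder_line: "matpoly F \<Longrightarrow> ((\<lambda>s. F (g + cscale s (g ** Z))) has_field_derivative mder Z F g) (at 0)"
  using mder_curve(1)[of F "\<lambda>s. g + cscale s (g ** Z)" 0 Z] mderiv_line[of g Z 0] by simp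

lemma mder_rules:
  "mder Z (\<lambda>_. c) = (\<lambda>_. 0)"
  "mder Z (\<lambda>g. g $ i $ j) = (\<lambda>g. (g ** Z) $ i $ j)"
  "matpoly F \<Longrightarrow> matpoly G \<Longrightarrow> mder Z (\<lambda>g. F g + G g) = (\<lambda>g. mder Z F g + mder Z G g)"
  "matpoly F \<Longrightarrow> matpoly G \<Longrightarrow> mder Z (\<lambda>g. F g * G g) = (\<lambda>g. mder Z F g * G g + mder Z G g * F g)"
proof -
  show "mder Z (\<lambda>_. c) = (\<lambda>_. 0)" by (simp add: mder_def fun_eq_iff)
  show "mder Z (\<lambda>g. g $ i $ j) = (\<lambda>g. (g ** Z) $ i $ j)"
  proof
    fix g
    have "((\<lambda>s. (g + cscale s (g ** Z)) $ i $ j) has_field_derivative (g ** Z) $ i $ j) (at 0)"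
      using mderiv_line[of g Z 0] by (simp add: mderiv_def)
    then show "mder Z (\<lambda>g. g $ i $ j) g = (g ** Z) $ i $ j" unfolding mder_def by (rule DERIV_imp_deriv)
  qed
  assume F: "matpoly F" and G: "matpoly G"
  show "mder Z (\<lambda>g. F g + G g) = (\<lambda>g. mder Z F g + mder Z G g)"
    by (rule ext, subst mder_def, rule DERIV_imp_deriv) (rule DERIV_add[OF mder_line[OF F] mder_line[OF G]])
  show "mder Z (\<lambda>g. F g * G g) = (\<lambda>g. mder Z F g * G g + mder Z G g * F g)"
  proof
    fix g
    show "mder Z (\<lambda>g. F g * G g) g = mder Z F g * G g + mder Z G g * F g"
      using DERIV_mult[OF mder_line[OF F, of g Z] mder_line[OF G, of g Z]]
      by (subst mder_def, intro DERIV_imp_deriv) simp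
  qed
qed

lemma mder_linear:
  assumes "matpoly F" shows "mder (cscale a Z + cscale b W) F = (\<lambda>g. a * mder Z F g + b * mder W F g)"
  using assms
proof (induction rule: matpoly.induct)
  case (entry i j)
  show ?case by (simp add: mder_rules mm.add_right cscale_mult_right)
qed (simp_all add: mder_rules fun_eq_iff algebra_simps)

lemma mder_add: "matpoly F \<Longrightarrow> mder (Z + W) F = (\<lambda>g. mder Z F g + mder W F g)"
  and mder_cscale: "matpoly F \<Longrightarrow> mder (cscale a Z) F = (\<lambda>g. a * mder Z F g)"
  using mder_linear[of F 1 Z 1 W] mder_linear[of F a Z 0 0] by simp_all

text \<open>Both sides are derivations of the algebra of polynomial functions, so it suffices to compare them on
  the matrix entries.\<close>

lemma mder_bracket:
  assumes "matpoly F"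
  shows "(\<lambda>g. mder Z (mder W F) g - mder W (mder Z F) g) = mder (Z ** W - W ** Z) F"
  using assms
proof (induction rule: matpoly.induct)
  case (entry i j)
  have "(\<lambda>g. (g ** V) $ i $ j) = (\<lambda>g. \<Sum>k\<in>UNIV. g $ i $ k * V $ k $ j)" for V :: "complex^'a^'a"
    by (simp add: matrix_mult_nth fun_eq_iff)
  have lin: "mder A (\<lambda>g. (g ** V) $ i $ j) g = (g ** A ** V) $ i $ j" for A V g :: "complex^'a^'a"
  proof -
    have "((\<lambda>s. ((g + cscale s (g ** A)) ** V) $ i $ j) has_field_derivative (g ** A ** V) $ i $ j) (at 0)"
      using mderiv_mult[OF mderiv_line[of g A 0] mderiv_const[of V 0]] by (simp add: mderiv_def mm.zero_right)
    then show ?thesis unfolding mder_def by (rule DERIV_imp_deriv)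
  qed
  show ?case by (simp add: mder_rules lin fun_eq_iff mm.diff_right matrix_mul_assoc)
next
  case (mult F G)
  have e: "mder Z (mder W F) g - mder W (mder Z F) g = mder (Z ** W - W ** Z) F g"
    "mder Z (mder W G) g - mder W (mder Z G) g = mder (Z ** W - W ** Z) G g" for g
    using mult.IH by (auto dest: fun_cong)
  have D2: "mder A (mder B (\<lambda>g. F g * G g)) = (\<lambda>g. (mder A (mder B F) g * G g + mder A G g * mder B F g) +
      (mder A (mder B G) g * F g + mder A F g * mder B G g))" for A B
    unfolding mder_rules(4)[OF mult.hyps, of B]
      mder_rules(3)[OF matpoly.mult[OF matpoly_mder[OF mult.hyps(1)] mult.hyps(2)]
        matpoly.mult[OF matpoly_mder[OF mult.hyps(2)] mult.hyps(1)]]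
      mder_rules(4)[OF matpoly_mder[OF mult.hyps(1)] mult.hyps(2)]
      mder_rules(4)[OF matpoly_mder[OF mult.hyps(2)] mult.hyps(1)] ..
  have "mder Z (mder W (\<lambda>g. F g * G g)) g - mder W (mder Z (\<lambda>g. F g * G g)) g =
      (mder Z (mder W F) g - mder W (mder Z F) g) * G g + (mder Z (mder W G) g - mder W (mder Z G) g) * F g" for g
    by (simp add: D2 algebra_simps)
  then show ?case by (simp add: e mder_rules mult.hyps)
next
  case (add F G)
  have e: "mder Z (mder W F) g - mder W (mder Z F) g = mder (Z ** W - W ** Z) F g"
    "mder Z (mder W G) g - mder W (mder Z G) g = mder (Z ** W - W ** Z) G g" for g
    using add.IH by (auto dest: fun_cong)
  have "mder Z (mder W (\<lambda>g. F g + G g)) g - mder W (mder Z (\<lambda>g. F g + G g)) g =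
      (mder Z (mder W F) g - mder W (mder Z F) g) + (mder Z (mder W G) g - mder W (mder Z G) g)" for g
    by (simp add: mder_rules add.hyps matpoly_mder)
  then show ?case by (simp add: e mder_rules add.hyps)
qed (simp add: mder_rules)

section \<open>The model function\<close>

text \<open>The columns of \<open>weight_frame\<close> are the vectors \<open>e\<^sub>j - \<i> e\<^sub>j'\<close> of weight \<open>\<epsilon>\<^sub>j\<close> under \<open>Y_elt\<close>.\<close>

definition weight_frame :: "complex^'p::{finite, linorder}^('p::{finite, linorder} + 'q::{finite, linorder})" where
  "weight_frame = (\<chi> i b. case i of Inl a \<Rightarrow> (if a = b then 1 else 0)
     | Inr r \<Rightarrow> (if r = last_rows b then - \<i> else 0))"

lemma weight_frame_nth [simp]:
  "weight_frame $ Inl a $ b = (if a = b then 1 else 0)"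
  "weight_frame $ Inr r $ b = (if r = last_rows b then - \<i> else 0)"
  by (simp_all add: weight_frame_def)

definition frame_minor ::
  "('p::{finite, linorder}, 'q::{finite, linorder}) bmat \<Rightarrow> complex^'p::{finite, linorder}^'p::{finite, linorder}" where
  "frame_minor g = (\<chi> a b. (g ** weight_frame) $ Inl a $ b)"

text \<open>This is the coefficient \<open>\<langle>g u, e\<rangle>\<close> of a highest weight vector \<open>u\<close> against a \<open>\<chi>\<close>-spherical vector \<open>e\<close>
  in the Cartan power \<open>k\<close> of the \<open>p\<close>-th exterior power of the standard representation, written down
  without constructing that representation.\<close>

definition model :: "nat \<Rightarrow> ('p::{finite, linorder}, 'q::{finite, linorder}) bmat \<Rightarrow> complex" where
  "model k g = det (frame_minor g) ^ k"

lemma frame_minor_nth: "frame_minor g $ a $ b = g $ Inl a $ Inl b - \<i> * g $ Inl a $ Inr (last_rows b)"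
  by (simp add: frame_minor_def matrix_mult_nth sum_UNIV_sum if_distrib cong: if_cong)

lemma matpoly_model: "matpoly (model k)"
proof -
  have e: "matpoly (\<lambda>g::('p::{finite, linorder}, 'q::{finite, linorder}) bmat. frame_minor g $ a $ b)" for a b
    using matpoly.add[OF matpoly.entry[of "Inl a" "Inl b"]
        matpoly.mult[OF matpoly.const[of "- \<i>"] matpoly.entry[of "Inl a" "Inr (last_rows b)"]]]
    by (simp add: frame_minor_nth)
  show ?thesis
    unfolding model_def[abs_def] det_def
    by (intro matpoly_power matpoly_sum matpoly.mult[OF matpoly.const] matpoly_prod e) (auto simp: finite_permutations)
qed

lemma model_one: "model k (mat 1 :: ('p::{finite, linorder}, 'q::{finite, linorder}) bmat) = 1"
proof -
  have "frame_minor (mat 1 :: ('p, 'q) bmat) = mat 1" by (simp add: vec_eq_iff frame_minor_nth mat_nth)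
  then show ?thesis by (simp add: model_def)
qed

lemma frame_minor_left: "frame_minor (diag_blocks A B ** g) = A ** frame_minor g"
  by (simp add: vec_eq_iff frame_minor_nth matrix_mult_nth diag_blocks_def sum_UNIV_sum
      sum_distrib_left sum_subtractf[symmetric] algebra_simps)

lemma frame_minor_right: "Z ** weight_frame = weight_frame ** S \<Longrightarrow> frame_minor (g ** Z) = frame_minor g ** S"
proof -
  assume Z: "Z ** weight_frame = weight_frame ** S"
  have "g ** Z ** weight_frame = g ** weight_frame ** S" by (simp add: Z flip: matrix_mul_assoc)
  then show ?thesis by (simp add: frame_minor_def vec_eq_iff matrix_mult_nth)
qed

lemma det_line_power: "((\<lambda>s. det (mat 1 + cscale s S) ^ k) has_field_derivative of_nat k * trace S) (at 0)"
  for S :: "complex^'n::finite^'n"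
proof -
  have "mderiv (\<lambda>s. mat 1 + cscale s S) S 0"
    using mderiv_add[OF mderiv_const[of "mat 1" 0] mderiv_cscale[of S 0]] by simp
  from det_deriv_at_identity[OF this] have "((\<lambda>s. det (mat 1 + cscale s S)) has_field_derivative trace S) (at 0)" by simp
  from DERIV_power[OF this, of k] show ?thesis by simp
qed

text \<open>Right multiplication by \<open>1 + s Z\<close> multiplies the minor by \<open>1 + s S\<close>, whose determinant has derivative
  \<open>trace S\<close>.\<close>

lemma mder_model_right:
  assumes Z: "Z ** weight_frame = weight_frame ** S"
  shows "mder Z (model k) = (\<lambda>g. of_nat k * trace S * model k g)"
proof
  fix g
  have lin: "frame_minor (g + cscale s (g ** Z)) = frame_minor g ** (mat 1 + cscale s S)" for s
  proof -
    have "frame_minor (g + cscale s (g ** Z)) = frame_minor g + cscale s (frame_minor (g ** Z))"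
      by (simp add: vec_eq_iff frame_minor_nth algebra_simps)
    then show ?thesis by (simp add: frame_minor_right[OF Z] mm.add_right cscale_mult_right)
  qed
  have "((\<lambda>s. model k (g + cscale s (g ** Z))) has_field_derivative model k g * (of_nat k * trace S)) (at 0)"
    unfolding model_def lin det_mul power_mult_distrib by (rule DERIV_cmult[OF det_line_power])
  then show "mder Z (model k) g = of_nat k * trace S * model k g"
    unfolding mder_def by (intro DERIV_imp_deriv) (simp add: mult_ac)
qed

text \<open>Block diagonal matrices on the left act through a power of the determinant of the first block; this
  property passes to derivatives by left invariant vector fields.\<close>

definition left_equivariant :: "nat \<Rightarrow> (('p::finite, 'q::finite) bmat \<Rightarrow> complex) \<Rightarrow> bool" where
  "left_equivariant k F \<longleftrightarrow> (\<forall>A B g. F (diag_blocks A B ** g) = det A ^ k * F g)"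

lemma left_equivariant_model: "left_equivariant k (model k)"
  by (simp add: left_equivariant_def model_def frame_minor_left det_mul power_mult_distrib)

lemma left_equivariant_mder:
  assumes F: "matpoly F" "left_equivariant k F" shows "left_equivariant k (mder Z F)"
  unfolding left_equivariant_def
proof (intro allI)
  fix A B g
  have "F (diag_blocks A B ** g + cscale s (diag_blocks A B ** g ** Z)) = det A ^ k * F (g + cscale s (g ** Z))" for s
  proof -
    have "diag_blocks A B ** g + cscale s (diag_blocks A B ** g ** Z) = diag_blocks A B ** (g + cscale s (g ** Z))"
      by (simp add: mm.add_right cscale_mult_right matrix_mul_assoc)
    then show ?thesis using F(2) by (simp add: left_equivariant_def)
  qed
  then show "mder Z F (diag_blocks A B ** g) = det A ^ k * mder Z F g"
    using DERIV_cmult[OF mder_line[OF F(1), of g Z], of "det A ^ k"]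
    unfolding mder_def[of Z F "diag_blocks A B ** g"] by (intro DERIV_imp_deriv) simp
qed

lemma mder_left_equivariant_one:
  assumes F: "matpoly F" "left_equivariant k F"
  shows "mder (diag_blocks A B) F (mat 1) = of_nat k * trace A * F (mat 1)"
proof -
  have "F (mat 1 + cscale s (mat 1 ** diag_blocks A B)) = det (mat 1 + cscale s A) ^ k * F (mat 1)" for s
  proof -
    have "mat 1 + cscale s (mat 1 ** diag_blocks A B) = diag_blocks (mat 1 + cscale s A) (mat 1 + cscale s B) ** mat 1"
      by (simp add: vec_eq_iff all_sum_iff diag_blocks_def mat_nth)
    then show ?thesis using F(2) unfolding left_equivariant_def by metis
  qed
  then show ?thesis
    using DERIV_cmult_right[OF det_line_power[of A k], of "F (mat 1)"]
    unfolding mder_def by (intro DERIV_imp_deriv) (simp add: mult_ac)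
qed

section \<open>Reordering words\<close>

text \<open>A partial Poincare-Birkhoff-Witt argument for a linear form \<open>W\<close> on words in \<open>k\<close> that transforms by a
  character under a subalgebra \<open>L\<close> on the left.  The last letter of a word may be replaced by an element
  of \<open>L\<close> and a scalar; moving that element to the left end costs only shorter words.\<close>

lemma words_vanish:
  fixes W :: "'x list \<Rightarrow> complex"
  assumes bracket: "\<And>As Bs X Y. set As \<subseteq> k \<Longrightarrow> set Bs \<subseteq> k \<Longrightarrow> X \<in> k \<Longrightarrow> Y \<in> k \<Longrightarrow>
      W (As @ X # Y # Bs) = W (As @ Y # X # Bs) + W (As @ br X Y # Bs)"
    and br: "\<And>X Y. X \<in> k \<Longrightarrow> Y \<in> k \<Longrightarrow> br X Y \<in> k"
    and left: "\<And>l Zs. l \<in> L \<Longrightarrow> set Zs \<subseteq> k \<Longrightarrow> W (l # Zs) = ch l * W Zs" "L \<subseteq> k"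
    and right: "\<And>Z. Z \<in> k \<Longrightarrow> \<exists>l\<in>L. \<exists>c. \<forall>Zs. set Zs \<subseteq> k \<longrightarrow> W (Zs @ [Z]) = W (Zs @ [l]) + c * W Zs"
    and nil: "W [] = 0"
    and Zs: "set Zs \<subseteq> k"
  shows "W Zs = 0"
  using Zs
proof (induction "length Zs" arbitrary: Zs rule: less_induct)
  case less
  show ?case
  proof (cases Zs rule: rev_cases)
    case Nil
    then show ?thesis by (simp add: nil)
  next
    case (snoc Ys Z)
    then have Ys: "set Ys \<subseteq> k" and Z: "Z \<in> k" using less.prems by auto
    obtain l c where l: "l \<in> L" and lc: "\<And>Zs. set Zs \<subseteq> k \<Longrightarrow> W (Zs @ [Z]) = W (Zs @ [l]) + c * W Zs"
      using right[OF Z] by blast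
    have lk: "l \<in> k" using l left(2) by auto
    have move: "W (As @ l # Bs) = 0"
      if "set As \<subseteq> k" "set Bs \<subseteq> k" "length As + length Bs = length Ys" for As Bs
      using that
    proof (induction As arbitrary: Bs rule: rev_induct)
      case Nil
      then have "W Bs = 0" by (intro less.hyps) (auto simp: snoc)
      then show ?case using Nil left(1)[OF l] by simp
    next
      case (snoc X As)
      have "W (As @ X # l # Bs) = W (As @ l # X # Bs) + W (As @ br X l # Bs)"
        using snoc.prems lk by (intro bracket) auto
      moreover have "W (As @ l # X # Bs) = 0" using snoc.prems by (intro snoc.IH) auto
      moreover have "W (As @ br X l # Bs) = 0"
        using snoc.prems lk br by (intro less.hyps) (auto simp: \<open>Zs = Ys @ [Z]\<close>)
      ultimately show ?case by simp
    qed
    have "W Ys = 0" using Ys by (intro less.hyps) (auto simp: snoc)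
    then show ?thesis using lc[OF Ys] move[of Ys "[]"] Ys by (simp add: snoc)
  qed
qed

section \<open>Restricted weights and roots\<close>

lemma card_greater_inj: "card {k::'a::{finite, linorder}. i < k} = card {k. j < k} \<Longrightarrow> i = j"
proof (rule ccontr)
  assume eq: "card {k. i < k} = card {k. j < k}" and ne: "i \<noteq> j"
  have "card {k. b < k} < card {k. a < k}" if "a < b" for a b :: 'a
    using that by (intro psubset_card_mono) auto
  then show False using eq ne by (metis less_irrefl neqE)
qed

lemma last_rows_card:
  assumes "CARD('p::{finite, linorder}) \<le> CARD('q::{finite, linorder})"
  shows "card {k. (last_rows (i::'p) :: 'q) < k} = card {k. i < k}"
proof -
  let ?f = "\<lambda>j::'q. card {k. j < k}"
  have lt: "card {k::'a::{finite, linorder}. a < k} < CARD('a)" for a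
    by (intro psubset_card_mono) auto
  have "inj ?f" by (rule injI) (rule card_greater_inj)
  moreover have "range ?f \<subseteq> {..<CARD('q)}" using lt by auto
  ultimately have "range ?f = {..<CARD('q)}" by (intro card_subset_eq) (auto simp: card_image)
  moreover have "card {k. i < k} < CARD('q)" using lt[of i] assms by simp
  ultimately obtain j where j: "?f j = card {k. i < k}" by (metis (mono_tags, lifting) imageE lessThan_iff)
  have "(THE j::'q. card {k. j < k} = card {k. i < k}) = j"
    using j by (intro the_equality) (auto intro: card_greater_inj)
  then show ?thesis using j by (simp add: last_rows_def)
qed

lemma inj_last_rows:
  assumes "CARD('p::{finite, linorder}) \<le> CARD('q::{finite, linorder})"
  shows "inj (last_rows :: 'p \<Rightarrow> 'q)"
  using last_rows_card[OF assms] card_greater_inj by (metis injI)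

definition Y_complex :: "complex^'p::{finite, linorder} \<Rightarrow> ('p::{finite, linorder}, 'q::{finite, linorder}) bmat" where
  "Y_complex c = blocks 0 (\<chi> i j. if j = last_rows i then - c $ i else 0)
                          (\<chi> j i. if j = last_rows i then c $ i else 0) 0"

lemma Y_elt_complex: "Y_elt t = Y_complex (\<chi> i. of_real (t $ i))"
  unfolding Y_elt_def Y_complex_def blocks_eq_iff by (simp add: vec_eq_iff)

lemma Y_complex_nth [simp]:
  "Y_complex c $ Inl i $ Inl j = 0" "Y_complex c $ Inl i $ Inr r = (if r = last_rows i then - c $ i else 0)"
  "Y_complex c $ Inr r $ Inl i = (if r = last_rows i then c $ i else 0)" "Y_complex c $ Inr r $ Inr r' = 0"
  by (simp_all add: Y_complex_def)

lemma axis_component: "axis i x $ j = (if i = j then x else 0)"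
  by (simp add: axis_def)

locale small_block =
  fixes dummy :: "('p::{finite, linorder} \<times> 'q::{finite, linorder}) itself"
  assumes card_le: "CARD('p) \<le> CARD('q)"
begin

abbreviation lr :: "'p \<Rightarrow> 'q" where "lr \<equiv> last_rows"

lemma lr_eq_iff [simp]: "lr i = lr j \<longleftrightarrow> i = j"
  using inj_last_rows[OF card_le] by (auto dest: injD)

lemma Y_mult_nth:
  fixes Z :: "complex^'n::finite^('p + 'q)"
  shows "(Y_complex c ** Z) $ Inl i $ k = - c $ i * Z $ Inr (lr i) $ k"
  "(Y_complex c ** Z) $ Inr (lr i) $ k = c $ i * Z $ Inl i $ k"
  "r \<notin> range lr \<Longrightarrow> (Y_complex c ** Z) $ Inr r $ k = 0"
  by (simp_all add: matrix_mult_nth sum_UNIV_sum if_distrib if_distribR image_iff cong: if_cong)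

lemma mult_Y_nth:
  fixes Z :: "complex^('p + 'q)^'n::finite"
  shows "(Z ** Y_complex c) $ k $ Inl j = Z $ k $ Inr (lr j) * c $ j"
  "(Z ** Y_complex c) $ k $ Inr (lr j) = - Z $ k $ Inl j * c $ j"
  "r \<notin> range lr \<Longrightarrow> (Z ** Y_complex c) $ k $ Inr r = 0"
  by (simp_all add: matrix_mult_nth sum_UNIV_sum if_distrib if_distribR image_iff cong: if_cong)

lemma Y_mult_vec_nth:
  "(Y_complex c *v x) $ Inl i = - c $ i * x $ Inr (lr i)"
  "(Y_complex c *v x) $ Inr (lr i) = c $ i * x $ Inl i"
  "r \<notin> range lr \<Longrightarrow> (Y_complex c *v x) $ Inr r = 0"
  by (simp_all add: matrix_vector_mult_def sum_UNIV_sum if_distrib if_distribR image_iff cong: if_cong)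

lemma all_index_iff: "(\<forall>i::'p + 'q. P i) \<longleftrightarrow> (\<forall>i. P (Inl i)) \<and> (\<forall>i. P (Inr (lr i))) \<and> (\<forall>r. r \<notin> range lr \<longrightarrow> P (Inr r))"
  unfolding all_sum_iff by (metis rangeE)

definition has_weight :: "complex^('p::{finite, linorder} + 'q::{finite, linorder}) \<Rightarrow> real^'p::{finite, linorder} \<Rightarrow> bool" where
  "has_weight x \<gamma> \<longleftrightarrow> (\<forall>t. Y_elt t *v x = (\<i> * of_real (\<gamma> \<bullet> t)) *s x)"

lemma has_weight_iff:
  "has_weight x \<gamma> \<longleftrightarrow> (\<forall>t. (\<forall>i. - (of_real (t $ i) * x $ Inr (lr i)) = \<i> * of_real (\<gamma> \<bullet> t) * x $ Inl i \<and>
      of_real (t $ i) * x $ Inl i = \<i> * of_real (\<gamma> \<bullet> t) * x $ Inr (lr i)) \<and>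
    (\<forall>r. r \<notin> range lr \<longrightarrow> of_real (\<gamma> \<bullet> t) * x $ Inr r = 0))"
  unfolding has_weight_def Y_elt_complex vec_eq_iff all_index_iff Y_mult_vec_nth vector_smult_component
  by (auto simp: Y_mult_vec_nth)

text \<open>In each plane spanned by the coordinates \<open>i\<close> and \<open>lr i\<close> the element \<open>Y_elt t\<close> acts as \<open>t\<^sub>i\<close> times a
  rotation by a right angle, with eigenvalues \<open>\<plusminus>\<i> t\<^sub>i\<close>; the other coordinates have weight zero.\<close>

lemma weight_cases:
  assumes x: "has_weight x \<gamma>" "x \<noteq> 0"
  shows "\<gamma> = 0 \<or> (\<exists>i. \<gamma> = axis i 1 \<or> \<gamma> = - axis i 1)"
proof (cases "\<exists>r. r \<notin> range lr \<and> x $ Inr r \<noteq> 0")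
  case True
  then have "\<gamma> \<bullet> \<gamma> = 0" using x(1) unfolding has_weight_iff by (metis mult_eq_0_iff of_real_eq_0_iff)
  then show ?thesis by simp
next
  case False
  then obtain i where i: "x $ Inl i \<noteq> 0 \<or> x $ Inr (lr i) \<noteq> 0"
    using x(2) by (auto simp: vec_eq_iff all_index_iff)
  have sq: "(t $ i)\<^sup>2 = (\<gamma> \<bullet> t)\<^sup>2" for t
  proof -
    let ?t = "complex_of_real (t $ i)" and ?g = "complex_of_real (\<gamma> \<bullet> t)"
    have 1: "- (?t * x $ Inr (lr i)) = \<i> * ?g * x $ Inl i" and 2: "?t * x $ Inl i = \<i> * ?g * x $ Inr (lr i)"
      using x(1) unfolding has_weight_iff by auto
    have "?t * (?t * x $ Inl i) = \<i> * ?g * (?t * x $ Inr (lr i))" unfolding 2 by (simp add: mult_ac)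
    also have "\<dots> = - (\<i> * ?g * (\<i> * ?g * x $ Inl i))" unfolding 1[symmetric] by simp
    finally have a: "?t\<^sup>2 * x $ Inl i = ?g\<^sup>2 * x $ Inl i" by (simp add: power2_eq_square mult_ac)
    have "?t * (?t * x $ Inr (lr i)) = - (\<i> * ?g * (?t * x $ Inl i))"
      using arg_cong[OF 1, of "\<lambda>z. - (?t * z)"] by (simp add: mult_ac)
    also have "\<dots> = - (\<i> * ?g * (\<i> * ?g * x $ Inr (lr i)))" unfolding 2 ..
    finally have b: "?t\<^sup>2 * x $ Inr (lr i) = ?g\<^sup>2 * x $ Inr (lr i)" by (simp add: power2_eq_square mult_ac)
    have "?t\<^sup>2 = ?g\<^sup>2" using a b i by auto
    then show ?thesis by (metis of_real_eq_iff of_real_power)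
  qed
  have g: "(\<gamma> $ j)\<^sup>2 = (if i = j then 1 else 0)" for j
    using sq[of "axis j 1"] by (auto simp: inner_axis axis_component)
  have "(\<gamma> $ i)\<^sup>2 = 1" using g[of i] by simp
  then have "\<gamma> $ i = 1 \<or> \<gamma> $ i = - 1" by (simp add: power2_eq_1_iff)
  moreover have "\<gamma> $ j = 0" if "j \<noteq> i" for j using g[of j] that by simp
  ultimately
  show ?thesis by (auto simp: vec_eq_iff axis_def)
qed

lemma weight_axis:
  assumes x: "has_weight x (axis i 1)"
  shows "x = x $ Inl i *s column i weight_frame"
proof -
  have w: "- (of_real (t $ j) * x $ Inr (lr j)) = \<i> * of_real (t $ i) * x $ Inl j"
    "of_real (t $ j) * x $ Inl j = \<i> * of_real (t $ i) * x $ Inr (lr j)"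
    "r \<notin> range lr \<Longrightarrow> of_real (t $ i) * x $ Inr r = 0" for t j r
    using x unfolding has_weight_iff by (auto simp: inner_axis')
  have z: "x $ Inl j = 0" "x $ Inr (lr j) = 0" if "j \<noteq> i" for j
    using w(1,2)[of "axis j 1" j] that by (simp_all add: axis_def)
  have i: "x $ Inr (lr i) = - \<i> * x $ Inl i" using w(1)[of "axis i 1" i] by (simp add: axis_def) (metis minus_minus)
  have r: "x $ Inr r = 0" if "r \<notin> range lr" for r using w(3)[of r "axis i 1"] that by (simp add: axis_def)
  show ?thesis
    unfolding vec_eq_iff all_index_iff by (auto simp: column_def z i r)
qed

lemma weight_frame_weights:
  "has_weight (column j weight_frame) (axis j 1)"
  "has_weight (\<chi> i. cnj (column j weight_frame $ i)) (- axis j 1)"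
  "r \<notin> range lr \<Longrightarrow> has_weight (axis (Inr r) 1) 0"
  unfolding has_weight_iff by (auto simp: column_def inner_axis' axis_component mult.assoc mult.commute[of _ \<i>])

text \<open>The weight vectors listed in the assumptions span the whole space.\<close>

lemma matrix_eq_0_weights:
  fixes Z :: "('p, 'q) bmat"
  assumes "\<And>j. Z *v column j weight_frame = 0" "\<And>j. Z *v (\<chi> i. cnj (column j weight_frame $ i)) = 0"
    "\<And>r. r \<notin> range lr \<Longrightarrow> Z *v axis (Inr r) 1 = 0"
  shows "Z = 0"
proof -
  have a: "Z $ i $ Inl j - \<i> * Z $ i $ Inr (lr j) = 0" "Z $ i $ Inl j + \<i> * Z $ i $ Inr (lr j) = 0" for i j
  proof -
    have "(Z *v column j weight_frame) $ i = Z $ i $ Inl j - \<i> * Z $ i $ Inr (lr j)"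
      by (simp add: matrix_vector_mult_def sum_UNIV_sum column_def if_distrib if_distribR cong: if_cong)
    then show "Z $ i $ Inl j - \<i> * Z $ i $ Inr (lr j) = 0" using assms(1)[of j] by simp
    have "(Z *v (\<chi> i. cnj (column j weight_frame $ i))) $ i = Z $ i $ Inl j + \<i> * Z $ i $ Inr (lr j)"
      by (simp add: matrix_vector_mult_def sum_UNIV_sum column_def if_distrib if_distribR cong: if_cong)
    then show "Z $ i $ Inl j + \<i> * Z $ i $ Inr (lr j) = 0" using assms(2)[of j] by simp
  qed
  have 1: "Z $ i $ Inl j = 0" for i j
  proof -
    have "2 * Z $ i $ Inl j = (Z $ i $ Inl j - \<i> * Z $ i $ Inr (lr j)) + (Z $ i $ Inl j + \<i> * Z $ i $ Inr (lr j))" by simp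
    also have "\<dots> = 0" unfolding a by simp
    finally show ?thesis by simp
  qed
  have 2: "Z $ i $ Inr (lr j) = 0" for i j using a(2)[of i j] 1[of i j] by simp
  have 3: "Z $ i $ Inr r = 0" if "r \<notin> range lr" for i r
  proof -
    have "(Z *v axis (Inr r) 1) $ i = Z $ i $ Inr r"
      by (simp add: matrix_vector_mult_def axis_def if_distrib if_distribR cong: if_cong)
    then show ?thesis using assms(3)[OF that] by simp
  qed
  show ?thesis unfolding vec_eq_iff all_index_iff using 1 2 3 by auto
qed

definition root_space :: "real^'p::{finite, linorder} \<Rightarrow> ('p::{finite, linorder}, 'q::{finite, linorder}) bmat \<Rightarrow> bool" where
  "root_space \<beta> Z \<longleftrightarrow> (\<forall>t. Y_elt t ** Z - Z ** Y_elt t = cscale (\<i> * of_real (\<beta> \<bullet> t)) Z)"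

lemma root_shift: "root_space \<beta> Z \<Longrightarrow> has_weight x \<gamma> \<Longrightarrow> has_weight (Z *v x) (\<beta> + \<gamma>)"
  unfolding has_weight_def
proof
  fix t assume Z: "root_space \<beta> Z" and x: "\<forall>t. Y_elt t *v x = (\<i> * of_real (\<gamma> \<bullet> t)) *s x"
  have "Y_elt t ** Z = Z ** Y_elt t + cscale (\<i> * of_real (\<beta> \<bullet> t)) Z"
    using Z by (simp add: root_space_def diff_eq_eq add.commute)
  then have "Y_elt t *v (Z *v x) = Z *v (Y_elt t *v x) + (\<i> * of_real (\<beta> \<bullet> t)) *s (Z *v x)"
    by (simp add: matrix_vector_mul_assoc mv.add_left cscale_vector_mult)
  then show "Y_elt t *v (Z *v x) = (\<i> * of_real ((\<beta> + \<gamma>) \<bullet> t)) *s (Z *v x)"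
    using x by (simp add: cscale_vector_mult' vec_eq_iff inner_add_left algebra_simps)
qed

lemma axis_sum_positive: "axis i 1 + axis j 1 \<in> (positive_restricted :: (real^'p::{finite, linorder}) set)"
proof (cases i j rule: linorder_cases)
  case equal
  then have "axis i 1 + axis j 1 = 2 *\<^sub>R (axis i 1 :: real^'p::{finite, linorder})" by (simp add: scaleR_2)
  then show ?thesis unfolding positive_restricted_def by blast
next
  case greater
  then have "axis i 1 + axis j 1 = axis j 1 + (axis i 1 :: real^'p::{finite, linorder})" by simp
  then show ?thesis unfolding positive_restricted_def using greater by blast
qed (auto simp: positive_restricted_def)

lemma axis_diff_cases:
  "axis i 1 - axis j 1 = (0 :: real^'p::{finite, linorder}) \<or> axis i 1 - axis j 1 \<in> (positive_restricted :: (real^'p::{finite, linorder}) set) \<or>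
    axis j 1 - axis i 1 \<in> (positive_restricted :: (real^'p::{finite, linorder}) set)"
  by (cases i j rule: linorder_cases) (auto simp: positive_restricted_def)

lemma axis_positive: "axis i 1 \<in> (positive_restricted :: (real^'p::{finite, linorder}) set)"
  by (auto simp: positive_restricted_def)

text \<open>A nonzero \<open>Z\<close> maps some weight vector to a nonzero weight vector, so \<open>\<beta>\<close> is a difference of two
  weights.\<close>

lemma root_cases:
  assumes Z: "root_space \<beta> Z" "Z \<noteq> 0"
  shows "\<beta> = 0 \<or> \<beta> \<in> positive_restricted \<or> - \<beta> \<in> positive_restricted"
proof -
  obtain x \<gamma> where x: "has_weight x \<gamma>" "Z *v x \<noteq> 0" "\<gamma> = 0 \<or> (\<exists>i. \<gamma> = axis i 1 \<or> \<gamma> = - axis i 1)"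
    using matrix_eq_0_weights[of Z] weight_frame_weights Z(2) by metis
  define \<gamma>' where "\<gamma>' = \<beta> + \<gamma>"
  have "\<gamma>' = 0 \<or> (\<exists>i. \<gamma>' = axis i 1 \<or> \<gamma>' = - axis i 1)"
    using weight_cases[OF root_shift[OF Z(1) x(1)] x(2)] by (simp add: \<gamma>'_def)
  moreover have \<beta>: "\<beta> = \<gamma>' - \<gamma>" by (simp add: \<gamma>'_def)
  moreover have D: "axis i 1 - axis j 1 = (0 :: real^'p::{finite, linorder}) \<or>
      axis i 1 - axis j 1 \<in> (positive_restricted :: (real^'p::{finite, linorder}) set) \<or>
      axis j 1 - axis i 1 \<in> (positive_restricted :: (real^'p::{finite, linorder}) set)" for i j
    by (rule axis_diff_cases)
  ultimately show ?thesis
    using x(3) by (elim disjE exE) (auto simp: axis_positive axis_sum_positive)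
qed

text \<open>The sum of the coordinates is a coarse height of a root that suffices for comparing weights.\<close>

lemma positive_restricted_sum:
  "\<beta> \<in> (positive_restricted :: (real^'p::{finite, linorder}) set) \<Longrightarrow> (\<Sum>k\<in>UNIV. \<beta> $ k) \<ge> 0 \<and> \<beta> \<noteq> 0"
proof -
  have s: "(\<Sum>k\<in>UNIV. axis i (1::real) $ k) = 1" for i :: 'p by (simp add: axis_def)
  assume "\<beta> \<in> positive_restricted"
  then consider i where "\<beta> = axis i 1" | i where "\<beta> = 2 *\<^sub>R axis i 1" | i j where "\<beta> = axis i 1 + axis j 1"
    | i j where "i < j" "\<beta> = axis i 1 - axis j 1"
    unfolding positive_restricted_def by blast
  then show ?thesis
  proof cases
    case (1 i)
    then show ?thesis by (simp add: s axis_eq_0_iff)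
  next
    case (2 i)
    then show ?thesis by (simp add: s axis_eq_0_iff flip: sum_distrib_left)
  next
    case (3 i j)
    then have "(\<Sum>k\<in>UNIV. \<beta> $ k) = 2" by (simp add: s sum.distrib)
    then show ?thesis by auto
  next
    case (4 i j)
    then show ?thesis by (auto simp: s sum_subtractf axis_eq_axis)
  qed
qed

text \<open>Weights are shifted by \<open>\<beta>\<close>.  From \<open>\<epsilon>\<^sub>j\<close> the result has coordinate sum at least one and differs from
  \<open>\<epsilon>\<^sub>j\<close>; so a weight vector of weight \<open>\<epsilon>\<^sub>j\<close> goes to zero or to one of weight \<open>\<epsilon>\<^sub>i\<close> with \<open>i \<noteq> j\<close>, and \<open>S\<close>
  has a zero diagonal.\<close>

lemma positive_root_frame:
  assumes Z: "root_space \<beta> Z" and \<beta>: "\<beta> \<in> positive_restricted"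
  obtains S where "Z ** weight_frame = weight_frame ** S" "trace S = 0"
proof -
  have "\<exists>i c. Z *v column j weight_frame = c *s column i weight_frame \<and> (i = j \<longrightarrow> c = 0)" for j :: 'p
  proof (cases "Z *v column j weight_frame = 0")
    case True
    then show ?thesis by (intro exI[of _ j] exI[of _ 0]) simp
  next
    case False
    have w: "has_weight (Z *v column j weight_frame) (\<beta> + axis j 1)"
      by (rule root_shift[OF Z weight_frame_weights(1)])
    have s: "(\<Sum>k\<in>UNIV. axis i (1::real) $ k) = 1" for i :: 'p by (simp add: axis_def)
    have pos: "(\<Sum>k\<in>UNIV. (\<beta> + axis j 1) $ k) \<ge> 1"
      using positive_restricted_sum[OF \<beta>] by (simp add: sum.distrib s)
    have "\<beta> + axis j 1 \<noteq> 0"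
    proof
      assume "\<beta> + axis j 1 = 0"
      then have "(\<Sum>k\<in>UNIV. (\<beta> + axis j 1) $ k) = 0" by (simp only: zero_index sum.neutral_const)
      then show False using pos by linarith
    qed
    moreover have "\<beta> + axis j 1 \<noteq> - axis i 1" for i
    proof
      assume "\<beta> + axis j 1 = - axis i 1"
      then have "(\<Sum>k\<in>UNIV. (\<beta> + axis j 1) $ k) = - 1" by (simp only: vector_uminus_component sum_negf s)
      then show False using pos by linarith
    qed
    ultimately obtain i where i: "\<beta> + axis j 1 = axis i 1" using weight_cases[OF w False] by blast
    then have "i \<noteq> j" using positive_restricted_sum[OF \<beta>] by auto
    then show ?thesis using weight_axis[OF w[unfolded i]] by blast
  qed
  then obtain i c where ic: "\<And>j. Z *v column j weight_frame = c j *s column (i j) weight_frame" "\<And>j. i j = j \<Longrightarrow> c j = 0"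
    by metis
  define S :: "complex^'p::{finite, linorder}^'p::{finite, linorder}" where "S = (\<chi> a j. if a = i j then c j else 0)"
  have "Z ** weight_frame = weight_frame ** S"
  proof -
    have "(Z ** weight_frame) $ k $ j = (weight_frame ** S) $ k $ j" for k j
    proof -
      have "(Z ** weight_frame) $ k $ j = (Z *v column j weight_frame) $ k"
        by (simp add: matrix_mult_nth matrix_vector_mult_def column_def)
      also have "\<dots> = (weight_frame ** S) $ k $ j"
        unfolding ic(1) by (simp add: matrix_mult_nth S_def column_def if_distrib cong: if_cong)
      finally show ?thesis .
    qed
    then show ?thesis by (simp add: vec_eq_iff)
  qed
  moreover have "trace S = 0" unfolding trace_def S_def using ic(2) by (intro sum.neutral) auto
  ultimately show ?thesis by (rule that)
qed

text \<open>Evaluating the commutation relation at the coordinate vectors \<open>t\<close> determines the off-diagonal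
  blocks entry by entry.\<close>

lemma root_space_zero:
  assumes Z: "root_space 0 Z"
  obtains A B c where "Z = diag_blocks A B + Y_complex c"
proof -
  have comm: "Y_elt t ** Z = Z ** Y_elt t" for t using Z by (simp add: root_space_def)
  have e: "(Y_elt t ** Z) $ k $ l = (Z ** Y_elt t) $ k $ l" for t k l by (simp add: comm)
  have a: "- (of_real (t $ i) * Z $ Inr (lr i) $ Inl j) = Z $ Inl i $ Inr (lr j) * of_real (t $ j)" for t i j
    using e[of t "Inl i" "Inl j"] by (simp add: Y_elt_complex Y_mult_nth mult_Y_nth)
  have off: "Z $ Inr (lr i) $ Inl j = 0" "Z $ Inl i $ Inr (lr j) = 0" if "i \<noteq> j" for i j
    using a[of "axis i 1" i j] a[of "axis j 1" i j] that by (simp_all add: axis_def)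
  have diag: "Z $ Inl i $ Inr (lr i) = - Z $ Inr (lr i) $ Inl i" for i
    using a[of "axis i 1" i i] by (simp add: axis_def)
  have r1: "Z $ Inr r $ Inl k = 0" if "r \<notin> range lr" for r k
    using e[of "axis k 1" "Inr r" "Inr (lr k)"] that by (simp add: Y_elt_complex Y_mult_nth mult_Y_nth axis_def)
  have r2: "Z $ Inl k $ Inr r = 0" if "r \<notin> range lr" for r k
    using e[of "axis k 1" "Inr (lr k)" "Inr r"] that by (simp add: Y_elt_complex Y_mult_nth mult_Y_nth axis_def)
  define c where "c = (\<chi> i. Z $ Inr (lr i) $ Inl i)"
  have c: "Z $ Inr (lr i) $ Inl i = c $ i" "Z $ Inl i $ Inr (lr i) = - c $ i" for i
    using diag by (simp_all add: c_def)
  have "Z = diag_blocks (block11 Z) (block22 Z) + Y_complex c"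
  proof -
    have 1: "Z $ Inl i $ Inr r = (if r = lr i then - c $ i else 0)" for i r
      using off(2)[of i] r2[of r] c by (cases "r \<in> range lr") auto
    have 2: "Z $ Inr r $ Inl i = (if r = lr i then c $ i else 0)" for i r
      using off(1)[of _ i] r1[of r] c by (cases "r \<in> range lr") auto
    show ?thesis
      unfolding vec_eq_iff all_sum_iff by (simp add: diag_blocks_def 1 2)
  qed
  then show ?thesis by (rule that)
qed

lemma Y_complex_frame:
  "(Y_complex c :: ('p, 'q) bmat) ** weight_frame = weight_frame ** (\<chi> i j. if i = j then \<i> * c $ j else 0)"
proof -
  have "((weight_frame :: complex^'p::{finite, linorder}^('p::{finite, linorder} + 'q::{finite, linorder})) **
      (\<chi> i j. if i = j then \<i> * c $ j else 0)) $ i $ k = weight_frame $ i $ k * (\<i> * c $ k)" for i k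
    by (simp add: matrix_mult_nth if_distrib cong: if_cong)
  moreover have "\<forall>i. \<forall>k. ((Y_complex c :: ('p, 'q) bmat) ** weight_frame) $ i $ k = weight_frame $ i $ k * (\<i> * c $ k)"
    unfolding all_index_iff by (auto simp: Y_mult_nth)
  ultimately show ?thesis by (simp add: vec_eq_iff)
qed

end

text \<open>The Cartan involution, conjugation by \<open>diag (1, -1)\<close>: its fixed points are the block diagonal
  matrices, and it negates \<open>Y_elt t\<close>.\<close>

definition theta :: "('p::finite, 'q::finite) bmat \<Rightarrow> ('p, 'q) bmat" where
  "theta Z = blocks (block11 Z) (- block12 Z) (- block21 Z) (block22 Z)"

lemma theta_nth [simp]:
  "theta Z $ Inl i $ Inl j = Z $ Inl i $ Inl j" "theta Z $ Inl i $ Inr s = - Z $ Inl i $ Inr s"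
  "theta Z $ Inr r $ Inl j = - Z $ Inr r $ Inl j" "theta Z $ Inr r $ Inr s = Z $ Inr r $ Inr s"
  by (simp_all add: theta_def)

lemma theta_mult: "theta (A ** B) = theta A ** theta B"
  by (simp add: vec_eq_iff all_sum_iff matrix_mult_nth sum_UNIV_sum sum_negf)

lemma theta_diff: "theta (A - B) = theta A - theta B" and theta_cscale: "theta (cscale c A) = cscale c (theta A)"
  by (simp_all add: vec_eq_iff all_sum_iff)

lemma add_theta: "Z + theta Z = diag_blocks (block11 Z + block11 Z) (block22 Z + block22 Z)"
  by (simp add: vec_eq_iff all_sum_iff diag_blocks_def)

lemma (in small_block) root_space_theta: "root_space \<beta> Z \<Longrightarrow> root_space (- \<beta>) (theta Z)"
  unfolding root_space_def
proof
  fix t :: "real^'p::{finite, linorder}" assume Z: "\<forall>t. Y_elt t ** Z - Z ** Y_elt t = cscale (\<i> * of_real (\<beta> \<bullet> t)) Z"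
  have tY: "theta (Y_elt t) = - Y_elt t"
    by (simp add: vec_eq_iff all_sum_iff Y_elt_complex)
  from arg_cong[OF Z[rule_format, of t], of theta]
  show "Y_elt t ** theta Z - theta Z ** Y_elt t = cscale (\<i> * of_real (- \<beta> \<bullet> t)) (theta Z)"
    unfolding theta_diff theta_mult theta_cscale tY
    by (simp add: mm.minus_left mm.minus_right vec_eq_iff algebra_simps)
qed

section \<open>The complexified Lie algebra\<close>

text \<open>The complexification of \<open>lie_K\<close>, as a set of complex matrices: \<open>so (n, \<complex>)\<close> or \<open>sl (n, \<complex>)\<close>.\<close>

definition kC :: "base_case \<Rightarrow> (complex^'n::finite^'n) set" where
  "kC \<kappa> = {Z. if \<kappa> = Real_Case then transpose Z = - Z else trace Z = 0}"

text \<open>The decomposition \<open>Z = X + \<i> Y\<close> with skew-Hermitian \<open>X\<close> and \<open>Y\<close>.\<close>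

definition skew_part :: "complex^'n^'n \<Rightarrow> complex^'n::finite^'n" where
  "skew_part Z = cscale (1/2) (Z - herm Z)"

definition skew_part' :: "complex^'n^'n \<Rightarrow> complex^'n::finite^'n" where
  "skew_part' Z = cscale (- \<i>/2) (Z + herm Z)"

lemma skew_parts: "Z = skew_part Z + cscale \<i> (skew_part' Z)"
  by (simp add: vec_eq_iff skew_part_def skew_part'_def field_simps)

lemma transpose_nth: "transpose A $ i $ j = A $ j $ i"
  by (simp add: transpose_def)

lemma transpose_simps:
  "transpose (A + B) = transpose A + transpose B" "transpose (A - B) = transpose A - transpose B"
  "transpose (- A) = - transpose A" "transpose (cscale c A) = cscale c (transpose A)"
  "transpose (0 :: complex^'n::finite^'n) = 0"
  for A B :: "complex^'n::finite^'n"
  by (simp_all add: vec_eq_iff transpose_nth)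

lemma trace_herm: "trace (herm Z) = cnj (trace Z)"
  by (simp add: trace_def)

lemma trace_simps: "trace (A + B) = trace A + trace B" "trace (A - B) = trace A - trace B" "trace (- A) = - trace A"
  for A :: "complex^'n::finite^'n"
  by (simp_all add: trace_def sum.distrib sum_subtractf sum_negf)

lemma lie_K_iff: "X \<in> lie_K \<kappa> \<longleftrightarrow> X \<in> kC \<kappa> \<and> herm X = - X"
proof (cases \<kappa>)
  case Real_Case
  have "mcnj X = X \<and> herm X = - X \<and> trace X = 0 \<longleftrightarrow> transpose X = - X \<and> herm X = - X"
  proof safe
    assume r: "mcnj X = X" and h: "herm X = - X"
    have "transpose X = mcnj (herm X)" by (simp add: vec_eq_iff transpose_nth)
    also have "\<dots> = - X" using r by (simp add: h vec_eq_iff)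
    finally show "transpose X = - X" .
  next
    assume t: "transpose X = - X" and h: "herm X = - X"
    have "cnj (X $ i $ j) = X $ i $ j" for i j
      using arg_cong[OF t, of "\<lambda>M. M $ j $ i"] arg_cong[OF h, of "\<lambda>M. M $ j $ i"] by (simp add: transpose_nth)
    then show "mcnj X = X" by (simp add: vec_eq_iff)
    have "X $ i $ i = 0" for i
    proof -
      have "transpose X $ i $ i = - X $ i $ i" by (simp only: t vector_uminus_component)
      then show ?thesis by (simp add: transpose_nth)
    qed
    then show "trace X = 0" by (simp add: trace_def)
  qed
  then show ?thesis by (auto simp: lie_K_def kC_def Real_Case matrices_over_Real)
qed (auto simp: lie_K_def kC_def)

lemma kC_closed:
  "Z \<in> kC \<kappa> \<Longrightarrow> W \<in> kC \<kappa> \<Longrightarrow> Z + W \<in> kC \<kappa>" "Z \<in> kC \<kappa> \<Longrightarrow> W \<in> kC \<kappa> \<Longrightarrow> Z - W \<in> kC \<kappa>"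
  "Z \<in> kC \<kappa> \<Longrightarrow> cscale c Z \<in> kC \<kappa>" "Z \<in> kC \<kappa> \<Longrightarrow> herm Z \<in> kC \<kappa>" "0 \<in> kC \<kappa>"
  "Z \<in> kC \<kappa> \<Longrightarrow> W \<in> kC \<kappa> \<Longrightarrow> Z ** W - W ** Z \<in> kC \<kappa>"
proof -
  show "Z \<in> kC \<kappa> \<Longrightarrow> W \<in> kC \<kappa> \<Longrightarrow> Z + W \<in> kC \<kappa>" "Z \<in> kC \<kappa> \<Longrightarrow> W \<in> kC \<kappa> \<Longrightarrow> Z - W \<in> kC \<kappa>"
    "Z \<in> kC \<kappa> \<Longrightarrow> cscale c Z \<in> kC \<kappa>" "0 \<in> kC \<kappa>"
    by (auto simp: kC_def trace_simps trace_cscale transpose_simps cscale_minus_right) (simp add: trace_def)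
  show "Z \<in> kC \<kappa> \<Longrightarrow> herm Z \<in> kC \<kappa>"
  proof (cases "\<kappa> = Real_Case")
    case True
    assume "Z \<in> kC \<kappa>"
    then have "herm (transpose Z) = herm (- Z)" using True by (simp add: kC_def)
    moreover have "herm (transpose Z) = transpose (herm Z)" by (simp add: vec_eq_iff transpose_nth)
    ultimately show ?thesis using True by (simp add: kC_def herm_minus)
  qed (auto simp: kC_def trace_herm)
  assume Z: "Z \<in> kC \<kappa>" and W: "W \<in> kC \<kappa>"
  show "Z ** W - W ** Z \<in> kC \<kappa>"
  proof (cases "\<kappa> = Real_Case")
    case True
    then have t: "transpose Z = - Z" "transpose W = - W" using Z W by (auto simp: kC_def)
    have "transpose (Z ** W - W ** Z) = transpose W ** transpose Z - transpose Z ** transpose W"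
      by (simp add: vec_eq_iff transpose_nth matrix_mult_nth mult.commute)
    then show ?thesis using True unfolding t by (simp add: kC_def mm.minus_left mm.minus_right)
  next
    case False
    have "trace (Z ** W) = trace (W ** Z)" by (rule trace_mul_sym)
    then show ?thesis using False by (simp add: kC_def trace_simps)
  qed
qed

lemma skew_parts_lie_K: "Z \<in> kC \<kappa> \<Longrightarrow> skew_part Z \<in> lie_K \<kappa>" "Z \<in> kC \<kappa> \<Longrightarrow> skew_part' Z \<in> lie_K \<kappa>"
proof -
  assume Z: "Z \<in> kC \<kappa>"
  show "skew_part Z \<in> lie_K \<kappa>" "skew_part' Z \<in> lie_K \<kappa>"
    unfolding lie_K_iff skew_part_def skew_part'_def using Z
    by (auto simp: kC_closed herm_cscale herm_diff herm_add) (auto simp: vec_eq_iff field_simps)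
qed

lemma skew_part_simps:
  "skew_part (Z + W) = skew_part Z + skew_part W" "skew_part' (Z + W) = skew_part' Z + skew_part' W"
  "skew_part (cscale c Z) = cscale (of_real (Re c)) (skew_part Z) - cscale (of_real (Im c)) (skew_part' Z)"
  "skew_part' (cscale c Z) = cscale (of_real (Re c)) (skew_part' Z) + cscale (of_real (Im c)) (skew_part Z)"
  "herm X = - X \<Longrightarrow> skew_part X = X" "herm X = - X \<Longrightarrow> skew_part' X = 0"
  by (simp_all add: skew_part_def skew_part'_def vec_eq_iff)
     (simp_all add: complex_eq_iff field_simps)

lemma kC_theta: "Z \<in> kC \<kappa> \<Longrightarrow> theta Z \<in> kC \<kappa>"
proof -
  have "transpose (theta Z) = theta (transpose Z)" "theta (- Z) = - theta Z" "trace (theta Z) = trace Z"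
    by (simp_all add: vec_eq_iff all_sum_iff transpose_nth trace_def sum_UNIV_sum)
  then show "Z \<in> kC \<kappa> \<Longrightarrow> theta Z \<in> kC \<kappa>" by (simp add: kC_def split: if_splits)
qed

lemma Y_elt_lie_K: "(Y_elt t :: ('p::{finite, linorder}, 'q::{finite, linorder}) bmat) \<in> lie_K \<kappa>"
  unfolding lie_K_def
  by (auto simp: matrices_over_def all_sum_iff Y_elt_complex vec_eq_iff trace_def sum_UNIV_sum intro: scalars_closed)

lemma Y_complex_kC: "(Y_complex c :: ('p::{finite, linorder}, 'q::{finite, linorder}) bmat) \<in> kC \<kappa>"
  by (auto simp: kC_def vec_eq_iff all_sum_iff transpose_nth trace_def sum_UNIV_sum)

lemma inner_mult_left: "(A ** X) \<bullet> Y = X \<bullet> (herm A ** Y)"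
  and inner_mult_right: "(X ** A) \<bullet> Y = X \<bullet> (Y ** herm A)"
  and inner_cscale: "cscale c X \<bullet> Y = X \<bullet> cscale (cnj c) Y"
  for A X Y :: "complex^'n::finite^'n"
proof -
  have tr: "U \<bullet> V = Re (trace (U ** herm V))" for U V :: "complex^'n^'n"
    by (simp add: inner_vec_def trace_def matrix_mult_nth inner_complex_def)
  show "(X ** A) \<bullet> Y = X \<bullet> (Y ** herm A)" by (simp add: tr herm_mult matrix_mul_assoc)
  have "trace (A ** X ** herm Y) = trace (X ** herm Y ** A)"
    using trace_mul_sym[of A "X ** herm Y"] by (simp add: matrix_mul_assoc)
  then show "(A ** X) \<bullet> Y = X \<bullet> (herm A ** Y)" by (simp add: tr herm_mult matrix_mul_assoc)
  show "cscale c X \<bullet> Y = X \<bullet> cscale (cnj c) Y"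
    by (simp add: tr herm_cscale cscale_mult_left cscale_mult_right trace_cscale)
qed

text \<open>The operators \<open>-\<i> ad H\<close> of commuting skew-Hermitian matrices are commuting and self-adjoint.\<close>

lemma ad_eigenvectors_span:
  fixes T W :: "(complex^'n::finite^'n) set"
  assumes skew: "\<And>H. H \<in> T \<Longrightarrow> herm H = - H"
    and comm: "\<And>H H'. H \<in> T \<Longrightarrow> H' \<in> T \<Longrightarrow> H ** H' = H' ** H"
    and W: "subspace W" "\<And>Z c. Z \<in> W \<Longrightarrow> cscale c Z \<in> W"
    and inv: "\<And>H Z. H \<in> T \<Longrightarrow> Z \<in> W \<Longrightarrow> H ** Z - Z ** H \<in> W"
  shows "W \<subseteq> span {Z \<in> W. Z \<noteq> 0 \<and> (\<forall>H\<in>T. \<exists>l::real. H ** Z - Z ** H = cscale (\<i> * of_real l) Z)}"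
proof -
  define ad where "ad H Z = cscale (- \<i>) (H ** Z - Z ** H)" for H Z :: "complex^'n^'n"
  let ?A = "ad ` T"
  have "W \<subseteq> span {Z \<in> W. joint_eigenvector ?A Z}"
  proof (rule joint_eigenvectors_span[OF W(1)])
    fix A assume A: "A \<in> ?A"
    then obtain H where H: "H \<in> T" "A = ad H" by auto
    show "linear A" unfolding H ad_def
      by (simp add: linear_iff mm.add_left mm.add_right mm.scaleR_left mm.scaleR_right scaleR_cscale
          cscale_mult_left cscale_mult_right cscale_diff_right cscale_add_right mult.commute)
    show "A Z \<in> W" if "Z \<in> W" for Z unfolding H ad_def by (intro W(2) inv H(1) that)
    show "A Z \<bullet> Z' = Z \<bullet> A Z'" for Z Z'
    proof -
      have s: "herm H = - H" by (rule skew[OF H(1)])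
      have "A Z \<bullet> Z' = (H ** Z - Z ** H) \<bullet> cscale \<i> Z'" by (simp add: H ad_def inner_cscale)
      also have "\<dots> = Z \<bullet> (herm H ** cscale \<i> Z' - cscale \<i> Z' ** herm H)"
        by (simp add: inner_diff_left inner_diff_right inner_mult_left[of H] inner_mult_right[of Z H])
      also have "herm H ** cscale \<i> Z' - cscale \<i> Z' ** herm H = A Z'"
        unfolding s H ad_def
        by (simp add: mm.minus_left mm.minus_right cscale_mult_left cscale_mult_right vec_eq_iff algebra_simps)
      finally show ?thesis .
    qed
    fix B Z assume "B \<in> ?A"
    then obtain H' where H': "H' \<in> T" "B = ad H'" by auto
    have c: "H ** H' = H' ** H" by (rule comm[OF H(1) H'(1)])
    have c1: "H ** (H' ** Z) = H' ** (H ** Z)" and c2: "Z ** H' ** H = Z ** H ** H'"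
      by (simp_all add: c matrix_mul_assoc) (simp add: c flip: matrix_mul_assoc)
    show "A (B Z) = B (A Z)"
      unfolding H H' ad_def
      using c1 c2 by (simp add: cscale_mult_left cscale_mult_right mm.diff_left mm.diff_right cscale_diff_right
          matrix_mul_assoc)
  qed
  also have "{Z \<in> W. joint_eigenvector ?A Z} \<subseteq>
      {Z \<in> W. Z \<noteq> 0 \<and> (\<forall>H\<in>T. \<exists>l::real. H ** Z - Z ** H = cscale (\<i> * of_real l) Z)}"
  proof safe
    fix Z H assume "joint_eigenvector ?A Z" "H \<in> T"
    then obtain l where "ad H Z = l *\<^sub>R Z" by (auto simp: joint_eigenvector_def)
    from arg_cong[OF this, of "cscale \<i>"]
    have "H ** Z - Z ** H = cscale (\<i> * of_real l) Z" by (simp add: ad_def scaleR_cscale)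
    then show "\<exists>l::real. H ** Z - Z ** H = cscale (\<i> * of_real l) Z" by blast
  qed (auto simp: joint_eigenvector_def)
  finally show ?thesis by (simp add: span_mono)
qed

section \<open>The matrix coefficient of a highest weight vector\<close>

lemma lie_K_closed:
  assumes "X \<in> lie_K \<kappa>" "Y \<in> lie_K \<kappa>"
  shows "X + Y \<in> lie_K \<kappa>" "X - Y \<in> lie_K \<kappa>" "X ** Y - Y ** X \<in> lie_K \<kappa>" "cscale (of_real r) X \<in> lie_K \<kappa>"
  using assms unfolding lie_K_iff
  by (auto simp: kC_closed herm_add herm_diff herm_mult herm_cscale cscale_minus_right mm.minus_left mm.minus_right)

lemma cip_mderiv:
  assumes "mderiv M M' s"
  shows "((\<lambda>s. cip (M s *v w) y) has_field_derivative cip (M' *v w) y) (at s)"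
proof -
  have e: "cip (A *v w) y = (\<Sum>i\<in>UNIV. (\<Sum>j\<in>UNIV. A $ i $ j * w $ j) * cnj (y $ i))" for A
    by (simp add: cip_def matrix_vector_mult_def)
  show ?thesis
    unfolding e by (intro DERIV_sum DERIV_cmult_right) (use assms in \<open>auto simp: mderiv_def\<close>)
qed

context haar_unitary_rep
begin

text \<open>The complex linear extension of the differential.\<close>

definition dC :: "complex^'n^'n \<Rightarrow> complex^'v^'v" where
  "dC Z = dpi (skew_part Z) + cscale \<i> (dpi (skew_part' Z))"

lemma dpi_cscale: "dpi (cscale (of_real r) X) = cscale (of_real r) (dpi X)"
  using linear_scale[OF linear_dpi, of r X] by (simp add: scaleR_cscale)

lemma dC_add: "dC (Z + W) = dC Z + dC W"
  by (simp add: dC_def skew_part_simps linear_add[OF linear_dpi] cscale_add_right)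

lemma dC_cscale: "dC (cscale c Z) = cscale c (dC Z)"
  unfolding dC_def skew_part_simps linear_add[OF linear_dpi] linear_diff[OF linear_dpi] dpi_cscale
  by (simp add: vec_eq_iff complex_eq_iff algebra_simps)

lemma dC_lie: "X \<in> lie_K \<kappa> \<Longrightarrow> dC X = dpi X"
  by (simp add: dC_def skew_part_simps lie_K_iff linear_0[OF linear_dpi])

lemma dC_parts: "X \<in> lie_K \<kappa> \<Longrightarrow> Y \<in> lie_K \<kappa> \<Longrightarrow> dC (X + cscale \<i> Y) = dpi X + cscale \<i> (dpi Y)"
  by (simp add: dC_add dC_cscale dC_lie)

lemma dC_bracket:
  assumes Z: "Z \<in> kC \<kappa>" and W: "W \<in> kC \<kappa>"
  shows "dC (Z ** W - W ** Z) = dC Z ** dC W - dC W ** dC Z"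
proof -
  define A B C D where "A = skew_part Z" and "B = skew_part' Z" and "C = skew_part W" and "D = skew_part' W"
  have k: "A \<in> lie_K \<kappa>" "B \<in> lie_K \<kappa>" "C \<in> lie_K \<kappa>" "D \<in> lie_K \<kappa>"
    unfolding A_def B_def C_def D_def by (rule skew_parts_lie_K[OF Z] skew_parts_lie_K[OF W])+
  have ZW: "Z = A + cscale \<i> B" "W = C + cscale \<i> D"
    unfolding A_def B_def C_def D_def by (rule skew_parts)+
  have br: "dpi (X ** Y) - dpi (Y ** X) = dpi X ** dpi Y - dpi Y ** dpi X" if "X \<in> lie_K \<kappa>" "Y \<in> lie_K \<kappa>" for X Y
    using dpi_bracket[OF that] by (simp add: linear_diff[OF linear_dpi])
  have "Z ** W - W ** Z = ((A ** C - C ** A) - (B ** D - D ** B)) + cscale \<i> ((A ** D - D ** A) + (B ** C - C ** B))"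
    unfolding ZW by (simp add: mm.add_left mm.add_right cscale_mult_left cscale_mult_right vec_eq_iff algebra_simps)
  then have "dC (Z ** W - W ** Z) = ((dpi A ** dpi C - dpi C ** dpi A) - (dpi B ** dpi D - dpi D ** dpi B)) +
      cscale \<i> ((dpi A ** dpi D - dpi D ** dpi A) + (dpi B ** dpi C - dpi C ** dpi B))"
    using k by (simp add: dC_parts lie_K_closed linear_add[OF linear_dpi] linear_diff[OF linear_dpi] br)
  also have "\<dots> = dC Z ** dC W - dC W ** dC Z"
    unfolding ZW using k
    by (simp add: dC_parts mm.add_left mm.add_right cscale_mult_left cscale_mult_right vec_eq_iff algebra_simps)
  finally show ?thesis .
qed

end

text \<open>For a negative integer the model is evaluated at the complex conjugate; this twists the group
  and its Lie algebra by an automorphism that fixes \<open>Y_elt\<close>.\<close>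

definition sg :: "base_case \<Rightarrow> complex^'n^'n \<Rightarrow> complex^'n^'n" where
  "sg \<kappa> g = (if conjugating \<kappa> then mcnj g else g)"

definition tau :: "base_case \<Rightarrow> complex^'n^'n \<Rightarrow> complex^'n^'n" where
  "tau \<kappa> Z = (if conjugating \<kappa> then - transpose Z else Z)"

lemma tau_add: "tau \<kappa> (Z + W) = tau \<kappa> Z + tau \<kappa> W" and tau_cscale: "tau \<kappa> (cscale c Z) = cscale c (tau \<kappa> Z)"
  for Z W :: "complex^'n::finite^'n"
  by (simp_all add: tau_def transpose_simps cscale_minus_right)

lemma tau_bracket: "tau \<kappa> (Z ** W - W ** Z) = tau \<kappa> Z ** tau \<kappa> W - tau \<kappa> W ** tau \<kappa> Z"
  for Z W :: "complex^'n::finite^'n"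
proof -
  have "transpose (A ** B) = transpose B ** transpose A" for A B :: "complex^'n^'n"
    by (simp add: vec_eq_iff transpose_nth matrix_mult_nth mult.commute)
  then show ?thesis by (simp add: tau_def transpose_simps mm.minus_left mm.minus_right)
qed

lemma scaleR_diag_blocks: "r *\<^sub>R diag_blocks A B = diag_blocks (r *\<^sub>R A) (r *\<^sub>R B)"
  by (simp add: vec_eq_iff all_sum_iff diag_blocks_def)

lemma tau_Y: "tau \<kappa> (Y_complex c :: ('p::{finite, linorder}, 'q::{finite, linorder}) bmat) = Y_complex c"
  by (simp add: tau_def vec_eq_iff all_sum_iff transpose_nth)

lemma tau_diag: "\<exists>A' B'. tau \<kappa> (diag_blocks A B) = diag_blocks A' B' \<and> trace A' = trace (block11 (tau \<kappa> (diag_blocks A B)))"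
proof -
  have "- transpose (diag_blocks A B) = diag_blocks (- transpose A) (- transpose B)"
    by (simp add: vec_eq_iff all_sum_iff transpose_nth diag_blocks_def)
  then show ?thesis by (auto simp: tau_def)
qed

lemma tau_skew: "herm X = - X \<Longrightarrow> tau \<kappa> X = sg \<kappa> X" for X :: "complex^'n::finite^'n"
proof -
  assume "herm X = - X"
  moreover have "transpose (herm X) = mcnj X" by (simp add: vec_eq_iff transpose_nth)
  ultimately have "mcnj X = - transpose X" by (simp add: transpose_simps)
  then show ?thesis by (simp add: tau_def sg_def)
qed

lemma sg_mult: "sg \<kappa> (g ** h) = sg \<kappa> g ** sg \<kappa> h" and sg_one: "sg \<kappa> (mat 1) = (mat 1 :: complex^'n::finite^'n)"
  and sg_mexp: "sg \<kappa> (mexp g) = mexp (sg \<kappa> g)"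
  for g h :: "complex^'n::finite^'n"
  by (simp_all add: sg_def mcnj_mult mcnj_mexp)

lemma (in small_block) root_space_tau: "root_space \<beta> Z \<Longrightarrow> root_space \<beta> (tau \<kappa> Z)"
  unfolding root_space_def
proof
  fix t :: "real^'p::{finite, linorder}"
  assume "\<forall>t. Y_elt t ** Z - Z ** Y_elt t = cscale (\<i> * of_real (\<beta> \<bullet> t)) Z"
  from arg_cong[OF this[rule_format, of t], of "tau \<kappa>"]
  show "Y_elt t ** tau \<kappa> Z - tau \<kappa> Z ** Y_elt t = cscale (\<i> * of_real (\<beta> \<bullet> t)) (tau \<kappa> Z)"
    by (simp add: tau_bracket tau_cscale Y_elt_complex tau_Y)
qed

lemma (in haar_unitary_rep) root_vector_kills:
  assumes hw: "\<And>\<alpha> X Y. root_vector (lie_K \<kappa>) T \<alpha> X Y \<Longrightarrow> Im (\<alpha> H) > 0 \<Longrightarrow>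
      drep \<pi> X *v v + \<i> *s (drep \<pi> Y *v v) = 0"
    and Z: "root_vector (lie_K \<kappa>) T \<alpha> (skew_part Z) (skew_part' Z)" "Im (\<alpha> H) > 0"
  shows "dC Z *v v = 0"
  using hw[OF Z] Z(1)
  by (simp add: root_vector_def dC_def drep_eq_dpi mv.add_left cscale_vector_mult)

locale spherical_block = haar_unitary_rep \<kappa> \<nu> \<pi> + small_block dummy
  for \<kappa> :: base_case
    and \<nu> :: "('p::{finite, linorder}, 'q::{finite, linorder}) bmat measure"
    and \<pi> :: "('p::{finite, linorder}, 'q::{finite, linorder}) bmat \<Rightarrow> complex^'v::finite^'v"
    and dummy :: "('p::{finite, linorder} \<times> 'q::{finite, linorder}) itself"
begin

text \<open>A restricted root space for a positive restricted root is spanned by root vectors of the Cartan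
  subalgebra \<open>T\<close>, because \<open>T\<close> commutes with all \<open>Y_elt t\<close>.  By compatibility these roots are positive,
  so the whole restricted root space kills the highest weight vector.\<close>

lemma highest_weight_vector:
  assumes weight: "restricted_highest_weight \<kappa> \<pi> mu"
  obtains v where "v \<noteq> 0" "\<And>t. dpi (Y_elt t) *v v = (\<i> * of_real (mu \<bullet> t)) *s v"
    "\<And>\<beta> Z. \<beta> \<in> positive_restricted \<Longrightarrow> Z \<in> kC \<kappa> \<Longrightarrow> root_space \<beta> Z \<Longrightarrow> dC Z *v v = 0"
proof -
  obtain T H \<Lambda> where T: "cartan_subalgebra (lie_K \<kappa>) T" "range Y_elt \<subseteq> T"
    and H: "compatible_element (lie_K \<kappa>) T H"
    and hw: "highest_weight (lie_K \<kappa>) T H \<pi> \<Lambda>" and mu: "restricts_to \<Lambda> mu"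
    using weight unfolding restricted_highest_weight_def lie_algebra_K_group by blast
  obtain v where v: "v \<noteq> 0" "\<And>X. X \<in> T \<Longrightarrow> drep \<pi> X *v v = \<Lambda> X *s v"
    "\<And>\<alpha> X Y. root_vector (lie_K \<kappa>) T \<alpha> X Y \<Longrightarrow> Im (\<alpha> H) > 0 \<Longrightarrow> drep \<pi> X *v v + \<i> *s (drep \<pi> Y *v v) = 0"
    using hw unfolding highest_weight_def by blast
  have Tk: "T \<subseteq> lie_K \<kappa>" and comm: "\<And>X Y. X \<in> T \<Longrightarrow> Y \<in> T \<Longrightarrow> X ** Y = Y ** X"
    using T(1) unfolding cartan_subalgebra_def abelian_subspace_def by blast+
  have YT: "Y_elt t \<in> T" for t using T(2) by auto
  show ?thesis
  proof (rule that[OF v(1)])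
    show "dpi (Y_elt t) *v v = (\<i> * of_real (mu \<bullet> t)) *s v" for t
      using v(2)[OF YT[of t]] mu by (simp add: drep_eq_dpi Y_elt_lie_K restricts_to_def)
    fix \<beta> :: "real^'p::{finite, linorder}" and Z :: "('p, 'q) bmat"
    assume \<beta>: "\<beta> \<in> positive_restricted" and Z: "Z \<in> kC \<kappa>" "root_space \<beta> Z"
    let ?W = "{Z \<in> kC \<kappa>. root_space \<beta> Z}"
    let ?S = "{Z \<in> ?W. Z \<noteq> 0 \<and> (\<forall>H\<in>T. \<exists>l::real. H ** Z - Z ** H = cscale (\<i> * of_real l) Z)}"
    have "?W \<subseteq> span ?S"
    proof (rule ad_eigenvectors_span)
      show "herm H = - H" if "H \<in> T" for H using Tk that by (auto simp: lie_K_iff)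
      show "H ** H' = H' ** H" if "H \<in> T" "H' \<in> T" for H H' by (rule comm[OF that])
      show cs: "cscale c Z \<in> ?W" if "Z \<in> ?W" for Z c
        using that by (simp add: kC_closed root_space_def cscale_mult_left cscale_mult_right mult.commute
            flip: cscale_diff_right)
      show "subspace ?W"
        unfolding subspace_def
      proof (intro conjI ballI allI)
        show "0 \<in> ?W" by (simp add: kC_closed root_space_def mm.zero_left mm.zero_right)
        show "x + y \<in> ?W" if "x \<in> ?W" "y \<in> ?W" for x y
          using that
          by (simp add: kC_closed root_space_def mm.add_left mm.add_right cscale_add_right add_diff_add)
        show "c *\<^sub>R x \<in> ?W" if "x \<in> ?W" for c x
          using cs[OF that] by (simp only: scaleR_cscale)
      qed
      show "H ** Z - Z ** H \<in> ?W" if H: "H \<in> T" and Z: "Z \<in> ?W" for H Z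
      proof -
        have "Y_elt t ** (H ** Z - Z ** H) - (H ** Z - Z ** H) ** Y_elt t =
            cscale (\<i> * of_real (\<beta> \<bullet> t)) (H ** Z - Z ** H)" for t
        proof -
          have c: "Y_elt t ** H = H ** Y_elt t" by (rule comm[OF YT H])
          have c1: "Y_elt t ** H ** Z = H ** Y_elt t ** Z" and c2: "Z ** H ** Y_elt t = Z ** Y_elt t ** H"
            by (simp add: c) (simp add: c flip: matrix_mul_assoc)
          have "Y_elt t ** (H ** Z - Z ** H) - (H ** Z - Z ** H) ** Y_elt t =
              H ** (Y_elt t ** Z - Z ** Y_elt t) - (Y_elt t ** Z - Z ** Y_elt t) ** H"
            by (simp add: mm.diff_left mm.diff_right matrix_mul_assoc c1 c2)
          also have "Y_elt t ** Z - Z ** Y_elt t = cscale (\<i> * of_real (\<beta> \<bullet> t)) Z"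
            using Z by (simp add: root_space_def)
          finally show ?thesis by (simp add: cscale_mult_left cscale_mult_right cscale_diff_right)
        qed
        moreover have "H ** Z - Z ** H \<in> kC \<kappa>" using H Z Tk by (intro kC_closed) (auto simp: lie_K_iff)
        ultimately show ?thesis by (simp add: root_space_def)
      qed
    qed
    moreover have "subspace {Z. dC Z *v v = 0}"
      unfolding subspace_def using dC_cscale[of 0 0]
      by (auto simp: dC_add dC_cscale mv.add_left mv.zero_left scaleR_cscale cscale_vector_mult)
    moreover have "?S \<subseteq> {Z. dC Z *v v = 0}"
    proof safe
      fix Z :: "('p, 'q) bmat" assume Z: "Z \<in> kC \<kappa>" "root_space \<beta> Z" "Z \<noteq> 0"
        and eig: "\<forall>H\<in>T. \<exists>l::real. H ** Z - Z ** H = cscale (\<i> * of_real l) Z"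
      then obtain l where l: "\<And>H. H \<in> T \<Longrightarrow> H ** Z - Z ** H = cscale (\<i> * of_real (l H)) Z" by metis
      (* The real eigenvalues of -\<i> ad H on a joint eigenvector make up a root of T. *)
      define \<alpha> where "\<alpha> H = \<i> * complex_of_real (l H)" for H
      have \<alpha>Y: "\<alpha> (Y_elt t) = \<i> * of_real (\<beta> \<bullet> t)" for t
      proof -
        have "cscale (\<alpha> (Y_elt t)) Z = cscale (\<i> * of_real (\<beta> \<bullet> t)) Z"
          using l[OF YT[of t]] Z(2) unfolding root_space_def \<alpha>_def by metis
        moreover obtain i j where "Z $ i $ j \<noteq> 0" using Z(3) by (auto simp: vec_eq_iff)
        ultimately show ?thesis by (metis cscale_nth mult_cancel_right)
      qed
      have "\<alpha> (Y_elt \<beta>) \<noteq> 0" using positive_restricted_sum[OF \<beta>] by (simp add: \<alpha>Y)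
      then have rv: "root_vector (lie_K \<kappa>) T \<alpha> (skew_part Z) (skew_part' Z)"
        unfolding root_vector_def skew_parts[symmetric]
        using skew_parts_lie_K[OF Z(1)] Z(3) YT[of \<beta>] l by (auto simp: \<alpha>_def)
      moreover have "restricts_to \<alpha> \<beta>" by (simp add: restricts_to_def \<alpha>Y)
      ultimately have "Im (\<alpha> H) > 0" using H \<beta> unfolding compatible_element_def is_root_def by blast
      with rv show "dC Z *v v = 0" by (rule root_vector_kills[rotated]) (rule v(3))
    qed
    ultimately have "?W \<subseteq> {Z. dC Z *v v = 0}" by (meson order_trans span_minimal)
    then show "dC Z *v v = 0" using Z by auto
  qed
qed


text \<open>A joint eigenvector of all \<open>ad (Y_elt t)\<close> has eigenvalues that are linear in \<open>t\<close>, hence of the form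
  \<open>\<i> (\<beta> \<bullet> t)\<close>.\<close>

lemma kC_root_spaces: "kC \<kappa> \<subseteq> span {Z :: ('p, 'q) bmat. Z \<in> kC \<kappa> \<and> Z \<noteq> 0 \<and> (\<exists>\<beta>. root_space \<beta> Z)}"
proof -
  let ?S = "{Z :: ('p, 'q) bmat. Z \<in> kC \<kappa> \<and> Z \<noteq> 0 \<and>
    (\<forall>H\<in>range Y_elt. \<exists>l::real. H ** Z - Z ** H = cscale (\<i> * of_real l) Z)}"
  have Ysum: "(Y_elt t :: ('p, 'q) bmat) = (\<Sum>i\<in>UNIV. cscale (of_real (t $ i)) (Y_elt (axis i 1)))" for t
  proof -
    have "linear (Y_elt :: _ \<Rightarrow> ('p, 'q) bmat)"
      by (simp add: linear_iff vec_eq_iff all_sum_iff Y_elt_complex) (simp add: complex_eq_iff)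
    then have "Y_elt (\<Sum>i\<in>UNIV. t $ i *\<^sub>R axis i 1) = (\<Sum>i\<in>UNIV. t $ i *\<^sub>R (Y_elt (axis i 1) :: ('p, 'q) bmat))"
      by (simp add: linear_sum linear_scale)
    moreover have "(\<Sum>i\<in>UNIV. t $ i *\<^sub>R axis i 1) = t"
      using basis_expansion[of t] by (simp add: scalar_mult_eq_scaleR)
    ultimately show ?thesis by (simp add: scaleR_cscale)
  qed
  have "subspace (kC \<kappa> :: ('p, 'q) bmat set)"
    unfolding subspace_def by (simp add: kC_closed scaleR_cscale)
  then have "kC \<kappa> \<subseteq> span ?S"
  proof (rule ad_eigenvectors_span[rotated 2])
    show "herm H = - H" if "H \<in> range Y_elt" for H :: "('p, 'q) bmat"
      using that Y_elt_lie_K by (auto simp: lie_K_iff)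
    show "H ** H' = H' ** H" if "H \<in> range Y_elt" "H' \<in> range Y_elt" for H H' :: "('p, 'q) bmat"
    proof -
      have "\<forall>i. \<forall>k. (Y_complex c ** Y_complex d :: ('p, 'q) bmat) $ i $ k = (Y_complex d ** Y_complex c) $ i $ k" for c d
        unfolding all_index_iff by (auto simp: Y_mult_nth)
      then have YY: "(Y_complex c ** Y_complex d :: ('p, 'q) bmat) = Y_complex d ** Y_complex c" for c d
        unfolding vec_eq_iff by blast
      obtain t s where "H = Y_elt t" "H' = Y_elt s" using \<open>H \<in> _\<close> \<open>H' \<in> _\<close> by blast
      then show ?thesis by (simp only: Y_elt_complex YY)
    qed
    show "H ** Z - Z ** H \<in> kC \<kappa>" if "H \<in> range Y_elt" "Z \<in> kC \<kappa>" for H Z :: "('p, 'q) bmat"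
      using that by (auto simp: Y_elt_complex intro!: kC_closed Y_complex_kC)
  qed (rule kC_closed)
  also have "?S \<subseteq> {Z. Z \<in> kC \<kappa> \<and> Z \<noteq> 0 \<and> (\<exists>\<beta>. root_space \<beta> Z)}"
  proof safe
    fix Z :: "('p, 'q) bmat"
    assume "\<forall>H\<in>range Y_elt. \<exists>l::real. H ** Z - Z ** H = cscale (\<i> * of_real l) Z"
    then have "\<exists>l::real. Y_elt t ** Z - Z ** Y_elt t = cscale (\<i> * of_real l) Z" for t by blast
    then obtain l where l: "\<And>t. Y_elt t ** Z - Z ** Y_elt t = cscale (\<i> * of_real (l t)) Z" by metis
    have "Y_elt t ** Z - Z ** Y_elt t = cscale (\<i> * of_real ((\<chi> i. l (axis i 1)) \<bullet> t)) Z" for t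
    proof -
      have "Y_elt t ** Z - Z ** Y_elt t =
          (\<Sum>i\<in>UNIV. cscale (of_real (t $ i)) (Y_elt (axis i 1) ** Z - Z ** Y_elt (axis i 1)))"
        unfolding Ysum[of t] mm.sum_left mm.sum_right
        by (simp add: cscale_mult_left cscale_mult_right cscale_diff_right sum_subtractf)
      also have "\<dots> = cscale (\<i> * of_real ((\<chi> i. l (axis i 1)) \<bullet> t)) Z"
        unfolding l by (simp add: vec_eq_iff inner_vec_def sum_distrib_left sum_distrib_right mult_ac)
      finally show ?thesis .
    qed
    then show "\<exists>\<beta>. root_space \<beta> Z" unfolding root_space_def by blast
  qed
  finally show ?thesis by (simp add: span_mono)
qed

lemma chi_twist:
  assumes e: "e \<in> chi_vectors \<kappa> \<pi>" and m: "m \<in> L_group \<kappa>"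
  shows "cip (\<pi> m *v w) e = unit_char \<kappa> (det (block11 m)) * cip w e"
proof -
  have "\<pi> (herm m) *v e = unit_char \<kappa> (det (block11 (herm m))) *s e"
    using e L_group_herm[OF m] unfolding chi_vectors_def by (simp add: chi_L_eq)
  moreover have "block11 (herm m) = herm (block11 m)" by (simp add: vec_eq_iff)
  ultimately show ?thesis
    using cip_rep[OF L_group_K[OF m], of w e] by (simp add: cip_linear cnj_unit_char det_herm)
qed

text \<open>For a skew-Hermitian element this is the derivative at the identity of the character of \<open>L_group\<close>;
  both sides are complex linear.\<close>

lemma dC_chi:
  assumes e: "e \<in> chi_vectors \<kappa> \<pi>" and l: "diag_blocks A B \<in> kC \<kappa>"
  shows "cip (dC (diag_blocks A B) *v w) e =
    of_nat (min_type \<kappa>) * trace (block11 (tau \<kappa> (diag_blocks A B))) * cip w e"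
proof -
  let ?k = "of_nat (min_type \<kappa>) :: complex"
  let ?t = "\<lambda>X. trace (block11 (tau \<kappa> X))"
  have real: "cip (dpi X *v w) e = ?k * ?t X * cip w e"
    if X: "X \<in> lie_K \<kappa>" "X = diag_blocks A B" for X :: "('p, 'q) bmat" and A B
  proof -
    have tX: "?t X = twist \<kappa> (trace A)"
      using tau_skew[of X \<kappa>] X by (simp add: lie_K_iff sg_def twist_def trace_def diag_blocks_def)
    have L: "mexp (s *\<^sub>R X) \<in> L_group \<kappa>" for s
    proof -
      have "mexp (s *\<^sub>R X) = diag_blocks (mexp (s *\<^sub>R A)) (mexp (s *\<^sub>R B))"
        by (simp add: X(2) scaleR_diag_blocks mexp_diag_blocks)
      then show ?thesis using mexp_lie_K[OF X(1), of s] unfolding L_group_def by blast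
    qed
    have uc: "unit_char \<kappa> (det (block11 (mexp (s *\<^sub>R X)))) = exp (of_real s * (?k * ?t X))" for s
    proof -
      have "block11 (mexp (s *\<^sub>R X)) = mexp (s *\<^sub>R A)" by (simp add: X(2) scaleR_diag_blocks mexp_diag_blocks)
      then have "det (block11 (mexp (s *\<^sub>R X))) = exp (of_real s * trace A)" by (simp add: det_mexp trace_scaleR)
      then have "unit_char \<kappa> (det (block11 (mexp (s *\<^sub>R X)))) = exp (of_real s * ?t X) ^ min_type \<kappa>"
        by (simp add: unit_char_def twist_def tX exp_cnj)
      then show ?thesis by (simp add: exp_of_nat_mult[symmetric] mult_ac)
    qed
    have "((\<lambda>s. cip (\<pi> (mexp (s *\<^sub>R X)) *v w) e) has_vector_derivative cip (dpi X *v w) e) (at 0)"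
      by (rule bounded_linear.has_vector_derivative[OF _ dpi_derivative_0[OF X(1)]])
        (simp add: linear_conv_bounded_linear[symmetric] linear_iff mv.add_left cip_linear scaleR_cscale
          cscale_vector_mult scaleR_conv_of_real)
    moreover have "((\<lambda>s. cip (\<pi> (mexp (s *\<^sub>R X)) *v w) e) has_vector_derivative ?k * ?t X * cip w e) (at 0)"
    proof -
      have "((\<lambda>s. exp (s * (?k * ?t X)) * cip w e) has_field_derivative ?k * ?t X * cip w e) (at (of_real 0))"
        by (auto intro!: derivative_eq_intros)
      from has_vector_derivative_real_field[OF this]
      show ?thesis unfolding chi_twist[OF e L] uc .
    qed
    ultimately show ?thesis by (rule vector_derivative_unique_at)
  qed
  let ?Z = "diag_blocks A B :: ('p, 'q) bmat"
  have 1: "skew_part ?Z = diag_blocks (skew_part A) (skew_part B)"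
    "skew_part' ?Z = diag_blocks (skew_part' A) (skew_part' B)"
    by (simp_all add: vec_eq_iff all_sum_iff skew_part_def skew_part'_def diag_blocks_def)
  have t: "?t ?Z = ?t (skew_part ?Z) + \<i> * ?t (skew_part' ?Z)"
    by (subst (1) skew_parts[of ?Z]) (simp add: tau_add tau_cscale trace_def sum.distrib sum_distrib_left)
  show ?thesis
    unfolding t dC_def
    using real[OF skew_parts_lie_K(1)[OF l] 1(1)] real[OF skew_parts_lie_K(2)[OF l] 1(2)]
    by (simp add: mv.add_left cip_linear cscale_vector_mult algebra_simps)
qed

text \<open>Iterated derivatives are indexed by words in the complexified Lie algebra; the first letter acts
  last on the vector, which is the order in which left invariant vector fields compose.\<close>

definition word_vec :: "('p::{finite, linorder}, 'q::{finite, linorder}) bmat list \<Rightarrow> complex^'v::finite \<Rightarrow> complex^'v::finite" where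
  "word_vec Zs w = foldr (\<lambda>Z w. dC Z *v w) Zs w"

definition word_fun :: "('p::{finite, linorder}, 'q::{finite, linorder}) bmat list \<Rightarrow>
    (('p::{finite, linorder}, 'q::{finite, linorder}) bmat \<Rightarrow> complex) \<Rightarrow> ('p::{finite, linorder}, 'q::{finite, linorder}) bmat \<Rightarrow> complex" where
  "word_fun Zs F = foldr (\<lambda>Z. mder (tau \<kappa> Z)) Zs F"

lemma word_simps [simp]:
  "word_vec [] w = w" "word_vec (Z # Zs) w = dC Z *v word_vec Zs w"
  "word_fun [] F = F" "word_fun (Z # Zs) F = mder (tau \<kappa> Z) (word_fun Zs F)"
  by (simp_all add: word_vec_def word_fun_def)

lemma word_append:
  "word_vec (As @ Bs) w = word_vec As (word_vec Bs w)" "word_fun (As @ Bs) F = word_fun As (word_fun Bs F)"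
  by (induction As) simp_all

lemma matpoly_word: "matpoly F \<Longrightarrow> matpoly (word_fun Zs F)"
  by (induction Zs) (auto intro: matpoly_mder)

lemma word_vec_linear: "word_vec Zs (w + w') = word_vec Zs w + word_vec Zs w'" "word_vec Zs (c *s w) = c *s word_vec Zs w"
  by (induction Zs) (simp_all add: mv.add_right cscale_vector_mult')

lemma word_fun_linear:
  assumes "matpoly F" "matpoly G"
  shows "word_fun Zs (\<lambda>g. F g + c * G g) = (\<lambda>g. word_fun Zs F g + c * word_fun Zs G g)"
proof (induction Zs)
  case (Cons Z Zs)
  then show ?case
    by (simp add: mder_rules matpoly.mult[OF matpoly.const] matpoly.const matpoly_word assms mult.commute)
qed simp


lemma model_tau_positive:
  assumes "\<beta> \<in> positive_restricted" "root_space \<beta> Z"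
  shows "mder (tau \<kappa> Z) (model k) = (\<lambda>_. 0)"
proof -
  obtain S where S: "tau \<kappa> Z ** weight_frame = weight_frame ** S" "trace S = 0"
    using positive_root_frame[OF root_space_tau[OF assms(2)] assms(1)] by blast
  show ?thesis unfolding mder_model_right[OF S(1)] S(2) by simp
qed

text \<open>The Iwasawa decomposition: every element of the complexified Lie algebra acts on the highest weight
  vector, and on the model at the right, like a block diagonal element up to a scalar.  Positive root
  spaces act by zero, a negative root vector \<open>Z\<close> acts as the block diagonal element \<open>Z + theta Z\<close>, and the
  zero root space is the sum of block diagonal elements and the elements \<open>Y_complex c\<close>, which act by the
  weight.\<close>

lemma right_reduction:
  assumes weight: "\<And>t. dpi (Y_elt t) *v v = (\<i> * of_real ((\<Sum>j\<in>UNIV. real k *\<^sub>R axis j 1) \<bullet> t)) *s v"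
    and pos: "\<And>\<beta> Z. \<beta> \<in> positive_restricted \<Longrightarrow> Z \<in> kC \<kappa> \<Longrightarrow> root_space \<beta> Z \<Longrightarrow> dC Z *v v = 0"
    and Z: "Z \<in> kC \<kappa>"
  shows "\<exists>l \<in> {Z \<in> kC \<kappa>. \<exists>A B. Z = diag_blocks A B}. \<exists>c. dC Z *v v = dC l *v v + c *s v \<and>
    mder (tau \<kappa> Z) (model k) = (\<lambda>g. mder (tau \<kappa> l) (model k) g + c * model k g)"
    (is "?good Z")
proof -
  let ?L = "{Z :: ('p, 'q) bmat. Z \<in> kC \<kappa> \<and> (\<exists>A B. Z = diag_blocks A B)}"
  have zero: "(0 :: ('p, 'q) bmat) = diag_blocks 0 0" by (simp add: vec_eq_iff all_sum_iff diag_blocks_def)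
  have L0: "0 \<in> ?L" using zero by (auto simp: kC_closed)
  have d0: "dC (0 :: ('p, 'q) bmat) *v v = 0" using dC_cscale[of 0 0] by simp
  have m0: "mder (tau \<kappa> (0 :: ('p, 'q) bmat)) (model k) = (\<lambda>_. 0)"
    using mder_cscale[OF matpoly_model, of 0 0] tau_cscale[of \<kappa> 0 "0 :: ('p, 'q) bmat"] by simp
  have Ladd: "l + l' \<in> ?L" if "l \<in> ?L" "l' \<in> ?L" for l l'
  proof -
    have "diag_blocks A B + diag_blocks A' B' = diag_blocks (A + A') (B + B')"
      for A A' :: "complex^'p::{finite, linorder}^'p::{finite, linorder}" and B B' :: "complex^'q::{finite, linorder}^'q::{finite, linorder}"
      by (simp add: vec_eq_iff all_sum_iff diag_blocks_def)
    then show ?thesis using that by (auto simp: kC_closed) metis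
  qed
  have Lscale: "cscale c l \<in> ?L" if "l \<in> ?L" for c l
  proof -
    have "cscale c (diag_blocks A B) = diag_blocks (cscale c A) (cscale c B)"
      for A :: "complex^'p::{finite, linorder}^'p::{finite, linorder}" and B :: "complex^'q::{finite, linorder}^'q::{finite, linorder}"
      by (simp add: vec_eq_iff all_sum_iff diag_blocks_def)
    then show ?thesis using that by (auto simp: kC_closed)
  qed
  have "subspace {Z. ?good Z}"
    unfolding subspace_def
  proof (intro conjI ballI allI CollectI; (elim CollectE)?)
    show "?good 0" using L0 d0 m0 by (intro bexI[of _ 0] exI[of _ 0]) auto
  next
    fix x y assume "?good x" "?good y"
    then obtain l c l' c' where l: "l \<in> ?L" "dC x *v v = dC l *v v + c *s v"
      "mder (tau \<kappa> x) (model k) = (\<lambda>g. mder (tau \<kappa> l) (model k) g + c * model k g)"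
      and l': "l' \<in> ?L" "dC y *v v = dC l' *v v + c' *s v"
      "mder (tau \<kappa> y) (model k) = (\<lambda>g. mder (tau \<kappa> l') (model k) g + c' * model k g)" by blast
    show "?good (x + y)"
      by (intro bexI[of _ "l + l'"] exI[of _ "c + c'"] conjI Ladd l(1) l'(1))
        (simp_all add: dC_add mv.add_left l l' tau_add mder_add[OF matpoly_model] algebra_simps vector_sadd_rdistrib)
  next
    fix x :: "('p, 'q) bmat" and r :: real assume "?good x"
    then obtain l c where l: "l \<in> ?L" "dC x *v v = dC l *v v + c *s v"
      "mder (tau \<kappa> x) (model k) = (\<lambda>g. mder (tau \<kappa> l) (model k) g + c * model k g)" by blast
    show "?good (r *\<^sub>R x)"
      unfolding scaleR_cscale
      by (intro bexI[of _ "cscale (of_real r) l"] exI[of _ "of_real r * c"] conjI Lscale l(1))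
        (simp_all add: dC_cscale cscale_vector_mult l tau_cscale mder_cscale[OF matpoly_model] algebra_simps
          vector_add_ldistrib vector_smult_assoc)
  qed
  moreover have "{Z :: ('p, 'q) bmat. Z \<in> kC \<kappa> \<and> Z \<noteq> 0 \<and> (\<exists>\<beta>. root_space \<beta> Z)} \<subseteq> {Z. ?good Z}"
  proof safe
    fix Z :: "('p, 'q) bmat" and \<beta> assume Z: "Z \<in> kC \<kappa>" "Z \<noteq> 0" "root_space \<beta> Z"
    from root_cases[OF Z(3,2)] consider "\<beta> = 0" | "\<beta> \<in> positive_restricted" | "- \<beta> \<in> positive_restricted" by blast
    then show "?good Z"
    proof cases
      case 1
      obtain A B c where ABc: "Z = diag_blocks A B + Y_complex c" using root_space_zero Z(3) 1 by blast
      let ?l = "diag_blocks A B :: ('p, 'q) bmat"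
      let ?a = "of_nat k * (\<Sum>j\<in>UNIV. \<i> * c $ j)"
      have "?l = Z - Y_complex c" using ABc by simp
      then have "?l \<in> kC \<kappa>" using kC_closed(2)[OF Z(1) Y_complex_kC[of c \<kappa>]] by simp
      then have l: "?l \<in> ?L" by blast
      have "(Y_complex c :: ('p, 'q) bmat) = Y_elt (\<chi> i. Re (c $ i)) + cscale \<i> (Y_elt (\<chi> i. Im (c $ i)))"
        by (simp add: vec_eq_iff all_sum_iff Y_elt_complex complex_eq_iff)
      then have "dC (Y_complex c :: ('p, 'q) bmat) =
          dpi (Y_elt (\<chi> i. Re (c $ i))) + cscale \<i> (dpi (Y_elt (\<chi> i. Im (c $ i))))"
        by (simp add: dC_parts Y_elt_lie_K)
      moreover have "(\<Sum>j\<in>UNIV. real k *\<^sub>R axis j 1) \<bullet> t = real k * (\<Sum>j\<in>UNIV. t $ j)" for t :: "real^'p::{finite, linorder}"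
        by (simp add: inner_sum_left inner_axis' sum_distrib_left)
      ultimately have "dC (Y_complex c :: ('p, 'q) bmat) *v v = (\<i> * of_real (real k * (\<Sum>j\<in>UNIV. Re (c $ j)))) *s v +
          (\<i> * (\<i> * of_real (real k * (\<Sum>j\<in>UNIV. Im (c $ j))))) *s v"
        by (simp add: mv.add_left cscale_vector_mult weight vector_smult_assoc)
      also have "\<dots> = ?a *s v"
      proof -
        have "(\<i> * of_real (real k * (\<Sum>j\<in>UNIV. Re (c $ j)))) + (\<i> * (\<i> * of_real (real k * (\<Sum>j\<in>UNIV. Im (c $ j))))) = ?a"
          by (simp add: complex_eq_iff sum_distrib_left[symmetric] sum_negf)
        then show ?thesis by (metis vector_sadd_rdistrib)
      qed
      finally have dY: "dC (Y_complex c :: ('p, 'q) bmat) *v v = ?a *s v" .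
      have mY: "mder (tau \<kappa> (Y_complex c :: ('p, 'q) bmat)) (model k) = (\<lambda>g. ?a * model k g)"
        unfolding tau_Y mder_model_right[OF Y_complex_frame] by (simp add: trace_def)
      show ?thesis
        by (intro bexI[OF _ l] exI[of _ ?a])
          (simp add: ABc dC_add mv.add_left dY tau_add mder_add[OF matpoly_model] mY)
    next
      case 2
      have "dC Z *v v = 0" "mder (tau \<kappa> Z) (model k) = (\<lambda>_. 0)"
        using pos[OF 2 Z(1,3)] model_tau_positive[OF 2 Z(3)] by auto
      then show ?thesis using L0 d0 m0 by (intro bexI[of _ 0] exI[of _ 0]) auto
    next
      case 3
      note th = root_space_theta[OF Z(3)]
      have "dC (theta Z) *v v = 0" "mder (tau \<kappa> (theta Z)) (model k) = (\<lambda>_. 0)"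
        using pos[OF 3 kC_theta[OF Z(1)] th] model_tau_positive[OF 3 th] by auto
      moreover have "Z + theta Z \<in> ?L" using kC_closed(1)[OF Z(1) kC_theta[OF Z(1)]] add_theta[of Z] by blast
      ultimately show ?thesis
        by (intro bexI[of _ "Z + theta Z"] exI[of _ 0])
          (auto simp: dC_add mv.add_left tau_add mder_add[OF matpoly_model])
    qed
  qed
  ultimately have "kC \<kappa> \<subseteq> {Z. ?good Z}" by (intro order_trans[OF kC_root_spaces span_minimal])
  then show ?thesis using Z by auto
qed


text \<open>The difference of the two sides satisfies the assumptions of \<open>words_vanish\<close>: at the left end block
  diagonal elements act by the same character, at the right end \<open>right_reduction\<close> treats both in the
  same way.\<close>

lemma words_agree:
  fixes k defines "k \<equiv> min_type \<kappa>"
  assumes weight: "\<And>t. dpi (Y_elt t) *v v = (\<i> * of_real ((\<Sum>j\<in>UNIV. real k *\<^sub>R axis j 1) \<bullet> t)) *s v"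
    and pos: "\<And>\<beta> Z. \<beta> \<in> positive_restricted \<Longrightarrow> Z \<in> kC \<kappa> \<Longrightarrow> root_space \<beta> Z \<Longrightarrow> dC Z *v v = 0"
    and e: "e \<in> chi_vectors \<kappa> \<pi>" and Zs: "set Zs \<subseteq> kC \<kappa>"
  shows "cip (word_vec Zs v) e = cip v e * word_fun Zs (model k) (mat 1)"
proof -
  define W where "W Zs = cip (word_vec Zs v) e - cip v e * word_fun Zs (model k) (mat 1)" for Zs
  let ?L = "{Z :: ('p, 'q) bmat. Z \<in> kC \<kappa> \<and> (\<exists>A B. Z = diag_blocks A B)}"
  have "W Zs = 0"
  proof (rule words_vanish[where k = "kC \<kappa>" and L = ?L and br = "\<lambda>X Y. X ** Y - Y ** X"
        and ch = "\<lambda>l. of_nat k * trace (block11 (tau \<kappa> l))"])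
    show "X ** Y - Y ** X \<in> kC \<kappa>" if "X \<in> kC \<kappa>" "Y \<in> kC \<kappa>" for X Y :: "('p, 'q) bmat"
      using that by (rule kC_closed)
    show "W (As @ X # Y # Bs) = W (As @ Y # X # Bs) + W (As @ (X ** Y - Y ** X) # Bs)"
      if "X \<in> kC \<kappa>" "Y \<in> kC \<kappa>" for As Bs X Y
    proof -
      have "word_vec (X # Y # Bs) v = word_vec (Y # X # Bs) v + word_vec ((X ** Y - Y ** X) # Bs) v"
        by (simp add: dC_bracket[OF that] mv.diff_left matrix_vector_mul_assoc)
      then have 1: "word_vec (As @ X # Y # Bs) v = word_vec (As @ Y # X # Bs) v + word_vec (As @ (X ** Y - Y ** X) # Bs) v"
        by (simp only: word_append word_vec_linear)
      have mp: "matpoly (word_fun Cs (model k))" for Cs by (rule matpoly_word[OF matpoly_model])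
      have "word_fun (X # Y # Bs) (model k) =
          (\<lambda>g. word_fun (Y # X # Bs) (model k) g + 1 * word_fun ((X ** Y - Y ** X) # Bs) (model k) g)"
        using mder_bracket[OF mp, of "tau \<kappa> X" "tau \<kappa> Y" Bs] by (simp add: tau_bracket fun_eq_iff algebra_simps)
      then have 2: "word_fun (As @ X # Y # Bs) (model k) =
          (\<lambda>g. word_fun (As @ Y # X # Bs) (model k) g + 1 * word_fun (As @ (X ** Y - Y ** X) # Bs) (model k) g)"
        by (simp only: word_append word_fun_linear[OF mp mp])
      show ?thesis unfolding W_def 1 2 by (simp add: cip_linear algebra_simps)
    qed
    show "W (l # Zs) = of_nat k * trace (block11 (tau \<kappa> l)) * W Zs" if "l \<in> ?L" for l Zs
    proof -
      obtain A B where l: "l \<in> kC \<kappa>" "l = diag_blocks A B" using \<open>l \<in> ?L\<close> by blast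
      obtain A' B' where t: "tau \<kappa> l = diag_blocks A' B'" "trace A' = trace (block11 (tau \<kappa> l))"
        using tau_diag[of \<kappa> A B] unfolding l(2)[symmetric] by metis
      have le: "left_equivariant k (word_fun Zs (model k))" for Zs
      proof (induction Zs)
        case (Cons Z Zs)
        then show ?case using left_equivariant_mder[OF matpoly_word[OF matpoly_model] Cons] by simp
      qed (simp add: left_equivariant_model)
      have "cip (word_vec (l # Zs) v) e = of_nat k * trace (block11 (tau \<kappa> l)) * cip (word_vec Zs v) e"
        unfolding word_simps l(2) k_def by (rule dC_chi[OF e l(1)[unfolded l(2)]])
      moreover have "word_fun (l # Zs) (model k) (mat 1) =
          of_nat k * trace (block11 (tau \<kappa> l)) * word_fun Zs (model k) (mat 1)"
        using mder_left_equivariant_one[OF matpoly_word[OF matpoly_model] le, of A' B' Zs] by (simp add: t(1))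
      ultimately show ?thesis by (simp add: W_def algebra_simps)
    qed
    show "?L \<subseteq> kC \<kappa>" by blast
    show "\<exists>l\<in>?L. \<exists>c. \<forall>Zs. set Zs \<subseteq> kC \<kappa> \<longrightarrow> W (Zs @ [Z]) = W (Zs @ [l]) + c * W Zs" if Z: "Z \<in> kC \<kappa>" for Z
    proof -
      have "\<exists>l\<in>?L. \<exists>c. dC Z *v v = dC l *v v + c *s v \<and>
          mder (tau \<kappa> Z) (model k) = (\<lambda>g. mder (tau \<kappa> l) (model k) g + c * model k g)"
        by (rule right_reduction[OF weight _ Z]) (rule pos)
      then obtain l c where l: "l \<in> ?L" and v: "dC Z *v v = dC l *v v + c *s v"
        and m: "mder (tau \<kappa> Z) (model k) = (\<lambda>g. mder (tau \<kappa> l) (model k) g + c * model k g)"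
        by blast
      have "W (Zs @ [Z]) = W (Zs @ [l]) + c * W Zs" for Zs
        unfolding W_def word_append word_simps v m word_vec_linear
          word_fun_linear[OF matpoly_mder[OF matpoly_model] matpoly_model]
        by (simp add: cip_linear algebra_simps)
      with l show ?thesis by blast
    qed
    show "W [] = 0" by (simp add: W_def model_one)
    show "set Zs \<subseteq> kC \<kappa>" by (rule Zs)
  qed
  then show ?thesis by (simp add: W_def)
qed

text \<open>Along \<open>s \<mapsto> g exp (s X)\<close> the difference of the two sides is an entire function of \<open>s\<close> whose derivatives
  at \<open>0\<close> are again of this kind with a longer word.  If all of them vanish at \<open>g\<close>, the function vanishes
  at \<open>s = 1\<close>, so equality for all words passes from \<open>g\<close> to \<open>g exp X\<close>.\<close>

lemma coefficient_eq_model: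
  fixes k defines "k \<equiv> min_type \<kappa>"
  assumes weight: "\<And>t. dpi (Y_elt t) *v v = (\<i> * of_real ((\<Sum>j\<in>UNIV. real k *\<^sub>R axis j 1) \<bullet> t)) *s v"
    and pos: "\<And>\<beta> Z. \<beta> \<in> positive_restricted \<Longrightarrow> Z \<in> kC \<kappa> \<Longrightarrow> root_space \<beta> Z \<Longrightarrow> dC Z *v v = 0"
    and e: "e \<in> chi_vectors \<kappa> \<pi>" and g: "g \<in> K_group \<kappa>"
  shows "cip (\<pi> g *v v) e = cip v e * model k (sg \<kappa> g)"
proof -
  let ?P = "\<lambda>g. \<forall>Zs. set Zs \<subseteq> kC \<kappa> \<longrightarrow>
    cip (\<pi> g *v word_vec Zs v) e = cip v e * word_fun Zs (model k) (sg \<kappa> g)"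
  have step: "?P (g ** mexp X)" if X: "X \<in> lie_K \<kappa>" and g: "g \<in> K_group \<kappa>" and IH: "?P g" for g X
  proof (intro allI impI)
    fix Zs :: "('p, 'q) bmat list" assume Zs: "set Zs \<subseteq> kC \<kappa>"
    have mexp_cscale_commute: "A ** mexp (cscale s A) = mexp (cscale s A) ** A" for A :: "complex^'m::finite^'m" and s
      by (rule mexp_commute) (simp add: cscale_mult_left cscale_mult_right)
    define h where "h Zs s = cip (mexp (cscale s (dpi X)) *v word_vec Zs v) (herm (\<pi> g) *v e) -
      cip v e * word_fun Zs (model k) (sg \<kappa> g ** mexp (cscale s (tau \<kappa> X)))" for Zs s
    have Xk: "X \<in> kC \<kappa>" and Xs: "herm X = - X" using X by (auto simp: lie_K_iff)
    have d: "(h Zs has_field_derivative h (X # Zs) s) (at s)" for Zs :: "('p, 'q) bmat list" and s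
    proof -
      have "mderiv (\<lambda>s. mexp (cscale s (dpi X))) (mexp (cscale s (dpi X)) ** dpi X) s"
        using mderiv_mexp[of "dpi X" s] by (simp add: mexp_cscale_commute)
      from cip_mderiv[OF this, of "word_vec Zs v" "herm (\<pi> g) *v e"]
      have 1: "((\<lambda>s. cip (mexp (cscale s (dpi X)) *v word_vec Zs v) (herm (\<pi> g) *v e)) has_field_derivative
          cip (mexp (cscale s (dpi X)) *v word_vec (X # Zs) v) (herm (\<pi> g) *v e)) (at s)"
        by (simp add: dC_lie[OF X] matrix_vector_mul_assoc)
      have "mderiv (\<lambda>s. sg \<kappa> g ** mexp (cscale s (tau \<kappa> X))) (sg \<kappa> g ** mexp (cscale s (tau \<kappa> X)) ** tau \<kappa> X) s"
        using mderiv_mult[OF mderiv_const[of "sg \<kappa> g" s] mderiv_mexp[of "tau \<kappa> X" s]]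
        by (simp add: mm.zero_left matrix_mul_assoc[symmetric] mexp_cscale_commute)
      from mder_curve(1)[OF matpoly_word[OF matpoly_model] this]
      have 2: "((\<lambda>s. word_fun Zs (model k) (sg \<kappa> g ** mexp (cscale s (tau \<kappa> X)))) has_field_derivative
          word_fun (X # Zs) (model k) (sg \<kappa> g ** mexp (cscale s (tau \<kappa> X)))) (at s)" by simp
      show ?thesis unfolding h_def by (rule DERIV_diff[OF 1 DERIV_cmult[OF 2]])
    qed
    have dn: "(deriv ^^ n) (h Zs) = h (replicate n X @ Zs)" for n
    proof (induction n)
      case (Suc n)
      have "deriv (h Ys) = h (X # Ys)" for Ys by (rule ext) (rule DERIV_imp_deriv[OF d])
      then show ?case by (simp add: Suc)
    qed simp
    have "h (replicate n X @ Zs) 0 = 0" for n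
    proof -
      have "set (replicate n X @ Zs) \<subseteq> kC \<kappa>" using Xk Zs by (auto simp: set_replicate_conv_if)
      then show ?thesis using IH unfolding h_def by (simp add: cip_adjoint)
    qed
    then have "h Zs 1 = 0"
      using holomorphic_fun_eq_0_on_connected[of "h Zs" UNIV 0 1] d
      by (simp add: dn holomorphic_on_def field_differentiable_def) blast
    then show "cip (\<pi> (g ** mexp X) *v word_vec Zs v) e = cip v e * word_fun Zs (model k) (sg \<kappa> (g ** mexp X))"
      using rep_mult[OF g mexp_lie_K[OF X, of 1]]
      by (simp add: h_def rep_mexp[OF X] sg_mult sg_mexp tau_skew[OF Xs] flip: cip_adjoint matrix_vector_mul_assoc)
  qed
  have "?P (herm (herm g))"
  proof (rule K_group_exp_induct[of "herm g" \<kappa> "\<lambda>g. ?P (herm g)"])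
    have "cip (word_vec Zs v) e = cip v e * word_fun Zs (model k) (mat 1)" if "set Zs \<subseteq> kC \<kappa>" for Zs
      unfolding k_def by (rule words_agree[OF weight[unfolded k_def] _ e that]) (rule pos)
    then show "?P (herm (mat 1))" by (simp add: rep_one sg_one)
    fix X g :: "('p, 'q) bmat" assume X: "X \<in> lie_K \<kappa>" and g: "g \<in> K_group \<kappa>" "?P (herm g)"
    have "- X \<in> lie_K \<kappa>" using lie_K_closed(2)[of 0 \<kappa> X] X kC_closed(5)[of \<kappa>] by (auto simp: lie_K_iff herm_def vec_eq_iff)
    moreover have "herm (mexp X ** g) = herm g ** mexp (- X)"
      using X by (simp add: herm_mult herm_mexp lie_K_iff)
    ultimately show "?P (herm (mexp X ** g))" using step[OF _ K_group_herm[OF g(1)] g(2)] by simp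
  qed (rule K_group_herm[OF g])
  from this[rule_format, of "[]"] show ?thesis by simp
qed

text \<open>The vectors with vanishing coefficient against \<open>e\<close> form an invariant subspace that does not contain
  \<open>e\<close>.\<close>

lemma coefficients_faithful:
  assumes irr: "irreducible_rep (K_group \<kappa>) \<pi>" and e: "e \<noteq> 0"
    and v: "\<And>g. g \<in> K_group \<kappa> \<Longrightarrow> cip (\<pi> g *v v) e = 0"
  shows "v = 0"
proof -
  let ?W = "{w. \<forall>g\<in>K_group \<kappa>. cip (\<pi> g *v w) e = 0}"
  have s: "vec.subspace ?W"
    unfolding vec.subspace_def by (auto simp: mv.zero_right mv.add_right cip_linear cscale_vector_mult')
  have i: "\<pi> g *v w \<in> ?W" if g: "g \<in> K_group \<kappa>" and w: "w \<in> ?W" for g w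
  proof safe
    fix h :: "('p, 'q) bmat" assume h: "h \<in> K_group \<kappa>"
    have "\<pi> h *v (\<pi> g *v w) = \<pi> (h ** g) *v w" by (simp add: matrix_vector_mul_assoc rep_mult[OF h g])
    then show "cip (\<pi> h *v (\<pi> g *v w)) e = 0" using w K_group_mult[OF h g] by simp
  qed
  have "?W = {0} \<or> ?W = UNIV"
    by (intro irr[unfolded irreducible_rep_def, rule_format] conjI ballI s i)
  moreover have "?W \<noteq> UNIV"
  proof
    assume "?W = UNIV"
    then have "cip (\<pi> (mat 1) *v e) e = 0" using K_group_one by blast
    then show False using e by (simp add: rep_one cip_self)
  qed
  ultimately show ?thesis using v by blast
qed

end

section \<open>The spherical function\<close>

lemma sum_over_signs:
  fixes a c :: "'a::finite \<Rightarrow> complex"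
  shows "(\<Sum>S\<in>UNIV. \<Prod>x\<in>UNIV. a x + (if x \<in> S then 1 else - 1) * c x) = 2 ^ CARD('a) * (\<Prod>x\<in>UNIV. a x)"
proof -
  have "(\<Prod>x\<in>UNIV. a x + (if x \<in> S then 1 else - 1) * c x) = (\<Prod>x\<in>S. a x + c x) * (\<Prod>x\<in>UNIV - S. a x - c x)" for S
  proof -
    have "(\<Prod>x\<in>UNIV. a x + (if x \<in> S then 1 else - 1) * c x) =
        (\<Prod>x\<in>S. a x + (if x \<in> S then 1 else - 1) * c x) * (\<Prod>x\<in>UNIV - S. a x + (if x \<in> S then 1 else - 1) * c x)"
      by (subst prod.subset_diff[of S]) (auto simp: mult.commute)
    then show ?thesis by simp
  qed
  then have "(\<Sum>S\<in>UNIV. \<Prod>x\<in>UNIV. a x + (if x \<in> S then 1 else - 1) * c x) =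
      (\<Prod>x\<in>UNIV. (a x + c x) + (a x - c x))"
    by (simp only: prod_add[OF finite] Pow_UNIV)
  also have "\<dots> = (\<Prod>x\<in>UNIV. 2 * a x)" by (intro prod.cong) simp_all
  finally show ?thesis by (simp add: prod.distrib)
qed

lemma det_columns: "det A = (\<Sum>\<sigma> | \<sigma> permutes UNIV. of_int (sign \<sigma>) * (\<Prod>j\<in>UNIV. A $ \<sigma> j $ j))"
  for A :: "complex^'n::finite^'n"
proof -
  have "det A = det (transpose A)" by simp
  then show ?thesis unfolding det_def[of "transpose A"] by (simp add: transpose_nth)
qed

text \<open>The determinant is affine in each column, so flipping signs independently averages out every
  term in which a column of \<open>C\<close> occurs.\<close>

lemma det_sum_over_signs:
  fixes A C :: "complex^'n::finite^'n"
  shows "(\<Sum>S\<in>UNIV. det (\<chi> i j. A $ i $ j + (if j \<in> S then 1 else - 1) * C $ i $ j)) = 2 ^ CARD('n) * det A"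
proof -
  have "(\<Sum>S\<in>UNIV. det (\<chi> i j. A $ i $ j + (if j \<in> S then 1 else - 1) * C $ i $ j)) =
      (\<Sum>\<sigma> | \<sigma> permutes UNIV. of_int (sign \<sigma>) *
        (\<Sum>S\<in>UNIV. \<Prod>j\<in>UNIV. A $ \<sigma> j $ j + (if j \<in> S then 1 else - 1) * C $ \<sigma> j $ j))"
    unfolding det_columns sum_distrib_left by (subst sum.swap) simp
  then show ?thesis unfolding sum_over_signs det_columns[of A] by (simp add: sum_distrib_left mult_ac)
qed

lemma det_pencil_poly:
  fixes A C :: "complex^'n::finite^'n"
  obtains P where "degree P \<le> CARD('n)" "\<And>s. poly P s = det (A + cscale s C)"
proof -
  let ?P = "\<Sum>\<sigma> | \<sigma> permutes UNIV. of_int (sign \<sigma>) * (\<Prod>j\<in>UNIV. [: A $ \<sigma> j $ j, C $ \<sigma> j $ j :])"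
  show ?thesis
  proof (rule that[of ?P])
    show "poly ?P s = det (A + cscale s C)" for s
      by (simp add: det_columns poly_sum poly_prod poly_of_int)
    show "degree ?P \<le> CARD('n)"
    proof (rule degree_sum_le)
      fix \<sigma> :: "'n \<Rightarrow> 'n"
      have "degree (of_int (sign \<sigma>) * (\<Prod>j\<in>UNIV. [: A $ \<sigma> j $ j, C $ \<sigma> j $ j :])) \<le>
          degree (of_int (sign \<sigma>) :: complex poly) + degree (\<Prod>j\<in>UNIV. [: A $ \<sigma> j $ j, C $ \<sigma> j $ j :])"
        by (rule degree_mult_le)
      also have "degree (of_int (sign \<sigma>) :: complex poly) = 0" by (rule degree_of_int)
      also have "degree (\<Prod>j\<in>UNIV. [: A $ \<sigma> j $ j, C $ \<sigma> j $ j :]) \<le>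
          (\<Sum>j\<in>UNIV. degree [: A $ \<sigma> j $ j, C $ \<sigma> j $ j :])"
        using degree_prod_sum_le[of UNIV "\<lambda>j. [: A $ \<sigma> j $ j, C $ \<sigma> j $ j :]"] by (simp add: comp_def)
      also have "\<dots> \<le> (\<Sum>j\<in>(UNIV :: 'n set). 1)" by (intro sum_mono) simp
      finally show "degree (of_int (sign \<sigma>) * (\<Prod>j\<in>UNIV. [: A $ \<sigma> j $ j, C $ \<sigma> j $ j :])) \<le> CARD('n)"
        by simp
    qed (simp add: finite_permutations)
  qed
qed

text \<open>All monomials of positive degree less than \<open>N\<close> sum to zero over the \<open>N\<close>-th roots of unity.\<close>

lemma sum_roots_of_unity_poly:
  assumes "degree P < N"
  shows "(\<Sum>j<N. poly P (cis (2 * pi * real j / real N))) = of_nat N * poly P 0"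
proof -
  have N: "N > 0" using assms by simp
  have geo: "(\<Sum>j<N. cis (2 * pi * real j / real N) ^ i) = (if i = 0 then of_nat N else 0)" if "i < N" for i
  proof (cases "i = 0")
    case False
    let ?z = "cis (2 * pi * real i / real N)"
    have pw: "cis (2 * pi * real j / real N) ^ i = ?z ^ j" for j
      unfolding Complex.DeMoivre by (simp add: mult_ac)
    have "?z \<noteq> 1"
    proof
      assume "?z = 1"
      then have "cos (2 * pi * real i / real N) = 1" by (metis cis.simps(1) one_complex.simps(1))
      then obtain n :: int where "2 * pi * real i / real N = real_of_int n * 2 * pi" using cos_one_2pi_int by auto
      then have "real i = real_of_int n * real N" using N by (simp add: field_simps)
      then have "int i = n * int N" by (metis of_int_eq_iff of_int_mult of_int_of_nat_eq)
      then have "int N dvd int i" by simp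
      then show False using that False by (simp add: dvd_imp_le nat_dvd_not_less)
    qed
    moreover have "?z ^ N = 1"
    proof -
      have "?z ^ N = cis (2 * pi * real i)" unfolding Complex.DeMoivre using N by simp
      also have "\<dots> = 1" by (rule cis_multiple_2pi) simp
      finally show ?thesis .
    qed
    ultimately show ?thesis using False by (simp add: pw geometric_sum)
  qed simp
  have "(\<Sum>j<N. poly P (cis (2 * pi * real j / real N))) =
      (\<Sum>i\<le>degree P. coeff P i * (\<Sum>j<N. cis (2 * pi * real j / real N) ^ i))"
    unfolding poly_altdef sum_distrib_left by (rule sum.swap)
  also have "\<dots> = (\<Sum>i\<le>degree P. if i = 0 then of_nat N * coeff P 0 else 0)"
    by (intro sum.cong refl) (use assms geo in auto)
  also have "\<dots> = of_nat N * poly P 0" by (simp add: poly_0_coeff_0)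
  finally show ?thesis .
qed

context spherical_block
begin

lemma det_block11_right: "det (block11 (g ** diag_blocks A B)) = det (block11 g) * det A"
proof -
  have "block11 (g ** diag_blocks A B) = block11 g ** A"
    by (simp add: vec_eq_iff matrix_mult_nth sum_UNIV_sum diag_blocks_def)
  then show ?thesis by (simp add: det_mul)
qed

lemma unit_char_sg: "det (block11 (sg \<kappa> g)) ^ min_type \<kappa> = unit_char \<kappa> (det (block11 g))"
proof -
  have "block11 (mcnj g) = mcnj (block11 g)" by (simp add: vec_eq_iff)
  then show ?thesis by (simp add: sg_def unit_char_def twist_def det_mcnj)
qed

lemma cip_sum_left: "cip (\<Sum>j\<in>J. f j) w = (\<Sum>j\<in>J. cip (f j) w)" for w :: "complex^'w::finite"
  by (induction J rule: infinite_finite_induct) (simp_all add: cip_linear)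

text \<open>The average \<open>v'\<close> of translates of the highest weight vector has the coefficient
  \<open>g \<mapsto> unit_char (det (block11 g))\<close>
  against every \<open>\<chi>\<close>-spherical vector \<open>e'\<close>, up to the factor \<open>cip v e'\<close>.  This function transforms by the
  character on the right, so \<open>v'\<close> is \<open>\<chi>\<close>-spherical.  The factor is nonzero for \<open>e' \<noteq> 0\<close> and conjugate
  linear in \<open>e'\<close>, so the \<open>\<chi>\<close>-spherical vectors form a line and \<open>v'\<close> is a multiple of \<open>e\<close>.\<close>

lemma spherical_from_average:
  fixes k and J :: "'j set" and m :: "'j \<Rightarrow> ('p, 'q) bmat"
  defines "k \<equiv> min_type \<kappa>"
  assumes irr: "irreducible_rep (K_group \<kappa>) \<pi>"
    and weight: "\<And>t. dpi (Y_elt t) *v v = (\<i> * of_real ((\<Sum>j\<in>UNIV. real k *\<^sub>R axis j 1) \<bullet> t)) *s v"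
    and pos: "\<And>\<beta> Z. \<beta> \<in> positive_restricted \<Longrightarrow> Z \<in> kC \<kappa> \<Longrightarrow> root_space \<beta> Z \<Longrightarrow> dC Z *v v = 0"
    and v: "v \<noteq> 0" and e: "e \<in> chi_vectors \<kappa> \<pi>" "norm e = 1"
    and m: "\<And>j. j \<in> J \<Longrightarrow> m j \<in> L_group \<kappa>"
    and average: "\<And>g. (\<Sum>j\<in>J. c j * model k (g ** sg \<kappa> (m j))) = det (block11 g) ^ k"
  shows "g \<in> K_group \<kappa> \<Longrightarrow> cip (\<pi> g *v e) e = unit_char \<kappa> (det (block11 g))"
    and "u \<in> chi_vectors \<kappa> \<pi> \<Longrightarrow> u = cip u e *s e"
proof -
  have e0: "e \<noteq> 0" using e(2) by auto
  define v' where "v' = (\<Sum>j\<in>J. c j *s (\<pi> (m j) *v v))"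
  have coeff: "cip (\<pi> g *v v) e' = cip v e' * model k (sg \<kappa> g)" if "e' \<in> chi_vectors \<kappa> \<pi>" "g \<in> K_group \<kappa>" for e' g
    unfolding k_def by (rule coefficient_eq_model[OF weight[unfolded k_def] _ that]) (rule pos)
  have F: "cip (\<pi> g *v v') e' = cip v e' * unit_char \<kappa> (det (block11 g))"
    if e': "e' \<in> chi_vectors \<kappa> \<pi>" and g: "g \<in> K_group \<kappa>" for g e'
  proof -
    have "cip (\<pi> g *v v') e' = (\<Sum>j\<in>J. c j * cip (\<pi> g *v (\<pi> (m j) *v v)) e')"
      unfolding v'_def by (simp add: mv.sum_right cip_sum_left cscale_vector_mult' cip_linear)
    also have "\<dots> = (\<Sum>j\<in>J. c j * (cip v e' * model k (sg \<kappa> g ** sg \<kappa> (m j))))"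
    proof (intro sum.cong refl)
      fix j assume "j \<in> J"
      then have mj: "m j \<in> K_group \<kappa>" using m L_group_K by blast
      show "c j * cip (\<pi> g *v (\<pi> (m j) *v v)) e' = c j * (cip v e' * model k (sg \<kappa> g ** sg \<kappa> (m j)))"
        using coeff[OF e' K_group_mult[OF g mj]] by (simp add: rep_mult[OF g mj] matrix_vector_mul_assoc sg_mult)
    qed
    also have "\<dots> = cip v e' * (\<Sum>j\<in>J. c j * model k (sg \<kappa> g ** sg \<kappa> (m j)))"
      by (simp add: sum_distrib_left mult_ac)
    finally show ?thesis unfolding average by (simp add: unit_char_sg k_def)
  qed
  have nz: "cip v e' \<noteq> 0" if e': "e' \<in> chi_vectors \<kappa> \<pi>" "e' \<noteq> 0" for e'
    using coefficients_faithful[OF irr e'(2), of v] coeff[OF e'(1)] v by auto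
  have "v' \<in> chi_vectors \<kappa> \<pi>"
    unfolding chi_vectors_def
  proof safe
    fix l :: "('p, 'q) bmat" assume l: "l \<in> L_group \<kappa>"
    obtain A B where AB: "l = diag_blocks A B" using l by (auto simp: L_group_def)
    have "\<pi> l *v v' - chi_L \<kappa> l *s v' = 0"
    proof (rule coefficients_faithful[OF irr e0])
      fix g :: "('p, 'q) bmat" assume g: "g \<in> K_group \<kappa>"
      have "cip (\<pi> g *v (\<pi> l *v v')) e = cip v e * unit_char \<kappa> (det (block11 (g ** l)))"
        using F[OF e(1) K_group_mult[OF g L_group_K[OF l]]] by (simp add: rep_mult[OF g L_group_K[OF l]] matrix_vector_mul_assoc)
      then show "cip (\<pi> g *v (\<pi> l *v v' - chi_L \<kappa> l *s v')) e = 0"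
        by (simp add: mv.diff_right cip_linear cscale_vector_mult' F[OF e(1) g] chi_L_eq[OF l, unfolded AB] AB det_block11_right unit_char_mult)
    qed
    then show "\<pi> l *v v' = chi_L \<kappa> l *s v'" by simp
  qed
  moreover have multiple: "\<exists>t. u = t *s e" if u: "u \<in> chi_vectors \<kappa> \<pi>" for u
  proof -
    (* The combination u - t e is annihilated by the conjugate linear functional cip v. *)
    define t where "t = cnj (cip v u / cip v e)"
    have "u - t *s e \<in> chi_vectors \<kappa> \<pi>"
      using u e(1) unfolding chi_vectors_def
      by (simp add: mv.diff_right cscale_vector_mult' vector_smult_assoc mult.commute vector_ssub_ldistrib)
    moreover have "cip v (u - t *s e) = 0" using nz[OF e(1) e0] by (simp add: cip_linear t_def)
    ultimately have "u - t *s e = 0" using nz by blast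
    then show ?thesis by auto
  qed
  ultimately obtain t where t: "v' = t *s e" by blast
  have ee: "cip e e = 1" by (simp add: cip_self e(2))
  have "t = cip v e" using F[OF e(1) K_group_one]
    by (simp add: t rep_one cip_linear ee)
  then have t0: "t = cip v e" "t \<noteq> 0" using nz[OF e(1) e0] by auto
  show "cip (\<pi> g *v e) e = unit_char \<kappa> (det (block11 g))" if "g \<in> K_group \<kappa>"
    using F[OF e(1) that] t0 by (simp add: t cscale_vector_mult' cip_linear)
  show "u = cip u e *s e" if u: "u \<in> chi_vectors \<kappa> \<pi>"
  proof -
    obtain s where "u = s *s e" using multiple[OF u] by blast
    then show ?thesis by (simp add: cip_linear ee)
  qed
qed

lemma frame_minor_diag:
  "frame_minor (g ** diag_blocks (mat x) (\<chi> r s. if r = s then d r else 0)) $ a $ b =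
    g $ Inl a $ Inl b * x - \<i> * (g $ Inl a $ Inr (lr b) * d (lr b))"
proof -
  have 1: "(\<Sum>c\<in>UNIV. f c * (if c = b then y c else 0)) = f b * (y b :: complex)" for f :: "'i::finite \<Rightarrow> complex" and b y
    by (simp add: if_distrib cong: if_cong)
  show ?thesis
    by (simp add: frame_minor_nth matrix_mult_nth sum_UNIV_sum diag_blocks_def mat_nth 1)
qed

text \<open>Signs on the rows \<open>lr j\<close> of the second block flip the second summands of the columns of the frame
  minor independently.  Since \<open>q > p\<close> there is another row \<open>r0\<close> whose sign restores determinant one.\<close>

lemma real_average:
  assumes \<kappa>: "\<kappa> = Real_Case" and pq: "CARD('p) < CARD('q)"
  obtains m :: "'p set \<Rightarrow> ('p, 'q) bmat" and c where "\<And>S. m S \<in> L_group \<kappa>"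
    "\<And>g. (\<Sum>S\<in>UNIV. c S * model 1 (g ** sg \<kappa> (m S))) = det (block11 g) ^ 1"
proof -
  have "card (range lr) = CARD('p)" by (intro card_image) (auto intro: injI)
  then obtain r0 where r0: "r0 \<notin> range lr" using pq by (metis UNIV_eq_I nat_neq_iff)
  define \<epsilon> :: "'p set \<Rightarrow> 'p \<Rightarrow> complex" where "\<epsilon> S j = (if j \<in> S then 1 else - 1)" for S j
  define d where "d S r = (if r \<in> range lr then \<epsilon> S (inv_into UNIV lr r)
      else if r = r0 then \<Prod>j\<in>UNIV. \<epsilon> S j else 1)" for S r
  define m :: "'p set \<Rightarrow> ('p, 'q) bmat" where "m S = diag_blocks (mat 1) (\<chi> r s. if r = s then d S r else 0)" for S
  have \<epsilon>: "\<epsilon> S j = 1 \<or> \<epsilon> S j = - 1" for S j by (simp add: \<epsilon>_def)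
  have \<epsilon>p: "(\<Prod>j\<in>X. \<epsilon> S j) = 1 \<or> (\<Prod>j\<in>X. \<epsilon> S j) = - 1" for S and X :: "'p set"
  proof (induction X rule: infinite_finite_induct)
    case (insert x F)
    then show ?case using \<epsilon>[of S x] by auto
  qed auto
  have d: "d S r = 1 \<or> d S r = - 1" for S r using \<epsilon> \<epsilon>p by (simp add: d_def)
  have inj: "inj lr" by (auto intro: injI)
  have dl: "d S (lr j) = \<epsilon> S j" for S j using inj by (simp add: d_def)
  have prod: "(\<Prod>r\<in>UNIV. d S r) = 1" for S
  proof -
    have "(\<Prod>r\<in>UNIV. d S r) = (\<Prod>r\<in>UNIV - range lr. d S r) * (\<Prod>r\<in>range lr. d S r)"
      by (rule prod.subset_diff) auto
    also have "(\<Prod>r\<in>range lr. d S r) = (\<Prod>j\<in>UNIV. \<epsilon> S j)" by (simp add: prod.reindex[OF inj] dl)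
    also have "(\<Prod>r\<in>UNIV - range lr. d S r) = (\<Prod>r\<in>UNIV - range lr. if r = r0 then \<Prod>j\<in>UNIV. \<epsilon> S j else 1)"
      by (intro prod.cong) (auto simp: d_def)
    also have "\<dots> = (\<Prod>j\<in>UNIV. \<epsilon> S j)" using r0 by simp
    finally show ?thesis using \<epsilon>p[of S UNIV] by auto
  qed
  show ?thesis
  proof (rule that[of m "\<lambda>_. 1 / 2 ^ CARD('p)"])
    show "m S \<in> L_group \<kappa>" for S
    proof -
      have dd: "d S r * d S r = 1" "cnj (d S r) = d S r" "d S r \<in> \<real>" for r using d[of S r] by auto
      define D :: "complex^'q::{finite, linorder}^'q::{finite, linorder}" where "D = (\<chi> r s. if r = s then d S r else 0)"
      have "D \<in> matrices_over \<kappa>" using dd(3) by (simp add: matrices_over_def \<kappa> D_def)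
      moreover have "herm D ** D = mat 1"
      proof -
        have "(herm D ** D) $ i $ j = mat 1 $ i $ j" for i j
        proof -
          have "(herm D ** D) $ i $ j = (\<Sum>r\<in>UNIV. if r = i then if i = j then 1 else 0 else 0)"
            unfolding matrix_mult_nth by (intro sum.cong) (auto simp: D_def dd)
          then show ?thesis by (simp add: mat_nth)
        qed
        then show ?thesis by (simp add: vec_eq_iff)
      qed
      moreover have "det D = 1" using prod by (subst det_diagonal) (simp_all add: D_def)
      moreover have "(mat 1 :: complex^'p::{finite, linorder}^'p::{finite, linorder}) \<in> matrices_over \<kappa>"
        by (intro matrices_over_mat) (simp add: \<kappa>)
      ultimately show ?thesis unfolding m_def D_def[symmetric] L_group_diag by simp
    qed
    show "(\<Sum>S\<in>UNIV. 1 / 2 ^ CARD('p) * model 1 (g ** sg \<kappa> (m S))) = det (block11 g) ^ 1" for g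
    proof -
      have M: "model 1 (g ** sg \<kappa> (m S)) = det (\<chi> a b. block11 g $ a $ b +
          (if b \<in> S then 1 else - 1) * (\<chi> a b. - \<i> * g $ Inl a $ Inr (lr b)) $ a $ b)" for S
      proof -
        have "frame_minor (g ** m S) = (\<chi> a b. block11 g $ a $ b +
          (if b \<in> S then 1 else - 1) * (\<chi> a b. - \<i> * g $ Inl a $ Inr (lr b)) $ a $ b)"
          by (simp add: vec_eq_iff m_def frame_minor_diag dl \<epsilon>_def)
        then show ?thesis by (simp add: model_def sg_def \<kappa> conjugating_def)
      qed
      show ?thesis unfolding M sum_distrib_left[symmetric] det_sum_over_signs by simp
    qed
  qed
qed

text \<open>The scalars \<open>a\<close> and \<open>b\<close> on the two blocks replace the frame minor \<open>A + C\<close> by \<open>a (A + (b/a) C)\<close>, a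
  polynomial in \<open>b/a\<close> after the factor \<open>a\<close> is removed.  Summation over the quotients \<open>b/a\<close> that are \<open>N\<close>-th
  roots of unity isolates its constant term.\<close>

lemma complex_average:
  assumes \<kappa>: "\<kappa> = Complex_Case l"
  obtains m :: "nat \<Rightarrow> ('p, 'q) bmat" and c N where "\<And>j. m j \<in> L_group \<kappa>"
    "\<And>g. (\<Sum>j<N. c j * model k (g ** sg \<kappa> (m j))) = det (block11 g) ^ k"
proof -
  define n where "n = CARD('p) + CARD('q)"
  (* The polynomial in b / a has degree at most p k < N. *)
  define N where "N = Suc (CARD('p) * k)"
  have n: "n > 0" by (simp add: n_def)
  (* a^p b^q = 1 and b / a = exp (2 \<pi> \<i> j / N). *)
  define a where "a j = cis (- (2 * pi * real j * real CARD('q)) / (real N * real n))" for j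
  define b where "b j = cis (2 * pi * real j * real CARD('p) / (real N * real n))" for j
  define m :: "nat \<Rightarrow> ('p, 'q) bmat" where "m j = diag_blocks (mat (twist \<kappa> (a j))) (mat (twist \<kappa> (b j)))" for j
  have ab: "b j = cis (2 * pi * real j / real N) * a j" for j
  proof -
    have "real CARD('p) = real n - real CARD('q)" by (simp add: n_def)
    moreover have "x * (real n - y) / (real N * real n) = x / real N + - (x * y) / (real N * real n)" for x y
      using n by (simp add: N_def right_diff_distrib diff_divide_distrib del: of_nat_Suc)
    ultimately have "2 * pi * real j * real CARD('p) / (real N * real n) =
        2 * pi * real j / real N + - (2 * pi * real j * real CARD('q)) / (real N * real n)" by presburger
    then show ?thesis unfolding a_def b_def cis_mult by simp
  qed
  have apbq: "a j ^ CARD('p) * b j ^ CARD('q) = 1" for j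
  proof -
    have "a j ^ CARD('p) * b j ^ CARD('q) = cis 0"
      unfolding a_def b_def Complex.DeMoivre cis_mult by (intro arg_cong[of _ _ cis]) (simp add: field_simps)
    then show ?thesis by simp
  qed
  have a0: "a j \<noteq> 0" for j by (simp add: a_def)
  have tw: "cnj (twist \<kappa> z) * twist \<kappa> z = 1" if "z = cis t" for z t
    by (simp add: that twist_def cis_cnj cis_mult)
  show ?thesis
  proof (rule that[of m "\<lambda>j. 1 / (of_nat N * a j ^ (CARD('p) * k))" N])
    show "m j \<in> L_group \<kappa>" for j
    proof -
      have "twist \<kappa> (a j) ^ CARD('p) * twist \<kappa> (b j) ^ CARD('q) = twist \<kappa> (a j ^ CARD('p) * b j ^ CARD('q))"
        by (simp add: twist_def)
      also have "\<dots> = 1" by (simp add: apbq twist_def)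
      finally show ?thesis
        unfolding m_def L_group_diag
        using tw[OF a_def[of j]] tw[OF b_def[of j]]
        by (simp add: matrices_over_def \<kappa> det_mat mat_mult_cscale) (simp add: vec_eq_iff mat_nth mult.commute)
    qed
    show "(\<Sum>j<N. 1 / (of_nat N * a j ^ (CARD('p) * k)) * model k (g ** sg \<kappa> (m j))) = det (block11 g) ^ k" for g
    proof -
      let ?C = "\<chi> a b. - \<i> * g $ Inl a $ Inr (lr b)"
      obtain P where P: "degree P \<le> CARD('p)" "\<And>s. poly P s = det (block11 g + cscale s ?C)"
        using det_pencil_poly[of "block11 g" ?C] by blast
      have "model k (g ** sg \<kappa> (m j)) = a j ^ (CARD('p) * k) * poly (P ^ k) (cis (2 * pi * real j / real N))" for j
      proof -
        have sgm: "sg \<kappa> (m j) = diag_blocks (mat (a j)) (\<chi> r s. if r = s then b j else 0)"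
          by (simp add: m_def sg_def twist_def vec_eq_iff all_sum_iff diag_blocks_def mat_nth)
        have "frame_minor (g ** sg \<kappa> (m j)) = cscale (a j) (block11 g + cscale (cis (2 * pi * real j / real N)) ?C)"
          unfolding sgm by (simp add: vec_eq_iff frame_minor_diag ab algebra_simps)
        then show ?thesis by (simp add: model_def det_cscale P(2) power_mult_distrib power_mult)
      qed
      then have "(\<Sum>j<N. 1 / (of_nat N * a j ^ (CARD('p) * k)) * model k (g ** sg \<kappa> (m j))) =
          (\<Sum>j<N. poly (P ^ k) (cis (2 * pi * real j / real N))) / of_nat N"
        by (simp add: a0 sum_divide_distrib)
      also have "\<dots> = poly (P ^ k) 0"
      proof -
        have "degree (P ^ k) \<le> degree P * k" by (rule degree_power_le)
        also have "\<dots> \<le> CARD('p) * k" using P(1) by (rule mult_le_mono1)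
        also have "\<dots> < N" by (simp add: N_def)
        finally show ?thesis by (subst sum_roots_of_unity_poly) (auto simp: N_def simp del: of_nat_Suc)
      qed
      finally show ?thesis by (simp add: P(2))
    qed
  qed
qed

text \<open>The coefficient of the highest weight vector is known by \<open>coefficient_eq_model\<close>, and averaging it over
  suitable elements of \<open>L_group\<close> removes the part of the frame minor outside the upper left block.\<close>

theorem spherical_function:
  assumes dims: "\<kappa> = Real_Case \<Longrightarrow> CARD('p) < CARD('q)"
    and irr: "irreducible_rep (K_group \<kappa>) \<pi>"
    and weight: "restricted_highest_weight \<kappa> \<pi> (\<Sum>j\<in>UNIV. real (min_type \<kappa>) *\<^sub>R axis j 1)"
    and e: "e \<in> chi_vectors \<kappa> \<pi>" "norm e = 1"
  shows "g \<in> K_group \<kappa> \<Longrightarrow> cip (\<pi> g *v e) e = unit_char \<kappa> (det (block11 g))"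
    and "u \<in> chi_vectors \<kappa> \<pi> \<Longrightarrow> u = cip u e *s e"
proof -
  obtain v where v: "v \<noteq> 0"
    "\<And>t. dpi (Y_elt t) *v v = (\<i> * of_real ((\<Sum>j\<in>UNIV. real (min_type \<kappa>) *\<^sub>R axis j 1) \<bullet> t)) *s v"
    "\<And>\<beta> Z. \<beta> \<in> positive_restricted \<Longrightarrow> Z \<in> kC \<kappa> \<Longrightarrow> root_space \<beta> Z \<Longrightarrow> dC Z *v v = 0"
    by (rule highest_weight_vector[OF weight]) blast
  have "(\<forall>g\<in>K_group \<kappa>. cip (\<pi> g *v e) e = unit_char \<kappa> (det (block11 g))) \<and>
    (\<forall>u\<in>chi_vectors \<kappa> \<pi>. u = cip u e *s e)"
  proof (cases \<kappa>)
    case Real_Case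
    obtain m :: "'p set \<Rightarrow> ('p, 'q) bmat" and c where mc: "\<And>S. m S \<in> L_group \<kappa>"
      "\<And>g. (\<Sum>S\<in>UNIV. c S * model 1 (g ** sg \<kappa> (m S))) = det (block11 g) ^ 1"
      using real_average[OF Real_Case dims[OF Real_Case]] by blast
    have k: "min_type \<kappa> = 1" by (simp add: Real_Case)
    have mc2: "(\<Sum>S\<in>UNIV. c S * model (min_type \<kappa>) (g ** sg \<kappa> (m S))) = det (block11 g) ^ min_type \<kappa>" for g
      unfolding k by (rule mc(2))
    show ?thesis
    proof (intro conjI ballI)
      show "cip (\<pi> g *v e) e = unit_char \<kappa> (det (block11 g))" if "g \<in> K_group \<kappa>" for g
        by (rule spherical_from_average(1)[where J = UNIV and m = m and c = c, OF irr v(2) _ v(1) e mc(1) mc2 that])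
          (rule v(3))
      show "u = cip u e *s e" if "u \<in> chi_vectors \<kappa> \<pi>" for u
        by (rule spherical_from_average(2)[where J = UNIV and m = m and c = c, OF irr v(2) _ v(1) e mc(1) mc2 that])
          (rule v(3))
    qed
  next
    case (Complex_Case l)
    obtain m :: "nat \<Rightarrow> ('p, 'q) bmat" and c N where mc: "\<And>j. m j \<in> L_group \<kappa>"
      "\<And>g. (\<Sum>j<N. c j * model (min_type \<kappa>) (g ** sg \<kappa> (m j))) = det (block11 g) ^ min_type \<kappa>"
      using complex_average[OF Complex_Case, of "min_type \<kappa>"] by blast
    show ?thesis
    proof (intro conjI ballI)
      show "cip (\<pi> g *v e) e = unit_char \<kappa> (det (block11 g))" if "g \<in> K_group \<kappa>" for g
        by (rule spherical_from_average(1)[where J = "{..<N}" and m = m and c = c, OF irr v(2) _ v(1) e mc(1,2) that])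
          (rule v(3))
      show "u = cip u e *s e" if "u \<in> chi_vectors \<kappa> \<pi>" for u
        by (rule spherical_from_average(2)[where J = "{..<N}" and m = m and c = c, OF irr v(2) _ v(1) e mc(1,2) that])
          (rule v(3))
    qed
  qed
  then show "g \<in> K_group \<kappa> \<Longrightarrow> cip (\<pi> g *v e) e = unit_char \<kappa> (det (block11 g))"
    "u \<in> chi_vectors \<kappa> \<pi> \<Longrightarrow> u = cip u e *s e" by blast+
qed

end

section \<open>The intertwining integral in the half plane of convergence\<close>

text \<open>The kernel \<open>\<alpha>(g)\<^sup>s \<chi>(m(g))\<close> on the group.\<close>

definition kern :: "base_case \<Rightarrow> complex \<Rightarrow> ('p::finite, 'q::finite) bmat \<Rightarrow> complex" where
  "kern \<kappa> s g = real_cpow (cmod (det (block11 g))) s * unit_char \<kappa> (det (block11 g) / of_real (cmod (det (block11 g))))"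

lemma J_integrand_kern:
  fixes x h :: "('p::finite, 'q::finite) bmat"
  assumes x: "x \<in> K_group \<kappa>" and h: "h \<in> K_group \<kappa>"
  shows "J_integrand \<kappa> f x z h = kern \<kappa> (z - rho \<kappa> TYPE('p \<times> 'q)) (herm x ** h) * f h"
proof -
  let ?g = "herm x ** h"
  have "matrix_inv x ** x = mat 1"
    unfolding matrix_inv_def by (rule someI2[of _ "herm x"]) (use K_groupD[OF x] in auto)
  then have "matrix_inv x ** x ** herm x = herm x" by simp
  then have "matrix_inv x = herm x" by (simp add: K_groupD(4)[OF x] flip: matrix_mul_assoc)
  moreover have g: "?g \<in> K_group \<kappa>" by (intro K_group_mult K_group_herm x h)
  moreover note cell = cell_kernel[OF K_groupD(1)[OF g] K_groupD(2)[OF g]]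
  ultimately show ?thesis
    unfolding J_integrand_def kern_def real_cpow_def by (simp add: Let_def mult_ac)
qed

lemma unit_char_of_real: "unit_char \<kappa> (of_real r) = of_real (r ^ min_type \<kappa>)"
  by (simp add: unit_char_def twist_def)

text \<open>The phases cancel and leave \<open>\<bar>det\<bar>\<^sup>k\<close>.\<close>

lemma kern_conjugate:
  "kern \<kappa> s g * cnj (unit_char \<kappa> (det (block11 g))) = real_cpow (cmod (det (block11 g))) (s + of_nat (min_type \<kappa>))"
proof (cases "det (block11 g) = 0")
  case True
  then show ?thesis by (simp add: kern_def real_cpow_def)
next
  case False
  let ?D = "det (block11 g)"
  have "unit_char \<kappa> (?D / of_real (cmod ?D)) * cnj (unit_char \<kappa> ?D) = unit_char \<kappa> (?D * cnj ?D / of_real (cmod ?D))"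
    unfolding cnj_unit_char unit_char_mult[symmetric] by simp
  also have "?D * cnj ?D / of_real (cmod ?D) = of_real (cmod ?D)"
    using False by (simp add: complex_norm_square[symmetric] power2_eq_square)
  finally show ?thesis
    using real_cpow_add_nat[of "cmod ?D" s "min_type \<kappa>"] by (simp add: kern_def unit_char_of_real mult.assoc)
qed

lemma kern_left:
  fixes g m :: "('p::finite, 'q::finite) bmat"
  assumes m: "m \<in> L_group \<kappa>"
  shows "kern \<kappa> s (m ** g) = unit_char \<kappa> (det (block11 m)) * kern \<kappa> s g"
proof -
  obtain A B where AB: "m = diag_blocks A B" "herm A ** A = mat 1" by (rule L_groupE[OF m])
  have "det (block11 (m ** g)) = det A * det (block11 g)"
  proof -
    have "block11 (m ** g) = A ** block11 g"
      by (simp add: vec_eq_iff AB(1) matrix_mult_nth sum_UNIV_sum diag_blocks_def)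
    then show ?thesis by (simp add: det_mul)
  qed
  moreover have "cmod (det A) = 1" by (rule cmod_det_unitary[OF AB(2)])
  ultimately show ?thesis by (simp add: kern_def AB(1) norm_mult unit_char_mult flip: times_divide_eq_right)
qed

lemma cmod_det_block11_le:
  fixes g :: "('p::finite, 'q::finite) bmat"
  assumes g: "g \<in> K_group \<kappa>" shows "cmod (det (block11 g)) \<le> 1"
proof -
  obtain js :: "'p list" where js: "set js = UNIV" "distinct js" using finite_distinct_list[of "UNIV :: 'p set"] by auto
  show ?thesis
    using row_weight_bounds[of 1 g \<kappa> js] row_weight_det[OF js(2,1), of 1 g] g by simp
qed

lemma norm_kern_le:
  assumes g: "g \<in> K_group \<kappa>" and s: "Re s > 0" shows "norm (kern \<kappa> s g) \<le> 1"
proof (cases "det (block11 g) = 0")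
  case False
  have "norm (kern \<kappa> s g) = cmod (det (block11 g)) powr Re s"
    using False by (simp add: kern_def norm_mult norm_real_cpow norm_unit_char norm_divide)
  also have "\<dots> \<le> 1 powr Re s" using s by (intro powr_mono2 cmod_det_block11_le[OF g]) auto
  finally show ?thesis by simp
qed (simp add: kern_def real_cpow_def)

lemma kern_measurable:
  fixes \<nu> :: "('p::finite, 'q::finite) bmat measure"
  assumes haar: "normalized_Haar (K_group \<kappa>) \<nu>"
  shows "kern \<kappa> s \<in> borel_measurable \<nu>"
proof -
  note [measurable] = haar_measurable_entry[OF haar]
  have [measurable]: "(\<lambda>g. det (block11 g)) \<in> borel_measurable \<nu>" unfolding det_def by simp
  show ?thesis
    unfolding kern_def[abs_def] real_cpow_def unit_char_def twist_def by (cases "conjugating \<kappa>") simp_all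
qed

lemma cip_bound: "continuous_on UNIV (\<lambda>y :: complex^'v::finite. cip v y)"
  unfolding cip_def by (intro continuous_intros)

lemma cip_eqI: "(\<And>u. cip u a = cip u b) \<Longrightarrow> a = b" for a b :: "complex^'v::finite"
proof -
  assume "\<And>u. cip u a = cip u b"
  then have "cip (a - b) (a - b) = 0" by (simp add: cip_linear)
  then show "a = b" by (simp add: cip_self)
qed

context haar_unitary_rep
begin

lemma integrable_kern_coefficient:
  assumes "f \<in> borel_measurable \<nu>" "\<And>g. g \<in> K_group \<kappa> \<Longrightarrow> norm (f g) \<le> 1" "continuous_on (K_group \<kappa>) h"
  shows "integrable \<nu> (\<lambda>g. f g * (h g :: complex))"
proof (rule Bochner_Integration.integrable_bound[OF haar_integrable_continuous[OF haar assms(3)]])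
  show "(\<lambda>g. f g * h g) \<in> borel_measurable \<nu>"
    using assms(1) haar_measurable_continuous[OF haar assms(3)] by (rule borel_measurable_times)
  show "AE g in \<nu>. norm (f g * h g) \<le> norm (h g)"
    using assms(2) by (intro AE_I2) (auto simp: haar_sets(3)[OF haar] norm_mult intro: mult_left_le_one_le)
qed

lemma continuous_coefficient: "continuous_on (K_group \<kappa>) (\<lambda>g. cip u (\<pi> g *v e))"
  by (rule continuous_on_compose2[OF cip_bound[of u]]) (auto intro!: mv.continuous_on rep_cont continuous_on_const)

end

context spherical_block
begin

text \<open>Left translation by \<open>L_group\<close> multiplies the kernel by the character, so the vector \<open>W\<close> that represents
  the integral is \<open>\<chi>\<close>-spherical, hence a multiple of \<open>e\<close>.  The factor is the integral of the kernel
  against the conjugate of the spherical function.\<close>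

lemma kern_integral:
  assumes one_dim: "\<And>u. u \<in> chi_vectors \<kappa> \<pi> \<Longrightarrow> u = cip u e *s e"
    and sph: "\<And>g. g \<in> K_group \<kappa> \<Longrightarrow> cip (\<pi> g *v e) e = unit_char \<kappa> (det (block11 g))"
    and s: "Re s > 0"
  shows "(\<integral>g. kern \<kappa> s g * cip u (\<pi> g *v e) \<partial>\<nu>) =
    cip u e * (\<integral>g. real_cpow (cmod (det (block11 g))) (s + of_nat (min_type \<kappa>)) \<partial>\<nu>)"
proof -
  define \<Phi> where "\<Phi> u = (\<integral>g. kern \<kappa> s g * cip u (\<pi> g *v e) \<partial>\<nu>)" for u
  have int: "integrable \<nu> (\<lambda>g. kern \<kappa> s g * cip u (\<pi> g *v e))" for u
    by (intro integrable_kern_coefficient kern_measurable[OF haar] norm_kern_le s continuous_coefficient)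
  have lin: "\<Phi> (u + u') = \<Phi> u + \<Phi> u'" "\<Phi> (c *s u) = c * \<Phi> u" for u u' c
    using int by (simp_all add: \<Phi>_def cip_linear distrib_left mult.left_commute)
  define W where "W = (\<chi> i. cnj (\<Phi> (axis i 1)))"
  have W: "cip u W = \<Phi> u" for u
  proof -
    have sum: "\<Phi> (\<Sum>i\<in>I. f i) = (\<Sum>i\<in>I. \<Phi> (f i))" if "finite I" for I :: "'v set" and f
      using that
    proof (induction I rule: finite_induct)
      case empty
      show ?case using lin(2)[of 0 0] by simp
    qed (simp add: lin)
    have "\<Phi> u = \<Phi> (\<Sum>i\<in>UNIV. u $ i *s axis i 1)" by (simp add: basis_expansion)
    also have "\<dots> = cip u W" by (simp add: sum lin cip_def W_def)
    finally show ?thesis ..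
  qed
  have "W \<in> chi_vectors \<kappa> \<pi>"
    unfolding chi_vectors_def
  proof safe
    fix m :: "('p, 'q) bmat" assume m: "m \<in> L_group \<kappa>"
    note mK = L_group_K[OF m] and hK = K_group_herm[OF L_group_K[OF m]]
    show "\<pi> m *v W = chi_L \<kappa> m *s W"
    proof (rule cip_eqI)
      fix u
      let ?F = "\<lambda>g. kern \<kappa> s g * cip (\<pi> (herm m) *v u) (\<pi> g *v e)"
      have "cip u (\<pi> m *v W) = cip (\<pi> (herm m) *v u) W"
        using cip_rep[OF hK, of u W] by simp
      also have "\<dots> = (\<integral>g. ?F (herm m ** g) \<partial>\<nu>)"
        unfolding W \<Phi>_def using int by (intro haar_left[OF haar hK, symmetric]) auto
      also have "\<dots> = (\<integral>g. cnj (chi_L \<kappa> m) * (kern \<kappa> s g * cip u (\<pi> g *v e)) \<partial>\<nu>)"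
      proof (intro Bochner_Integration.integral_cong refl)
        fix g assume "g \<in> space \<nu>"
        then have g: "g \<in> K_group \<kappa>" by (simp add: haar_sets(3)[OF haar])
        have "cip (\<pi> (herm m) *v u) (\<pi> (herm m ** g) *v e) = cip u (\<pi> g *v e)"
          by (simp add: rep_mult[OF hK g] rep_cip[OF hK] flip: matrix_vector_mul_assoc)
        moreover have "unit_char \<kappa> (det (block11 (herm m))) = cnj (chi_L \<kappa> m)"
        proof -
          have "block11 (herm m) = herm (block11 m)" by (simp add: vec_eq_iff)
          then show ?thesis by (simp add: chi_L_eq[OF m] cnj_unit_char det_herm)
        qed
        ultimately show "?F (herm m ** g) = cnj (chi_L \<kappa> m) * (kern \<kappa> s g * cip u (\<pi> g *v e))"
          by (simp add: kern_left[OF L_group_herm[OF m]])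
      qed
      also have "\<dots> = cip u (chi_L \<kappa> m *s W)" by (simp add: cip_linear W \<Phi>_def)
      finally show "cip u (\<pi> m *v W) = cip u (chi_L \<kappa> m *s W)" .
    qed
  qed
  from one_dim[OF this] have "cip u W = cip u (cip W e *s e)" by simp
  also have "\<dots> = cip u e * \<Phi> e" by (simp add: cip_linear cip_commute W mult.commute)
  also have "\<Phi> e = (\<integral>g. real_cpow (cmod (det (block11 g))) (s + of_nat (min_type \<kappa>)) \<partial>\<nu>)"
    unfolding \<Phi>_def
  proof (intro Bochner_Integration.integral_cong refl)
    fix g assume "g \<in> space \<nu>"
    then have g: "g \<in> K_group \<kappa>" by (simp add: haar_sets(3)[OF haar])
    have "cip e (\<pi> g *v e) = cnj (unit_char \<kappa> (det (block11 g)))"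
      using cip_commute[of "\<pi> g *v e" e] by (simp add: sph[OF g])
    then show "kern \<kappa> s g * cip e (\<pi> g *v e) = real_cpow (cmod (det (block11 g))) (s + of_nat (min_type \<kappa>))"
      by (simp add: kern_conjugate)
  qed
  finally show ?thesis unfolding W \<Phi>_def .
qed

text \<open>The substitution \<open>h = x g\<close> turns the integral into the one of \<open>kern_integral\<close> for the vector
  \<open>\<pi>(x)\<^sup>-\<^sup>1 v\<close>.\<close>

lemma J_integral:
  assumes one_dim: "\<And>u. u \<in> chi_vectors \<kappa> \<pi> \<Longrightarrow> u = cip u e *s e"
    and sph: "\<And>g. g \<in> K_group \<kappa> \<Longrightarrow> cip (\<pi> g *v e) e = unit_char \<kappa> (det (block11 g))"
    and z: "Re z > Re (rho \<kappa> TYPE('p \<times> 'q))"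
    and f: "f \<in> matrix_coefficients \<pi> e" and x: "x \<in> K_group \<kappa>"
  shows "integrable \<nu> (J_integrand \<kappa> f x z)"
    and "integral\<^sup>L \<nu> (J_integrand \<kappa> f x z) =
      (\<integral>g. real_cpow (cmod (det (block11 g))) (z - rho \<kappa> TYPE('p \<times> 'q) + of_nat (min_type \<kappa>)) \<partial>\<nu>) * f x"
proof -
  obtain v where v: "f = (\<lambda>x. cip v (\<pi> x *v e))" using f by (auto simp: matrix_coefficients_def)
  define s where "s = z - rho \<kappa> TYPE('p \<times> 'q)"
  have s: "Re s > 0" using z by (simp add: s_def)
  note hK = K_group_herm[OF x]
  have m: "(\<lambda>h. kern \<kappa> s (herm x ** h)) \<in> borel_measurable \<nu>"
    by (rule measurable_compose[OF haar_measurable_left[OF haar hK] kern_measurable[OF haar]])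
  have int: "integrable \<nu> (\<lambda>h. kern \<kappa> s (herm x ** h) * f h)"
    unfolding v by (intro integrable_kern_coefficient m norm_kern_le s continuous_coefficient K_group_mult hK)
  have J: "J_integrand \<kappa> f x z h = kern \<kappa> s (herm x ** h) * f h" if "h \<in> space \<nu>" for h
    using that J_integrand_kern[OF x, of h f z] by (simp add: haar_sets(3)[OF haar] s_def)
  show "integrable \<nu> (J_integrand \<kappa> f x z)"
  proof -
    have "integrable \<nu> (J_integrand \<kappa> f x z) \<longleftrightarrow> integrable \<nu> (\<lambda>h. kern \<kappa> s (herm x ** h) * f h)"
      by (rule Bochner_Integration.integrable_cong[OF refl]) (rule J)
    then show ?thesis using int by simp
  qed
  let ?F = "\<lambda>g. kern \<kappa> s g * cip (\<pi> (herm x) *v v) (\<pi> g *v e)"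
  have "integral\<^sup>L \<nu> (J_integrand \<kappa> f x z) = (\<integral>h. ?F (herm x ** h) \<partial>\<nu>)"
  proof (intro Bochner_Integration.integral_cong refl)
    fix h assume h: "h \<in> space \<nu>"
    then have hk: "h \<in> K_group \<kappa>" by (simp add: haar_sets(3)[OF haar])
    have "cip (\<pi> (herm x) *v v) (\<pi> (herm x ** h) *v e) = f h"
      by (simp add: v rep_mult[OF hK hk] rep_cip[OF hK] flip: matrix_vector_mul_assoc)
    then show "J_integrand \<kappa> f x z h = ?F (herm x ** h)" by (simp add: J[OF h])
  qed
  also have "\<dots> = integral\<^sup>L \<nu> ?F"
    by (intro haar_left[OF haar hK] borel_measurable_times kern_measurable[OF haar]
        haar_measurable_continuous[OF haar continuous_coefficient])
  also have "\<dots> = cip (\<pi> (herm x) *v v) e *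
      (\<integral>g. real_cpow (cmod (det (block11 g))) (s + of_nat (min_type \<kappa>)) \<partial>\<nu>)"
    by (rule kern_integral[OF one_dim sph s])
  also have "cip (\<pi> (herm x) *v v) e = f x" using cip_rep[OF hK, of v e] by (simp add: v)
  finally show "integral\<^sup>L \<nu> (J_integrand \<kappa> f x z) =
      (\<integral>g. real_cpow (cmod (det (block11 g))) (z - rho \<kappa> TYPE('p \<times> 'q) + of_nat (min_type \<kappa>)) \<partial>\<nu>) * f x"
    by (simp add: s_def mult.commute)
qed

end

section \<open>Meromorphic continuation\<close>

lemma prod_predecessors: "(\<Prod>j\<in>(UNIV :: 'p::{finite, linorder} set). f (card {i. i < j})) = (\<Prod>i<CARD('p). f i)"
proof (rule prod.reindex_bij_betw)
  let ?r = "\<lambda>j::'p. card {i. i < j}"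
  have mono: "?r a < ?r b" if "a < b" for a b using that by (intro psubset_card_mono) auto
  have "inj ?r" using mono by (intro injI) (metis less_irrefl neqE)
  moreover have "range ?r \<subseteq> {..<CARD('p)}" by (auto intro!: psubset_card_mono)
  ultimately show "bij_betw ?r UNIV {..<CARD('p)}"
    by (simp add: bij_betw_def card_subset_eq card_image)
qed

text \<open>The index \<open>j\<close> enters only through the number of its predecessors, which runs through \<open>0, ..., p - 1\<close>.\<close>

lemma eta_formula_eq:
  "eta_formula \<kappa> TYPE('p::{finite, linorder} \<times> 'q::{finite, linorder}) z =
    (\<Prod>i<CARD('p). gamma_quotient (of_nat (dim_base \<kappa>) * of_nat (CARD('p) - i) / 2)
      (of_nat (dim_base \<kappa>) * of_nat CARD('q) / 2) (z - rho \<kappa> TYPE('p \<times> 'q) + of_nat (min_type \<kappa>)))"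
proof -
  let ?d = "of_nat (dim_base \<kappa>) :: complex" and ?k = "of_nat (min_type \<kappa>) :: complex"
  let ?c = "\<lambda>j::'p. card {i. i < j}"
  let ?G = "\<lambda>w j. Gamma (w - ?d / 2 * of_nat j)"
  have "eta_formula \<kappa> TYPE('p \<times> 'q) z =
      (\<Prod>j\<in>(UNIV :: 'p set). ?G (of_nat (dim_base \<kappa> * CARD('p + 'q)) / 2) (?c j) / ?G (of_nat (dim_base \<kappa> * CARD('p)) / 2) (?c j) *
        (?G ((z - rho \<kappa> TYPE('p \<times> 'q) + ?k + of_nat (dim_base \<kappa> * CARD('p))) / 2) (?c j) /
         ?G ((z + rho \<kappa> TYPE('p \<times> 'q) + ?k) / 2) (?c j)))"
    by (simp only: eta_formula_def Let_def Gamma_pd_def vec_component prod_dividef prod.distrib)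
  also have "\<dots> = (\<Prod>i<CARD('p). ?G (of_nat (dim_base \<kappa> * CARD('p + 'q)) / 2) i / ?G (of_nat (dim_base \<kappa> * CARD('p)) / 2) i *
        (?G ((z - rho \<kappa> TYPE('p \<times> 'q) + ?k + of_nat (dim_base \<kappa> * CARD('p))) / 2) i /
         ?G ((z + rho \<kappa> TYPE('p \<times> 'q) + ?k) / 2) i))"
    by (rule prod_predecessors)
  also have "\<dots> = (\<Prod>i<CARD('p). gamma_quotient (?d * of_nat (CARD('p) - i) / 2) (?d * of_nat CARD('q) / 2)
      (z - rho \<kappa> TYPE('p \<times> 'q) + ?k))"
  proof (intro prod.cong refl)
    fix i assume "i \<in> {..<CARD('p)}"
    then have i: "(of_nat (CARD('p) - i) :: complex) = of_nat CARD('p) - of_nat i" by (simp add: of_nat_diff)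
    have 1: "of_nat (dim_base \<kappa> * CARD('p + 'q)) / 2 - ?d / 2 * of_nat i =
        ?d * of_nat (CARD('p) - i) / 2 + ?d * of_nat CARD('q) / 2"
      unfolding i by (simp add: field_simps)
    have 2: "of_nat (dim_base \<kappa> * CARD('p)) / 2 - ?d / 2 * of_nat i = ?d * of_nat (CARD('p) - i) / 2"
      unfolding i by (simp add: field_simps)
    have 3: "(z - rho \<kappa> TYPE('p \<times> 'q) + ?k + of_nat (dim_base \<kappa> * CARD('p))) / 2 - ?d / 2 * of_nat i =
        ?d * of_nat (CARD('p) - i) / 2 + (z - rho \<kappa> TYPE('p \<times> 'q) + ?k) / 2"
      unfolding i by (simp add: field_simps)
    have 4: "(z + rho \<kappa> TYPE('p \<times> 'q) + ?k) / 2 - ?d / 2 * of_nat i =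
        ?d * of_nat (CARD('p) - i) / 2 + (z - rho \<kappa> TYPE('p \<times> 'q) + ?k) / 2 + ?d * of_nat CARD('q) / 2"
      unfolding i by (simp add: rho_def field_simps)
    show "?G (of_nat (dim_base \<kappa> * CARD('p + 'q)) / 2) i / ?G (of_nat (dim_base \<kappa> * CARD('p)) / 2) i *
        (?G ((z - rho \<kappa> TYPE('p \<times> 'q) + ?k + of_nat (dim_base \<kappa> * CARD('p))) / 2) i /
         ?G ((z + rho \<kappa> TYPE('p \<times> 'q) + ?k) / 2) i) =
      gamma_quotient (?d * of_nat (CARD('p) - i) / 2) (?d * of_nat CARD('q) / 2) (z - rho \<kappa> TYPE('p \<times> 'q) + ?k)"
      unfolding 1 2 3 4 gamma_quotient_def by (simp only: times_divide_times_eq) (simp only: mult.commute)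
  qed
  finally show ?thesis .
qed

lemma meromorphic_Gamma_affine: "(\<lambda>z. Gamma (a + (z + c) / 2)) meromorphic_on UNIV"
proof -
  have "(\<lambda>z. inverse (rGamma (a + (z + c) / 2))) meromorphic_on UNIV"
    by (intro meromorphic_on_inverse analytic_on_imp_meromorphic_on analytic_intros) auto
  then show ?thesis by (simp add: rGamma_inverse_Gamma)
qed

lemma eta_formula_meromorphic:
  "eta_formula \<kappa> TYPE('p::{finite, linorder} \<times> 'q::{finite, linorder}) meromorphic_on UNIV"
proof -
  have "(\<lambda>z. gamma_quotient a b (z - c + k)) meromorphic_on UNIV" for a b c k
  proof -
    have "(\<lambda>z. Gamma (a + (z + (k - c)) / 2) * Gamma (a + b) / (Gamma (a + b + (z + (k - c)) / 2) * Gamma a)) meromorphic_on UNIV"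
      by (intro meromorphic_on_divide meromorphic_on_mult meromorphic_on_const meromorphic_Gamma_affine)
    then show ?thesis by (simp add: gamma_quotient_def algebra_simps)
  qed
  then show ?thesis unfolding eta_formula_eq[abs_def] by (intro meromorphic_on_prod)
qed

lemma gamma_quotient_rGamma:
  "gamma_quotient a b s = Gamma (a + s / 2) * Gamma (a + b) * rGamma (a + s / 2 + b) * inverse (Gamma a)"
  by (simp only: gamma_quotient_def rGamma_inverse_Gamma divide_inverse inverse_mult_distrib mult.assoc)

lemma eta_formula_analytic:
  assumes z: "Re z > Re (rho \<kappa> TYPE('p::{finite, linorder} \<times> 'q::{finite, linorder}))"
  shows "eta_formula \<kappa> TYPE('p \<times> 'q) analytic_on {z}"
proof -
  have "(\<lambda>z. gamma_quotient (of_nat (dim_base \<kappa>) * of_nat (CARD('p) - i) / 2) b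
      (z - rho \<kappa> TYPE('p \<times> 'q) + of_nat (min_type \<kappa>))) analytic_on {z}" for i b
  proof -
    let ?a = "of_nat (dim_base \<kappa>) * of_nat (CARD('p) - i) / 2 :: complex"
    let ?s = "\<lambda>z. z - rho \<kappa> TYPE('p \<times> 'q) + of_nat (min_type \<kappa>)"
    define w where "w = ?a + ?s z / 2"
    have pos: "Re w > 0" using z by (simp add: w_def add_nonneg_pos)
    have "w \<notin> \<int>\<^sub>\<le>\<^sub>0"
    proof
      assume "w \<in> \<int>\<^sub>\<le>\<^sub>0"
      then obtain n where "w = of_int n" "n \<le> 0" by (rule nonpos_Ints_cases)
      then show False using pos by simp
    qed
    then have 1: "(\<lambda>z. Gamma (?a + ?s z / 2)) analytic_on {z}"
      using analytic_on_compose_gen[of "\<lambda>z. ?a + ?s z / 2" "{z}" Gamma "- \<int>\<^sub>\<le>\<^sub>0"] analytic_Gamma[of "- \<int>\<^sub>\<le>\<^sub>0"]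
      by (simp add: comp_def w_def analytic_intros)
    show ?thesis
      unfolding gamma_quotient_rGamma by (intro analytic_on_mult 1 analytic_intros) auto
  qed
  then show ?thesis unfolding eta_formula_eq[abs_def] by (intro analytic_on_prod)
qed

lemma nicely_meromorphic_remove_sings:
  assumes "f nicely_meromorphic_on UNIV" shows "f z = remove_sings f z"
proof -
  have "(is_pole f z \<and> f z = 0) \<or> f \<midarrow>z\<rightarrow> f z" using assms unfolding nicely_meromorphic_on_def by blast
  then show ?thesis by (auto dest: remove_sings_eqI)
qed

text \<open>The difference vanishes on a half plane, hence outside a discrete set, and the values of both functions
  at their singularities are determined by the values nearby.\<close>

lemma nicely_meromorphic_eqI:
  assumes f: "f nicely_meromorphic_on UNIV" and g: "g nicely_meromorphic_on UNIV"
    and eq: "\<And>z. Re z > c \<Longrightarrow> f z = g z"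
  shows "f = g"
proof
  fix z
  let ?d = "\<lambda>z. f z - g z"
  have d: "?d meromorphic_on UNIV"
    using f g unfolding nicely_meromorphic_on_def by (intro meromorphic_on_diff) auto
  have zero: "remove_sings ?d w = 0" if "Re w > c" for w
  proof -
    have "eventually (\<lambda>z. z \<in> {z. Re z > c}) (at w)"
      using that by (intro eventually_at_in_open') (auto simp: open_halfspace_Re_gt)
    then have "eventually (\<lambda>z. ?d z = 0) (at w)" by eventually_elim (simp add: eq)
    then have "?d \<midarrow>w\<rightarrow> 0" by (rule tendsto_eventually)
    then show ?thesis by (rule remove_sings_eqI)
  qed
  have "remove_sings ?d w = 0" for w
  proof (rule frequently_eq_meromorphic_imp_constant[where z = "of_real (c + 1)" and f = "remove_sings ?d" and c = 0 and A = UNIV])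
    have "eventually (\<lambda>z. z \<in> {z. Re z > c}) (at (complex_of_real (c + 1)))"
      by (intro eventually_at_in_open') (auto simp: open_halfspace_Re_gt)
    then have "eventually (\<lambda>z. remove_sings ?d z = 0) (at (complex_of_real (c + 1)))"
      by eventually_elim (simp add: zero)
    then show "frequently (\<lambda>z. remove_sings ?d z = 0) (at (complex_of_real (c + 1)))"
      by (rule eventually_frequently[rotated]) simp
  qed (use remove_sings_nicely_meromorphic[OF d] in auto)
  moreover have "eventually (\<lambda>w. remove_sings ?d w = ?d w) (at z)"
    using meromorphic_on_isolated_singularity[OF meromorphic_on_subset[OF d, of "{z}"]]
    by (intro eventually_remove_sings_eq_at) auto
  ultimately have "eventually (\<lambda>w. f w = g w) (at z)" by simp
  then have "remove_sings f z = remove_sings g z" by (rule remove_sings_cong) simp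
  then show "f z = g z" using nicely_meromorphic_remove_sings[OF f] nicely_meromorphic_remove_sings[OF g] by simp
qed

lemma J_continuation_unique:
  assumes "J_continuation \<kappa> \<nu> f x F" "J_continuation \<kappa> \<nu> f x G"
  shows "F = G"
proof -
  obtain c c' where "\<And>z. Re z > c \<Longrightarrow> F z = integral\<^sup>L \<nu> (J_integrand \<kappa> f x z)"
    "\<And>z. Re z > c' \<Longrightarrow> G z = integral\<^sup>L \<nu> (J_integrand \<kappa> f x z)"
    using assms unfolding J_continuation_def by blast
  then have "F z = G z" if "Re z > max c c'" for z using that by simp
  then show ?thesis using assms unfolding J_continuation_def by (intro nicely_meromorphic_eqI[where c = "max c c'"]) auto
qed

theorem theorem6p5:
  fixes \<kappa> :: base_case
    and \<nu> :: "('p::{finite, linorder}, 'q::{finite, linorder}) bmat measure"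
    and \<pi> :: "('p, 'q) bmat \<Rightarrow> complex^'v^'v"
    and e :: "complex^'v"
  assumes dims: "case \<kappa> of Real_Case \<Rightarrow> CARD('p) = 2 \<and> CARD('q) \<ge> 3
      | Complex_Case l \<Rightarrow> CARD('q) \<ge> CARD('p) \<and> CARD('p) \<ge> 1"
    and haar: "normalized_Haar (K_group \<kappa>) \<nu>"
    and rep: "unitary_rep (K_group \<kappa>) \<pi>" "irreducible_rep (K_group \<kappa>) \<pi>"
    and spherical: "chi_spherical \<kappa> \<pi>"
    and weight: "restricted_highest_weight \<kappa> \<pi> (\<Sum>j\<in>UNIV. real (min_type \<kappa>) *\<^sub>R axis j 1)"
    and e: "e \<in> chi_vectors \<kappa> \<pi>" "norm e = 1"
  shows "(\<forall>f\<in>matrix_coefficients \<pi> e. \<forall>x\<in>K_group \<kappa>.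
            J_continuation \<kappa> \<nu> f x (\<lambda>z. J_op \<kappa> \<nu> z f x))
      \<and> J_scalar \<kappa> \<nu> (matrix_coefficients \<pi> e) meromorphic_on UNIV
      \<and> (\<forall>\<^sub>\<approx>z\<in>UNIV. acts_by_scalar \<kappa> (J_op \<kappa> \<nu> z) (matrix_coefficients \<pi> e)
            (J_scalar \<kappa> \<nu> (matrix_coefficients \<pi> e) z))
      \<and> (\<forall>\<^sub>\<approx>z\<in>UNIV. J_scalar \<kappa> \<nu> (matrix_coefficients \<pi> e) z
            = eta_formula \<kappa> TYPE('p \<times> 'q) z)"
proof -
  have pq: "CARD('p) \<le> CARD('q)" "\<kappa> = Real_Case \<Longrightarrow> CARD('p) < CARD('q)"
    using dims by (auto split: base_case.splits)
  note irr = rep(2)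
  interpret spherical_block \<kappa> \<nu> \<pi> "TYPE('p \<times> 'q)"
    by unfold_locales (fact haar rep(1) pq(1))+
  note sph = spherical_function[OF pq(2) irr weight e]
  let ?\<eta>0 = "eta_formula \<kappa> TYPE('p \<times> 'q)" and ?S = "matrix_coefficients \<pi> e"
  let ?\<rho> = "rho \<kappa> TYPE('p \<times> 'q)"
  (* Removable singularities of the quotient of Gamma functions are filled in, as in the continuation of J. *)
  define \<eta> where "\<eta> = remove_sings ?\<eta>0"
  have nice: "\<eta> nicely_meromorphic_on UNIV"
    unfolding \<eta>_def by (rule remove_sings_nicely_meromorphic[OF eta_formula_meromorphic])
  have cont: "J_continuation \<kappa> \<nu> f x (\<lambda>z. \<eta> z * f x)" if f: "f \<in> ?S" and x: "x \<in> K_group \<kappa>" for f x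
    unfolding J_continuation_def
  proof (intro conjI exI allI impI)
    show "(\<lambda>z. \<eta> z * f x) nicely_meromorphic_on UNIV" by (rule nicely_meromorphic_on_cmult_right[OF nice])
    fix z assume z: "Re z > Re ?\<rho>"
    note J = J_integral[OF sph(2) sph(1) z f x]
    show "integrable \<nu> (J_integrand \<kappa> f x z)" by (rule J(1))
    have "Re (z - ?\<rho> + of_nat (min_type \<kappa>)) > 0" using z by simp
    from haar_integral_det_power[OF haar this]
    have "(\<integral>g. real_cpow (cmod (det (block11 g))) (z - ?\<rho> + of_nat (min_type \<kappa>)) \<partial>\<nu>) = ?\<eta>0 z"
      unfolding eta_formula_eq .
    then have "integral\<^sup>L \<nu> (J_integrand \<kappa> f x z) = ?\<eta>0 z * f x" using J(2) by simp
    then show "\<eta> z * f x = integral\<^sup>L \<nu> (J_integrand \<kappa> f x z)"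
      unfolding \<eta>_def by (simp add: eta_formula_analytic[OF z])
  qed
  have J_op: "J_op \<kappa> \<nu> z f x = \<eta> z * f x" if "f \<in> ?S" "x \<in> K_group \<kappa>" for f x z
  proof -
    have "(THE F. J_continuation \<kappa> \<nu> f x F) = (\<lambda>z. \<eta> z * f x)"
    proof (rule the_equality)
      show "J_continuation \<kappa> \<nu> f x (\<lambda>z. \<eta> z * f x)" by (rule cont[OF that])
      show "F = (\<lambda>z. \<eta> z * f x)" if "J_continuation \<kappa> \<nu> f x F" for F
        using that cont[OF \<open>f \<in> ?S\<close> \<open>x \<in> K_group \<kappa>\<close>] by (rule J_continuation_unique)
    qed
    then show ?thesis by (simp add: J_op_def)
  qed
  have acts: "acts_by_scalar \<kappa> (J_op \<kappa> \<nu> z) ?S (\<eta> z)" for z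
    by (simp add: acts_by_scalar_def J_op)
  have scalar: "J_scalar \<kappa> \<nu> ?S z = \<eta> z" for z
    unfolding J_scalar_def
  proof (rule the_equality)
    show "acts_by_scalar \<kappa> (J_op \<kappa> \<nu> z) ?S (\<eta> z)" by (rule acts)
    fix c assume c: "acts_by_scalar \<kappa> (J_op \<kappa> \<nu> z) ?S c"
    (* The spherical function has value 1 at the identity, so the scalar is determined. *)
    let ?f = "\<lambda>x. cip e (\<pi> x *v e)"
    have f: "?f \<in> ?S" by (auto simp: matrix_coefficients_def)
    have "?f (mat 1) = 1" by (simp add: rep_one cip_self e(2))
    then show "c = \<eta> z"
      using c f K_group_one[of \<kappa>] J_op[OF f K_group_one, of z] unfolding acts_by_scalar_def by (metis mult.right_neutral)
  qed
  have scalar': "J_scalar \<kappa> \<nu> ?S = \<eta>" by (rule ext) (rule scalar)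
  have "(\<lambda>z. J_op \<kappa> \<nu> z f x) = (\<lambda>z. \<eta> z * f x)" if "f \<in> ?S" "x \<in> K_group \<kappa>" for f x
    using J_op[OF that] by (rule ext)
  moreover have "\<forall>\<^sub>\<approx>z\<in>UNIV. \<eta> z = ?\<eta>0 z"
    unfolding \<eta>_def by (rule eventually_remove_sings_eq[OF eta_formula_meromorphic])
  ultimately show ?thesis
    using cont nice acts unfolding scalar' by (simp add: nicely_meromorphic_on_def)
qed

end
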